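(* Let $s\ge 2$ and let $(\mathbf u,p)$ be a solution of the Navier--Stokes equations with homogeneous Dirichlet boundary conditions on the time interval $J$ such that $\mathbf u\in L^\infty(J;H^s(\Omega)^d)\cap L^\infty(J;W^{1,\infty}(\Omega)^d)$, $p\in L^\infty(J;H^{s-1}(\Omega)/\mathbb R)$ and $\mathbf u_t\in L^\infty(J;H^{s-1}(\Omega)^d)$. Let $2\le r\le s$, $\mu>0$, and let $\mathbf u_h:J\to V_{h,r}$ satisfy, for all $\boldsymbol\varphi_h\in V_{h,r}$ and $t\in J$, the data assimilation Galerkin method with grad-div stabilization $$(\dot{\mathbf u}_h,\boldsymbol\varphi_h)+\nu(\nabla\mathbf u_h,\nabla\boldsymbol\varphi_h)+b_h(\mathbf u_h,\mathbf u_h,\boldsymbol\varphi_h)+\mu(\nabla\cdot\mathbf u_h,\nabla\cdot\boldsymbol\varphi_h)=(\mathbf f,\boldsymbol\varphi_h)-\beta(I_H(\mathbf u_h)-I_H(\mathbf u),I_H\boldsymbol\varphi_h).$$ Let $\mathbf s_h^m$ be the modified Stokes projection of $\mathbf u$ and set $$L=2\sup_{t\in J}\left(\|\nabla\mathbf s_h^m(t)\|_\infty+\frac{\|\mathbf s_h^m(t)\|_\infty^2}{4\mu}\right),\qquad\gamma=\min\left\{\frac{\nu}{2}c_I^{-2}H^{-2},\frac{\beta}{2}\right\}.$$ If $\beta\ge8L$ and $H\le\dfrac{\nu^{1/2}}{(8L)^{1/2}c_I}$, then for every $t\in J$ $$\|\mathbf u(t)-\mathbf u_h(t)\|_0\le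 e^{-\gamma t/4}\|\mathbf u_h(0)-\mathbf u(0)\|_0+\frac{C}{L^{1/2}}h^{r-1}\max_{0\le\tau\le t}\left(\Bigl(\beta^{1/2}h+\mu^{1/2}+\frac{K_1(\mathbf u,|\Omega|)}{L^{1/2}}\Bigr)\|\mathbf u\|_r+\frac1{L^{1/2}}\|\mathbf u_t\|_{r-1}+\frac1{\mu^{1/2}}\|p\|_{H^{r-1}/\mathbb R}\right),$$ where functions inside the maximum are evaluated at time $\tau$ and the constant $C$ does not depend on $\nu$.
   Context: **Domain and norms.** $d\in\{2,3\}$; $\Omega\subset\mathbb R^d$ is a bounded Lipschitz domain with polygonal/polyhedral or smooth boundary, $|\Omega|$ its Lebesgue measure. $|\cdot|_{s,p,D}$ is the standard $W^{s,p}(D)$ seminorm and $\|f\|_{s,p,D}^p=\sum_{j=0}^s|D|^{p(j-s)/d}|f|_{j,p,D}^p$; $\|\cdot\|_s$ is this norm for $p=2$, $D=\Omega$ (so $\|\cdot\|_0$ is the $L^2(\Omega)$ norm), $(\cdot,\cdot)$ the $L^2(\Omega)$ inner product, $\|\cdot\|_\infty$ the $L^\infty(\Omega)$ norm. $V=\{\mathbf v\in H^1_0(\Omega)^d:\nabla\cdot\mathbf v=0\}$. **Time interval.** $J=[0,T]$ with $0<T<\infty$, or $J=[0,\infty)$. **Navier--Stokes equations.** $\mathbf u_t-\nu\Delta\mathbf u+(\mathbf u\cdot\nabla)\mathbf u+\nabla p=\mathbf f$, $\nabla\cdot\mathbf u=0$ in $\Omega$, $\mathbf u=\mathbf 0$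 on $\partial\Omega$, with $\nu>0$. **Finite elements.** $\mathcal T_h$ is a shape-regular, quasi-uniform family of partitions of $\Omega$ into (possibly curved, affine if $\Omega$ is polygonal/polyhedral) simplices with maximal diameter $h$, matching $\Omega$ exactly. For $r\ge2$, $S_{h,r}$ is the space of continuous functions which, mapped to the reference simplex, are polynomials of degree at most $r-1$ on each element, $S^0_{h,r}=S_{h,r}\cap H^1_0(\Omega)$. For $r\ge3$ (Hood--Taylor): $X_{h,r}=(S^0_{h,r})^d$, $Q_{h,r-1}=S_{h,r-1}\cap L^2(\Omega)/\mathbb R$. For $r=2$ (mini-element): $X_{h,2}=(S^0_{h,2})^d\oplus\mathbb B_h$, with $\mathbb B_h$ spanned by the element bubble functions, and $Q_{h,1}=S_{h,2}\cap L^2(\Omega)/\mathbb R$. These pairs satisfy a uniform inf-sup condition. $V_{h,r}=\{\chi_h\in X_{h,r}:(q_h,\nabla\cdot\chi_h)=0\ \forall q_h\in Q_{h,r-1}\}$. $b_h(\mathbf u,\mathbf v,\mathbf w)=((\mathbf u\cdot\nabla)\mathbf v,\mathbf w)+\frac12((\nabla\cdot\mathbf u)\mathbf v,\mathbf w)$. **Coarse interpolation.** $H>0$ is the resolution of the coarse mesh, $\beta>0$ the nudging parameter, and $I_H$ is a linear operator on $L^2(\Omega)^d$ with $\|I_H\mathbf v\|_0\le c_0\|\mathbf v\|_0$ for $\mathbf v\in L^2(\Omega)^d$ and $\|\mathbf v-I_H\mathbf v\|_0\le c_IH\|\nabla\mathbf v\|_0$ for $\mathbf v\in H^1_0(\Omega)^d$.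 **Modified Stokes projection.** For each $t$, $\mathbf s_h^m\in V_{h,r}$ is defined by $\nu(\nabla\mathbf s_h^m,\nabla\boldsymbol\varphi_h)=(\mathbf f-\mathbf u_t-(\mathbf u\cdot\nabla)\mathbf u-\nabla p,\boldsymbol\varphi_h)$, i.e. $(\nabla\mathbf s_h^m,\nabla\boldsymbol\varphi_h)=(\nabla\mathbf u,\nabla\boldsymbol\varphi_h)$, for all $\boldsymbol\varphi_h\in V_{h,r}$. Standing facts assumed about the discretization: $\|\mathbf u-\mathbf s_h^m\|_0+h\|\mathbf u-\mathbf s_h^m\|_1\le C\|\mathbf u\|_jh^j$ for $1\le j\le r$ (and likewise for $\mathbf u_t$ and $\dot{\mathbf s}_h^m$); $\|\nabla(\mathbf u-\mathbf s_h^m)\|_\infty\le C\|\nabla\mathbf u\|_\infty$; and the $L^2$ projection $\pi_hp$ of $p$ onto $Q_{h,r-1}$ satisfies $\|p-\pi_hp\|_0\le Ch^{j-1}\|p\|_{H^{j-1}/\mathbb R}$, $1\le j\le r$. **Constants.** $K_1(\mathbf u,|\Omega|)=C\bigl((\|\mathbf u\|_{d-2}\|\mathbf u\|_2)^{1/2}+|\Omega|^{(3-d)/(2d)}(\|\mathbf u\|_1\|\mathbf u\|_2)^{1/2}\bigr)$. $C$ denotes generic positive constants, possibly different at each occurrence, which are scale invariant and independent of $h,H,\nu,\mu,\beta,t,\mathbf u,p,\mathbf f$ (they may depend on $d$, $r$, the shape of $\Omega$, mesh regularity, the inf-sup constant, $c_0$). It is implicit that $L>0$. *)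

theory Defs
  imports "HOL-Analysis.Analysis" "HOL-Probability.Essential_Supremum"
begin

section \<open>Smooth functions and domains\<close>

definition partial :: "'n::finite \<Rightarrow> (real^'n \<Rightarrow> real) \<Rightarrow> real^'n \<Rightarrow> real" where
  "partial i f x = frechet_derivative f (at x) (axis i 1)"

primrec partials :: "'n::finite list \<Rightarrow> (real^'n \<Rightarrow> real) \<Rightarrow> real^'n \<Rightarrow> real" where
  "partials [] f = f"
| "partials (i # is) f = partial i (partials is f)"

text \<open>Every iterated partial derivative is differentiable everywhere, i.e. the class of
  infinitely differentiable functions on the whole space.\<close>
definition smooth :: "(real^'n::finite \<Rightarrow> real) \<Rightarrow> bool" where
  "smooth f \<longleftrightarrow> (\<forall>is. partials is f differentiable_on UNIV)"

definition test_functions :: "(real^'n::finite) set \<Rightarrow> (real^'n \<Rightarrow> real) set" where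
  "test_functions \<Omega> =
     {\<phi>. smooth \<phi> \<and> (\<exists>K. compact K \<and> K \<subseteq> \<Omega> \<and> (\<forall>x. x \<notin> K \<longrightarrow> \<phi> x = 0))}"

text \<open>Near x the set \<open>\<Omega>\<close> lies strictly above the graph of g over the hyperplane orthogonal to
  the unit vector e; the argument of g is the orthogonal projection of y onto that hyperplane.\<close>
definition local_graph :: "(real^'n::finite) set \<Rightarrow> real^'n \<Rightarrow> (real^'n \<Rightarrow> real) \<Rightarrow> bool" where
  "local_graph \<Omega> x g \<longleftrightarrow> (\<exists>\<rho>>0. \<exists>e. norm e = 1 \<and>
     \<Omega> \<inter> ball x \<rho> = {y \<in> ball x \<rho>. g (y - (y \<bullet> e) *\<^sub>R e) < y \<bullet> e})"

definition lipschitz_domain :: "(real^'n::finite) set \<Rightarrow> bool" where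
  "lipschitz_domain \<Omega> \<longleftrightarrow> open \<Omega> \<and> connected \<Omega> \<and> \<Omega> \<noteq> {} \<and> bounded \<Omega> \<and>
     (\<forall>x\<in>frontier \<Omega>. \<exists>g. local_graph \<Omega> x g \<and> (\<exists>K. K-lipschitz_on UNIV g))"

definition smooth_boundary :: "(real^'n::finite) set \<Rightarrow> bool" where
  "smooth_boundary \<Omega> \<longleftrightarrow> (\<forall>x\<in>frontier \<Omega>. \<exists>g. local_graph \<Omega> x g \<and> smooth g)"

definition polyhedral_domain :: "(real^'n::finite) set \<Rightarrow> bool" where
  "polyhedral_domain \<Omega> \<longleftrightarrow> (\<exists>P. finite P \<and> (\<forall>K\<in>P. polytope K) \<and> closure \<Omega> = \<Union>P)"

abbreviation vol :: "(real^'n::finite) set \<Rightarrow> real" where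
  "vol \<Omega> \<equiv> measure lebesgue \<Omega>"

section \<open>Lebesgue and Sobolev spaces\<close>

text \<open>Elements of the spaces are functions on the whole of \<open>\<real>\<^sup>n\<close>; only their values on \<open>\<Omega>\<close>, up to
  null sets, matter. On vectors and matrices the Euclidean (Frobenius) norm and inner product are
  used.\<close>

definition L2 :: "(real^'n::finite) set \<Rightarrow> (real^'n \<Rightarrow> 'b::euclidean_space) set" where
  "L2 \<Omega> = {f. f \<in> borel_measurable (lebesgue_on \<Omega>) \<and> integrable (lebesgue_on \<Omega>) (\<lambda>x. (norm (f x))\<^sup>2)}"

definition ip :: "(real^'n::finite) set \<Rightarrow> (real^'n \<Rightarrow> 'b::euclidean_space) \<Rightarrow> (real^'n \<Rightarrow> 'b) \<Rightarrow> real" where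
  "ip \<Omega> f g = (\<integral>x. f x \<bullet> g x \<partial>lebesgue_on \<Omega>)"

definition L2_norm :: "(real^'n::finite) set \<Rightarrow> (real^'n \<Rightarrow> 'b::euclidean_space) \<Rightarrow> real" where
  "L2_norm \<Omega> f = sqrt (ip \<Omega> f f)"

definition Linf :: "(real^'n::finite) set \<Rightarrow> (real^'n \<Rightarrow> 'b::euclidean_space) set" where
  "Linf \<Omega> = {f. f \<in> borel_measurable (lebesgue_on \<Omega>) \<and> (\<exists>M. AE x in lebesgue_on \<Omega>. norm (f x) \<le> M)}"

definition Linf_norm :: "(real^'n::finite) set \<Rightarrow> (real^'n \<Rightarrow> 'b::euclidean_space) \<Rightarrow> real" where
  "Linf_norm \<Omega> f = real_of_ereal (esssup (lebesgue_on \<Omega>) (\<lambda>x. ereal (norm (f x))))"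

definition locally_integrable :: "(real^'n::finite) set \<Rightarrow> (real^'n \<Rightarrow> real) \<Rightarrow> bool" where
  "locally_integrable \<Omega> f \<longleftrightarrow> (\<forall>K. compact K \<and> K \<subseteq> \<Omega> \<longrightarrow> integrable (lebesgue_on K) f)"

text \<open>Multi-indices are functions \<open>\<alpha> :: 'n \<Rightarrow> nat\<close>. A list \<open>is\<close> realises \<open>\<alpha>\<close> if every i occurs
  \<open>\<alpha> i\<close> times in it; as the order of differentiation is irrelevant for smooth \<open>\<phi>\<close>, all such lists
  give the same classical derivative.\<close>
definition weak_deriv :: "(real^'n::finite) set \<Rightarrow> ('n \<Rightarrow> nat) \<Rightarrow> (real^'n \<Rightarrow> real) \<Rightarrow> (real^'n \<Rightarrow> real) \<Rightarrow> bool" where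
  "weak_deriv \<Omega> \<alpha> f g \<longleftrightarrow> locally_integrable \<Omega> f \<and> locally_integrable \<Omega> g \<and>
     (\<forall>\<phi>\<in>test_functions \<Omega>. \<forall>is. (\<forall>i. count_list is i = \<alpha> i) \<longrightarrow>
        ip \<Omega> f (partials is \<phi>) = (- 1) ^ (\<Sum>i\<in>UNIV. \<alpha> i) * ip \<Omega> g \<phi>)"

text \<open>A representative of the weak derivative; unique up to null sets where it exists.\<close>
definition wd :: "(real^'n::finite) set \<Rightarrow> ('n \<Rightarrow> nat) \<Rightarrow> (real^'n \<Rightarrow> real) \<Rightarrow> real^'n \<Rightarrow> real" where
  "wd \<Omega> \<alpha> f = (SOME g. weak_deriv \<Omega> \<alpha> f g)"

definition single :: "'n \<Rightarrow> nat \<Rightarrow> 'n \<Rightarrow> nat" where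
  "single j k = (\<lambda>i. if i = j then k else 0)"

definition multi_indices :: "nat \<Rightarrow> ('n::finite \<Rightarrow> nat) set" where
  "multi_indices k = {\<alpha>. (\<Sum>i\<in>UNIV. \<alpha> i) = k}"

definition Hs :: "(real^'n::finite) set \<Rightarrow> nat \<Rightarrow> (real^'n \<Rightarrow> real) set" where
  "Hs \<Omega> s = {f \<in> L2 \<Omega>. \<forall>k\<le>s. \<forall>\<alpha>\<in>multi_indices k. \<exists>g\<in>L2 \<Omega>. weak_deriv \<Omega> \<alpha> f g}"

definition Hs_vec :: "(real^'n::finite) set \<Rightarrow> nat \<Rightarrow> (real^'n \<Rightarrow> real^'n) set" where
  "Hs_vec \<Omega> s = {v. \<forall>i. (\<lambda>x. v x $ i) \<in> Hs \<Omega> s}"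

definition Hs_seminorm :: "(real^'n::finite) set \<Rightarrow> nat \<Rightarrow> (real^'n \<Rightarrow> real) \<Rightarrow> real" where
  "Hs_seminorm \<Omega> j f = sqrt (\<Sum>\<alpha>\<in>multi_indices j. (L2_norm \<Omega> (wd \<Omega> \<alpha> f))\<^sup>2)"

definition Hs_norm :: "(real^'n::finite) set \<Rightarrow> nat \<Rightarrow> (real^'n \<Rightarrow> real) \<Rightarrow> real" where
  "Hs_norm \<Omega> s f =
     sqrt (\<Sum>j\<le>s. vol \<Omega> powr (2 * (real j - real s) / real CARD('n)) * (Hs_seminorm \<Omega> j f)\<^sup>2)"

definition Hs_vec_norm :: "(real^'n::finite) set \<Rightarrow> nat \<Rightarrow> (real^'n \<Rightarrow> real^'n) \<Rightarrow> real" where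
  "Hs_vec_norm \<Omega> s v = sqrt (\<Sum>i\<in>UNIV. (Hs_norm \<Omega> s (\<lambda>x. v x $ i))\<^sup>2)"

text \<open>The norm of the quotient of \<open>H\<^sup>k\<close> by the constants.\<close>
definition quot_norm :: "(real^'n::finite) set \<Rightarrow> nat \<Rightarrow> (real^'n \<Rightarrow> real) \<Rightarrow> real" where
  "quot_norm \<Omega> k p = (INF c. Hs_norm \<Omega> k (\<lambda>x. p x + c))"

definition H10 :: "(real^'n::finite) set \<Rightarrow> (real^'n \<Rightarrow> real) set" where
  "H10 \<Omega> = {f \<in> Hs \<Omega> 1. \<forall>\<epsilon>>0. \<exists>\<phi>\<in>test_functions \<Omega>. Hs_norm \<Omega> 1 (\<lambda>x. f x - \<phi> x) < \<epsilon>}"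

definition H10_vec :: "(real^'n::finite) set \<Rightarrow> (real^'n \<Rightarrow> real^'n) set" where
  "H10_vec \<Omega> = {v. \<forall>i. (\<lambda>x. v x $ i) \<in> H10 \<Omega>}"

text \<open>Row i of \<open>grad \<Omega> v x\<close> is the gradient of the i-th component of v.\<close>
definition grad :: "(real^'n::finite) set \<Rightarrow> (real^'n \<Rightarrow> real^'n) \<Rightarrow> real^'n \<Rightarrow> real^'n^'n" where
  "grad \<Omega> v x = (\<chi> i j. wd \<Omega> (single j 1) (\<lambda>y. v y $ i) x)"

definition dvg :: "(real^'n::finite) set \<Rightarrow> (real^'n \<Rightarrow> real^'n) \<Rightarrow> real^'n \<Rightarrow> real" where
  "dvg \<Omega> v x = trace (grad \<Omega> v x)"

definition laplacian :: "(real^'n::finite) set \<Rightarrow> (real^'n \<Rightarrow> real^'n) \<Rightarrow> real^'n \<Rightarrow> real^'n" where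
  "laplacian \<Omega> v x = (\<chi> i. \<Sum>j\<in>UNIV. wd \<Omega> (single j 2) (\<lambda>y. v y $ i) x)"

definition sgrad :: "(real^'n::finite) set \<Rightarrow> (real^'n \<Rightarrow> real) \<Rightarrow> real^'n \<Rightarrow> real^'n" where
  "sgrad \<Omega> q x = (\<chi> j. wd \<Omega> (single j 1) q x)"

definition W1inf_vec :: "(real^'n::finite) set \<Rightarrow> (real^'n \<Rightarrow> real^'n) set" where
  "W1inf_vec \<Omega> = {v \<in> Linf \<Omega>. \<forall>i j. \<exists>g\<in>Linf \<Omega>. weak_deriv \<Omega> (single j 1) (\<lambda>x. v x $ i) g}"

definition W1inf_vec_norm :: "(real^'n::finite) set \<Rightarrow> (real^'n \<Rightarrow> real^'n) \<Rightarrow> real" where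
  "W1inf_vec_norm \<Omega> v = vol \<Omega> powr (- 1 / real CARD('n)) * Linf_norm \<Omega> v + Linf_norm \<Omega> (grad \<Omega> v)"

definition div_free :: "(real^'n::finite) set \<Rightarrow> (real^'n \<Rightarrow> real^'n) set" where
  "div_free \<Omega> = {v \<in> H10_vec \<Omega>. AE x in lebesgue_on \<Omega>. dvg \<Omega> v x = 0}"

section \<open>Functions of time\<close>

definition time_interval :: "real set \<Rightarrow> bool" where
  "time_interval J \<longleftrightarrow> (\<exists>T>0. J = {0..T}) \<or> J = {0..}"

text \<open>Bochner (strong) measurability of \<open>u : J \<rightarrow> X\<close>, where X is a space of functions with norm N:
  u is almost everywhere on J a limit, in the norm N, of X-valued simple functions.\<close>
definition strongly_measurable ::
    "('x \<Rightarrow> 'b::real_vector) set \<Rightarrow> (('x \<Rightarrow> 'b) \<Rightarrow> real) \<Rightarrow> real set \<Rightarrow> (real \<Rightarrow> 'x \<Rightarrow> 'b) \<Rightarrow> bool" where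
  "strongly_measurable X N J u \<longleftrightarrow>
     (\<exists>w :: nat \<Rightarrow> real \<Rightarrow> 'x \<Rightarrow> 'b.
        (\<forall>k. finite (w k ` J) \<and> w k ` J \<subseteq> X \<and> (\<forall>y. {t\<in>J. w k t = y} \<in> sets lebesgue)) \<and>
        (AE t in lebesgue_on J. (\<lambda>k. N (\<lambda>x. w k t x - u t x)) \<longlonglongrightarrow> 0))"

text \<open>\<open>L\<^sup>\<infinity>(J; X)\<close>\<close>
definition Linf_time ::
    "('x \<Rightarrow> 'b::real_vector) set \<Rightarrow> (('x \<Rightarrow> 'b) \<Rightarrow> real) \<Rightarrow> real set \<Rightarrow> (real \<Rightarrow> 'x \<Rightarrow> 'b) set" where
  "Linf_time X N J = {u. strongly_measurable X N J u \<and>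
     (\<exists>M. AE t in lebesgue_on J. u t \<in> X \<and> N (u t) \<le> M)}"

text \<open>u is the continuous-in-time representative with generalised derivative \<open>ut\<close>:
  \<open>u(t) = u(0) + \<integral>\<^sub>0\<^sup>t ut\<close> in \<open>L\<^sup>2(\<Omega>)\<close> for every t in J.\<close>
definition time_derivative ::
    "(real^'n::finite) set \<Rightarrow> real set \<Rightarrow> (real \<Rightarrow> real^'n \<Rightarrow> real^'n) \<Rightarrow> (real \<Rightarrow> real^'n \<Rightarrow> real^'n) \<Rightarrow> bool" where
  "time_derivative \<Omega> J u ut \<longleftrightarrow>
     (\<forall>w\<in>L2 \<Omega>. \<forall>t\<in>J. ip \<Omega> (u t) w - ip \<Omega> (u 0) w = (\<integral>\<tau>. ip \<Omega> (ut \<tau>) w \<partial>lebesgue_on {0..t}))"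

text \<open>Classical derivative in \<open>L\<^sup>2(\<Omega>)\<close> (one-sided at the end points of J).\<close>
definition has_L2_time_derivative ::
    "(real^'n::finite) set \<Rightarrow> real set \<Rightarrow> (real \<Rightarrow> real^'n \<Rightarrow> real^'n) \<Rightarrow> (real^'n \<Rightarrow> real^'n) \<Rightarrow> real \<Rightarrow> bool" where
  "has_L2_time_derivative \<Omega> J v v' t \<longleftrightarrow>
     ((\<lambda>\<tau>. L2_norm \<Omega> (\<lambda>x. (1 / (\<tau> - t)) *\<^sub>R (v \<tau> x - v t x) - v' x)) \<longlongrightarrow> 0) (at t within J)"

text \<open>The maximum over \<open>[0,t]\<close> of a function that is only defined almost everywhere.
  At t = 0 the value is 0.\<close>
definition ess_max :: "real \<Rightarrow> (real \<Rightarrow> real) \<Rightarrow> real" where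
  "ess_max t g = real_of_ereal (esssup (lebesgue_on {0..t}) (\<lambda>\<tau>. ereal (g \<tau>)))"

text \<open>Strong solutions of the Navier--Stokes equations with homogeneous Dirichlet conditions;
  \<open>grad \<Omega> v x *v w x\<close> is \<open>((w \<cdot> \<nabla>) v)(x)\<close>.\<close>
definition navier_stokes ::
    "real \<Rightarrow> (real^'n::finite) set \<Rightarrow> real set \<Rightarrow> (real \<Rightarrow> real^'n \<Rightarrow> real^'n) \<Rightarrow> (real \<Rightarrow> real^'n \<Rightarrow> real^'n)
      \<Rightarrow> (real \<Rightarrow> real^'n \<Rightarrow> real^'n) \<Rightarrow> (real \<Rightarrow> real^'n \<Rightarrow> real) \<Rightarrow> bool" where
  "navier_stokes \<nu> \<Omega> J f u ut p \<longleftrightarrow>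
     (\<forall>t\<in>J. u t \<in> div_free \<Omega>) \<and> (\<forall>t\<in>J. f t \<in> L2 \<Omega>) \<and> time_derivative \<Omega> J u ut \<and>
     (AE t in lebesgue_on J. AE x in lebesgue_on \<Omega>.
        ut t x - \<nu> *\<^sub>R laplacian \<Omega> (u t) x + grad \<Omega> (u t) x *v u t x + sgrad \<Omega> (p t) x = f t x)"

section \<open>Meshes and finite element spaces\<close>

definition ref_vertices :: "(real^'n::finite) set" where
  "ref_vertices = insert 0 Basis"

definition ref_simplex :: "(real^'n::finite) set" where
  "ref_simplex = convex hull ref_vertices"

text \<open>An element is represented by its map F from the reference simplex. Shape regularity asks the
  derivative of F and its inverse to be of size \<open>diameter\<close> and \<open>1 / diameter\<close>, up to the factor
  \<open>\<sigma>\<close>; for affine F this is the usual bound of diameter over inradius.\<close>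
definition regular_element :: "real \<Rightarrow> (real^'n::finite \<Rightarrow> real^'n) \<Rightarrow> bool" where
  "regular_element \<sigma> F \<longleftrightarrow> inj_on F ref_simplex \<and>
     (\<exists>F'. continuous_on ref_simplex (\<lambda>x. matrix (F' x)) \<and>
        (\<forall>x\<in>ref_simplex. (F has_derivative F' x) (at x within ref_simplex) \<and>
           (\<forall>v. norm (F' x v) \<le> \<sigma> * diameter (F ` ref_simplex) * norm v \<and>
                diameter (F ` ref_simplex) * norm v \<le> \<sigma> * norm (F' x v))))"

text \<open>Two elements meet in a common face (possibly empty), on which the two parametrisations agree up
  to a renumbering of the vertices.\<close>
definition conforming :: "(real^'n::finite \<Rightarrow> real^'n) \<Rightarrow> (real^'n \<Rightarrow> real^'n) \<Rightarrow> bool" where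
  "conforming F G \<longleftrightarrow> (\<exists>A B \<pi>. A \<subset> ref_vertices \<and> B \<subset> ref_vertices \<and> bij_betw \<pi> A B \<and>
     F ` ref_simplex \<inter> G ` ref_simplex = F ` (convex hull A) \<and>
     (\<forall>c. (\<forall>a\<in>A. 0 \<le> c a) \<and> sum c A = 1 \<longrightarrow>
        F (\<Sum>a\<in>A. c a *\<^sub>R a) = G (\<Sum>a\<in>A. c a *\<^sub>R \<pi> a)))"

definition affine_on_ref :: "(real^'n::finite \<Rightarrow> real^'n) \<Rightarrow> bool" where
  "affine_on_ref F \<longleftrightarrow> (\<exists>A b. \<forall>x\<in>ref_simplex. F x = A *v x + b)"

text \<open>\<open>\<sigma>\<close> is the mesh regularity constant, bounding both shape regularity and quasi-uniformity.\<close>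
definition mesh :: "real \<Rightarrow> (real^'n::finite) set \<Rightarrow> real \<Rightarrow> (real^'n \<Rightarrow> real^'n) set \<Rightarrow> bool" where
  "mesh \<sigma> \<Omega> h T \<longleftrightarrow> finite T \<and> T \<noteq> {} \<and>
     (\<Union>F\<in>T. F ` ref_simplex) = closure \<Omega> \<and>
     (\<forall>F\<in>T. regular_element \<sigma> F) \<and>
     (\<forall>F\<in>T. \<forall>G\<in>T. F \<noteq> G \<longrightarrow> conforming F G) \<and>
     (polyhedral_domain \<Omega> \<longrightarrow> (\<forall>F\<in>T. affine_on_ref F)) \<and>
     h = Max ((\<lambda>F. diameter (F ` ref_simplex)) ` T) \<and>
     (\<forall>F\<in>T. h \<le> \<sigma> * diameter (F ` ref_simplex))"

definition poly_deg :: "nat \<Rightarrow> (real^'n::finite \<Rightarrow> real) \<Rightarrow> bool" where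
  "poly_deg k q \<longleftrightarrow>
     (\<exists>c. \<forall>x. q x = (\<Sum>\<alpha>\<in>(\<Union>m\<le>k. multi_indices m). c \<alpha> * (\<Prod>i\<in>UNIV. (x $ i) ^ \<alpha> i)))"

definition Sh :: "(real^'n::finite) set \<Rightarrow> (real^'n \<Rightarrow> real^'n) set \<Rightarrow> nat \<Rightarrow> (real^'n \<Rightarrow> real) set" where
  "Sh \<Omega> T r = {v. continuous_on (closure \<Omega>) v \<and>
     (\<forall>F\<in>T. \<exists>q. poly_deg (r - 1) q \<and> (\<forall>x\<in>ref_simplex. v (F x) = q x))}"

definition Sh0_vec :: "(real^'n::finite) set \<Rightarrow> (real^'n \<Rightarrow> real^'n) set \<Rightarrow> nat \<Rightarrow> (real^'n \<Rightarrow> real^'n) set" where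
  "Sh0_vec \<Omega> T r = {v. \<forall>i. (\<lambda>x. v x $ i) \<in> Sh \<Omega> T r \<inter> H10 \<Omega>}"

text \<open>The product of the barycentric coordinates of the element.\<close>
definition bubble :: "(real^'n::finite \<Rightarrow> real^'n) \<Rightarrow> real^'n \<Rightarrow> real" where
  "bubble F x = (if x \<in> F ` ref_simplex
     then let y = inv_into ref_simplex F x in (1 - (\<Sum>i\<in>UNIV. y $ i)) * (\<Prod>i\<in>UNIV. y $ i)
     else 0)"

text \<open>Velocity and pressure spaces: mini-element for r = 2, Hood--Taylor for \<open>r \<ge> 3\<close>.
  In \<open>Qh\<close> the quotient of \<open>L\<^sup>2\<close> by the constants is realised by functions of zero mean.\<close>
definition Xh :: "(real^'n::finite) set \<Rightarrow> (real^'n \<Rightarrow> real^'n) set \<Rightarrow> nat \<Rightarrow> (real^'n \<Rightarrow> real^'n) set" where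
  "Xh \<Omega> T r = (if r = 2
     then {\<lambda>x. v x + (\<Sum>F\<in>T. bubble F x *\<^sub>R c F) | v c. v \<in> Sh0_vec \<Omega> T 2}
     else Sh0_vec \<Omega> T r)"

definition Qh :: "(real^'n::finite) set \<Rightarrow> (real^'n \<Rightarrow> real^'n) set \<Rightarrow> nat \<Rightarrow> (real^'n \<Rightarrow> real) set" where
  "Qh \<Omega> T r = {q \<in> Sh \<Omega> T (if r = 2 then 2 else r - 1). (\<integral>x. q x \<partial>lebesgue_on \<Omega>) = 0}"

definition Vh :: "(real^'n::finite) set \<Rightarrow> (real^'n \<Rightarrow> real^'n) set \<Rightarrow> nat \<Rightarrow> (real^'n \<Rightarrow> real^'n) set" where
  "Vh \<Omega> T r = {v \<in> Xh \<Omega> T r. \<forall>q\<in>Qh \<Omega> T r. ip \<Omega> q (dvg \<Omega> v) = 0}"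

text \<open>For \<open>\<nabla>v = 0\<close> the quotient is 0 by the convention on division.\<close>
definition inf_sup :: "real \<Rightarrow> (real^'n::finite) set \<Rightarrow> (real^'n \<Rightarrow> real^'n) set \<Rightarrow> nat \<Rightarrow> bool" where
  "inf_sup \<kappa> \<Omega> T r \<longleftrightarrow> (\<forall>q\<in>Qh \<Omega> T r.
     \<kappa> * L2_norm \<Omega> q \<le> (SUP v\<in>Xh \<Omega> T r. ip \<Omega> q (dvg \<Omega> v) / L2_norm \<Omega> (grad \<Omega> v)))"

definition bh :: "(real^'n::finite) set \<Rightarrow> (real^'n \<Rightarrow> real^'n) \<Rightarrow> (real^'n \<Rightarrow> real^'n) \<Rightarrow> (real^'n \<Rightarrow> real^'n) \<Rightarrow> real" where
  "bh \<Omega> u v w = ip \<Omega> (\<lambda>x. grad \<Omega> v x *v u x) w + 1/2 * ip \<Omega> (\<lambda>x. dvg \<Omega> u x *\<^sub>R v x) w"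

section \<open>The numerical method\<close>

text \<open>Linearity holds in \<open>L\<^sup>2(\<Omega>)\<close>, i.e. almost everywhere; with the \<open>L\<^sup>2\<close> bound this makes \<open>IH\<close>
  well defined on classes of functions.\<close>
definition coarse_interpolation ::
    "real \<Rightarrow> real \<Rightarrow> real \<Rightarrow> (real^'n::finite) set \<Rightarrow> ((real^'n \<Rightarrow> real^'n) \<Rightarrow> real^'n \<Rightarrow> real^'n) \<Rightarrow> bool" where
  "coarse_interpolation c\<^sub>0 c\<^sub>I H \<Omega> IH \<longleftrightarrow>
     (\<forall>v\<in>L2 \<Omega>. IH v \<in> L2 \<Omega> \<and> L2_norm \<Omega> (IH v) \<le> c\<^sub>0 * L2_norm \<Omega> v) \<and>
     (\<forall>v\<in>L2 \<Omega>. \<forall>w\<in>L2 \<Omega>. \<forall>a b. AE x in lebesgue_on \<Omega>.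
        IH (\<lambda>x. a *\<^sub>R v x + b *\<^sub>R w x) x = a *\<^sub>R IH v x + b *\<^sub>R IH w x) \<and>
     (\<forall>v\<in>H10_vec \<Omega>. L2_norm \<Omega> (\<lambda>x. v x - IH v x) \<le> c\<^sub>I * H * L2_norm \<Omega> (grad \<Omega> v))"

definition da_galerkin ::
    "real \<Rightarrow> real \<Rightarrow> real \<Rightarrow> (real^'n::finite) set \<Rightarrow> (real^'n \<Rightarrow> real^'n) set
      \<Rightarrow> ((real^'n \<Rightarrow> real^'n) \<Rightarrow> real^'n \<Rightarrow> real^'n) \<Rightarrow> real set
      \<Rightarrow> (real \<Rightarrow> real^'n \<Rightarrow> real^'n) \<Rightarrow> (real \<Rightarrow> real^'n \<Rightarrow> real^'n) \<Rightarrow> (real \<Rightarrow> real^'n \<Rightarrow> real^'n) \<Rightarrow> nat \<Rightarrow> bool" where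
  "da_galerkin \<nu> \<mu> \<beta> \<Omega> T IH J f u uh r \<longleftrightarrow>
     (\<forall>t\<in>J. uh t \<in> Vh \<Omega> T r) \<and>
     (\<exists>uh'. \<forall>t\<in>J. uh' t \<in> Vh \<Omega> T r \<and> has_L2_time_derivative \<Omega> J uh (uh' t) t \<and>
       (\<forall>\<phi>\<in>Vh \<Omega> T r.
          ip \<Omega> (uh' t) \<phi> + \<nu> * ip \<Omega> (grad \<Omega> (uh t)) (grad \<Omega> \<phi>) + bh \<Omega> (uh t) (uh t) \<phi>
            + \<mu> * ip \<Omega> (dvg \<Omega> (uh t)) (dvg \<Omega> \<phi>)
          = ip \<Omega> (f t) \<phi> - \<beta> * ip \<Omega> (\<lambda>x. IH (uh t) x - IH (u t) x) (IH \<phi>)))"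

definition stokes_projection ::
    "(real^'n::finite) set \<Rightarrow> (real^'n \<Rightarrow> real^'n) set \<Rightarrow> nat \<Rightarrow> (real^'n \<Rightarrow> real^'n) \<Rightarrow> (real^'n \<Rightarrow> real^'n) \<Rightarrow> bool" where
  "stokes_projection \<Omega> T r w s \<longleftrightarrow> s \<in> Vh \<Omega> T r \<and>
     (\<forall>\<phi>\<in>Vh \<Omega> T r. ip \<Omega> (grad \<Omega> s) (grad \<Omega> \<phi>) = ip \<Omega> (grad \<Omega> w) (grad \<Omega> \<phi>))"

definition L2_projection ::
    "(real^'n::finite) set \<Rightarrow> (real^'n \<Rightarrow> real) set \<Rightarrow> (real^'n \<Rightarrow> real) \<Rightarrow> (real^'n \<Rightarrow> real) \<Rightarrow> bool" where
  "L2_projection \<Omega> Q p q \<longleftrightarrow> q \<in> Q \<and> (\<forall>g\<in>Q. ip \<Omega> (\<lambda>x. p x - q x) g = 0)"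

text \<open>The approximation properties of the discretization along the solution \<open>(u, p)\<close>, with
  constant \<open>C\<^sub>a\<close>. The time derivative of the Stokes projection of u is the Stokes projection \<open>sd\<close> of
  \<open>ut\<close>; its estimate is required for those j for which \<open>ut\<close> has the regularity occurring in the
  bound. The pressure p is determined up to a constant, whence the quotient norm on the left.\<close>
definition approximation_properties ::
    "real \<Rightarrow> (real^'n::finite) set \<Rightarrow> real \<Rightarrow> (real^'n \<Rightarrow> real^'n) set \<Rightarrow> nat \<Rightarrow> real set
      \<Rightarrow> (real \<Rightarrow> real^'n \<Rightarrow> real^'n) \<Rightarrow> (real \<Rightarrow> real^'n \<Rightarrow> real^'n) \<Rightarrow> (real \<Rightarrow> real^'n \<Rightarrow> real^'n)
      \<Rightarrow> (real \<Rightarrow> real^'n \<Rightarrow> real) \<Rightarrow> bool" where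
  "approximation_properties C\<^sub>a \<Omega> h T r J u ut sm p \<longleftrightarrow>
     (AE t in lebesgue_on J.
        (\<forall>j\<in>{1..r}. L2_norm \<Omega> (\<lambda>x. u t x - sm t x) + h * Hs_vec_norm \<Omega> 1 (\<lambda>x. u t x - sm t x)
            \<le> C\<^sub>a * Hs_vec_norm \<Omega> j (u t) * h ^ j) \<and>
        (\<forall>j\<in>{1..r}. \<forall>sd. ut t \<in> Hs_vec \<Omega> j \<and> stokes_projection \<Omega> T r (ut t) sd \<longrightarrow>
           L2_norm \<Omega> (\<lambda>x. ut t x - sd x) + h * Hs_vec_norm \<Omega> 1 (\<lambda>x. ut t x - sd x)
            \<le> C\<^sub>a * Hs_vec_norm \<Omega> j (ut t) * h ^ j) \<and>
        Linf_norm \<Omega> (grad \<Omega> (\<lambda>x. u t x - sm t x)) \<le> C\<^sub>a * Linf_norm \<Omega> (grad \<Omega> (u t)) \<and>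
        (\<forall>j\<in>{1..r}. \<forall>q. L2_projection \<Omega> (Qh \<Omega> T r) (p t) q \<longrightarrow>
           quot_norm \<Omega> 0 (\<lambda>x. p t x - q x) \<le> C\<^sub>a * h ^ (j - 1) * quot_norm \<Omega> (j - 1) (p t)))"

text \<open>\<open>K\<^sub>1\<close> with its generic constant c made explicit.\<close>
definition K1 :: "real \<Rightarrow> (real^'n::finite) set \<Rightarrow> (real^'n \<Rightarrow> real^'n) \<Rightarrow> real" where
  "K1 c \<Omega> u = c * (sqrt (Hs_vec_norm \<Omega> (CARD('n) - 2) u * Hs_vec_norm \<Omega> 2 u)
     + vol \<Omega> powr ((3 - real CARD('n)) / (2 * real CARD('n)))
         * sqrt (Hs_vec_norm \<Omega> 1 u * Hs_vec_norm \<Omega> 2 u))"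

definition L_const :: "(real^'n::finite) set \<Rightarrow> real \<Rightarrow> real set \<Rightarrow> (real \<Rightarrow> real^'n \<Rightarrow> real^'n) \<Rightarrow> real" where
  "L_const \<Omega> \<mu> J sm =
     2 * (SUP t\<in>J. Linf_norm \<Omega> (grad \<Omega> (sm t)) + (Linf_norm \<Omega> (sm t))\<^sup>2 / (4 * \<mu>))"

end

theory Submission
  imports Defs
begin

text \<open>With the Stokes projection s of u put \<open>w = u - s\<close> and \<open>e = u\<^sub>h - s\<close>. The time derivative of s is
  the Stokes projection of \<open>u\<^sub>t\<close>, so the error equation can be tested with e. By skew symmetry the
  convective terms reduce to \<open>b\<^sub>h(e, s, e)\<close>, at most \<open>L/2 |e|\<^sup>2 + \<mu>/4 |div e|\<^sup>2\<close>, and terms containing w.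
  The first is absorbed by viscosity, nudging and grad-div stabilization, as the conditions on \<open>\<beta>\<close> and H
  give \<open>\<gamma> \<ge> 4L\<close>. No Sobolev embedding is used: in \<open>((w \<cdot> \<nabla>)w, e)\<close> the inverse inequality bounds e in the
  supremum norm by \<open>h\<^sup>-\<^sup>d\<^sup>/\<^sup>2 |e|\<close>, and \<open>|w| \<le> C h\<^sup>3\<^sup>/\<^sup>2 (|u|\<^sub>1 |u|\<^sub>2)\<^sup>1\<^sup>/\<^sup>2\<close> follows from the approximation orders 1
  and 2.\<close>

text \<open>The approximation hypotheses speak of whatever is a Stokes or pressure projection, so
  existence of the projections of \<open>ut\<close> and \<open>p\<close> has to be supplied, and
  that calls for finite dimension. But discrete functions live on the whole space and count only up
  to null sets, so their spaces are literally infinite dimensional. Semi-inner products take the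
  place of inner products, and a pointwise bound by the norm limits the length of orthonormal
  families. Equation and estimates hold at almost every time, the claim at every time. The
  boundedness of \<open>ut\<close> makes u and its projection Lipschitz in time, which carries
  bounds from a dense set of times to all. The final constants may not depend on the size of the
  domain, nor on the mesh beyond \<sigma>; the inverse inequality and a lower bound on the volume
  are therefore derived uniformly in both. Cruder bounds with mesh-dependent constants, such as
  those on gradients of discrete functions, serve only integrability, finite dimension and Lipschitz
  continuity in time and do not enter the result.\<close>

abbreviation (input) seq_limit (infix "---->" 60) where "X ----> l \<equiv> X \<longlonglongrightarrow> l"

section \<open>Square integrable functions\<close>

text \<open>Lebesgue measure is complete: the preimages of an open set under f and g differ by
  subsets of a null set, and these are measurable.\<close>

lemma borel_measurable_lebesgue_on_AE:
 fixes f g :: "'a::euclidean_space => 'b::topological_space"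
 assumes f: "f \<in> borel_measurable (lebesgue_on S)" and S: "S \<in> sets lebesgue"
  and ae: "AE x in lebesgue_on S. f x = g x"
 shows "g \<in> borel_measurable (lebesgue_on S)"
proof (rule borel_measurableI)
 fix B :: "'b set" assume "open B"
 have "AE x in lebesgue. x \<in> S --> f x = g x"
  using ae S by (simp add: AE_restrict_space_iff)
 then obtain N where N: "N \<in> null_sets lebesgue" "{x. \<not> (x \<in> S --> f x = g x)} \<subseteq> N"
  unfolding eventually_ae_filter by auto
 have fB: "f -` B \<inter> S \<in> sets lebesgue"
  using measurable_sets[OF f borel_open[OF \<open>open B\<close>]] S
  by (auto simp: sets_restrict_space_iff space_restrict_space)
 have nullsub: "A \<in> sets lebesgue" if "A \<subseteq> N" for A
  using null_sets_completion_subset[OF that N(1)] by auto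
 have eq: "g -` B \<inter> S = ((f -` B \<inter> S) - {x \<in> f -` B \<inter> S. f x ~= g x}) \<union> {x \<in> g -` B \<inter> S. f x ~= g x}"
  by auto
 have "g -` B \<inter> S \<in> sets lebesgue"
  using N(2) by (subst eq) (intro sets.Un sets.Diff fB nullsub; blast)
 then show "g -` B \<inter> space (lebesgue_on S) \<in> sets (lebesgue_on S)"
  using S by (auto simp: sets_restrict_space_iff space_restrict_space)
qed

lemma L2_zero [simp]: "(%x. 0) \<in> L2 S"
 by (simp add: L2_def)

lemma L2_measurable: "f \<in> L2 S ==> f \<in> borel_measurable (lebesgue_on S)"
 by (simp add: L2_def)

lemma L2_bound:
 assumes "f \<in> borel_measurable (lebesgue_on S)" "g \<in> L2 S"
  and "AE x in lebesgue_on S. norm (f x) <= K * norm (g x)"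
 shows "f \<in> L2 S"
proof -
 have [measurable]: "f \<in> borel_measurable (lebesgue_on S)" by fact
 have "integrable (lebesgue_on S) (%x. K\<^sup>2 * (norm (g x))\<^sup>2)"
  using assms(2) by (simp add: L2_def)
 then have "integrable (lebesgue_on S) (%x. (norm (f x))\<^sup>2)"
 proof (rule Bochner_Integration.integrable_bound)
  show "AE x in lebesgue_on S. norm ((norm (f x))\<^sup>2) <= norm (K\<^sup>2 * (norm (g x))\<^sup>2)"
   using assms(3)
  proof eventually_elim
   case (elim x)
   then have "(norm (f x))\<^sup>2 <= (K * norm (g x))\<^sup>2" by (intro power_mono) auto
   then show ?case by (simp add: power_mult_distrib)
  qed
 qed measurable
 then show ?thesis using assms(1) by (simp add: L2_def)
qed

lemma L2_scaleR: "f \<in> L2 S ==> (%x. a *\<^sub>R f x) \<in> L2 S"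
 by (rule L2_bound[where g=f and K="\<bar>a\<bar>"]) (auto simp: L2_def)

lemma L2_add: assumes "f \<in> L2 S" "g \<in> L2 S" shows "(%x. f x + g x) \<in> L2 S"
proof -
 have [measurable]: "f \<in> borel_measurable (lebesgue_on S)" "g \<in> borel_measurable (lebesgue_on S)"
  using assms by (auto simp: L2_def)
 have "integrable (lebesgue_on S) (%x. 2 * (norm (f x))\<^sup>2 + 2 * (norm (g x))\<^sup>2)"
  using assms by (simp add: L2_def)
 then have "integrable (lebesgue_on S) (%x. (norm (f x + g x))\<^sup>2)"
 proof (rule Bochner_Integration.integrable_bound)
  have "(norm (f x + g x))\<^sup>2 <= 2 * (norm (f x))\<^sup>2 + 2 * (norm (g x))\<^sup>2" for x
  proof -
   have "(norm (f x + g x))\<^sup>2 <= (norm (f x) + norm (g x))\<^sup>2"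
    by (intro power_mono norm_triangle_ineq) auto
   also have "... <= 2 * (norm (f x))\<^sup>2 + 2 * (norm (g x))\<^sup>2"
    using zero_le_power2[of "norm (f x) - norm (g x)"] by (simp add: power2_eq_square algebra_simps)
   finally show ?thesis .
  qed
  then show "AE x in lebesgue_on S. norm ((norm (f x + g x))\<^sup>2) <= norm (2 * (norm (f x))\<^sup>2 + 2 * (norm (g x))\<^sup>2)"
   by auto
 qed measurable
 then show ?thesis by (simp add: L2_def)
qed

lemma L2_diff: "f \<in> L2 S ==> g \<in> L2 S ==> (%x. f x - g x) \<in> L2 S"
 using L2_add[OF _ L2_scaleR, of f S g "-1"] by simp

lemma L2_sum: "(!!i. i \<in> I ==> f i \<in> L2 S) ==> (%x. \<Sum>i\<in>I. f i x) \<in> L2 S"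
 by (induction I rule: infinite_finite_induct) (auto intro: L2_add)

lemma L2_AE_cong:
 assumes "f \<in> L2 S" "S \<in> sets lebesgue" "AE x in lebesgue_on S. f x = g x"
 shows "g \<in> L2 S"
proof (rule L2_bound[where g=f and K=1])
 show "g \<in> borel_measurable (lebesgue_on S)"
  by (rule borel_measurable_lebesgue_on_AE[OF L2_measurable[OF assms(1)] assms(2,3)])
 show "AE x in lebesgue_on S. norm (g x) <= 1 * norm (f x)"
  using assms(3) by eventually_elim auto
qed (use assms in auto)

lemma norm_axis_eq: "norm (axis i y :: ('b::real_normed_vector)^'m::finite) = norm y"
 by (simp add: norm_vec_def L2_set_def axis_def if_distrib[of norm] if_distrib[of "%t. t\<^sup>2"] sum.delta cong: if_cong)

text \<open>The field is reassembled as a sum of axis vectors, so that measurability and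
  integrability both follow from closure under sums.\<close>

lemma L2_componentwise:
 assumes "!!i. (%x. v x $ i) \<in> L2 S"
 shows "(v :: real^'n => ('b::euclidean_space)^'m) \<in> L2 S"
proof -
 have *: "(%x. axis i (v x $ i)) \<in> L2 S" for i
 proof (rule L2_bound[where K=1, OF _ assms[of i]])
  have "(%y. axis i y :: 'b^'m) \<in> borel_measurable borel"
   by (intro borel_measurable_continuous_onI continuous_intros linear_continuous_on)
    (auto simp: linear_linear intro!: linearI simp: axis_def vec_eq_iff)
  then show "(%x. axis i (v x $ i)) \<in> borel_measurable (lebesgue_on S)"
   using assms[of i] by (auto simp: L2_def intro: measurable_compose)
  show "AE x in lebesgue_on S. norm (axis i (v x $ i)) <= 1 * norm (v x $ i)"
   by (simp add: norm_axis_eq)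
 qed
 have "(%x. \<Sum>i\<in>UNIV. axis i (v x $ i)) \<in> L2 S"
  by (intro L2_sum *)
 moreover have "(\<Sum>i\<in>UNIV. axis i (v x $ i)) = v x" for x
  by (simp add: vec_eq_iff axis_def if_distrib[of "%f. f $ _"] sum.delta cong: if_cong)
 ultimately show ?thesis by simp
qed

lemma L2_component: "(v :: real^'n => ('b::euclidean_space)^'m) \<in> L2 S ==> (%x. v x $ i) \<in> L2 S"
 by (rule L2_bound[where g=v and K=1])
  (auto simp: L2_def Finite_Cartesian_Product.norm_nth_le
   intro!: measurable_compose[OF _ borel_measurable_continuous_onI[OF continuous_on_component]])

lemma L2_inner_integrable:
 assumes "f \<in> L2 S" "g \<in> L2 S"
 shows "integrable (lebesgue_on S) (%x. f x \<bullet> g x)"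
proof -
 have [measurable]: "f \<in> borel_measurable (lebesgue_on S)" "g \<in> borel_measurable (lebesgue_on S)"
  using assms by (auto simp: L2_def)
 have "integrable (lebesgue_on S) (%x. (norm (f x))\<^sup>2 + (norm (g x))\<^sup>2)"
  using assms by (simp add: L2_def)
 then show ?thesis
 proof (rule Bochner_Integration.integrable_bound)
  have "\<bar>f x \<bullet> g x\<bar> <= (norm (f x))\<^sup>2 + (norm (g x))\<^sup>2" for x
  proof -
   have "\<bar>f x \<bullet> g x\<bar> <= norm (f x) * norm (g x)" by (rule Cauchy_Schwarz_ineq2)
   also have "... <= (norm (f x))\<^sup>2 + (norm (g x))\<^sup>2"
    using zero_le_power2[of "norm (f x) - norm (g x)"] mult_nonneg_nonneg[OF norm_ge_zero norm_ge_zero, of "f x" "g x"]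
    unfolding power2_diff by linarith
   finally show ?thesis .
  qed
  then show "AE x in lebesgue_on S. norm (f x \<bullet> g x) <= norm ((norm (f x))\<^sup>2 + (norm (g x))\<^sup>2)"
   by auto
 qed measurable
qed

lemma ip_sym: "ip S f g = ip S g f"
 by (simp add: ip_def inner_commute)

lemma ip_nonneg: "0 <= ip S f f"
 by (simp add: ip_def)

lemma ip_lin:
 assumes "f \<in> L2 S" "g \<in> L2 S" "h \<in> L2 S"
 shows "ip S (%x. a *\<^sub>R f x + b *\<^sub>R g x) h = a * ip S f h + b * ip S g h"
 using L2_inner_integrable[OF assms(1,3)] L2_inner_integrable[OF assms(2,3)]
 by (simp add: ip_def inner_add_left)

lemma ip_add: "f \<in> L2 S ==> g \<in> L2 S ==> h \<in> L2 S ==> ip S (%x. f x + g x) h = ip S f h + ip S g h"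
 using ip_lin[of f S g h 1 1] by simp

lemma ip_diff: "f \<in> L2 S ==> g \<in> L2 S ==> h \<in> L2 S ==> ip S (%x. f x - g x) h = ip S f h - ip S g h"
 using ip_lin[of f S g h 1 "-1"] by simp

lemma ip_scaleR: "f \<in> L2 S ==> h \<in> L2 S ==> ip S (%x. a *\<^sub>R f x) h = a * ip S f h"
 using ip_lin[of f S f h a 0] by simp

lemma ip_add_right: "f \<in> L2 S ==> g \<in> L2 S ==> h \<in> L2 S ==> ip S h (%x. f x + g x) = ip S h f + ip S h g"
 unfolding ip_sym[of S h] by (rule ip_add)

lemma ip_diff_right: "f \<in> L2 S ==> g \<in> L2 S ==> h \<in> L2 S ==> ip S h (%x. f x - g x) = ip S h f - ip S h g"
 unfolding ip_sym[of S h] by (rule ip_diff)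

lemma ip_AE_cong:
 assumes "AE x in lebesgue_on S. f x = f' x" "AE x in lebesgue_on S. g x = g' x"
  "f \<in> L2 S" "g \<in> L2 S" "S \<in> sets lebesgue"
 shows "ip S f g = ip S f' g'"
proof -
 have [measurable]: "f \<in> borel_measurable (lebesgue_on S)" "g \<in> borel_measurable (lebesgue_on S)"
  "f' \<in> borel_measurable (lebesgue_on S)" "g' \<in> borel_measurable (lebesgue_on S)"
  using assms L2_AE_cong L2_measurable by blast+
 show ?thesis unfolding ip_def
  by (rule Bochner_Integration.integral_cong_AE) (use assms(1,2) in \<open>auto elim: eventually_elim2\<close>)
qed


lemma L2_norm_nonneg [simp]: "0 <= L2_norm S f"
 by (simp add: L2_norm_def ip_nonneg)

lemma L2_norm_sq: "(L2_norm S f)\<^sup>2 = ip S f f"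
 by (simp add: L2_norm_def ip_nonneg)

lemma L2_norm_AE_cong:
 assumes "AE x in lebesgue_on S. f x = g x" "f \<in> L2 S" "S \<in> sets lebesgue"
 shows "L2_norm S f = L2_norm S g"
 using ip_AE_cong[OF assms(1,1,2,2,3)] by (simp add: L2_norm_def)

text \<open>A semi-inner product on a space of functions: \<open>B\<close> may have null vectors, so functions that
  agree almost everywhere, or have the same gradient, need not be identified.\<close>

locale semi_inner =
 fixes V :: "('x => 'b::real_vector) set" and B :: "('x => 'b) => ('x => 'b) => real"
 assumes V_lin: "!!f g a b. f \<in> V ==> g \<in> V ==> (%x. a *\<^sub>R f x + b *\<^sub>R g x) \<in> V"
  and V_zero: "(%x. 0) \<in> V"
  and B_sym: "!!f g. f \<in> V ==> g \<in> V ==> B f g = B g f"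
  and B_lin: "!!f g h a b. f \<in> V ==> g \<in> V ==> h \<in> V ==>
    B (%x. a *\<^sub>R f x + b *\<^sub>R g x) h = a * B f h + b * B g h"
  and B_nonneg: "!!f. f \<in> V ==> 0 <= B f f"
begin

definition nrm :: "('x => 'b) => real" where "nrm f = sqrt (B f f)"

lemma nrm_nonneg [simp]: "f \<in> V ==> 0 <= nrm f"
 by (simp add: nrm_def B_nonneg)

lemma nrm_sq: "f \<in> V ==> (nrm f)\<^sup>2 = B f f"
 by (simp add: nrm_def B_nonneg)

lemma V_add: "f \<in> V ==> g \<in> V ==> (%x. f x + g x) \<in> V"
 using V_lin[of f g 1 1] by simp

lemma V_diff: "f \<in> V ==> g \<in> V ==> (%x. f x - g x) \<in> V"
 using V_lin[of f g 1 "-1"] by simp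

lemma V_scaleR: "f \<in> V ==> (%x. a *\<^sub>R f x) \<in> V"
 using V_lin[of f f a 0] by simp

lemma V_sum: "(!!i. i \<in> I ==> e i \<in> V) ==> (%x. \<Sum>i\<in>I. a i *\<^sub>R e i x) \<in> V"
proof (induction I rule: infinite_finite_induct)
 case (insert i I)
 then show ?case using V_add[OF V_scaleR[of "e i" "a i"], of "%x. \<Sum>i\<in>I. a i *\<^sub>R e i x"] by simp
qed (auto intro: V_zero)

lemma B_add: "f \<in> V ==> g \<in> V ==> h \<in> V ==> B (%x. f x + g x) h = B f h + B g h"
 using B_lin[of f g h 1 1] by simp

lemma B_diff: "f \<in> V ==> g \<in> V ==> h \<in> V ==> B (%x. f x - g x) h = B f h - B g h"
 using B_lin[of f g h 1 "-1"] by simp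

lemma B_scaleR: "f \<in> V ==> h \<in> V ==> B (%x. a *\<^sub>R f x) h = a * B f h"
 using B_lin[of f f h a 0] by simp

lemma B_zero: "h \<in> V ==> B (%x. 0) h = 0"
 using B_scaleR[of h h 0] by simp

lemma B_sum: "(!!i. i \<in> I ==> e i \<in> V) ==> h \<in> V ==> B (%x. \<Sum>i\<in>I. a i *\<^sub>R e i x) h = (\<Sum>i\<in>I. a i * B (e i) h)"
 by (induction I rule: infinite_finite_induct)
  (auto simp: B_zero B_add B_scaleR V_scaleR V_sum)

text \<open>The form is nonnegative on all combinations of f and g. Since \<open>B g g = 0\<close>
  does not force g to vanish, that case is separate: a nonzero \<open>B f g\<close> would make the
  form negative for a suitable b.\<close>

lemma Cauchy_Schwarz:
 assumes "f \<in> V" "g \<in> V"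
 shows "\<bar>B f g\<bar> <= nrm f * nrm g"
proof -
 have *: "0 <= a\<^sup>2 * B f f + 2 * a * b * B f g + b\<^sup>2 * B g g" for a b
 proof -
  let ?w = "%x. a *\<^sub>R f x + b *\<^sub>R g x"
  have w: "?w \<in> V" by (intro V_lin assms)
  have "0 <= B ?w ?w" by (rule B_nonneg[OF w])
  also have "... = a * B f ?w + b * B g ?w" by (rule B_lin[OF assms w])
  also have "B f ?w = a * B f f + b * B g f"
   using B_sym[OF assms(1) w] B_lin[OF assms assms(1)] by simp
  also have "B g ?w = a * B f g + b * B g g"
   using B_sym[OF assms(2) w] B_lin[OF assms assms(2)] by simp
  also have "B g f = B f g" using B_sym assms by simp
  finally show ?thesis by (simp add: algebra_simps power2_eq_square)
 qed
 have "(B f g)\<^sup>2 <= B f f * B g g"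
 proof (cases "B g g = 0")
  case True
  have "B f g = 0"
  proof (rule ccontr)
   assume n: "B f g ~= 0"
   have "0 <= B f f + 2 * (- (B f f + 1) / (2 * B f g)) * B f g"
    using *[of 1 "- (B f f + 1) / (2 * B f g)"] True by simp
   then show False using n by (simp add: field_simps)
  qed
  then show ?thesis using True by simp
 next
  case False
  then have pos: "B g g > 0" using B_nonneg[OF assms(2)] by simp
  \<comment> \<open>The coefficients \<open>B g g\<close> and \<open>- B f g\<close> are the
    minimising ones up to a common factor, which avoids a division.\<close>
  have "0 <= (B g g)\<^sup>2 * B f f + 2 * B g g * (- B f g) * B f g + (- B f g)\<^sup>2 * B g g"
   by (rule *)
  then have "0 <= B g g * (B f f * B g g - (B f g)\<^sup>2)"
   by (simp add: algebra_simps power2_eq_square)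
  then show ?thesis using pos by (simp add: zero_le_mult_iff)
 qed
 then have "sqrt ((B f g)\<^sup>2) <= sqrt (B f f * B g g)" by (rule real_sqrt_le_mono)
 then show ?thesis by (simp add: nrm_def real_sqrt_mult)
qed

lemma nrm_triangle:
 assumes "f \<in> V" "g \<in> V"
 shows "nrm (%x. f x + g x) <= nrm f + nrm g"
proof (rule power2_le_imp_le)
 let ?w = "%x. f x + g x"
 have w: "?w \<in> V" by (intro V_add assms)
 have "(nrm ?w)\<^sup>2 = B f ?w + B g ?w" using B_add[OF assms w] nrm_sq[OF w] by simp
 also have "... = B f f + 2 * B f g + B g g"
  using B_sym[OF assms(1) w] B_sym[OF assms(2) w] B_add[OF assms assms(1)] B_add[OF assms assms(2)] B_sym[OF assms] by simp
 also have "... <= (nrm f + nrm g)\<^sup>2"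
  using Cauchy_Schwarz[OF assms] by (simp add: power2_sum nrm_sq assms)
 finally show "(nrm ?w)\<^sup>2 <= (nrm f + nrm g)\<^sup>2" .
qed (use assms in auto)

lemma nrm_scaleR: "f \<in> V ==> nrm (%x. a *\<^sub>R f x) = \<bar>a\<bar> * nrm f"
 unfolding nrm_def using B_scaleR[of f "%x. a *\<^sub>R f x" a] B_scaleR[of f f a] B_sym[OF V_scaleR[of f a], of f] V_scaleR[of f a]
 by (simp add: real_sqrt_mult flip: power2_eq_square mult.assoc)

lemma nrm_diff_triangle: "f \<in> V ==> g \<in> V ==> nrm (%x. f x - g x) <= nrm f + nrm g"
 using nrm_triangle[of f "%x. (-1) *\<^sub>R g x"] nrm_scaleR[of g "-1"] V_scaleR[of g "-1"] by simp

lemma nrm_reverse_triangle: "f \<in> V ==> g \<in> V ==> \<bar>nrm f - nrm g\<bar> <= nrm (%x. f x - g x)"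
 using nrm_triangle[of "%x. f x - g x" g] nrm_triangle[of "%x. (-1) *\<^sub>R (f x - g x)" f]
  nrm_scaleR[of "%x. f x - g x" "-1"] V_scaleR[of "%x. f x - g x" "-1"] V_diff[of f g] by simp

section \<open>Orthonormal families and the Riesz representation\<close>

definition orthonormal :: "(nat => 'x => 'b) => nat => bool" where
 "orthonormal e k \<longleftrightarrow> (\<forall>i<k. e i \<in> V) & (\<forall>i<k. \<forall>j<k. B (e i) (e j) = (if i = j then 1 else 0))"

definition resid :: "(nat => 'x => 'b) => nat => ('x => 'b) => 'x => 'b" where
 "resid e k v = (%x. v x - (\<Sum>i<k. B v (e i) *\<^sub>R e i x))"

lemma resid_in: "orthonormal e k ==> v \<in> V ==> resid e k v \<in> V"
 unfolding resid_def orthonormal_def by (intro V_diff V_sum) auto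

lemma resid_orth:
 assumes "orthonormal e k" "v \<in> V" "j < k"
 shows "B (resid e k v) (e j) = 0"
proof -
 have e: "!!i. i \<in> {..<k} ==> e i \<in> V" "e j \<in> V" using assms by (auto simp: orthonormal_def)
 have "B (resid e k v) (e j) = B v (e j) - (\<Sum>i<k. B v (e i) * B (e i) (e j))"
  unfolding resid_def using B_diff[OF assms(2) V_sum[of "{..<k}" e "%i. B v (e i)"] e(2)] B_sum[of "{..<k}" e "e j"] e by simp
 also have "(\<Sum>i<k. B v (e i) * B (e i) (e j)) = (\<Sum>i<k. if i = j then B v (e i) else 0)"
  using assms by (intro sum.cong) (auto simp: orthonormal_def)
 finally show ?thesis using assms(3) by simp
qed

lemma orthonormal_extend:
 assumes "orthonormal e k" "v \<in> V" "B (resid e k v) (resid e k v) ~= 0"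
 shows "orthonormal (e(k := (%x. (1 / nrm (resid e k v)) *\<^sub>R resid e k v x))) (Suc k)"
proof -
 let ?r = "resid e k v"
 have r: "?r \<in> V" by (rule resid_in[OF assms(1,2)])
 have n: "nrm ?r ~= 0" "nrm ?r * nrm ?r = B ?r ?r"
  using assms(3) nrm_sq[OF r] by (auto simp: power2_eq_square)
 let ?f = "%x. (1 / nrm ?r) *\<^sub>R ?r x"
 have f: "?f \<in> V" by (intro V_scaleR r)
 have 1: "B ?f (e j) = 0" "B (e j) ?f = 0" if "j < k" for j
 proof -
  have ej: "e j \<in> V" using assms(1) that by (auto simp: orthonormal_def)
  show "B ?f (e j) = 0" using B_scaleR[OF r ej] resid_orth[OF assms(1,2) that] by simp
  then show "B (e j) ?f = 0" using B_sym[OF ej f] by simp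
 qed
 have "B ?f ?f = 1"
  using B_scaleR[OF r f, of "1 / nrm ?r"] B_sym[OF r f] B_scaleR[OF r r, of "1 / nrm ?r"] n(1) n(2)[symmetric] by simp
 then show ?thesis using 1 f assms(1) by (auto simp: orthonormal_def less_Suc_eq)
qed

text \<open>Completeness is meant modulo null vectors: the residual has norm zero but need not be
  the zero function.\<close>

definition complete_orthonormal :: "(nat => 'x => 'b) => nat => bool" where
 "complete_orthonormal e k \<longleftrightarrow> orthonormal e k & (\<forall>v\<in>V. nrm (resid e k v) = 0)"

text \<open>A family of maximal length is complete, because a residual of nonzero norm could be
  normalised and appended.\<close>

lemma complete_orthonormal_exists:
 assumes "!!e k. orthonormal e k ==> k <= N"
 shows "\<exists>e k. complete_orthonormal e k"
proof -
 let ?P = "%k. \<exists>e. orthonormal e k"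
 have 0: "?P 0" by (auto simp: orthonormal_def)
 define k where "k = (GREATEST k. ?P k)"
 have k: "?P k" unfolding k_def by (rule GreatestI_nat[of ?P 0 N]) (use assms 0 in auto)
 have km: "j <= k" if "?P j" for j unfolding k_def by (rule Greatest_le_nat[of ?P j N]) (use assms that in auto)
 from k obtain e where e: "orthonormal e k" by auto
 have "nrm (resid e k v) = 0" if "v \<in> V" for v
  using orthonormal_extend[OF e that] km[of "Suc k"] by (force simp: nrm_def)
 then show ?thesis using e by (auto simp: complete_orthonormal_def)
qed

lemma B_null: "f \<in> V ==> g \<in> V ==> nrm f = 0 ==> B f g = 0"
 using Cauchy_Schwarz[of f g] by simp

text \<open>The representer has the coefficients \<open>l (e i)\<close>. The bound on l, whatever
  its constant, makes l vanish on residuals, which have norm zero.\<close>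

lemma Riesz:
 assumes e: "complete_orthonormal e k"
  and lin: "!!f g a b. f \<in> V ==> g \<in> V ==> l (%x. a *\<^sub>R f x + b *\<^sub>R g x) = a * l f + b * l g"
  and bd: "!!f. f \<in> V ==> \<bar>l f\<bar> <= K * nrm f"
 shows "\<exists>s\<in>V. \<forall>v\<in>V. B s v = l v"
proof
 have o: "orthonormal e k" using e by (simp add: complete_orthonormal_def)
 have eV: "!!i. i \<in> {..<k} ==> e i \<in> V" using o by (auto simp: orthonormal_def)
 let ?s = "%x. \<Sum>i<k. l (e i) *\<^sub>R e i x"
 show "?s \<in> V" by (intro V_sum eV)
 show "\<forall>v\<in>V. B ?s v = l v"
 proof
  fix v assume v: "v \<in> V"
  have l0: "l (%x. 0) = 0" using lin[OF V_zero V_zero, of 0 0] by simp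
  have lsum: "l (%x. \<Sum>i\<in>I. a i *\<^sub>R e i x) = (\<Sum>i\<in>I. a i * l (e i))" if "I \<subseteq> {..<k}" for a and I :: "nat set"
   using that
  proof (induction I rule: infinite_finite_induct)
   case (insert i I)
   then have "(%x. \<Sum>i\<in>I. a i *\<^sub>R e i x) \<in> V" "e i \<in> V" by (auto intro!: V_sum eV)
   then show ?case using lin[of "e i" "%x. \<Sum>i\<in>I. a i *\<^sub>R e i x" "a i" 1] insert by simp
  qed (auto simp: l0)
  have r: "resid e k v \<in> V" by (rule resid_in[OF o v])
  have "l (resid e k v) = 0" using bd[OF r] e v by (simp add: complete_orthonormal_def)
  moreover have "l (resid e k v) = l v - (\<Sum>i<k. B v (e i) * l (e i))"
   using lin[OF v V_sum[of "{..<k}" e "%i. B v (e i)", OF eV], of 1 "-1"] lsum[of "{..<k}" "%i. B v (e i)"]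
   by (simp add: resid_def)
  moreover have "B ?s v = (\<Sum>i<k. B v (e i) * l (e i))"
   using B_sum[of "{..<k}" e, OF eV v, where a="%i. l (e i)"] B_sym[OF v eV] by (simp add: mult.commute)
  ultimately show "B ?s v = l v" by simp
 qed
qed

end

lemma semi_inner_L2: "semi_inner (L2 S) (ip S)"
 by unfold_locales (auto intro!: L2_add L2_scaleR simp: ip_lin ip_nonneg intro: ip_sym)

lemma L2_norm_eq_nrm: "L2_norm S = semi_inner.nrm (ip S)"
 by (rule ext) (simp add: L2_norm_def semi_inner.nrm_def[OF semi_inner_L2])

lemmas ip_CS = semi_inner.Cauchy_Schwarz[OF semi_inner_L2, folded L2_norm_eq_nrm]
lemmas L2_norm_triangle = semi_inner.nrm_triangle[OF semi_inner_L2, folded L2_norm_eq_nrm]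
lemmas L2_norm_diff_triangle = semi_inner.nrm_diff_triangle[OF semi_inner_L2, folded L2_norm_eq_nrm]
lemmas L2_norm_reverse_triangle = semi_inner.nrm_reverse_triangle[OF semi_inner_L2, folded L2_norm_eq_nrm]
lemmas L2_norm_scaleR = semi_inner.nrm_scaleR[OF semi_inner_L2, folded L2_norm_eq_nrm]

lemma L2_norm_sum: "(!!i. i \<in> I ==> f i \<in> L2 S) ==> L2_norm S (%x. \<Sum>i\<in>I. f i x) <= (\<Sum>i\<in>I. L2_norm S (f i))"
proof (induction I rule: infinite_finite_induct)
 case (insert i I)
 then show ?case
  using L2_norm_triangle[of "f i" S "%x. \<Sum>i\<in>I. f i x"] by (auto simp: L2_sum)
qed (auto simp: L2_norm_def ip_def)

lemma L2_norm_mono: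
 assumes "f \<in> borel_measurable (lebesgue_on S)" "g \<in> L2 S" "0 <= K"
  and "AE x in lebesgue_on S. norm (f x) <= K * norm (g x)"
 shows "L2_norm S f <= K * L2_norm S g"
proof -
 have f: "f \<in> L2 S" by (rule L2_bound[OF assms(1,2,4)])
 have "ip S f f <= (\<integral>x. K\<^sup>2 * (g x \<bullet> g x) \<partial>lebesgue_on S)"
  unfolding ip_def
 proof (rule integral_mono_AE)
  show "AE x in lebesgue_on S. f x \<bullet> f x <= K\<^sup>2 * (g x \<bullet> g x)"
   using assms(4)
  proof eventually_elim
   case (elim x)
   then have "(norm (f x))\<^sup>2 <= (K * norm (g x))\<^sup>2" by (intro power_mono) auto
   then show ?case by (simp add: power_mult_distrib power2_norm_eq_inner)
  qed
 qed (use L2_inner_integrable[OF f f] L2_inner_integrable[OF assms(2,2)] in auto)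
 then have "ip S f f <= K\<^sup>2 * ip S g g" by (simp add: ip_def)
 then have "sqrt (ip S f f) <= sqrt (K\<^sup>2 * ip S g g)" by simp
 then show ?thesis using assms(3) by (simp add: L2_norm_def real_sqrt_mult)
qed

lemma L2_norm_zero_AE:
 assumes "f \<in> L2 S" "L2_norm S f = 0"
 shows "AE x in lebesgue_on S. f x = 0"
proof -
 have "(\<integral>x. f x \<bullet> f x \<partial>lebesgue_on S) = 0" using assms(2) by (simp add: L2_norm_def ip_def)
 then have "AE x in lebesgue_on S. f x \<bullet> f x = 0"
  using integral_nonneg_eq_0_iff_AE[OF L2_inner_integrable[OF assms(1,1)]] by simp
 then show ?thesis by eventually_elim auto
qed

lemma L2_mult_bounded:
 fixes f :: "real^'n => real" and g :: "real^'n => 'b::euclidean_space"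
 assumes "f \<in> borel_measurable (lebesgue_on S)" "AE x in lebesgue_on S. \<bar>f x\<bar> <= K" "g \<in> L2 S"
 shows "(%x. f x *\<^sub>R g x) \<in> L2 S"
proof (rule L2_bound[OF _ assms(3)])
 show "(%x. f x *\<^sub>R g x) \<in> borel_measurable (lebesgue_on S)"
  using assms(1) L2_measurable[OF assms(3)] by measurable
 show "AE x in lebesgue_on S. norm (f x *\<^sub>R g x) <= K * norm (g x)"
  using assms(2) by eventually_elim (simp add: mult_right_mono)
qed

lemma L2_bounded:
 assumes "f \<in> borel_measurable (lebesgue_on S)" "AE x in lebesgue_on S. norm (f x) <= K" "S \<in> lmeasurable"
 shows "f \<in> L2 S"
proof (rule L2_bound[OF assms(1), where g="%x. 1::real" and K=K])
 show "(%x. 1) \<in> L2 S" using assms(3)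
  by (simp add: L2_def finite_measure.integrable_const finite_measure_lebesgue_on)
qed (use assms in auto)

section \<open>Test functions\<close>

lemma diff_continuous: "(!!x. x \<in> U ==> g differentiable (at x)) ==> continuous_on U g"
 by (meson continuous_at_imp_continuous_on differentiable_imp_continuous_within)

lemma lmeasurable_open_bounded: "open (S::(real^'n) set) ==> bounded S ==> S \<in> lmeasurable"
 by (rule lmeasurable_open)

section \<open>Partial derivatives and smooth functions\<close>

lemma partial_eq: "(f has_derivative f') (at x) ==> partial j f x = f' (axis j 1)"
 unfolding partial_def using frechet_derivative_at[of f f' x] by simp

lemma partial_add:
 assumes "f differentiable (at x)" "g differentiable (at x)"
 shows "partial j (%x. f x + g x) x = partial j f x + partial j g x"
 using partial_eq[OF has_derivative_add[OF assms[unfolded frechet_derivative_works]]]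
 by (simp add: partial_def)

lemma partial_scale:
 assumes "f differentiable (at x)"
 shows "partial j (%x. c * f x) x = c * partial j f x"
 using partial_eq[OF has_derivative_mult_right[OF assms[unfolded frechet_derivative_works]]]
 by (simp add: partial_def)

lemma partial_mult:
 assumes "f differentiable (at x)" "g differentiable (at x)"
 shows "partial j (%x. f x * g x) x = f x * partial j g x + partial j f x * g x"
 using partial_eq[OF has_derivative_mult[OF assms[unfolded frechet_derivative_works]]]
 by (simp add: partial_def)

lemma partial_local:
 assumes "open U" "x \<in> U" "!!y. y \<in> U ==> f y = g y"
 shows "partial j f x = partial j g x"
proof -
 have "((f has_derivative D) (at x)) = ((g has_derivative D) (at x))" for D
  using has_derivative_transform_within_open[of f D x UNIV U g] has_derivative_transform_within_open[of g D x UNIV U f] assms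
  by auto
 then show ?thesis by (simp add: partial_def frechet_derivative_def)
qed

lemma smooth_differentiable: "smooth f ==> f differentiable (at x)"
 unfolding smooth_def by (metis partials.simps(1) differentiable_on_def UNIV_I)

lemma partials_append: "partials (is @ js) f = partials is (partials js f)"
 by (induction "is") auto

lemma smooth_partials: "smooth f ==> smooth (partials js f)"
 unfolding smooth_def partials_append[symmetric] by blast

lemma smooth_partial: "smooth f ==> smooth (partial j f)"
 using smooth_partials[of f "[j]"] by simp

text \<open>Meant for classes closed under \<open>partial\<close>, such as products of bumps or
  convolutions with smooth kernels, whose iterated derivatives have no convenient closed
  form.\<close>

lemma smooth_coinduct:
 assumes "f \<in> S" "!!g x. g \<in> S ==> g differentiable (at x)" "!!g j. g \<in> S ==> partial j g \<in> S"
 shows "smooth f"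
proof -
 have "partials is f \<in> S" for "is" by (induction "is") (use assms in auto)
 then show ?thesis using assms(2) by (auto simp: smooth_def differentiable_on_def)
qed

lemma partials_add: "smooth f ==> smooth g ==> partials is (%x. f x + g x) = (%x. partials is f x + partials is g x)"
proof (induction "is")
 case (Cons a "is")
 then show ?case
  using partial_add[OF smooth_differentiable smooth_differentiable, OF smooth_partials smooth_partials, of f g]
  by (simp add: fun_eq_iff[of "partial _ _"])
qed simp

lemma partials_scale: "smooth f ==> partials is (%x. c * f x) = (%x. c * partials is f x)"
proof (induction "is")
 case (Cons a "is")
 then show ?case
  using partial_scale[OF smooth_differentiable, OF smooth_partials, of f]
  by (simp add: fun_eq_iff[of "partial _ _"])
qed simp

lemma smooth_add: "smooth f ==> smooth g ==> smooth (%x. f x + g x)"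
 unfolding smooth_def[of "%x. f x + g x"] differentiable_on_def
 by (auto simp: partials_add intro!: differentiable_add smooth_differentiable[OF smooth_partials])

lemma smooth_scale: "smooth f ==> smooth (%x. c * f x)"
 unfolding smooth_def[of "%x. c * f x"] differentiable_on_def
 by (auto simp: partials_scale intro!: differentiable_mult differentiable_const smooth_differentiable[OF smooth_partials])

lemma partial_zero_outside:
 assumes "closed K" "!!x. x \<notin> K ==> f x = 0" "x \<notin> K"
 shows "partial j f x = 0"
proof -
 have "partial j f x = partial j (%x. 0) x"
  by (rule partial_local[of "- K"]) (use assms in auto)
 also have "... = 0" by (simp add: partial_def)
 finally show ?thesis .
qed

lemma test_add: assumes "f \<in> test_functions S" "g \<in> test_functions S" shows "(%x. f x + g x) \<in> test_functions S"
proof -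
 obtain K L where "compact K" "K \<subseteq> S" "\<forall>x. x \<notin> K --> f x = 0" "compact L" "L \<subseteq> S" "\<forall>x. x \<notin> L --> g x = 0"
  using assms by (auto simp: test_functions_def)
 then have "compact (K \<union> L) & K \<union> L \<subseteq> S & (\<forall>x. x \<notin> K \<union> L --> f x + g x = 0)" by auto
 then show ?thesis using assms smooth_add by (auto simp: test_functions_def)
qed

lemma test_scale: "f \<in> test_functions S ==> (%x. c * f x) \<in> test_functions S"
 using smooth_scale by (auto simp: test_functions_def)

lemma test_partial: assumes "f \<in> test_functions S" shows "partial j f \<in> test_functions S"
proof -
 obtain K where K: "compact K" "K \<subseteq> S" "!!x. x \<notin> K ==> f x = 0" "smooth f"
  using assms by (auto simp: test_functions_def)
 then show ?thesis
  using partial_zero_outside[OF compact_imp_closed[OF K(1)] K(3)] smooth_partial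
  by (auto simp: test_functions_def)
qed

lemma test_partials: "f \<in> test_functions S ==> partials is f \<in> test_functions S"
 by (induction "is") (auto intro: test_partial)

lemma test_mono: "S \<subseteq> S' ==> test_functions S \<subseteq> test_functions S'"
 unfolding test_functions_def by blast

lemma test_differentiable: "f \<in> test_functions S ==> f differentiable (at x)"
 by (simp add: test_functions_def smooth_differentiable)

lemma test_continuous: "f \<in> test_functions W ==> continuous_on S f"
 by (meson continuous_at_imp_continuous_on differentiable_imp_continuous_within test_differentiable)

lemma test_measurable: "f \<in> test_functions S ==> f \<in> borel_measurable borel"
 by (intro borel_measurable_continuous_onI test_continuous)

lemma test_measurable_on:
 assumes "f \<in> test_functions W" shows "f \<in> borel_measurable (lebesgue_on S)"
 by (rule measurable_restrict_space1, rule measurable_completion) (simp add: test_measurable[OF assms])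

lemma test_outside: "f \<in> test_functions S ==> x \<notin> S ==> f x = 0"
 unfolding test_functions_def by blast

lemma test_bounded: assumes "f \<in> test_functions S" shows "\<exists>M\<ge>0. \<forall>x. \<bar>f x\<bar> <= M"
proof -
 obtain K where K: "compact K" "!!x. x \<notin> K ==> f x = 0"
  using assms by (auto simp: test_functions_def)
 have "bounded (f ` K)"
  by (intro compact_imp_bounded compact_continuous_image test_continuous[OF assms] K(1))
 then obtain M where M: "!!x. x \<in> K ==> \<bar>f x\<bar> <= M" by (auto simp: bounded_iff)
 show ?thesis
 proof (intro exI[of _ "\<bar>M\<bar>"] conjI allI)
  fix x show "\<bar>f x\<bar> <= \<bar>M\<bar>" using M[of x] K(2)[of x] by (cases "x \<in> K") auto
 qed auto
qed


lemma integrable_lebesgue_on: "S \<in> sets lebesgue ==>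
  integrable (lebesgue_on S) f \<longleftrightarrow> integrable lebesgue (%x. indicator S x *\<^sub>R (f x :: 'b::euclidean_space))"
 by (simp add: integrable_restrict_space)

lemma integral_lebesgue_on: "S \<in> sets lebesgue ==>
  (\<integral>x. f x \<partial>lebesgue_on S) = (\<integral>x. indicator S x *\<^sub>R (f x :: 'b::euclidean_space) \<partial>lebesgue)"
 by (simp add: integral_restrict_space)

lemma integrable_lebesgue_on_subset:
 "integrable (lebesgue_on S) (f :: 'a::euclidean_space => 'b::euclidean_space) ==> T \<subseteq> S ==> S \<in> sets lebesgue ==> T \<in> sets lebesgue ==> integrable (lebesgue_on T) f"
proof -
 assume f: "integrable (lebesgue_on S) f" and T: "T \<subseteq> S" "S \<in> sets lebesgue" "T \<in> sets lebesgue"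
 have "integrable lebesgue (%x. indicator T x *\<^sub>R (indicator S x *\<^sub>R f x))"
  by (rule integrable_mult_indicator[OF T(3) f[unfolded integrable_lebesgue_on[OF T(2)]]])
 also have "(%x. indicator T x *\<^sub>R (indicator S x *\<^sub>R f x)) = (%x. indicator T x *\<^sub>R f x)"
  using T by (auto simp: fun_eq_iff indicator_def)
 finally show ?thesis using T by (simp add: integrable_lebesgue_on)
qed

lemma test_L2: assumes "f \<in> test_functions S'" "S \<in> sets lebesgue" shows "f \<in> L2 S"
proof -
 obtain K where K: "compact K" "!!x. x \<notin> K ==> f x = 0"
  using assms by (auto simp: test_functions_def)
 obtain M where M: "!!x. \<bar>f x\<bar> <= M" using test_bounded[OF assms(1)] by auto
 have "integrable lebesgue (%x. M\<^sup>2 * indicator K x)"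
  using lmeasurable_compact[OF K(1)] by (intro integrable_mult_right) (simp add: lmeasurable_iff_integrable)
 moreover have "AE x in lebesgue. norm ((norm (f x))\<^sup>2) <= norm (M\<^sup>2 * indicator K x)"
 proof (rule AE_I2)
  fix x
  have "(norm (f x))\<^sup>2 <= M\<^sup>2" using M[of x] by (intro power_mono) auto
  then show "norm ((norm (f x))\<^sup>2) <= norm (M\<^sup>2 * indicator K x)"
   using K(2)[of x] by (auto simp: indicator_def)
 qed
 moreover have "(%x. (norm (f x))\<^sup>2) \<in> borel_measurable lebesgue"
  using test_measurable[OF assms(1)] by (intro measurable_completion) measurable
 ultimately have "integrable lebesgue (%x. (norm (f x))\<^sup>2)"
  by (intro Bochner_Integration.integrable_bound[where g="%x. (norm (f x))\<^sup>2"])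
 then have i: "integrable (lebesgue_on UNIV) (%x. (norm (f x))\<^sup>2)"
  by (simp only: lebesgue_on_UNIV_eq)
 show ?thesis
  using test_measurable_on[OF assms(1), of S] integrable_lebesgue_on_subset[OF i _ _ assms(2)] by (simp add: L2_def)
qed

section \<open>Smooth bumps with compact support\<close>

definition psi :: "real poly => real => real" where
 "psi p t = (if t > 0 then poly p (1 / t) * exp (- (1 / t)) else 0)"

lemma poly_exp_tendsto_0: "((%x. poly p x * exp (- x)) \<longlongrightarrow> (0::real)) at_top"
proof -
 have "((%x. \<Sum>i\<le>degree p. coeff p i * (x ^ i / exp x)) \<longlongrightarrow> (\<Sum>i\<le>degree p. coeff p i * 0)) at_top"
  by (intro tendsto_sum tendsto_mult tendsto_const tendsto_power_div_exp_0)
 then show ?thesis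
  by (simp add: poly_altdef sum_distrib_right exp_minus field_simps sum_divide_distrib)
qed

text \<open>For t > 0 the chain rule sends p to X^2 (p - p'), so the family of all
  \<open>psi p\<close> is closed under differentiation. At 0 every member is flat because exp(-x)
  beats every polynomial.\<close>

lemma psi_has_derivative: "(psi p has_real_derivative psi (monom 1 2 * (p - pderiv p)) t) (at t)"
proof -
 consider "t > 0" | "t < 0" | "t = 0" by linarith
 then show ?thesis
 proof cases
  case 1
  have "((%t. poly p (1 / t) * exp (- (1 / t))) has_real_derivative psi (monom 1 2 * (p - pderiv p)) t) (at t)"
   using 1 by (auto intro!: derivative_eq_intros simp: psi_def poly_monom power2_eq_square field_simps)
  then show ?thesis
   by (rule has_field_derivative_transform_within_open[of _ _ _ "{0<..}"]) (use 1 in \<open>auto simp: psi_def\<close>)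
 next
  case 2
  have "((%t. 0) has_real_derivative psi (monom 1 2 * (p - pderiv p)) t) (at t)"
   using 2 by (simp add: psi_def)
  then show ?thesis
   by (rule has_field_derivative_transform_within_open[of _ _ _ "{..<0}"]) (use 2 in \<open>auto simp: psi_def\<close>)
 next
  case 3
  \<comment> \<open>Once h is replaced by 1/h, division by h becomes multiplication by the variable,
    hence the polynomial \<open>pCons 0 p\<close>.\<close>
  have "((%h. poly (pCons 0 p) h * exp (- h)) \<longlongrightarrow> 0) at_top" by (rule poly_exp_tendsto_0)
  then have "((%h. psi p h / h) \<longlongrightarrow> 0) (at_right 0)"
   unfolding filterlim_at_right_to_top
   by (rule Lim_transform_eventually)
    (auto simp: psi_def field_simps inverse_eq_divide intro!: eventually_mono[OF eventually_gt_at_top[of 0]])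
  moreover have "((%h. psi p h / h) \<longlongrightarrow> 0) (at_left 0)"
   by (rule Lim_transform_eventually[OF tendsto_const])
    (auto simp: psi_def eventually_at_left_field intro!: exI[of _ "-1"])
  ultimately have "((%h. psi p h / h) \<longlongrightarrow> 0) (at 0)"
   by (simp add: filterlim_split_at)
  moreover have "psi q 0 = 0" for q by (simp add: psi_def)
  ultimately show ?thesis using 3 by (simp add: DERIV_def)
 qed
qed

text \<open>Sums and products are included because the product rule leads to them; the class is then
  closed under \<open>partial\<close>, and smoothness follows by coinduction.\<close>

inductive bumpfun :: "(real^'n::finite => real) => bool" where
 psi: "bumpfun (%x. psi p (c * x $ i + a))"
| const: "bumpfun (%x. c)"
| add: "bumpfun f ==> bumpfun g ==> bumpfun (%x. f x + g x)"
| mult: "bumpfun f ==> bumpfun g ==> bumpfun (%x. f x * g x)"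

lemma bumpfun_derivative:
 fixes f :: "real^'n::finite => real"
 shows "bumpfun f ==> (\<forall>x. f differentiable (at x)) & (\<forall>j. bumpfun (partial j f))"
proof (induction rule: bumpfun.induct)
 case (psi p c i a)
 let ?q = "monom 1 2 * (p - pderiv p)"
 have d: "((%x. psi p (c * x $ i + a)) has_derivative (%h. psi ?q (c * x $ i + a) * (c * h $ i))) (at x)" for x :: "real^'n"
  by (rule has_derivative_compose[OF _ psi_has_derivative[unfolded has_field_derivative_def], where f="%x. c * x $ i + a"])
   (auto intro!: derivative_eq_intros bounded_linear.has_derivative[OF bounded_linear_vec_nth])
 have "partial j (%x. psi p (c * x $ i + a)) = (%x. psi ?q (c * x $ i + a) * (c * (axis j 1 :: real^'n) $ i))" for j
  using partial_eq[OF d] by (simp add: fun_eq_iff)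
 then have "bumpfun (partial j (%x::real^'n. psi p (c * x $ i + a)))" for j
  by (simp only:) (intro bumpfun.intros)
 then show ?case using d by (auto simp: differentiable_def)
next
 case (const c)
 have "partial j (%x. c) = (%x::real^'n. 0)" for j
  by (simp add: partial_def fun_eq_iff)
 then show ?case by (auto intro: bumpfun.intros)
next
 case (add f g)
 then have "partial j (%x. f x + g x) = (%x. partial j f x + partial j g x)" for j
  by (simp add: fun_eq_iff partial_add)
 then show ?case using add by (auto intro: bumpfun.intros)
next
 case (mult f g)
 then have "partial j (%x. f x * g x) = (%x. f x * partial j g x + partial j f x * g x)" for j
  by (simp add: fun_eq_iff partial_mult)
 then show ?case using mult by (auto intro!: bumpfun.intros)
qed

lemma bumpfun_smooth: "bumpfun f ==> smooth f"
 by (rule smooth_coinduct[of f "Collect bumpfun"]) (use bumpfun_derivative in auto)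

lemma bumpfun_prod: "(!!i. i \<in> I ==> bumpfun (f i)) ==> bumpfun (%x. \<Prod>i\<in>I. f i x)"
 by (induction I rule: infinite_finite_induct) (auto intro: bumpfun.intros)

text \<open>The factor k steepens the flanks: as k grows the functions tend to the indicator of the
  open box.\<close>

definition box_bump :: "real => real^'n::finite => real^'n => real^'n => real" where
 "box_bump k a b x = (\<Prod>i\<in>UNIV. psi 1 (k * x $ i + (- k * a $ i)) * psi 1 (- k * x $ i + k * b $ i))"

lemma psi_1: "0 <= psi 1 t" "psi 1 t <= 1" "psi 1 t > 0 \<longleftrightarrow> t > 0" "t <= 0 ==> psi 1 t = 0"
 by (auto simp: psi_def)

lemma box_bump_bounds: "0 <= box_bump k a b x" "box_bump k a b x <= 1"
 unfolding box_bump_def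
 by (auto intro!: prod_nonneg prod_le_1 mult_nonneg_nonneg mult_le_one psi_1)

lemma box_bump_zero: assumes "k > 0" "x \<notin> box a b" shows "box_bump k a b x = 0"
proof -
 obtain i where "\<not> (a $ i < x $ i & x $ i < b $ i)" using assms(2) by (auto simp: mem_box_cart)
 then have "k * x $ i + (- k * a $ i) <= 0 \<or> - k * x $ i + k * b $ i <= 0"
  using assms(1) by (auto simp: not_less)
 then have "psi 1 (k * x $ i + (- k * a $ i)) * psi 1 (- k * x $ i + k * b $ i) = 0"
  using psi_1(4) by auto
 then show ?thesis unfolding box_bump_def by (intro prod_zero) auto
qed

lemma box_bump_pos: assumes "k > 0" "x \<in> box a b" shows "0 < box_bump k a b x"
 unfolding box_bump_def
proof (intro prod_pos mult_pos_pos ballI)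
 fix i
 have "a $ i < x $ i" "x $ i < b $ i" using assms by (auto simp: mem_box_cart)
 then show "0 < psi 1 (k * x $ i + (- k * a $ i))" "0 < psi 1 (- k * x $ i + k * b $ i)"
  using assms(1) by (auto simp: psi_1)
qed

lemma box_bump_test:
 assumes "k > 0" "cbox a b \<subseteq> S"
 shows "box_bump k a b \<in> test_functions S"
proof -
 have "bumpfun (box_bump k a b)"
  unfolding box_bump_def by (intro bumpfun_prod bumpfun.mult bumpfun.psi)
 moreover have "\<forall>x. x \<notin> cbox a b --> box_bump k a b x = 0"
  using box_bump_zero[OF assms(1)] box_subset_cbox by blast
 ultimately show ?thesis using assms(2) bumpfun_smooth by (auto simp: test_functions_def intro!: exI[of _ "cbox a b"])
qed

lemma psi_tendsto_1: "t > 0 ==> (%k. psi 1 (real (Suc k) * t)) ----> 1"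
proof -
 assume t: "t > 0"
 have "(%k. exp (- (inverse (real (Suc k)) / t))) ----> exp (- (0 / t))"
  by (intro tendsto_intros LIMSEQ_inverse_real_of_nat) (use t in auto)
 moreover have "psi 1 (real (Suc k) * t) = exp (- (inverse (real (Suc k)) / t))" for k
  using t by (simp add: psi_def field_simps zero_less_mult_iff del: of_nat_Suc)
 ultimately show ?thesis by simp
qed

lemma box_bump_tendsto: "(%k. box_bump (real (Suc k)) a b x) ----> indicator (box a b) x"
proof (cases "x \<in> box a b")
 case True
 have "(%k. \<Prod>i\<in>UNIV. psi 1 (real (Suc k) * (x $ i - a $ i)) * psi 1 (real (Suc k) * (b $ i - x $ i))) ----> (\<Prod>i\<in>(UNIV::'a set). 1 * 1)"
  using True by (intro tendsto_prod tendsto_mult psi_tendsto_1) (auto simp: mem_box_cart)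
 then show ?thesis using True by (simp add: box_bump_def algebra_simps)
qed (simp add: box_bump_zero)

section \<open>The fundamental lemma of the calculus of variations\<close>

lemma fundamental_lemma_box:
 fixes g :: "real^'n::finite => real"
 assumes g: "locally_integrable S g" and S: "open S" and z: "!!\<phi>. \<phi> \<in> test_functions S ==> ip S g \<phi> = 0"
  and ab: "cbox a b \<subseteq> S"
 shows "(\<integral>x. indicator (box a b) x * g x \<partial>lebesgue) = 0"
proof -
 have O: "S \<in> sets lebesgue" using S by simp
 have "integrable (lebesgue_on (cbox a b)) g" using g ab by (simp add: locally_integrable_def compact_cbox)
 then have gi: "integrable lebesgue (%x. indicator (cbox a b) x * g x)"
  by (simp add: integrable_lebesgue_on)
 have eq: "box_bump (real (Suc k)) a b x * (indicator (cbox a b) x * g x) = indicator S x * (g x * box_bump (real (Suc k)) a b x)" for k x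
  using box_bump_zero[of "real (Suc k)" x a b] ab box_subset_cbox[of a b] by (cases "x \<in> box a b") (auto simp: indicator_def)
 \<comment> \<open>Dominated convergence, with g cut off to the closed box as majorant. Each bump is
   a test function on S because the closed box lies in S.\<close>
 have "(%k. \<integral>x. box_bump (real (Suc k)) a b x * (indicator (cbox a b) x * g x) \<partial>lebesgue)
   ----> (\<integral>x. indicator (box a b) x * (indicator (cbox a b) x * g x) \<partial>lebesgue)"
 proof (rule integral_dominated_convergence[where w="%x. \<bar>indicator (cbox a b) x * g x\<bar>"])
  show "AE x in lebesgue. (%k. box_bump (real (Suc k)) a b x * (indicator (cbox a b) x * g x)) ----> indicator (box a b) x * (indicator (cbox a b) x * g x)"
   by (intro AE_I2 tendsto_mult box_bump_tendsto tendsto_const)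
  show "(%x. box_bump (real (Suc k)) a b x * (indicator (cbox a b) x * g x)) \<in> borel_measurable lebesgue" for k
  proof (rule borel_measurable_times[OF _ borel_measurable_integrable[OF gi]])
   show "box_bump (real (Suc k)) a b \<in> borel_measurable lebesgue"
    using test_measurable[OF box_bump_test[of "real (Suc k)" a b UNIV]] by (intro measurable_completion) simp
  qed
  show "AE x in lebesgue. norm (box_bump (real (Suc k)) a b x * (indicator (cbox a b) x * g x)) <= \<bar>indicator (cbox a b) x * g x\<bar>" for k
   using box_bump_bounds[of "real (Suc k)" a b] by (auto simp: abs_mult intro!: mult_left_le_one_le)
  show "(%x. indicator (box a b) x * (indicator (cbox a b) x * g x)) \<in> borel_measurable lebesgue"
   by (rule borel_measurable_times[OF borel_measurable_indicator borel_measurable_integrable[OF gi]]) simp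
 qed (use gi in auto)
 moreover have "(\<integral>x. box_bump (real (Suc k)) a b x * (indicator (cbox a b) x * g x) \<partial>lebesgue) = 0" for k
  using z[OF box_bump_test[of "real (Suc k)" a b S]] ab unfolding eq by (simp add: ip_def integral_lebesgue_on[OF O])
 moreover have "indicator (box a b) x * (indicator (cbox a b) x * g x) = indicator (box a b) x * g x" for x
  using box_subset_cbox[of a b] by (auto simp: indicator_def)
 ultimately have "(%k::nat. 0::real) ----> (\<integral>x. indicator (box a b) x * g x \<partial>lebesgue)" by (simp only:)
 then show ?thesis using LIMSEQ_unique[OF tendsto_const] by metis
qed

text \<open>Open boxes are an intersection-stable generator of the Borel sets. The induction step
  for complements needs a vanishing integral over the whole space, obtained by exhausting it with
  boxes.\<close>

lemma integral_boxes_zero_AE: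
 fixes g :: "'a::euclidean_space => real"
 assumes g: "integrable lborel g" and z: "!!a b. (\<integral>x. indicator (box a b) x * g x \<partial>lborel) = 0"
 shows "AE x in lborel. g x = 0"
proof (rule density_unique_real)
 have m: "(\<integral>x. g x \<partial>lborel) = 0"
 proof -
  have "(%k. \<integral>x. indicator (box (- real k *\<^sub>R One) (real k *\<^sub>R One)) x * g x \<partial>lborel) ----> (\<integral>x. g x \<partial>lborel)"
  proof (rule integral_dominated_convergence[where w="%x. \<bar>g x\<bar>"])
   show "AE x in lborel. (%k. indicator (box (- real k *\<^sub>R One) (real k *\<^sub>R One)) x * g x) ----> g x"
   proof (rule AE_I2)
    fix x :: 'a
    obtain n where n: "norm x < real n" using reals_Archimedean2 by blast
    have "\<forall>\<^sub>F k in sequentially. x \<in> box (- real k *\<^sub>R One) (real k *\<^sub>R One)"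
    proof (rule eventually_sequentiallyI[of n])
     fix k assume "n <= k"
     then have "\<bar>x \<bullet> i\<bar> < real k" if "i \<in> Basis" for i
      using Basis_le_norm[OF that, of x] n by linarith
     then show "x \<in> box (- real k *\<^sub>R One) (real k *\<^sub>R One)" by (auto simp: mem_box abs_less_iff minus_less_iff)
    qed
    then have "\<forall>\<^sub>F k in sequentially. indicator (box (- real k *\<^sub>R One) (real k *\<^sub>R One)) x * g x = g x"
     by (rule eventually_mono) (simp only: indicator_simps mult_1)
    then show "(%k. indicator (box (- real k *\<^sub>R One) (real k *\<^sub>R One)) x * g x) ----> g x"
     by (rule tendsto_eventually)
   qed
  qed (use g in \<open>auto simp: indicator_def\<close>)
  then have "(%k::nat. 0::real) ----> (\<integral>x. g x \<partial>lborel)" by (simp only: z)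
  then show ?thesis using LIMSEQ_unique[OF tendsto_const] by metis
 qed
 have "(\<integral>x. indicator A x * g x \<partial>lborel) = 0" if "A \<in> sets borel" for A
 proof -
  have A: "A \<in> sigma_sets UNIV (range (%(a, b). box a b))" using that by (simp add: borel_eq_box)
  have I: "Int_stable (range (%(a, b). box a b :: 'a set))"
   by (auto simp: Int_stable_def box_Int_box)
  show ?thesis
   using I subset_Pow_Union[of "range (%(a, b). box a b :: 'a set)", THEN subset_trans, OF Pow_mono[OF subset_UNIV]] A
  proof (induction rule: sigma_sets_induct_disjoint)
   case (compl A)
   have A: "A \<in> sets borel" using compl(1) by (simp add: borel_eq_box)
   have "(\<integral>x. indicator (UNIV - A) x * g x \<partial>lborel) = (\<integral>x. g x - indicator A x * g x \<partial>lborel)"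
    by (intro Bochner_Integration.integral_cong) (auto simp: indicator_def)
   also have "... = 0"
    using integrable_mult_indicator[OF _ g, of A] A compl m by (simp add: Bochner_Integration.integral_diff g)
   finally show ?case .
  next
   case (union A)
   have A: "A i \<in> sets lborel" for i using union by (auto simp: borel_eq_box)
   have "(LINT x:(\<Union>i. A i)|lborel. g x) = (\<Sum>i. LINT x:A i|lborel. g x)"
   proof (rule lebesgue_integral_countable_add[OF A])
    show "A i \<inter> A j = {}" if "i ~= j" for i j using union(1) that by (auto simp: disjoint_family_on_def)
    show "set_integrable lborel (\<Union>i. A i) g"
     unfolding set_integrable_def using A by (intro integrable_mult_indicator[OF _ g]) auto
   qed
   then show ?case using union by (simp add: set_lebesgue_integral_def)
  qed (use z in auto)
 qed
 then show "(LINT x:A|lborel. g x) = (LINT x:A|lborel. 0)" if "A \<in> sets lborel" for A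
  using that by (simp add: set_lebesgue_integral_def)
qed (use g in auto)


text \<open>S is a countable union of closed boxes. On each of them the cut-off function is replaced
  by a Borel representative, to which \<open>integral_boxes_zero_AE\<close> applies since boxes
  intersect in boxes.\<close>

lemma fundamental_lemma:
 fixes g :: "real^'n::finite => real"
 assumes g: "locally_integrable S g" and S: "open S" and z: "!!\<phi>. \<phi> \<in> test_functions S ==> ip S g \<phi> = 0"
 shows "AE x in lebesgue_on S. g x = 0"
proof -
 have *: "AE x in lebesgue. x \<in> cbox a b --> g x = 0" if ab: "cbox a b \<subseteq> S" for a b
 proof -
  let ?f = "%x. indicator (cbox a b) x * g x"
  have "integrable (lebesgue_on (cbox a b)) g" using g ab by (simp add: locally_integrable_def compact_cbox)
  then have gi: "integrable lebesgue ?f" by (simp add: integrable_lebesgue_on)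
  obtain h where h: "h \<in> borel_measurable lborel" "AE x in lborel. ?f x = h x"
   using completion_ex_borel_measurable_real[OF borel_measurable_integrable[OF gi]] by auto
  have h': "AE x in lebesgue. ?f x = h x" using h(2) by (rule AE_completion)
  have hi: "integrable lebesgue h"
   using integrable_cong_AE_imp[OF gi measurable_completion[OF h(1)]] h' by (auto simp: eq_commute)
  have "(\<integral>x. indicator (box c d) x * h x \<partial>lborel) = 0" for c d
  proof -
   obtain u v where uv: "box a b \<inter> box c d = box u v" unfolding box_Int_box by blast
   \<comment> \<open>A degenerate closed box may leave S, but then the open box is empty and
     contributes nothing.\<close>
   have "cbox u v \<subseteq> S \<or> box u v = {}"
   proof (cases "box u v = {}")
    case False
    then have "cbox u v = closure (box u v)" by simp
    also have "... \<subseteq> cbox a b" using uv box_subset_cbox[of a b] by (intro closure_minimal) auto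
    finally show ?thesis using ab by auto
   qed simp
   then have zz: "(\<integral>x. indicator (box u v) x * g x \<partial>lebesgue) = 0"
    using fundamental_lemma_box[OF g S z] by auto
   \<comment> \<open>The boundary of the box is null, so open and closed box are interchangeable
     under the integral.\<close>
   have fr: "AE x in lebesgue. x \<notin> cbox a b - box a b"
    using negligible_frontier_interval[of a b] by (auto simp: negligible_iff_null_sets dest: AE_not_in)
   have "(\<integral>x. indicator (box c d) x * h x \<partial>lborel) = (\<integral>x. indicator (box c d) x * h x \<partial>lebesgue)"
    using h(1) by (intro integral_completion[symmetric]) auto
   also have "... = (\<integral>x. indicator (box u v) x * g x \<partial>lebesgue)"
   proof (rule Bochner_Integration.integral_cong_AE)
    show "(%x. indicator (box c d) x * h x) \<in> borel_measurable lebesgue"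
     by (rule borel_measurable_times[OF borel_measurable_indicator borel_measurable_integrable[OF hi]]) simp
    have "(%x. indicator (box u v) x * ?f x) \<in> borel_measurable lebesgue"
     by (rule borel_measurable_times[OF borel_measurable_indicator borel_measurable_integrable[OF gi]]) simp
    also have "(%x. indicator (box u v) x * ?f x) = (%x. indicator (box u v) x * g x)"
     using uv box_subset_cbox[of a b] by (auto simp: fun_eq_iff indicator_def)
    finally show "(%x. indicator (box u v) x * g x) \<in> borel_measurable lebesgue" .
    show "AE x in lebesgue. indicator (box c d) x * h x = indicator (box u v) x * g x"
     using h' fr
    proof eventually_elim
     case (elim x)
     have "x \<in> box u v \<longleftrightarrow> x \<in> box a b & x \<in> box c d" unfolding uv[symmetric] by blast
     moreover have "x \<in> cbox a b \<longleftrightarrow> x \<in> box a b" using elim(2) box_subset_cbox[of a b] by blast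
     ultimately show ?case using elim(1)
      by (cases "x \<in> box a b"; cases "x \<in> box c d") simp_all
    qed
   qed
   finally show ?thesis using zz by simp
  qed
  moreover have "integrable lborel h" using hi h(1) by (simp add: integrable_completion)
  ultimately have "AE x in lborel. h x = 0" by (intro integral_boxes_zero_AE)
  then have "AE x in lebesgue. h x = 0" by (rule AE_completion)
  with h' show ?thesis by eventually_elim (auto simp: indicator_def split: if_splits)
 qed
 obtain D where D: "countable D" "!!X. X \<in> D ==> X \<subseteq> S" "!!X. X \<in> D ==> \<exists>a b. X = cbox a b" "\<Union>D = S"
  by (rule open_countable_Union_open_cbox[OF S]) blast
 have "AE x in lebesgue. \<forall>X\<in>D. x \<in> X --> g x = 0"
  unfolding AE_ball_countable[OF D(1)] using D(2,3) * by metis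
 then have "AE x in lebesgue. x \<in> S --> g x = 0"
  by eventually_elim (use D(4) in auto)
 then show ?thesis using S by (simp add: AE_restrict_space_iff)
qed

section \<open>Sobolev spaces\<close>

lemma finite_multi_indices: "finite (multi_indices k :: ('n::finite => nat) set)"
proof -
 have "multi_indices k \<subseteq> (UNIV :: 'n set) \<rightarrow>\<^sub>E {..k}"
  by (auto simp: multi_indices_def intro!: member_le_sum)
 then show ?thesis by (rule finite_subset) (auto intro: finite_PiE)
qed

locale bounded_domain =
 fixes \<Omega> :: "(real^'n::finite) set"
 assumes open_dom: "open \<Omega>" and bounded_dom: "bounded \<Omega>" and nonempty_dom: "\<Omega> ~= {}"
begin

abbreviation "Hvn \<equiv> Hs_vec_norm \<Omega>"
abbreviation "nrm2 \<equiv> L2_norm \<Omega>"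
abbreviation "leb \<equiv> lebesgue_on \<Omega>"
abbreviation "bm \<equiv> borel_measurable leb"
abbreviation "qn \<equiv> quot_norm \<Omega>"
abbreviation "TF \<equiv> test_functions \<Omega>"
abbreviation "Sn \<equiv> Linf_norm \<Omega>"
abbreviation "wder \<equiv> weak_deriv \<Omega>"
abbreviation "Hsn \<equiv> Hs_norm \<Omega>"
abbreviation "H0v \<equiv> H10_vec \<Omega>"
abbreviation "Hv \<equiv> Hs_vec \<Omega>"
abbreviation "Gr \<equiv> grad \<Omega>"
abbreviation "Dv \<equiv> dvg \<Omega>"
abbreviation "H0 \<equiv> H10 \<Omega>"
abbreviation "HS \<equiv> Hs \<Omega>"
abbreviation "LL \<equiv> L2 \<Omega>"
abbreviation "inn \<equiv> ip \<Omega>"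
abbreviation "b3 \<equiv> bh \<Omega>"
abbreviation "vD \<equiv> vol \<Omega>"


lemma lmeas: "\<Omega> \<in> lmeasurable"
 using open_dom bounded_dom by (rule lmeasurable_open_bounded)

lemma sets_dom: "\<Omega> \<in> sets lebesgue"
 using lmeas by auto

lemma vol_pos: "0 < vD"
proof -
 have "\<not> negligible \<Omega>" using open_not_negligible[OF open_dom nonempty_dom] .
 then have "vD ~= 0" using negligible_iff_measure0[OF lmeas] by simp
 then show ?thesis by (simp add: zero_less_measure_iff)
qed

lemma L2_subset: "f \<in> LL ==> K \<subseteq> \<Omega> ==> K \<in> sets lebesgue ==> (f :: real^'n => 'b::euclidean_space) \<in> L2 K"
 using integrable_lebesgue_on_subset[of \<Omega> "%x. (norm (f x))\<^sup>2" K] sets_dom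
 by (auto simp: L2_def intro: measurable_restrict_mono)

lemma const_L2: "(%x. c) \<in> LL"
 by (rule L2_bounded[where K="norm c"]) (auto simp: lmeas)

lemma L2_locally_integrable: assumes "f \<in> LL" shows "locally_integrable \<Omega> f"
 unfolding locally_integrable_def
proof (intro allI impI)
 fix K assume K: "compact K & K \<subseteq> \<Omega>"
 then have K': "K \<in> lmeasurable" by (auto intro: lmeasurable_compact)
 have "(%x. 1::real) \<in> L2 K" by (rule L2_bounded[where K=1]) (auto simp: K')
 then show "integrable (lebesgue_on K) f"
  using L2_inner_integrable[OF L2_subset[OF assms, of K], of "%x. 1"] K K' by (auto simp: fmeasurable_def)
qed

lemma locally_integrable_test:
 assumes "locally_integrable \<Omega> g" "\<phi> \<in> TF"
 shows "integrable leb (%x. g x * \<phi> x)"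
proof -
 obtain K where K: "compact K" "K \<subseteq> \<Omega>" "!!x. x \<notin> K ==> \<phi> x = 0"
  using assms by (auto simp: test_functions_def)
 obtain M where M: "M >= 0" "!!x. \<bar>\<phi> x\<bar> <= M" using test_bounded[OF assms(2)] by auto
 have Ks: "K \<in> sets lebesgue" using lmeasurable_compact[OF K(1)] by auto
 have "integrable (lebesgue_on K) g" using assms(1) K by (simp add: locally_integrable_def)
 then have i: "integrable lebesgue (%x. M * (indicator K x * g x))"
  by (simp add: integrable_lebesgue_on[OF Ks])
 have m: "(%x. \<phi> x * (indicator K x * g x)) \<in> borel_measurable lebesgue"
 proof (rule borel_measurable_times)
  show "\<phi> \<in> borel_measurable lebesgue"
   using test_measurable[OF assms(2)] by (intro measurable_completion) simp
  show "(%x. indicator K x * g x) \<in> borel_measurable lebesgue"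
   using borel_measurable_integrable[OF \<open>integrable (lebesgue_on K) g\<close>[unfolded integrable_lebesgue_on[OF Ks]]] by simp
 qed
 have "integrable lebesgue (%x. \<phi> x * (indicator K x * g x))"
  using i m by (rule Bochner_Integration.integrable_bound)
   (use M in \<open>auto simp: abs_mult intro!: mult_right_mono\<close>)
 also have "(%x. \<phi> x * (indicator K x * g x)) = (%x. indicator \<Omega> x *\<^sub>R (g x * \<phi> x))"
  using K(2,3) by (auto simp: fun_eq_iff indicator_def)
 finally show ?thesis by (simp only: integrable_lebesgue_on[OF sets_dom])
qed

lemma ip_loc_lin:
 assumes "locally_integrable \<Omega> f" "locally_integrable \<Omega> g" "\<phi> \<in> TF"
 shows "inn (%x. a * f x + b * g x) \<phi> = a * inn f \<phi> + b * inn g \<phi>"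
proof -
 have "inn (%x. a * f x + b * g x) \<phi> = (\<integral>x. a * (f x * \<phi> x) + b * (g x * \<phi> x) \<partial>leb)"
  by (simp add: ip_def algebra_simps)
 also have "... = a * inn f \<phi> + b * inn g \<phi>"
  using locally_integrable_test[OF assms(1,3)] locally_integrable_test[OF assms(2,3)]
  by (simp add: ip_def)
 finally show ?thesis .
qed

lemma locally_integrable_lin:
 "locally_integrable \<Omega> f ==> locally_integrable \<Omega> g ==> locally_integrable \<Omega> (%x. a * f x + b * g x)"
 unfolding locally_integrable_def by auto

lemma weak_deriv_lin:
 assumes "wder \<alpha> f g" "wder \<alpha> f' g'"
 shows "wder \<alpha> (%x. a * f x + b * f' x) (%x. a * g x + b * g' x)"
 using assms unfolding weak_deriv_def
 by (auto simp: locally_integrable_lin ip_loc_lin test_partials algebra_simps)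

text \<open>\<open>weak_deriv\<close> quantifies over the lists realising a multi-index; without
  such a list it would impose no condition, and uniqueness would fail.\<close>

lemma ex_count_list: "\<exists>is. \<forall>i. count_list is i = (\<alpha> :: 'n => nat) i"
proof -
 have "\<exists>is. \<forall>i. count_list is i = (if i \<in> I then \<alpha> i else 0)" if "finite I" for I :: "'n set"
  using that
 proof (induction I)
  case (insert j I)
  then obtain "is" where "\<forall>i. count_list is i = (if i \<in> I then \<alpha> i else 0)" by blast
  moreover have "count_list (replicate k j) i = (if i = j then k else 0)" for k i
   by (induction k) auto
  ultimately have "\<forall>i. count_list (replicate (\<alpha> j) j @ is) i = (if i \<in> insert j I then \<alpha> i else 0)"
   using insert by auto
  then show ?case by blast
 qed (auto intro!: exI[of _ "[]"])
 from this[of UNIV] show ?thesis by auto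
qed

lemma weak_deriv_unique:
 assumes "wder \<alpha> f g" "wder \<alpha> f g'"
 shows "AE x in leb. g x = g' x"
proof -
 have l: "locally_integrable \<Omega> g" "locally_integrable \<Omega> g'" using assms by (auto simp: weak_deriv_def)
 obtain "is" where "is": "\<forall>i. count_list is i = \<alpha> i" using ex_count_list by blast
 have "AE x in leb. 1 * g x + (-1) * g' x = 0"
 proof (rule fundamental_lemma[OF locally_integrable_lin[OF l] open_dom])
  fix \<phi> assume \<phi>: "\<phi> \<in> TF"
  have "(- 1) ^ (\<Sum>i\<in>UNIV. \<alpha> i) * inn g \<phi> = (- 1) ^ (\<Sum>i\<in>UNIV. \<alpha> i) * inn g' \<phi>"
   using assms \<phi> "is" unfolding weak_deriv_def by metis
  then show "inn (%x. 1 * g x + (-1) * g' x) \<phi> = 0"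
   unfolding ip_loc_lin[OF l \<phi>] by simp
 qed
 then show ?thesis by eventually_elim simp
qed

text \<open>\<open>wd\<close> picks some weak derivative, not necessarily the square integrable one
  promised by the space; uniqueness up to null sets makes the pick square integrable as
  well.\<close>

lemma HsD:
 assumes "f \<in> HS s" "\<alpha> \<in> multi_indices k" "k <= s"
 shows "wder \<alpha> f (wd \<Omega> \<alpha> f)" "wd \<Omega> \<alpha> f \<in> LL"
proof -
 obtain g where g: "g \<in> LL" "wder \<alpha> f g" using assms by (auto simp: Hs_def)
 show w: "wder \<alpha> f (wd \<Omega> \<alpha> f)" unfolding wd_def by (rule someI[where P="wder \<alpha> f", OF g(2)])
 show "wd \<Omega> \<alpha> f \<in> LL" by (rule L2_AE_cong[OF g(1) sets_dom weak_deriv_unique[OF g(2) w]])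
qed

lemma wd_eq: "wder \<alpha> f g ==> AE x in leb. wd \<Omega> \<alpha> f x = g x"
 unfolding wd_def by (rule weak_deriv_unique[OF someI[where P="wder \<alpha> f"]])

lemma Hs_L2: "f \<in> HS s ==> f \<in> LL"
 by (simp add: Hs_def)

lemma Hs_mono: "f \<in> HS s ==> k <= s ==> f \<in> HS k"
 unfolding Hs_def using order_trans by blast

lemma Hs_lin: assumes "f \<in> HS s" "g \<in> HS s" shows "(%x. a * f x + b * g x) \<in> HS s"
 unfolding Hs_def
proof (intro CollectI conjI allI impI ballI)
 show "(%x. a * f x + b * g x) \<in> LL"
  using L2_add[OF L2_scaleR L2_scaleR, OF Hs_L2 Hs_L2, OF assms, of a b] by simp
 fix k and \<alpha> :: "'n => nat" assume k: "k <= s" "\<alpha> \<in> multi_indices k"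
 have "(%x. a * wd \<Omega> \<alpha> f x + b * wd \<Omega> \<alpha> g x) \<in> LL"
  using L2_add[OF L2_scaleR L2_scaleR, OF HsD(2) HsD(2), OF assms(1) k(2,1) assms(2) k(2,1), of a b] by simp
 then show "\<exists>h\<in>LL. wder \<alpha> (%x. a * f x + b * g x) h"
  using weak_deriv_lin[OF HsD(1) HsD(1), OF assms(1) k(2,1) assms(2) k(2,1)] by blast
qed

lemma wd_lin:
 assumes "f \<in> HS s" "g \<in> HS s" "\<alpha> \<in> multi_indices k" "k <= s"
 shows "AE x in leb. wd \<Omega> \<alpha> (%x. a * f x + b * g x) x = a * wd \<Omega> \<alpha> f x + b * wd \<Omega> \<alpha> g x"
 by (rule wd_eq[OF weak_deriv_lin[OF HsD(1) HsD(1)]]) (use assms in auto)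

lemma weak_deriv_0: "f \<in> LL ==> wder (%_. 0) f f"
proof -
 assume f: "f \<in> LL"
 have "is = []" if "\<forall>i. count_list is i = 0" for "is" :: "'n list"
  using that by (cases "is") (auto split: if_splits)
 then have "inn f (partials is \<phi>) = inn f \<phi>" if "\<forall>i. count_list is i = 0" for \<phi> "is"
  using that by (metis partials.simps(1))
 then show ?thesis unfolding weak_deriv_def by (simp add: L2_locally_integrable f)
qed

lemma multi_indices_0: "multi_indices 0 = {%_::'n. 0}"
 by (auto simp: multi_indices_def)

lemma single_in: "single j k \<in> multi_indices k"
 by (simp add: single_def multi_indices_def)

lemma multi_indices_1: "multi_indices 1 = range (%j::'n. single j 1)"
proof
 show "multi_indices 1 \<subseteq> range (%j::'n. single j 1)"
 proof
  fix \<alpha> :: "'n => nat" assume "\<alpha> \<in> multi_indices 1"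
  then have "sum \<alpha> UNIV = Suc 0" by (simp add: multi_indices_def)
  then obtain j where j: "\<alpha> j = Suc 0" "\<forall>i. i ~= j --> \<alpha> i = 0"
   by (auto simp: sum_eq_Suc0_iff)
  then have "\<alpha> = single j 1" by (auto simp: single_def fun_eq_iff)
  then show "\<alpha> \<in> range (%j::'n. single j 1)" by blast
 qed
qed (auto intro: single_in)

lemma inj_single: "inj (%j::'n. single j 1)"
 by (rule injI) (metis single_def zero_neq_one)

lemma sum_multi_indices_1: "(\<Sum>\<alpha>\<in>multi_indices 1. F \<alpha>) = (\<Sum>j\<in>(UNIV::'n set). F (single j 1))"
 unfolding multi_indices_1 by (subst sum.reindex[OF inj_single]) simp

text \<open>The bilinear form behind \<open>Hs_norm\<close>, with the same volume weights; it makes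
  the theory of semi-inner products available for Sobolev norms.\<close>

definition Hs_ip :: "nat => (real^'n => real) => (real^'n => real) => real" where
 "Hs_ip s f g = (\<Sum>j\<le>s. vD powr (2 * (real j - real s) / real CARD('n)) *
  (\<Sum>\<alpha>\<in>multi_indices j. inn (wd \<Omega> \<alpha> f) (wd \<Omega> \<alpha> g)))"

lemma Hs_norm_eq: "Hsn s f = sqrt (Hs_ip s f f)"
 by (simp add: Hs_norm_def Hs_seminorm_def Hs_ip_def L2_norm_sq sum_nonneg ip_nonneg)

lemma semi_inner_Hs: "semi_inner (HS s) (Hs_ip s)"
proof
 fix f g h :: "real^'n => real" and a b :: real
 assume fg: "f \<in> HS s" "g \<in> HS s"
 show "(%x. a *\<^sub>R f x + b *\<^sub>R g x) \<in> HS s" using Hs_lin[OF fg] by simp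
 show "Hs_ip s f g = Hs_ip s g f" by (simp add: Hs_ip_def ip_sym)
 assume h: "h \<in> HS s"
 have "inn (wd \<Omega> \<alpha> (%x. a *\<^sub>R f x + b *\<^sub>R g x)) (wd \<Omega> \<alpha> h) = a * inn (wd \<Omega> \<alpha> f) (wd \<Omega> \<alpha> h) + b * inn (wd \<Omega> \<alpha> g) (wd \<Omega> \<alpha> h)"
  if k: "\<alpha> \<in> multi_indices k" "k <= s" for \<alpha> :: "'n => nat" and k
 proof -
  have "inn (wd \<Omega> \<alpha> (%x. a *\<^sub>R f x + b *\<^sub>R g x)) (wd \<Omega> \<alpha> h) = inn (%x. a *\<^sub>R wd \<Omega> \<alpha> f x + b *\<^sub>R wd \<Omega> \<alpha> g x) (wd \<Omega> \<alpha> h)"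
  proof (rule ip_AE_cong[OF _ _ _ _ sets_dom])
   show "AE x in leb. wd \<Omega> \<alpha> (%x. a *\<^sub>R f x + b *\<^sub>R g x) x = a *\<^sub>R wd \<Omega> \<alpha> f x + b *\<^sub>R wd \<Omega> \<alpha> g x"
    using wd_lin[OF fg k] by simp
   show "wd \<Omega> \<alpha> (%x. a *\<^sub>R f x + b *\<^sub>R g x) \<in> LL" "wd \<Omega> \<alpha> h \<in> LL"
    using HsD(2)[OF Hs_lin[OF fg] k] HsD(2)[OF h k] by auto
  qed auto
  also have "... = a * inn (wd \<Omega> \<alpha> f) (wd \<Omega> \<alpha> h) + b * inn (wd \<Omega> \<alpha> g) (wd \<Omega> \<alpha> h)"
   by (rule ip_lin) (use HsD(2) fg h k in blast)+
  finally show ?thesis .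
 qed
 then show "Hs_ip s (%x. a *\<^sub>R f x + b *\<^sub>R g x) h = a * Hs_ip s f h + b * Hs_ip s g h"
  unfolding Hs_ip_def by (simp add: sum.distrib sum_distrib_left algebra_simps flip: sum_distrib_left)
next
 show "(%x. 0) \<in> HS s"
  unfolding Hs_def by (auto simp: weak_deriv_def ip_def locally_integrable_def intro!: bexI[of _ "%x. 0"])
next
 fix f assume "f \<in> HS s"
 show "0 <= Hs_ip s f f" by (auto simp: Hs_ip_def ip_nonneg intro!: sum_nonneg mult_nonneg_nonneg)
qed

lemma Hs_norm_eq_nrm: "Hsn s = semi_inner.nrm (Hs_ip s)"
 by (rule ext) (simp add: Hs_norm_eq semi_inner.nrm_def[OF semi_inner_Hs])

lemmas Hs_norm_triangle = semi_inner.nrm_triangle[OF semi_inner_Hs, folded Hs_norm_eq_nrm]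
lemmas Hs_add = semi_inner.V_add[OF semi_inner_Hs]
lemmas Hs_diff = semi_inner.V_diff[OF semi_inner_Hs]

lemma Hs_norm_nonneg [simp]: "0 <= Hsn s f"
 by (auto simp: Hs_norm_def intro!: sum_nonneg)

definition Hs_vec_ip :: "nat => (real^'n => real^'n) => (real^'n => real^'n) => real" where
 "Hs_vec_ip s v w = (\<Sum>i\<in>UNIV. Hs_ip s (%x. v x $ i) (%x. w x $ i))"

lemma Hs_ip_nonneg: "0 <= Hs_ip s f f"
 by (auto simp: Hs_ip_def ip_nonneg intro!: sum_nonneg mult_nonneg_nonneg)

lemma Hs_vec_norm_eq: "Hvn s v = sqrt (Hs_vec_ip s v v)"
 by (simp add: Hs_vec_norm_def Hs_vec_ip_def Hs_norm_eq Hs_ip_nonneg)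

lemma semi_inner_Hs_vec: "semi_inner (Hv s) (Hs_vec_ip s)"
proof -
 interpret H: semi_inner "HS s" "Hs_ip s" by (rule semi_inner_Hs)
 show ?thesis
 proof
  fix v w z :: "real^'n => real^'n" and a b :: real
  assume vw: "v \<in> Hv s" "w \<in> Hv s"
  show "(%x. a *\<^sub>R v x + b *\<^sub>R w x) \<in> Hv s"
   using vw H.V_lin by (auto simp: Hs_vec_def)
  show "Hs_vec_ip s v w = Hs_vec_ip s w v"
   using vw H.B_sym by (auto simp: Hs_vec_ip_def Hs_vec_def intro!: sum.cong)
  assume z: "z \<in> Hv s"
  show "Hs_vec_ip s (%x. a *\<^sub>R v x + b *\<^sub>R w x) z = a * Hs_vec_ip s v z + b * Hs_vec_ip s w z"
   unfolding Hs_vec_ip_def sum_distrib_left sum.distrib[symmetric]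
   by (intro sum.cong refl) (use vw z H.B_lin in \<open>auto simp: Hs_vec_def\<close>)
 qed (auto simp: Hs_vec_def H.V_zero Hs_vec_ip_def Hs_ip_nonneg intro!: sum_nonneg)
qed

lemma Hs_vec_norm_eq_nrm: "Hvn s = semi_inner.nrm (Hs_vec_ip s)"
 by (rule ext) (simp add: Hs_vec_norm_eq semi_inner.nrm_def[OF semi_inner_Hs_vec])

lemmas Hs_vec_norm_reverse_triangle = semi_inner.nrm_reverse_triangle[OF semi_inner_Hs_vec, folded Hs_vec_norm_eq_nrm]
lemmas Hs_vec_diff = semi_inner.V_diff[OF semi_inner_Hs_vec]

lemma Hs_vec_norm_nonneg [simp]: "0 <= Hvn s v"
 by (auto simp: Hs_vec_norm_def intro!: sum_nonneg)

text \<open>Passing from order s to order k multiplies all weights by the same power of the volume,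
  and the sum up to k is part of the sum up to s.\<close>

lemma Hs_norm_mono:
 assumes "k <= s"
 shows "Hsn k f <= vD powr ((real s - real k) / real CARD('n)) * Hsn s f"
proof -
 let ?d = "real CARD('n)"
 let ?c = "vD powr ((real s - real k) / ?d)"
 have "(\<Sum>j\<le>k. vD powr (2 * (real j - real k) / ?d) * (Hs_seminorm \<Omega> j f)\<^sup>2)
   = (\<Sum>j\<le>k. ?c\<^sup>2 * (vD powr (2 * (real j - real s) / ?d) * (Hs_seminorm \<Omega> j f)\<^sup>2))"
 proof (intro sum.cong refl)
  fix j
  have "?c\<^sup>2 = vD powr (2 * ((real s - real k) / ?d))"
   using vol_pos by (simp add: powr_add[symmetric] power2_eq_square)
  then have "vD powr (2 * (real j - real k) / ?d) = ?c\<^sup>2 * vD powr (2 * (real j - real s) / ?d)"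
   by (simp add: powr_add[symmetric] add_divide_distrib[symmetric] algebra_simps)
  then show "vD powr (2 * (real j - real k) / ?d) * (Hs_seminorm \<Omega> j f)\<^sup>2 = ?c\<^sup>2 * (vD powr (2 * (real j - real s) / ?d) * (Hs_seminorm \<Omega> j f)\<^sup>2)"
   by simp
 qed
 also have "... <= (\<Sum>j\<le>s. ?c\<^sup>2 * (vD powr (2 * (real j - real s) / ?d) * (Hs_seminorm \<Omega> j f)\<^sup>2))"
  by (rule sum_mono2) (use assms in auto)
 finally have "Hsn k f <= sqrt (?c\<^sup>2 * (\<Sum>j\<le>s. vD powr (2 * (real j - real s) / ?d) * (Hs_seminorm \<Omega> j f)\<^sup>2))"
  unfolding Hs_norm_def sum_distrib_left by (rule real_sqrt_le_mono)
 then show ?thesis by (simp add: real_sqrt_mult Hs_norm_def)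
qed

lemma Hs_vec_norm_mono:
 assumes "k <= s"
 shows "Hvn k v <= vD powr ((real s - real k) / real CARD('n)) * Hvn s v"
proof -
 let ?c = "vD powr ((real s - real k) / real CARD('n))"
 have "(\<Sum>i\<in>UNIV. (Hsn k (%x. v x $ i))\<^sup>2) <= (\<Sum>i\<in>UNIV. (?c * Hsn s (%x. v x $ i))\<^sup>2)"
  by (intro sum_mono power_mono Hs_norm_mono assms) auto
 also have "... = ?c\<^sup>2 * (\<Sum>i\<in>UNIV. (Hsn s (%x. v x $ i))\<^sup>2)"
  by (simp add: power_mult_distrib sum_distrib_left)
 finally have "Hvn k v <= sqrt (?c\<^sup>2 * (\<Sum>i\<in>UNIV. (Hsn s (%x. v x $ i))\<^sup>2))"
  unfolding Hs_vec_norm_def by (rule real_sqrt_le_mono)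
 then show ?thesis by (simp add: real_sqrt_mult Hs_vec_norm_def)
qed

lemma wd_0: "f \<in> LL ==> AE x in leb. wd \<Omega> (%_. 0) f x = f x"
 by (rule wd_eq[OF weak_deriv_0])

lemma wd_0_norm: "f \<in> LL ==> nrm2 (wd \<Omega> (%_. 0) f) = nrm2 f"
 using L2_norm_AE_cong[where f=f and g="wd \<Omega> (%_. 0) f"] wd_0[of f] sets_dom by (simp add: eq_commute)

lemma Hs_norm_0: "f \<in> LL ==> Hsn 0 f = nrm2 f"
 using vol_pos by (simp add: Hs_norm_def Hs_seminorm_def multi_indices_0 wd_0_norm)

abbreviation D :: "'n => (real^'n => real) => real^'n => real" where
 "D j \<equiv> wd \<Omega> (single j 1)"
abbreviation "Dc j i v \<equiv> D j (%x. v x $ i)"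

lemma H1_iff: "f \<in> HS 1 \<longleftrightarrow> f \<in> LL & (\<forall>j. \<exists>g\<in>LL. wder (single j 1) f g)"
proof -
 have "(\<forall>k\<le>1. \<forall>\<alpha>\<in>multi_indices k. P \<alpha>) \<longleftrightarrow> P (%_::'n. 0) & (\<forall>j::'n. P (single j 1))" for P
 proof
  assume P: "P (%_::'n. 0) & (\<forall>j::'n. P (single j 1))"
  show "\<forall>k\<le>1. \<forall>\<alpha>\<in>multi_indices k. P \<alpha>"
  proof (intro allI impI ballI)
   fix k :: nat and \<alpha> :: "'n => nat" assume "k <= 1" "\<alpha> \<in> multi_indices k"
   then have "\<alpha> \<in> multi_indices 0 \<or> \<alpha> \<in> multi_indices 1" by (cases "k = 0") (auto simp: le_Suc_eq)
   then show "P \<alpha>" using P unfolding multi_indices_0 multi_indices_1 by auto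
  qed
 qed (use single_in[of _ 1] multi_indices_0 in blast)
 then have e: "f \<in> HS 1 \<longleftrightarrow> f \<in> LL & (\<exists>g\<in>LL. wder (%_. 0) f g) & (\<forall>j. \<exists>g\<in>LL. wder (single j 1) f g)"
  unfolding Hs_def mem_Collect_eq by (simp only:)
 have "\<exists>g\<in>LL. wder (%_. 0) f g" if "f \<in> LL" using weak_deriv_0[OF that] that by (rule bexI)
 then show ?thesis unfolding e by iprover
qed

lemma H1_norm_sq:
 assumes "f \<in> LL"
 shows "(Hsn 1 f)\<^sup>2 = vD powr (- 2 / real CARD('n)) * (nrm2 f)\<^sup>2 + (\<Sum>j\<in>UNIV. (nrm2 (D j f))\<^sup>2)"
 using vol_pos sum_multi_indices_1[where F="%\<alpha>. (nrm2 (wd \<Omega> \<alpha> f))\<^sup>2"]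
 by (simp add: Hs_norm_def Hs_seminorm_def multi_indices_0 wd_0_norm[OF assms] sum_nonneg)

lemma H1_norm_D: "f \<in> LL ==> nrm2 (D j f) <= Hsn 1 f"
proof (rule power2_le_imp_le)
 assume "f \<in> LL"
 have "(nrm2 (D j f))\<^sup>2 <= (\<Sum>j\<in>UNIV. (nrm2 (D j f))\<^sup>2)"
  by (rule member_le_sum) auto
 then show "(nrm2 (D j f))\<^sup>2 <= (Hsn 1 f)\<^sup>2"
  unfolding H1_norm_sq[OF \<open>f \<in> LL\<close>] by (smt (verit) mult_nonneg_nonneg powr_ge_zero zero_le_power2)
qed simp

lemma H1_norm_L2: "f \<in> LL ==> nrm2 f <= vD powr (1 / real CARD('n)) * Hsn 1 f"
 using Hs_norm_mono[of 0 1 f] Hs_norm_0[of f] by simp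

end

section \<open>Integration by parts\<close>

text \<open>Otherwise \<open>Hs \<Omega> 1\<close> is rewritten to \<open>Hs \<Omega> (Suc 0)\<close>.\<close>

declare One_nat_def [simp del]

lemma LIMSEQ_zero_unique:
 assumes "f ----> (L::real)" "!!n. f n = 0"
 shows "L = 0"
proof -
 have "f = (%n. 0)" using assms(2) by auto
 then show ?thesis using LIMSEQ_unique[OF tendsto_const, of 0 L] assms(1) by simp
qed

lemma line_has_derivative:
 fixes f :: "real^'n::finite => real"
 assumes "f differentiable (at (x + t *\<^sub>R axis j 1))"
 shows "((%t. f (x + t *\<^sub>R axis j 1)) has_real_derivative partial j f (x + t *\<^sub>R axis j 1)) (at t)"
proof -
 let ?y = "x + t *\<^sub>R axis j 1"
 have f: "(f has_derivative frechet_derivative f (at ?y)) (at ?y)"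
  using assms by (simp add: frechet_derivative_works)
 have "((%t. x + t *\<^sub>R axis j (1::real)) has_derivative (%h. h *\<^sub>R axis j 1)) (at t)"
  by (auto intro!: derivative_eq_intros)
 from has_derivative_compose[OF this f]
 have "((%t. f (x + t *\<^sub>R axis j 1)) has_derivative (%h. frechet_derivative f (at ?y) (h *\<^sub>R axis j 1))) (at t)" .
 moreover have "frechet_derivative f (at ?y) (h *\<^sub>R axis j 1) = partial j f ?y * h" for h
  using linear_scale[OF linear_frechet_derivative[OF assms]] by (simp add: partial_def)
 ultimately show ?thesis by (simp add: has_field_derivative_def)
qed

lemma diff_quotient_tendsto:
 fixes f :: "real^'n::finite => real"
 assumes "f differentiable (at x)"
 shows "(%k. (f (x + inverse (real (Suc k)) *\<^sub>R axis j 1) - f x) / inverse (real (Suc k))) ----> partial j f x"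
proof -
 have "((%h. (f (x + h *\<^sub>R axis j 1) - f x) / h) \<longlongrightarrow> partial j f x) (at 0)"
  using line_has_derivative[of f x 0 j] assms by (simp add: DERIV_def)
 then show ?thesis
  by (rule filterlim_compose) (auto simp: filterlim_at intro!: LIMSEQ_inverse_real_of_nat simp del: of_nat_Suc)
qed

lemma lborel_integral_translation:
 fixes f :: "'a::euclidean_space => real"
 assumes "f \<in> borel_measurable borel"
 shows "(\<integral>x. f (c + x) \<partial>lborel) = (\<integral>x. f x \<partial>lborel)"
proof -
 have "(\<integral>x. f x \<partial>distr lborel borel ((+) c)) = (\<integral>x. f (c + x) \<partial>lborel)"
  by (rule integral_distr) (use assms in auto)
 then show ?thesis by (simp add: lborel_distr_plus)
qed

text \<open>Difference quotients integrate to zero by translation invariance. The mean value theorem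
  bounds them by M on a fixed ball, so dominated convergence applies without continuity of the
  derivative.\<close>

lemma integral_partial_zero:
 fixes f :: "real^'n::finite => real"
 assumes d: "!!x. f differentiable (at x)" and K: "compact K" "!!x. x \<notin> K ==> f x = 0"
  and M: "!!x. \<bar>partial j f x\<bar> <= M"
 shows "integrable lebesgue (partial j f)" "(\<integral>x. partial j f x \<partial>lebesgue) = 0"
proof -
 define q where "q k x = (f (x + inverse (real (Suc k)) *\<^sub>R axis j 1) - f x) / inverse (real (Suc k))" for k x
 have cont: "continuous_on UNIV f"
  using d by (rule diff_continuous)
 have fm[measurable]: "f \<in> borel_measurable borel" by (rule borel_measurable_continuous_onI[OF cont])
 have fs[measurable]: "(%x. f (x + c)) \<in> borel_measurable borel" for c
  by (intro borel_measurable_continuous_onI continuous_on_compose2[OF cont] continuous_intros) auto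
 have qm[measurable]: "q k \<in> borel_measurable lborel" for k
  unfolding q_def by measurable
 obtain R where R: "!!x. x \<in> K ==> norm x <= R"
  using compact_imp_bounded[OF K(1)] by (auto simp: bounded_iff)
 \<comment> \<open>Radius R + 1, since the increments have length at most 1.\<close>
 let ?B = "cball 0 (R + 1) :: (real^'n) set"
 have qB: "\<bar>q k x\<bar> <= M * indicator ?B x" for k x
 proof -
  let ?t = "inverse (real (Suc k))"
  have t: "0 < ?t" "?t <= 1" by (auto simp: field_simps)
  show ?thesis
  proof (cases "x \<in> ?B")
   case True
   obtain z where "f (x + ?t *\<^sub>R axis j 1) - f (x + 0 *\<^sub>R axis j 1) = (?t - 0) * partial j f (x + z *\<^sub>R axis j 1)"
    using MVT2[OF t(1), of "%t. f (x + t *\<^sub>R axis j 1)" "%t. partial j f (x + t *\<^sub>R axis j 1)"]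
     line_has_derivative[OF d] by metis
   then have "q k x = partial j f (x + z *\<^sub>R axis j 1)" using t by (simp add: q_def)
   then show ?thesis using True M by simp
  next
   case False
   have "norm (x + ?t *\<^sub>R axis j 1) >= norm x - norm (?t *\<^sub>R (axis j 1 :: real^'n))"
    using norm_triangle_ineq2[of x "- (?t *\<^sub>R (axis j 1 :: real^'n))"] by simp
   moreover have "norm (?t *\<^sub>R (axis j 1 :: real^'n)) <= 1" using t by (simp add: norm_axis_1)
   ultimately have "x + ?t *\<^sub>R axis j 1 \<notin> K" "x \<notin> K" using R[of x] R[of "x + ?t *\<^sub>R axis j 1"] False by auto
   then show ?thesis using False K(2) by (simp add: q_def)
  qed
 qed
 have qlim: "(%k. q k x) ----> partial j f x" for x
  unfolding q_def by (rule diff_quotient_tendsto[OF d])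
 have pm: "partial j f \<in> borel_measurable lborel"
  by (rule borel_measurable_LIMSEQ_real[OF qlim qm])
 have bi: "integrable lborel (%x. M * indicator ?B x :: real)"
  using emeasure_bounded_finite[OF bounded_cball] by (intro integrable_mult_right integrable_real_indicator) auto
 have i: "integrable lborel (partial j f)" "(%k. \<integral>x. q k x \<partial>lborel) ----> (\<integral>x. partial j f x \<partial>lborel)" "!!k. integrable lborel (q k)"
  using integral_dominated_convergence[of _ _ q, OF pm qm bi] integrable_dominated_convergence[of _ _ q, OF pm qm bi]
   integrable_dominated_convergence2[of _ _ q, OF pm qm bi] qlim qB
  by auto
 have fi: "integrable lborel f"
  using borel_integrable_compact[OF K(1), of f] continuous_on_subset[OF cont] K(2)
  by (auto intro: Bochner_Integration.integrable_cong[THEN iffD1, rotated 2] simp: indicator_def)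
 have "(\<integral>x. q k x \<partial>lborel) = 0" for k
 proof -
  let ?c = "inverse (real (Suc k)) *\<^sub>R axis j 1 :: real^'n"
  have "integrable lborel (%x. q k x * inverse (real (Suc k)) + f x)"
   using i(3)[of k] fi by auto
  then have fi': "integrable lborel (%x. f (x + ?c))" by (simp add: q_def)
  have "(\<integral>x. f (x + ?c) \<partial>lborel) = (\<integral>x. f x \<partial>lborel)"
   using lborel_integral_translation[OF fm, of ?c] by (simp add: add.commute)
  then show ?thesis using fi fi' by (simp add: q_def)
 qed
 then have "(\<integral>x. partial j f x \<partial>lborel) = 0" using i(2) LIMSEQ_zero_unique by blast
 then show "(\<integral>x. partial j f x \<partial>lebesgue) = 0" "integrable lebesgue (partial j f)"
  using i(1) pm by (simp_all add: integral_completion integrable_completion)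
qed

context bounded_domain
begin

lemma count_single: "(\<forall>i::'n. count_list is i = single j 1 i) \<longleftrightarrow> is = [j]"
proof
 assume a: "\<forall>i. count_list is i = single j 1 i"
 have "length is = 1" using a sum_count_set[of "is" UNIV] by (simp add: single_def)
 then obtain i where "is = [i]" by (metis One_nat_def length_0_conv length_Suc_conv)
 then show "is = [j]" using a by (auto simp: single_def split: if_splits)
qed (simp add: single_def)

lemma sum_single: "(\<Sum>i\<in>(UNIV::'n set). single j k i) = k"
 by (simp add: single_def)

lemma weak_deriv_1_iff:
 "wder (single j 1) f g \<longleftrightarrow> locally_integrable \<Omega> f & locally_integrable \<Omega> g &
  (\<forall>\<phi>\<in>TF. inn f (partial j \<phi>) = - inn g \<phi>)"
 unfolding weak_deriv_def count_single sum_single by simp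

text \<open>The product of g with a test function, extended by zero, is differentiable everywhere
  with bounded partial derivative, and this derivative integrates to zero.\<close>

lemma weak_deriv_classical:
 fixes g :: "real^'n => real"
 assumes d: "!!x. x \<in> \<Omega> ==> g differentiable (at x)" and M: "!!x. x \<in> \<Omega> ==> \<bar>partial j g x\<bar> <= M"
 shows "wder (single j 1) g (partial j g)" "partial j g \<in> bm"
proof -
 have cont: "continuous_on \<Omega> g"
  using d by (rule diff_continuous)
 let ?g = "%x. indicator \<Omega> x *\<^sub>R g x"
 have gm: "?g \<in> borel_measurable borel"
  using cont open_dom by (intro borel_measurable_continuous_on_indicator) auto
 have gms: "(%x. ?g (x + c)) \<in> borel_measurable borel" for c
  by (rule measurable_compose[OF _ gm]) measurable
 define q where "q k x = (?g (x + inverse (real (Suc k)) *\<^sub>R axis j 1) - ?g x) / inverse (real (Suc k))" for k x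
 have qm: "q k \<in> borel_measurable borel" for k
  unfolding q_def using gm gms by (intro borel_measurable_divide borel_measurable_diff) auto
 have ql: "(%k. q k x) ----> partial j g x" if x: "x \<in> \<Omega>" for x
 proof (rule Lim_transform_eventually[OF diff_quotient_tendsto[OF d[OF x], of j]])
  have "(%k. x + inverse (real (Suc k)) *\<^sub>R axis j 1) ----> x + 0 *\<^sub>R axis j 1"
   by (intro tendsto_intros LIMSEQ_inverse_real_of_nat)
  then have "\<forall>\<^sub>F k in sequentially. x + inverse (real (Suc k)) *\<^sub>R axis j 1 \<in> \<Omega>"
   using topological_tendstoD[OF _ open_dom] x by simp
  then show "\<forall>\<^sub>F k in sequentially. (g (x + inverse (real (Suc k)) *\<^sub>R axis j 1) - g x) / inverse (real (Suc k)) = q k x"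
   by eventually_elim (use x in \<open>simp add: q_def\<close>)
 qed
 show pm: "partial j g \<in> bm"
 proof (rule borel_measurable_LIMSEQ_real[of _ q])
  show "(%i. q i x) ----> partial j g x" if "x \<in> space leb" for x
   using that ql by simp
  show "q i \<in> bm" for i
   by (rule measurable_restrict_space1, rule measurable_completion) (simp add: qm)
 qed
 have pl: "partial j g \<in> LL" by (rule L2_bounded[OF pm _ lmeas, where K=M]) (use M in auto)
 have gl: "locally_integrable \<Omega> g"
  unfolding locally_integrable_def
 proof (intro allI impI)
  fix K assume K: "compact K & K \<subseteq> \<Omega>"
  have Ks: "K \<in> sets lebesgue" using lmeasurable_compact K by (auto simp: fmeasurable_def)
  have c: "continuous_on K g" using cont K continuous_on_subset by blast
  have "integrable lborel (%x. indicator K x *\<^sub>R g x)" using borel_integrable_compact[of K g] K c by simp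
  then have "integrable lebesgue (%x. indicator K x *\<^sub>R g x)"
   using borel_measurable_integrable by (subst integrable_completion) auto
  then show "integrable (lebesgue_on K) g" using integrable_lebesgue_on[OF Ks] by blast
 qed
 show "wder (single j 1) g (partial j g)"
  unfolding weak_deriv_1_iff
 proof (intro conjI ballI)
  fix \<phi> assume \<phi>: "\<phi> \<in> TF"
  then obtain K where K: "compact K" "K \<subseteq> \<Omega>" "!!x. x \<notin> K ==> \<phi> x = 0"
   by (auto simp: test_functions_def)
  let ?f = "%x. ?g x * \<phi> x"
  have cl: "closed K" using K(1) by (rule compact_imp_closed)
  have f_in: "?f differentiable (at x) & partial j ?f x = g x * partial j \<phi> x + partial j g x * \<phi> x" if x: "x \<in> \<Omega>" for x
  proof
   have fd: "(%x. g x * \<phi> x) differentiable (at x)"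
    using d[OF x] test_differentiable[OF \<phi>] by (rule differentiable_mult)
   then obtain F where F: "((%x. g x * \<phi> x) has_derivative F) (at x)" by (auto simp: differentiable_def)
   have "(?f has_derivative F) (at x)"
    by (rule has_derivative_transform_within_open[OF F open_dom x]) simp
   then show "?f differentiable (at x)" by (auto simp: differentiable_def)
   have "partial j ?f x = partial j (%x. g x * \<phi> x) x"
    by (rule partial_local[OF open_dom x]) simp
   then show "partial j ?f x = g x * partial j \<phi> x + partial j g x * \<phi> x"
    using partial_mult[OF d[OF x] test_differentiable[OF \<phi>]] by simp
  qed
  have f_out: "?f differentiable (at x) & partial j ?f x = 0" if x: "x \<notin> K" for x
  proof
   have "(?f has_derivative (%_. 0)) (at x)"
    by (rule has_derivative_transform_within_open[where s="- K" and f="%_. 0"])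
     (use x cl K(3) in auto)
   then show "?f differentiable (at x)" by (auto simp: differentiable_def)
   show "partial j ?f x = 0" by (rule partial_zero_outside[OF cl _ x]) (use K(3) in auto)
  qed
  have pout: "partial j \<phi> x = 0" if "x \<notin> K" for x
   by (rule partial_zero_outside[OF cl K(3) that])
  obtain A where A: "!!x. x \<in> K ==> \<bar>g x\<bar> <= A"
   using compact_imp_bounded[OF compact_continuous_image[OF continuous_on_subset[OF cont K(2)] K(1)]]
   by (auto simp: bounded_iff)
  obtain P where P: "P >= 0" "!!x. \<bar>\<phi> x\<bar> <= P" using test_bounded[OF \<phi>] by auto
  obtain Q where Q: "Q >= 0" "!!x. \<bar>partial j \<phi> x\<bar> <= Q" using test_bounded[OF test_partial[OF \<phi>]] by auto
  have bound: "\<bar>partial j ?f x\<bar> <= \<bar>A\<bar> * Q + \<bar>M\<bar> * P" for x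
  proof (cases "x \<in> K")
   case True
   then have x: "x \<in> \<Omega>" using K(2) by auto
   have "\<bar>g x * partial j \<phi> x\<bar> <= \<bar>A\<bar> * Q" unfolding abs_mult using A[OF True] Q by (intro mult_mono) auto
   moreover have "\<bar>partial j g x * \<phi> x\<bar> <= \<bar>M\<bar> * P" unfolding abs_mult using M[OF x] P by (intro mult_mono) auto
   ultimately show ?thesis using f_in[OF x] by simp
  next
   case False
   then show ?thesis using f_out P Q by simp
  qed
  have z: "(\<integral>x. partial j ?f x \<partial>lebesgue) = 0"
  proof (rule integral_partial_zero(2)[OF _ K(1) _ bound])
   show "?f differentiable (at x)" for x using f_in f_out K(2) by (cases "x \<in> K") auto
   show "?f x = 0" if "x \<notin> K" for x using K(3) that by simp
  qed
  have "partial j ?f x = indicator \<Omega> x *\<^sub>R (g x * partial j \<phi> x + partial j g x * \<phi> x)" for x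
   using f_in[of x] f_out[of x] K(2) by (cases "x \<in> \<Omega>") auto
  then have "(\<integral>x. g x * partial j \<phi> x + partial j g x * \<phi> x \<partial>leb) = 0"
   using z by (simp add: integral_lebesgue_on[OF sets_dom])
  then show "inn g (partial j \<phi>) = - inn (partial j g) \<phi>"
   using locally_integrable_test[OF gl test_partial[OF \<phi>]] locally_integrable_test[OF L2_locally_integrable[OF pl] \<phi>]
   by (simp add: ip_def)
 qed (use gl L2_locally_integrable[OF pl] in auto)
qed

lemma test_weak_deriv: "\<phi> \<in> TF ==> wder (single j 1) \<phi> (partial j \<phi>)"
 using test_bounded[OF test_partial, of \<phi> \<Omega> j] test_differentiable by (metis weak_deriv_classical(1))

lemma test_H1: "\<phi> \<in> TF ==> \<phi> \<in> HS 1"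
 unfolding H1_iff using test_L2 test_weak_deriv test_partial sets_dom by blast

lemma test_D: "\<phi> \<in> TF ==> AE x in leb. D j \<phi> x = partial j \<phi> x"
 by (rule wd_eq[OF test_weak_deriv])

lemma H10_H1: "f \<in> H0 ==> f \<in> HS 1"
 by (simp add: H10_def)

lemma D_L2: "f \<in> HS 1 ==> D j f \<in> LL"
 by (rule HsD(2)[OF _ single_in]) auto

lemma D_lin: "f \<in> HS 1 ==> g \<in> HS 1 ==>
  AE x in leb. D j (%x. a * f x + b * g x) x = a * D j f x + b * D j g x"
 by (rule wd_lin[OF _ _ single_in]) auto

lemma D_diff: "f \<in> HS 1 ==> g \<in> HS 1 ==>
  AE x in leb. D j (%x. f x - g x) x = D j f x - D j g x"
 using D_lin[of f g j 1 "-1"] by simp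

lemma H10_lin: assumes "f \<in> H0" "g \<in> H0" shows "(%x. a * f x + b * g x) \<in> H0"
 unfolding H10_def
proof (intro CollectI conjI allI impI)
 interpret H: semi_inner "HS 1" "Hs_ip 1" by (rule semi_inner_Hs)
 show "(%x. a * f x + b * g x) \<in> HS 1" using Hs_lin H10_H1 assms by blast
 fix \<epsilon> :: real assume e: "\<epsilon> > 0"
 define c where "c = \<bar>a\<bar> + \<bar>b\<bar> + 1"
 have c: "c > 0" unfolding c_def by linarith
 let ?e = "\<epsilon> / c"
 have e': "?e > 0" using e c by auto
 obtain \<phi> \<psi> where \<phi>: "\<phi> \<in> TF" "Hsn 1 (%x. f x - \<phi> x) < ?e"
  and \<psi>: "\<psi> \<in> TF" "Hsn 1 (%x. g x - \<psi> x) < ?e"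
  using assms e' unfolding H10_def by blast
 have i: "(%x. f x - \<phi> x) \<in> HS 1" "(%x. g x - \<psi> x) \<in> HS 1"
  using Hs_diff H10_H1 assms test_H1 \<phi> \<psi> by blast+
 have "Hsn 1 (%x. a *\<^sub>R (f x - \<phi> x) + b *\<^sub>R (g x - \<psi> x)) <= \<bar>a\<bar> * Hsn 1 (%x. f x - \<phi> x) + \<bar>b\<bar> * Hsn 1 (%x. g x - \<psi> x)"
  using H.nrm_triangle[OF H.V_scaleR[OF i(1), of a] H.V_scaleR[OF i(2), of b]] H.nrm_scaleR[OF i(1)] H.nrm_scaleR[OF i(2)]
  by (simp add: Hs_norm_eq_nrm)
 also have "... <= \<bar>a\<bar> * ?e + \<bar>b\<bar> * ?e"
  using \<phi>(2) \<psi>(2) by (intro add_mono mult_left_mono) auto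
 also have "... = (c - 1) * ?e" by (simp add: c_def algebra_simps add_divide_distrib)
 also have "... < \<epsilon>" using e c by (simp add: field_simps)
 finally have "Hsn 1 (%x. (a * f x + b * g x) - (a * \<phi> x + b * \<psi> x)) < \<epsilon>"
  by (simp add: algebra_simps)
 then show "\<exists>\<phi>\<in>TF. Hsn 1 (%x. (a * f x + b * g x) - \<phi> x) < \<epsilon>"
  using test_add[OF test_scale[OF \<phi>(1), of a] test_scale[OF \<psi>(1), of b]] by (rule bexI)
qed

lemma ip_tendsto:
 assumes "!!n. f n \<in> LL" "f' \<in> LL" "g \<in> LL" "(%n. nrm2 (%x. f' x - f n x)) ----> 0"
 shows "(%n. inn (f n) g) ----> inn f' g"
proof -
 have "(%n. inn f' g - inn (f n) g) ----> 0"
 proof (rule Lim_null_comparison)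
  show "\<forall>\<^sub>F n in sequentially. norm (inn f' g - inn (f n) g) <= nrm2 (%x. f' x - f n x) * nrm2 g"
   using ip_CS[OF L2_diff[OF assms(2,1)] assms(3)] assms(1-3) by (simp add: ip_diff)
  show "(%n. nrm2 (%x. f' x - f n x) * nrm2 g) ----> 0"
   using tendsto_mult_left_zero[OF assms(4)] by simp
 qed
 then show ?thesis using tendsto_diff[OF tendsto_const[of "inn f' g"]] by force
qed

lemma H10_approx:
 assumes "f \<in> H0"
 obtains \<psi> where "!!n. \<psi> n \<in> TF"
  "(%n. nrm2 (%x. f x - \<psi> n x)) ----> 0"
  "!!j. (%n. nrm2 (%x. D j f x - partial j (\<psi> n) x)) ----> 0"
proof -
 have "\<exists>\<phi>\<in>TF. Hsn 1 (%x. f x - \<phi> x) < inverse (real (Suc n))" for n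
  using assms by (simp add: H10_def)
 then obtain \<psi> where \<psi>: "!!n. \<psi> n \<in> TF" "!!n. Hsn 1 (%x. f x - \<psi> n x) < inverse (real (Suc n))"
  by metis
 have lim: "(%n. Hsn 1 (%x. f x - \<psi> n x)) ----> 0"
  by (rule tendsto_sandwich[OF _ _ tendsto_const LIMSEQ_inverse_real_of_nat]) (auto intro!: always_eventually less_imp_le[OF \<psi>(2)] simp del: of_nat_Suc One_nat_def)
 have fl: "f \<in> LL" "f \<in> HS 1" using assms H10_H1 Hs_L2 by blast+
 have l: "(%x. f x - \<psi> n x) \<in> LL" for n
  using fl test_L2[OF \<psi>(1) sets_dom] by (intro L2_diff)
 show ?thesis
 proof (rule that[of \<psi>])
  show "(%n. nrm2 (%x. f x - \<psi> n x)) ----> 0"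
   by (rule tendsto_sandwich[OF _ _ tendsto_const tendsto_mult_right_zero[OF lim, of "vD powr (1 / real CARD('n))"]])
    (auto intro!: H1_norm_L2 l always_eventually)
  fix j
  have "nrm2 (%x. D j f x - partial j (\<psi> n) x) <= Hsn 1 (%x. f x - \<psi> n x)" for n
  proof -
   have "AE x in leb. D j f x - partial j (\<psi> n) x = D j (%x. f x - \<psi> n x) x"
    using D_diff[OF fl(2) test_H1[OF \<psi>(1)], of j n] test_D[OF \<psi>(1), of j n] by eventually_elim simp
   then have "nrm2 (%x. D j f x - partial j (\<psi> n) x) = nrm2 (D j (%x. f x - \<psi> n x))"
    using D_L2[OF fl(2)] test_L2[OF test_partial[OF \<psi>(1)] sets_dom] by (intro L2_norm_AE_cong L2_diff sets_dom)
   then show ?thesis using H1_norm_D[OF l] by simp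
  qed
  then show "(%n. nrm2 (%x. D j f x - partial j (\<psi> n) x)) ----> 0"
   by (intro tendsto_sandwich[OF _ _ tendsto_const lim]) (auto intro!: always_eventually)
 qed (use \<psi> in auto)
qed

text \<open>The definition gives the identity for test functions; both sides are continuous in g
  along an approximating sequence.\<close>

lemma weak_deriv_ibp:
 assumes f: "f \<in> LL" "G \<in> LL" "wder (single j 1) f G" and "g \<in> H0"
 shows "inn G g = - inn f (D j g)"
proof -
 obtain \<psi> where \<psi>: "!!n. \<psi> n \<in> TF"
  "(%n. nrm2 (%x. g x - \<psi> n x)) ----> 0"
  "!!j. (%n. nrm2 (%x. D j g x - partial j (\<psi> n) x)) ----> 0"
  by (rule H10_approx[OF assms(4)]) blast
 have g: "g \<in> HS 1" by (rule H10_H1[OF assms(4)])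
 have "(%n. inn (\<psi> n) G) ----> inn g G"
  by (rule ip_tendsto[OF test_L2[OF \<psi>(1) sets_dom] Hs_L2[OF g] f(2) \<psi>(2)])
 moreover have "(%n. inn (partial j (\<psi> n)) f) ----> inn (D j g) f"
  by (rule ip_tendsto[OF test_L2[OF test_partial[OF \<psi>(1)] sets_dom] D_L2[OF g] f(1) \<psi>(3)])
 moreover have "inn (partial j (\<psi> n)) f = - inn (\<psi> n) G" for n
  using f(3) \<psi>(1)[of n] by (simp add: weak_deriv_1_iff ip_sym del: One_nat_def)
 ultimately have "(%n. - inn (\<psi> n) G) ----> inn (D j g) f" "(%n. - inn (\<psi> n) G) ----> - inn g G"
  by (simp_all only: tendsto_minus)
 from LIMSEQ_unique[OF this] show ?thesis by (simp add: ip_sym)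
qed


lemma D_ibp: "f \<in> HS 1 ==> g \<in> H0 ==> inn (D j f) g = - inn f (D j g)"
 by (rule weak_deriv_ibp[OF Hs_L2 D_L2 HsD(1)[OF _ single_in]]) auto

lemma ip_eq_integral_mult: "inn f g = (\<integral>x. f x * g x \<partial>leb)" for f :: "real^'n => real"
 by (simp add: ip_def)

lemma integral_partial_zero_on:
 assumes "!!x. f differentiable (at x)" "compact K" "K \<subseteq> \<Omega>" "!!x. x \<notin> K ==> f x = 0" "!!x. \<bar>partial j f x\<bar> <= M"
 shows "(\<integral>x. partial j f x \<partial>leb) = 0"
proof -
 have "partial j f x = 0" if "x \<notin> K" for x
  by (rule partial_zero_outside[OF compact_imp_closed[OF assms(2)] assms(4) that])
 then have "indicator \<Omega> x *\<^sub>R partial j f x = partial j f x" for x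
  using assms(3) by (auto simp: indicator_def)
 moreover have "(\<integral>x. partial j f x \<partial>lebesgue) = 0"
  by (rule integral_partial_zero(2)[of f K]) (use assms in auto)
 ultimately show ?thesis by (simp only: integral_lebesgue_on[OF sets_dom])
qed

text \<open>Derivatives of test functions integrate to zero, and this passes to the limit. That
  constants belong to the Sobolev spaces is later deduced from it.\<close>

lemma D_integral_zero:
 assumes "v \<in> H0"
 shows "inn (D j v) (%x. c) = 0"
proof -
 obtain \<psi> where \<psi>: "!!n. \<psi> n \<in> TF"
  "(%n. nrm2 (%x. v x - \<psi> n x)) ----> 0"
  "!!j. (%n. nrm2 (%x. D j v x - partial j (\<psi> n) x)) ----> 0"
  by (rule H10_approx[OF assms]) blast
 have v: "v \<in> HS 1" by (rule H10_H1[OF assms])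
 have "(%n. inn (partial j (\<psi> n)) (%x. c)) ----> inn (D j v) (%x. c)"
  by (rule ip_tendsto[OF test_L2[OF test_partial[OF \<psi>(1)] sets_dom] D_L2[OF v] const_L2 \<psi>(3)])
 moreover have "inn (partial j (\<psi> n)) (%x. c) = 0" for n
 proof -
  obtain K where K: "compact K" "K \<subseteq> \<Omega>" "!!x. x \<notin> K ==> \<psi> n x = 0" using \<psi>(1)[of n] by (auto simp: test_functions_def)
  obtain M where M: "!!x. \<bar>partial j (\<psi> n) x\<bar> <= M" using test_bounded[OF test_partial[OF \<psi>(1)]] by blast
  show ?thesis using integral_partial_zero_on[OF test_differentiable[OF \<psi>(1)] K M] by (simp add: ip_def)
 qed
 ultimately have "(%n::nat. 0::real) ----> inn (D j v) (%x. c)" by simp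
 from LIMSEQ_unique[OF tendsto_const this] show ?thesis by simp
qed

section \<open>The Poincare inequality\<close>

lemma poincare_test:
 assumes R: "!!x. x \<in> \<Omega> ==> norm x <= R" and \<phi>: "\<phi> \<in> TF"
 shows "nrm2 \<phi> <= 2 * R * nrm2 (partial j \<phi>)"
proof -
 obtain K where K: "compact K" "K \<subseteq> \<Omega>" "!!x. x \<notin> K ==> \<phi> x = 0"
  using \<phi> by (auto simp: test_functions_def)
 obtain P where P: "P >= 0" "!!x. \<bar>\<phi> x\<bar> <= P" using test_bounded[OF \<phi>] by auto
 obtain Q where Q: "Q >= 0" "!!x. \<bar>partial j \<phi> x\<bar> <= Q" using test_bounded[OF test_partial[OF \<phi>]] by auto
 have dx: "((%x::real^'n. x $ j) has_derivative (%h. h $ j)) (at x)" for x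
  by (rule bounded_linear.has_derivative[OF bounded_linear_vec_nth]) (rule has_derivative_ident)
 have dx': "(%x::real^'n. x $ j) differentiable (at x)" for x using dx by (auto simp: differentiable_def)
 have px: "partial j (%x::real^'n. x $ j) x = 1" for x using partial_eq[OF dx] by (simp add: axis_def)
 \<comment> \<open>Its j-th derivative, \<phi>^2 + 2 x_j \<phi> d_j \<phi>, integrates to zero; with
   |x_j| <= R this yields the factor 2 R.\<close>
 let ?f = "%x. x $ j * (\<phi> x * \<phi> x)"
 have d2: "(%x. \<phi> x * \<phi> x) differentiable (at x)" for x
  by (intro differentiable_mult test_differentiable[OF \<phi>])
 have pf: "partial j ?f x = \<phi> x * \<phi> x + 2 * (x $ j * \<phi> x * partial j \<phi> x)" for x
  using partial_mult[OF dx' d2] partial_mult[OF test_differentiable[OF \<phi>] test_differentiable[OF \<phi>]] px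
  by (simp add: algebra_simps)
 have R0: "0 <= R" using R nonempty_dom norm_ge_zero order_trans by blast
 have xb: "\<bar>x $ j\<bar> <= R" if "x \<in> \<Omega>" for x using R[OF that] component_le_norm_cart[of x j] by linarith
 have "(\<integral>x. partial j ?f x \<partial>leb) = 0"
 proof (rule integral_partial_zero_on[OF _ K(1,2)])
  show "?f differentiable (at x)" for x by (intro differentiable_mult dx' test_differentiable[OF \<phi>])
  show "\<bar>partial j ?f x\<bar> <= P * P + 2 * (R * P * Q)" for x
  proof (cases "x \<in> \<Omega>")
   case True
   have "\<bar>\<phi> x * \<phi> x\<bar> <= P * P" unfolding abs_mult by (intro mult_mono P) auto
   moreover have "\<bar>x $ j * \<phi> x * partial j \<phi> x\<bar> <= R * P * Q"
    unfolding abs_mult using xb[OF True] P Q R0 by (intro mult_mono) auto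
   ultimately show ?thesis unfolding pf by linarith
  next
   case False
   then have "\<phi> x = 0" using test_outside[OF \<phi>] by auto
   then show ?thesis using P Q R0 unfolding pf by simp
  qed
 qed (use K(3) in auto)
 moreover have l: "\<phi> \<in> LL" "partial j \<phi> \<in> LL" using test_L2 sets_dom \<phi> test_partial by blast+
 have xm: "(%x. x $ j) \<in> bm"
  by (rule measurable_restrict_space1, rule measurable_completion) (auto intro!: borel_measurable_continuous_onI continuous_intros)
 have lx: "(%x. x $ j *\<^sub>R \<phi> x) \<in> LL"
  by (rule L2_mult_bounded[OF xm _ l(1), of R]) (use xb in auto)
 ultimately have "inn \<phi> \<phi> = - 2 * inn (%x. x $ j *\<^sub>R \<phi> x) (partial j \<phi>)"
  using L2_inner_integrable[OF l(1,1)] L2_inner_integrable[OF lx l(2)] unfolding pf by (simp add: ip_def)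
 then have "(nrm2 \<phi>)\<^sup>2 <= 2 * \<bar>inn (%x. x $ j *\<^sub>R \<phi> x) (partial j \<phi>)\<bar>"
  unfolding L2_norm_sq by linarith
 also have "... <= 2 * (nrm2 (%x. x $ j *\<^sub>R \<phi> x) * nrm2 (partial j \<phi>))"
  using ip_CS[OF lx l(2)] by simp
 also have "nrm2 (%x. x $ j *\<^sub>R \<phi> x) <= R * nrm2 \<phi>"
  by (rule L2_norm_mono[OF L2_measurable[OF lx] l(1) R0]) (use xb in \<open>auto simp: abs_mult intro!: mult_right_mono\<close>)
 finally have "nrm2 \<phi> * nrm2 \<phi> <= (2 * R * nrm2 (partial j \<phi>)) * nrm2 \<phi>"
  by (simp add: power2_eq_square mult_right_mono algebra_simps)
 then show ?thesis
  using R0 by (cases "nrm2 \<phi> = 0") (auto simp: mult_le_cancel_right order_less_le)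
qed

lemma poincare:
 assumes R: "!!x. x \<in> \<Omega> ==> norm x <= R" and f: "f \<in> H0"
 shows "nrm2 f <= 2 * R * nrm2 (D j f)"
proof -
 obtain \<psi> where \<psi>: "!!n. \<psi> n \<in> TF"
  "(%n. nrm2 (%x. f x - \<psi> n x)) ----> 0"
  "!!j. (%n. nrm2 (%x. D j f x - partial j (\<psi> n) x)) ----> 0"
  by (rule H10_approx[OF f]) blast
 have R0: "0 <= R" using R nonempty_dom norm_ge_zero order_trans by blast
 have fl: "f \<in> LL" "D j f \<in> LL" using H10_H1[OF f] Hs_L2 D_L2 by blast+
 have pl: "\<psi> n \<in> LL" "partial j (\<psi> n) \<in> LL" for n using test_L2 \<psi>(1) test_partial sets_dom by blast+
 have "nrm2 f <= nrm2 (%x. f x - \<psi> n x) + 2 * R * (nrm2 (D j f) + nrm2 (%x. D j f x - partial j (\<psi> n) x))" for n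
 proof -
  have "nrm2 f <= nrm2 (%x. f x - \<psi> n x) + nrm2 (\<psi> n)"
   using L2_norm_triangle[OF L2_diff[OF fl(1) pl(1)] pl(1), of n n] by simp
  moreover have "nrm2 (\<psi> n) <= 2 * R * nrm2 (partial j (\<psi> n))" by (rule poincare_test[OF R \<psi>(1)])
  moreover have "nrm2 (partial j (\<psi> n)) <= nrm2 (D j f) + nrm2 (%x. D j f x - partial j (\<psi> n) x)"
   using L2_norm_diff_triangle[OF fl(2) L2_diff[OF fl(2) pl(2)], of n] by simp
  ultimately show ?thesis using R0 mult_left_mono[of _ _ "2 * R"] by (smt (verit))
 qed
 moreover have "(%n. nrm2 (%x. f x - \<psi> n x) + 2 * R * (nrm2 (D j f) + nrm2 (%x. D j f x - partial j (\<psi> n) x)))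
   ----> 0 + 2 * R * (nrm2 (D j f) + 0)"
  by (intro tendsto_intros \<psi>)
 ultimately show ?thesis using LIMSEQ_le_const by (metis (no_types, lifting) add.right_neutral add_0)
qed

section \<open>Integration by parts for products of three functions\<close>

lemma trilinear_test:
 assumes "\<phi> \<in> TF" "a \<in> TF" "b \<in> TF"
 shows "inn (%x. partial j \<phi> x * b x) a + inn (%x. \<phi> x * b x) (partial j a) + inn (%x. \<phi> x * partial j b x) a = 0"
proof -
 note d = test_differentiable[OF assms(1)] test_differentiable[OF assms(2)] test_differentiable[OF assms(3)]
 have d2: "(%x. \<phi> x * b x) differentiable (at x)" for x by (intro differentiable_mult d)
 let ?f = "%x. (\<phi> x * b x) * a x"
 have pf: "partial j ?f x = (partial j \<phi> x * b x) * a x + (\<phi> x * b x) * partial j a x + (\<phi> x * partial j b x) * a x" for x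
  using partial_mult[OF d2 d(2)] partial_mult[OF d(1,3)] by (simp add: algebra_simps)
 obtain K where K: "compact K" "K \<subseteq> \<Omega>" "!!x. x \<notin> K ==> \<phi> x = 0"
  using assms by (auto simp: test_functions_def)
 obtain P where P: "P >= 0" "!!x. \<bar>\<phi> x\<bar> <= P" using test_bounded[OF assms(1)] by auto
 obtain P' where P': "P' >= 0" "!!x. \<bar>partial j \<phi> x\<bar> <= P'" using test_bounded[OF test_partial[OF assms(1)]] by auto
 obtain A where A: "A >= 0" "!!x. \<bar>a x\<bar> <= A" using test_bounded[OF assms(2)] by auto
 obtain A' where A': "A' >= 0" "!!x. \<bar>partial j a x\<bar> <= A'" using test_bounded[OF test_partial[OF assms(2)]] by auto
 obtain B where B: "B >= 0" "!!x. \<bar>b x\<bar> <= B" using test_bounded[OF assms(3)] by auto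
 obtain B' where B': "B' >= 0" "!!x. \<bar>partial j b x\<bar> <= B'" using test_bounded[OF test_partial[OF assms(3)]] by auto
 have z: "(\<integral>x. partial j ?f x \<partial>leb) = 0"
 proof (rule integral_partial_zero_on[OF _ K(1,2)])
  show "?f differentiable (at x)" for x by (intro differentiable_mult d)
  show "\<bar>partial j ?f x\<bar> <= (P' * B) * A + (P * B) * A' + (P * B') * A" for x
  proof -
   have "\<bar>(partial j \<phi> x * b x) * a x\<bar> <= (P' * B) * A" "\<bar>(\<phi> x * b x) * partial j a x\<bar> <= (P * B) * A'"
    "\<bar>(\<phi> x * partial j b x) * a x\<bar> <= (P * B') * A"
    unfolding abs_mult by (intro mult_mono P P' A A' B B' mult_nonneg_nonneg abs_ge_zero)+
   then show ?thesis unfolding pf by linarith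
  qed
 qed (use K(3) in auto)
 have l: "\<phi> \<in> LL" "a \<in> LL" "b \<in> LL" "partial j \<phi> \<in> LL" "partial j a \<in> LL" "partial j b \<in> LL"
  using assms test_L2 sets_dom test_partial by blast+
 have "(%x. partial j \<phi> x *\<^sub>R b x) \<in> LL" "(%x. \<phi> x *\<^sub>R b x) \<in> LL" "(%x. \<phi> x *\<^sub>R partial j b x) \<in> LL"
  by (rule L2_mult_bounded[OF L2_measurable[OF l(4)] AE_I2[OF P'(2)] l(3)]
    L2_mult_bounded[OF L2_measurable[OF l(1)] AE_I2[OF P(2)] l(3)] L2_mult_bounded[OF L2_measurable[OF l(1)] AE_I2[OF P(2)] l(6)])+
 then have "integrable leb (%x. (partial j \<phi> x * b x) * a x)" "integrable leb (%x. (\<phi> x * b x) * partial j a x)"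
  "integrable leb (%x. (\<phi> x * partial j b x) * a x)"
  using L2_inner_integrable l by force+
 then show ?thesis using z unfolding pf ip_eq_integral_mult by simp
qed

lemma mult_L2:
 fixes f g :: "real^'n => real"
 assumes "f \<in> bm" "AE x in leb. \<bar>f x\<bar> <= K" "g \<in> LL"
 shows "(%x. f x * g x) \<in> LL" "(%x. g x * f x) \<in> LL"
 using L2_mult_bounded[OF assms] by (simp_all add: mult.commute)

lemma test_mult_L2: "\<phi> \<in> TF ==> g \<in> LL ==> (%x. \<phi> x * g x) \<in> LL" "\<phi> \<in> TF ==> g \<in> LL ==> (%x. g x * \<phi> x) \<in> LL"
 using test_bounded[of \<phi> \<Omega>] mult_L2[OF test_measurable_on AE_I2] by (metis (no_types, lifting))+

text \<open>Test functions are replaced one at a time, in the order a, b, v. In each limit the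
  remaining product must be square integrable: test functions are bounded, and at the end the bounds
  on a and b take over.\<close>

lemma trilinear:
 assumes v: "v \<in> H0" and a: "a \<in> H0" "AE x in leb. \<bar>a x\<bar> <= A" and b: "b \<in> H0" "AE x in leb. \<bar>b x\<bar> <= B"
 shows "inn (%x. a x * b x) (D j v) + inn (%x. D j a x * b x + a x * D j b x) v = 0"
proof -
 obtain \<phi> where \<phi>: "!!n. \<phi> n \<in> TF" "(%n. nrm2 (%x. v x - \<phi> n x)) ----> 0"
  "!!j. (%n. nrm2 (%x. D j v x - partial j (\<phi> n) x)) ----> 0" by (rule H10_approx[OF v]) blast
 obtain \<alpha> where \<alpha>: "!!n. \<alpha> n \<in> TF" "(%n. nrm2 (%x. a x - \<alpha> n x)) ----> 0"
  "!!j. (%n. nrm2 (%x. D j a x - partial j (\<alpha> n) x)) ----> 0" by (rule H10_approx[OF a(1)]) blast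
 obtain \<beta> where \<beta>: "!!n. \<beta> n \<in> TF" "(%n. nrm2 (%x. b x - \<beta> n x)) ----> 0"
  "!!j. (%n. nrm2 (%x. D j b x - partial j (\<beta> n) x)) ----> 0" by (rule H10_approx[OF b(1)]) blast
 have al: "a \<in> LL" "D j a \<in> LL" and bl: "b \<in> LL" "D j b \<in> LL" and vl: "v \<in> LL" "D j v \<in> LL"
  using v a b H10_H1 Hs_L2 D_L2 by blast+
 have tl: "!!n. \<alpha> n \<in> LL" "!!n. \<beta> n \<in> LL" "!!n. \<phi> n \<in> LL" "!!n. partial j (\<alpha> n) \<in> LL" "!!n. partial j (\<beta> n) \<in> LL" "!!n. partial j (\<phi> n) \<in> LL"
  using \<alpha>(1) \<beta>(1) \<phi>(1) test_L2 sets_dom test_partial by blast+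
 have 1: "inn a (%x. partial j p x * q x) + inn (D j a) (%x. p x * q x) + inn a (%x. p x * partial j q x) = 0"
  if p: "p \<in> TF" and q: "q \<in> TF" for p q
 proof -
  have "(%n. inn (\<alpha> n) (%x. partial j p x * q x) + inn (partial j (\<alpha> n)) (%x. p x * q x) + inn (\<alpha> n) (%x. p x * partial j q x))
   ----> inn a (%x. partial j p x * q x) + inn (D j a) (%x. p x * q x) + inn a (%x. p x * partial j q x)"
   by (intro tendsto_add ip_tendsto tl al \<alpha> test_mult_L2 test_partial p q test_L2[OF q sets_dom] test_L2[OF test_partial[OF q] sets_dom])
  moreover have "inn (\<alpha> n) (%x. partial j p x * q x) + inn (partial j (\<alpha> n)) (%x. p x * q x) + inn (\<alpha> n) (%x. p x * partial j q x) = 0" for n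
   using trilinear_test[OF p \<alpha>(1) q, of j n] by (simp add: ip_sym)
  ultimately show ?thesis by (rule LIMSEQ_zero_unique)
 qed
 have 2: "inn (partial j p) (%x. a x * b x) + inn p (%x. D j a x * b x) + inn p (%x. a x * D j b x) = 0"
  if p: "p \<in> TF" for p
 proof -
  have "(%n. inn (\<beta> n) (%x. partial j p x * a x) + inn (\<beta> n) (%x. p x * D j a x) + inn (partial j (\<beta> n)) (%x. p x * a x))
   ----> inn b (%x. partial j p x * a x) + inn b (%x. p x * D j a x) + inn (D j b) (%x. p x * a x)"
   by (intro tendsto_add ip_tendsto tl bl \<beta> test_mult_L2 test_partial p al)
  moreover have "inn (\<beta> n) (%x. partial j p x * a x) + inn (\<beta> n) (%x. p x * D j a x) + inn (partial j (\<beta> n)) (%x. p x * a x) = 0" for n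
   using 1[OF p \<beta>(1), of n] by (simp add: ip_eq_integral_mult mult_ac)
  ultimately have "inn b (%x. partial j p x * a x) + inn b (%x. p x * D j a x) + inn (D j b) (%x. p x * a x) = 0"
   by (rule LIMSEQ_zero_unique)
  then show ?thesis by (simp add: ip_eq_integral_mult mult_ac)
 qed
 have ab: "(%x. a x * b x) \<in> LL" "(%x. D j a x * b x) \<in> LL" "(%x. a x * D j b x) \<in> LL"
  using mult_L2[OF L2_measurable[OF al(1)] a(2)] mult_L2[OF L2_measurable[OF bl(1)] b(2)] al bl by blast+
 have "(%n. inn (partial j (\<phi> n)) (%x. a x * b x) + inn (\<phi> n) (%x. D j a x * b x) + inn (\<phi> n) (%x. a x * D j b x))
   ----> inn (D j v) (%x. a x * b x) + inn v (%x. D j a x * b x) + inn v (%x. a x * D j b x)"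
  by (intro tendsto_add ip_tendsto tl vl \<phi> ab)
 then have "inn (D j v) (%x. a x * b x) + inn v (%x. D j a x * b x) + inn v (%x. a x * D j b x) = 0"
  by (rule LIMSEQ_zero_unique) (rule 2[OF \<phi>(1)])
 then show ?thesis using ip_add[OF ab(2,3) vl(1)] by (simp add: ip_sym)
qed

end

section \<open>Mollification and bubble functions\<close>

lemma has_derivative_partials:
 fixes f :: "real^'n::finite => real"
 assumes "f differentiable (at z)"
 shows "(f has_derivative (%h. \<Sum>j\<in>UNIV. partial j f z * (h $ j))) (at z)"
proof -
 have f: "(f has_derivative frechet_derivative f (at z)) (at z)"
  using assms by (simp add: frechet_derivative_works)
 have lin: "linear (frechet_derivative f (at z))" by (rule linear_frechet_derivative[OF assms])
 have "frechet_derivative f (at z) h = (\<Sum>j\<in>UNIV. partial j f z * (h $ j))" for h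
 proof -
  have "h = (\<Sum>j\<in>UNIV. (h $ j) *\<^sub>R axis j 1)"
   using basis_expansion[of h] by (simp add: scalar_mult_eq_scaleR)
  then have "frechet_derivative f (at z) h = frechet_derivative f (at z) (\<Sum>j\<in>UNIV. (h $ j) *\<^sub>R axis j 1)" by simp
  also have "... = (\<Sum>j\<in>UNIV. (h $ j) * partial j f z)"
   using lin by (simp add: linear_sum linear_scale partial_def)
  finally show ?thesis by (simp add: mult.commute)
 qed
 then have "frechet_derivative f (at z) = (%h. \<Sum>j\<in>UNIV. partial j f z * (h $ j))" by (rule ext)
 then show ?thesis using f by simp
qed

lemma smooth_continuous: "smooth f ==> continuous_on S f"
 by (meson continuous_at_imp_continuous_on differentiable_imp_continuous_within smooth_differentiable)

text \<open>Convolution. The integral runs over a box that contains the support of G in all uses, so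
  that differentiation under an integral over a compact set is available.\<close>

definition conv :: "real^'n => real^'n => (real^'n::finite => real) => (real^'n => real) => real^'n => real" where
 "conv a b G \<eta> x = integral (cbox a b) (%y. G y * \<eta> (x - y))"

text \<open>The derivative falls on the smooth factor \<eta>, so continuity of G suffices and the
  formula can be iterated.\<close>

lemma conv_derivative:
 fixes G \<eta> :: "real^'n::finite => real"
 assumes G: "continuous_on UNIV G" and \<eta>: "smooth \<eta>"
 shows "conv a b G \<eta> differentiable (at x)" "partial j (conv a b G \<eta>) x = conv a b G (partial j \<eta>) x"
proof -
 define fx where "fx x y = (\<Sum>j\<in>UNIV. (G y * partial j \<eta> (x - y)) *\<^sub>R blinfun_inner_left (axis j 1 :: real^'n))" for x y
 have c\<eta>: "continuous_on UNIV \<eta>" "continuous_on UNIV (partial j \<eta>)" for j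
  using \<eta> smooth_continuous smooth_partial by blast+
 note ci = continuous_on_compose2[OF G _ subset_UNIV] continuous_on_compose2[OF c\<eta>(1) _ subset_UNIV] continuous_on_compose2[OF c\<eta>(2) _ subset_UNIV]
 have "((%x. integral (cbox a b) (%y. G y * \<eta> (x - y))) has_derivative blinfun_apply (integral (cbox a b) (fx x))) (at x within UNIV)"
 proof (rule leibniz_rule)
  fix x y :: "real^'n"
  have "((%x. \<eta> (x - y)) has_derivative (%h. \<Sum>j\<in>UNIV. partial j \<eta> (x - y) * (h $ j))) (at x)"
   by (rule has_derivative_compose[OF _ has_derivative_partials[OF smooth_differentiable[OF \<eta>]]])
    (auto intro!: derivative_eq_intros)
  then have "((%x. G y * \<eta> (x - y)) has_derivative (%h. G y * (\<Sum>j\<in>UNIV. partial j \<eta> (x - y) * (h $ j)))) (at x)"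
   by (rule has_derivative_mult_right)
  moreover have "(%h. G y * (\<Sum>j\<in>UNIV. partial j \<eta> (x - y) * (h $ j))) = blinfun_apply (fx x y)"
   by (auto simp: fx_def fun_eq_iff blinfun.sum_left blinfun.scaleR_left inner_axis sum_distrib_left mult_ac)
  ultimately show "((%x. G y * \<eta> (x - y)) has_derivative blinfun_apply (fx x y)) (at x within UNIV)" by simp
 next
  show "(%y. G y * \<eta> (x - y)) integrable_on cbox a b" for x
   by (intro integrable_continuous continuous_intros ci)
  show "continuous_on (UNIV \<times> cbox a b) (%(x, t). fx x t)"
   unfolding fx_def split_beta by (intro continuous_intros ci)
 qed auto
 then have d: "(conv a b G \<eta> has_derivative blinfun_apply (integral (cbox a b) (fx x))) (at x)"
  by (simp add: conv_def[abs_def])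
 then show "conv a b G \<eta> differentiable (at x)" by (auto simp: differentiable_def)
 have fi: "fx x integrable_on cbox a b"
  unfolding fx_def by (intro integrable_continuous continuous_intros ci)
 have bl: "bounded_linear (%B. blinfun_apply B (axis j 1 :: real^'n) :: real)" by (rule blinfun.bounded_linear_left)
 have "partial j (conv a b G \<eta>) x = blinfun_apply (integral (cbox a b) (fx x)) (axis j 1)"
  by (rule partial_eq[OF d])
 also have "... = integral (cbox a b) (%y. blinfun_apply (fx x y) (axis j 1))"
  using integral_linear[OF fi bl] by (simp add: o_def)
 also have "... = conv a b G (partial j \<eta>) x"
  unfolding conv_def
  by (intro arg_cong2[where f=integral] refl ext)
   (simp add: fx_def blinfun.sum_left blinfun.scaleR_left inner_axis_axis if_distrib[of "%t. _ * t"] sum.delta cong: if_cong)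
 finally show "partial j (conv a b G \<eta>) x = conv a b G (partial j \<eta>) x" .
qed

lemma conv_smooth:
 assumes G: "continuous_on UNIV G" and \<eta>: "smooth \<eta>"
 shows "smooth (conv a b G \<eta>)"
proof (rule smooth_coinduct[of _ "{conv a b G \<eta> | \<eta>. smooth \<eta>}"])
 show "g differentiable (at x)" if "g \<in> {conv a b G \<eta> | \<eta>. smooth \<eta>}" for g x
  using that conv_derivative[OF G] by auto
 show "partial j g \<in> {conv a b G \<eta> | \<eta>. smooth \<eta>}" if g: "g \<in> {conv a b G \<eta> | \<eta>. smooth \<eta>}" for g j
 proof -
  obtain \<eta> where "g = conv a b G \<eta>" "smooth \<eta>" using g by blast
  have "partial j g = conv a b G (partial j \<eta>)"
   unfolding \<open>g = conv a b G \<eta>\<close> by (rule ext) (rule conv_derivative(2)[OF G \<open>smooth \<eta>\<close>])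
  then show ?thesis using smooth_partial[OF \<open>smooth \<eta>\<close>] by blast
 qed
qed (use \<eta> in auto)

lemma conv_eq_lborel:
 fixes G \<eta> :: "real^'n::finite => real"
 assumes G: "continuous_on UNIV G" and \<eta>: "continuous_on UNIV \<eta>" and K: "compact K" "K \<subseteq> cbox a b" "!!x. x \<notin> K ==> G x = 0"
 shows "conv a b G \<eta> x = (\<integral>y. G y * \<eta> (x - y) \<partial>lborel)" "integrable lborel (%y. G y * \<eta> (x - y))"
proof -
 let ?f = "%y. G y * \<eta> (x - y)"
 have c: "continuous_on S ?f" for S
  by (intro continuous_intros continuous_on_compose2[OF G _ subset_UNIV] continuous_on_compose2[OF \<eta> _ subset_UNIV])
 have "integrable lborel (%y. indicator K y *\<^sub>R ?f y)" by (rule borel_integrable_compact[OF K(1) c])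
 moreover have "indicator K y *\<^sub>R ?f y = ?f y" for y using K(3) by (auto simp: indicator_def)
 ultimately show i: "integrable lborel ?f" by (simp only:)
 have "(?f has_integral integral (cbox a b) ?f) (cbox a b)"
  using integrable_continuous[OF c] by (simp add: has_integral_integral)
 then have "(?f has_integral integral (cbox a b) ?f) UNIV"
  by (rule has_integral_on_superset) (use K in auto)
 then show "conv a b G \<eta> x = (\<integral>y. ?f y \<partial>lborel)"
  using integral_lborel[OF i] by (simp add: conv_def integral_unique)
qed

lemma lborel_integral_reflect:
 fixes f :: "'a::euclidean_space => real"
 assumes f: "f \<in> borel_measurable borel"
 shows "(\<integral>y. f (x - y) \<partial>lborel) = (\<integral>y. f y \<partial>lborel)"
proof -
 have "(\<integral>y. f y \<partial>lborel) = (\<integral>y. f y \<partial>distr lborel borel (%y. x + (-1) *\<^sub>R y))"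
  using lborel_affine[of "-1::real" x] by (simp add: density_1)
 also have "... = (\<integral>y. f (x + (-1) *\<^sub>R y) \<partial>lborel)"
  by (rule integral_distr) (use f in auto)
 finally show ?thesis by simp
qed

text \<open>A box bump on the cube of half side \<delta> / n, divided by its integral. The cube lies
  in the ball of radius \<delta> because the Euclidean norm is at most the sum of the n coordinates
  in absolute value.\<close>

lemma mollifier:
 assumes "\<delta> > 0"
 obtains \<eta> :: "real^'n::finite => real" where "smooth \<eta>" "!!x. 0 <= \<eta> x" "!!x. norm x > \<delta> ==> \<eta> x = 0" "integrable lborel \<eta>" "(\<integral>x. \<eta> x \<partial>lborel) = 1"
  "!!j. \<exists>M. \<forall>x. \<bar>\<eta> x\<bar> <= M & \<bar>partial j \<eta> x\<bar> <= M"
proof -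
 let ?r = "\<delta> / real CARD('n)"
 let ?a = "(\<chi> i. - ?r) :: real^'n" and ?b = "(\<chi> i. ?r) :: real^'n"
 let ?g = "box_bump 1 ?a ?b :: real^'n => real"
 have r: "?r > 0" using assms by simp
 have gt: "?g \<in> test_functions UNIV" by (rule box_bump_test) auto
 have pos: "?g x > 0 \<longleftrightarrow> x \<in> box ?a ?b" for x
  using box_bump_pos[of 1 x ?a ?b] box_bump_zero[of 1 x ?a ?b] by force
 have gi: "integrable lborel ?g"
 proof -
  have "integrable lborel (%x. indicator (cbox ?a ?b) x *\<^sub>R ?g x)"
   by (rule borel_integrable_compact[OF compact_cbox test_continuous[OF gt]])
  moreover have "indicator (cbox ?a ?b) x *\<^sub>R ?g x = ?g x" for x
   using box_bump_zero[of 1 x ?a ?b] box_subset_cbox[of ?a ?b] by (auto simp: indicator_def)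
  ultimately show ?thesis by (simp only:)
 qed
 define c where "c = (\<integral>x. ?g x \<partial>lborel)"
 have "c ~= 0"
 proof
  assume "c = 0"
  then have "AE x in lborel. ?g x = 0"
   using integral_nonneg_eq_0_iff_AE[OF gi AE_I2[OF box_bump_bounds(1)]] by (simp add: c_def)
  then have "AE x in lborel. x \<notin> box ?a ?b" by eventually_elim (use pos in force)
  then have "box ?a ?b \<in> null_sets lborel" by (subst AE_iff_null_sets) auto
  then have "emeasure lborel (box ?a ?b) = 0" by auto
  moreover have lt: "?a \<bullet> i < ?b \<bullet> i" if "i \<in> Basis" for i using that r by (auto simp: Basis_vec_def inner_axis)
  have "emeasure lborel (box ?a ?b) = ennreal (\<Prod>i\<in>Basis. (?b - ?a) \<bullet> i)"
   by (rule emeasure_lborel_box) (use lt less_imp_le in blast)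
  moreover have "0 < (\<Prod>i\<in>Basis. (?b - ?a) \<bullet> i)"
   by (intro prod_pos) (use lt in \<open>simp add: inner_diff_left\<close>)
  ultimately show False by (metis ennreal_eq_0_iff not_less)
 qed
 moreover have "c >= 0" unfolding c_def using box_bump_bounds by (intro Bochner_Integration.integral_nonneg) auto
 ultimately have c: "c > 0" by simp
 show ?thesis
 proof (rule that[of "%x. inverse c * ?g x"])
  show "smooth (%x. inverse c * ?g x)" using gt by (intro smooth_scale) (simp add: test_functions_def)
  show "0 <= inverse c * ?g x" for x using c box_bump_bounds(1)[of 1 ?a ?b x] by simp
  show "inverse c * ?g x = 0" if "norm x > \<delta>" for x
  proof -
   have "x \<notin> box ?a ?b"
   proof
    assume "x \<in> box ?a ?b"
    then have "- ?r < x $ i & x $ i < ?r" for i by (simp add: mem_box_cart)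
    then have "\<bar>x $ i\<bar> <= ?r" for i by (intro abs_leI) (meson less_imp_le minus_less_iff)+
    then have "(\<Sum>i\<in>UNIV. \<bar>x $ i\<bar>) <= (\<Sum>i\<in>(UNIV::'n set). ?r)" by (intro sum_mono) auto
    then show False using norm_le_l1_cart[of x] that by simp
   qed
   then have "?g x = 0" by (rule box_bump_zero[OF zero_less_one])
   then show ?thesis by (simp only: mult_zero_right)
  qed
  show "integrable lborel (%x. inverse c * ?g x)" using gi by simp
  show "(\<integral>x. inverse c * ?g x \<partial>lborel) = 1" using c gi by (simp add: c_def)
  have t: "(%x. inverse c * ?g x) \<in> test_functions UNIV" by (rule test_scale[OF gt])
  show "\<exists>M. \<forall>x. \<bar>inverse c * ?g x\<bar> <= M & \<bar>partial j (%x. inverse c * ?g x) x\<bar> <= M" for j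
  proof -
   obtain M N where "\<forall>x. \<bar>inverse c * ?g x\<bar> <= M" "\<forall>x. \<bar>partial j (%x. inverse c * ?g x) x\<bar> <= N"
    using test_bounded[OF t] test_bounded[OF test_partial[OF t]] by blast
   then show ?thesis by (intro exI[of _ "max M N"]) (auto simp: max.coboundedI1 max.coboundedI2)
  qed
 qed
qed

lemma compact_support_uniform:
 fixes G :: "'a::euclidean_space => real"
 assumes G: "continuous_on UNIV G" and K: "compact K" "!!x. x \<notin> K ==> G x = 0" and e: "e > 0"
 shows "\<exists>d>0. \<forall>x y. norm (x - y) <= d --> \<bar>G x - G y\<bar> <= e"
proof -
 obtain R where R: "!!x. x \<in> K ==> norm x <= R"
  using compact_imp_bounded[OF K(1)] by (auto simp: bounded_iff)
 have "uniformly_continuous_on (cball 0 (R + 1)) G"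
  by (rule compact_uniformly_continuous[OF continuous_on_subset[OF G]]) auto
 then obtain d where d: "d > 0" "!!x y. x \<in> cball 0 (R + 1) ==> y \<in> cball 0 (R + 1) ==> dist y x < d ==> dist (G y) (G x) < e"
  using e unfolding uniformly_continuous_on_def by metis
 show ?thesis
 proof (intro exI[of _ "min 1 (d / 2)"] conjI allI impI)
  fix x y :: 'a assume xy: "norm (x - y) <= min 1 (d / 2)"
  show "\<bar>G x - G y\<bar> <= e"
  proof (cases "x \<in> K \<or> y \<in> K")
   case True
   have "norm x <= norm y + 1" "norm y <= norm x + 1"
    using xy norm_triangle_ineq2[of x y] norm_triangle_ineq3[of x y] by auto
   then have "x \<in> cball 0 (R + 1)" "y \<in> cball 0 (R + 1)" using True R[of x] R[of y] by auto
   then have "dist (G y) (G x) < e" using d(1) xy by (intro d(2)) (auto simp: dist_norm norm_minus_commute)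
   then show ?thesis by (simp add: dist_real_def abs_minus_commute)
  qed (use K(2) e in auto)
 qed (use d in auto)
qed

lemma mollify_close:
 fixes G \<eta> :: "real^'n::finite => real"
 assumes G: "continuous_on UNIV G" and K: "compact K" "!!x. x \<notin> K ==> G x = 0"
  and \<eta>: "continuous_on UNIV \<eta>" "!!x. 0 <= \<eta> x" "!!x. norm x > d ==> \<eta> x = 0" "integrable lborel \<eta>" "(\<integral>x. \<eta> x \<partial>lborel) = 1"
  and d: "!!x y. norm (x - y) <= d ==> \<bar>G x - G y\<bar> <= e"
 shows "\<bar>(\<integral>y. G y * \<eta> (x - y) \<partial>lborel) - G x\<bar> <= e"
proof -
 obtain c where c: "K \<subseteq> cbox (- c) c" using bounded_subset_cbox_symmetric[OF compact_imp_bounded[OF K(1)]] by blast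
 have \<eta>m: "\<eta> \<in> borel_measurable borel" by (rule borel_measurable_continuous_onI[OF \<eta>(1)])
 have i1: "integrable lborel (%y. G y * \<eta> (x - y))" by (rule conv_eq_lborel(2)[OF G \<eta>(1) K(1) c K(2)])
 have i2: "integrable lborel (%y. \<eta> (x - y))"
  using \<eta>(5) lborel_integral_reflect[OF \<eta>m, of x] not_integrable_integral_eq[of lborel "%y. \<eta> (x - y)"] by fastforce
 have one: "(\<integral>y. \<eta> (x - y) \<partial>lborel) = 1" using \<eta>(5) lborel_integral_reflect[OF \<eta>m, of x] by simp
 have "(\<integral>y. G y * \<eta> (x - y) \<partial>lborel) - G x = (\<integral>y. G y * \<eta> (x - y) - G x * \<eta> (x - y) \<partial>lborel)"
  using i1 i2 one by simp
 also have "\<bar>...\<bar> <= (\<integral>y. e * \<eta> (x - y) \<partial>lborel)"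
 proof (rule integral_abs_bound[THEN order_trans], rule integral_mono)
  show "\<bar>G y * \<eta> (x - y) - G x * \<eta> (x - y)\<bar> <= e * \<eta> (x - y)" for y
  proof (cases "norm (x - y) <= d")
   case True
   have "\<bar>G y - G x\<bar> <= e" using d[OF True] by (simp add: abs_minus_commute)
   then show ?thesis using \<eta>(2)[of "x - y"] by (simp add: left_diff_distrib[symmetric] abs_mult mult_right_mono)
  qed (use \<eta>(3) in auto)
 qed (use i1 i2 in auto)
 also have "... = e" using one by simp
 finally show ?thesis .
qed

context bounded_domain
begin

text \<open>G and its partial derivatives are uniformly continuous, having compact support, and
  averaging over short distances moves a uniformly continuous function by little.\<close>

lemma C1_approx:
 assumes d: "!!x. G differentiable (at x)" and c: "!!j. continuous_on UNIV (partial j G)"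
  and K: "compact K" "K \<subseteq> \<Omega>" "!!x. x \<notin> K ==> G x = 0" and e: "e > 0"
 shows "\<exists>\<phi>\<in>TF. (\<forall>x. \<bar>G x - \<phi> x\<bar> <= e) & (\<forall>j x. \<bar>partial j G x - partial j \<phi> x\<bar> <= e)"
proof -
 have G: "continuous_on UNIV G"
  using d by (rule diff_continuous)
 have pK: "partial j G x = 0" if "x \<notin> K" for j x
  by (rule partial_zero_outside[OF compact_imp_closed[OF K(1)] K(3) that])
 obtain d0 where d0: "d0 > 0" "!!x y. norm (x - y) <= d0 ==> \<bar>G x - G y\<bar> <= e"
  using compact_support_uniform[OF G K(1,3) e] by metis
 have "\<forall>j. \<exists>d>0. \<forall>x y. norm (x - y) <= d --> \<bar>partial j G x - partial j G y\<bar> <= e"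
  using compact_support_uniform[OF c K(1) pK e] by blast
 then obtain d1 where d1: "!!j. d1 j > 0" "!!j x y. norm (x - y) <= d1 j ==> \<bar>partial j G x - partial j G y\<bar> <= e"
  by metis
 obtain d2 where d2: "d2 > 0" "(\<Union>x\<in>K. cball x d2) \<subseteq> \<Omega>"
  by (rule compact_subset_open_imp_cball_epsilon_subset[OF K(1) open_dom K(2)])
 \<comment> \<open>Small enough for the moduli of continuity of G and of its partial derivatives,
   and for the enlarged support to stay in the domain.\<close>
 define \<delta> where "\<delta> = min (min d0 d2) (Min (range d1))"
 have \<delta>: "\<delta> > 0" "\<delta> <= d0" "\<delta> <= d2" "!!j. \<delta> <= d1 j"
  using d0(1) d1(1) d2(1) by (auto simp: \<delta>_def Min_gr_iff intro!: min.coboundedI2)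
 obtain \<eta> :: "real^'n => real" where \<eta>: "smooth \<eta>" "!!x. 0 <= \<eta> x" "!!x. norm x > \<delta> ==> \<eta> x = 0" "integrable lborel \<eta>" "(\<integral>x. \<eta> x \<partial>lborel) = 1"
  "!!j. \<exists>M. \<forall>x. \<bar>\<eta> x\<bar> <= M & \<bar>partial j \<eta> x\<bar> <= M"
  using mollifier[OF \<delta>(1)] by metis
 obtain b where b: "K \<subseteq> cbox (- b) b" using bounded_subset_cbox_symmetric[OF compact_imp_bounded[OF K(1)]] by blast
 let ?\<phi> = "conv (- b) b G \<eta>"
 have \<eta>c: "continuous_on UNIV \<eta>" "continuous_on UNIV (partial j \<eta>)" for j using \<eta>(1) smooth_continuous smooth_partial by blast+
 have e1: "?\<phi> x = (\<integral>y. G y * \<eta> (x - y) \<partial>lborel)" for x by (rule conv_eq_lborel(1)[OF G \<eta>c(1) K(1) b K(3)])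
 \<comment> \<open>The derivative moves from the kernel to G because the derivative of G(y) \<eta>(x
   - y) in y_j integrates to zero.\<close>
 have e2: "partial j ?\<phi> x = (\<integral>y. partial j G y * \<eta> (x - y) \<partial>lborel)" for j x
 proof -
  let ?f = "%y. G y * \<eta> (x - y)"
  have dr: "((%y. \<eta> (x - y)) has_derivative (%h. \<Sum>j\<in>UNIV. partial j \<eta> (x - y) * ((- h) $ j))) (at y)" for y
   by (rule has_derivative_compose[OF _ has_derivative_partials[OF smooth_differentiable[OF \<eta>(1)]]])
    (auto intro!: derivative_eq_intros)
  have dr': "(%y. \<eta> (x - y)) differentiable (at y)" for y using dr by (auto simp: differentiable_def)
  have pr: "partial j (%y. \<eta> (x - y)) y = - partial j \<eta> (x - y)" for y
   using partial_eq[OF dr, of j] by (simp add: axis_def if_distrib[of "%t. _ * t"] if_distrib[of uminus] sum.delta sum_negf cong: if_cong)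
  have pf: "partial j ?f y = partial j G y * \<eta> (x - y) - G y * partial j \<eta> (x - y)" for y
   using partial_mult[OF d dr'] pr by simp
  obtain M where M: "!!x. \<bar>\<eta> x\<bar> <= M" "!!x. \<bar>partial j \<eta> x\<bar> <= M" using \<eta>(6) by blast
  obtain A where A: "!!x. x \<in> K ==> \<bar>G x\<bar> <= A"
   using compact_imp_bounded[OF compact_continuous_image[OF continuous_on_subset[OF G] K(1)]] by (auto simp: bounded_iff)
  obtain A' where A': "!!x. x \<in> K ==> \<bar>partial j G x\<bar> <= A'"
   using compact_imp_bounded[OF compact_continuous_image[OF continuous_on_subset[OF c[of j]] K(1)]] by (auto simp: bounded_iff)
  have "\<bar>partial j ?f y\<bar> <= \<bar>A'\<bar> * M + \<bar>A\<bar> * M" for y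
  proof (cases "y \<in> K")
   case True
   have "\<bar>partial j G y * \<eta> (x - y)\<bar> <= \<bar>A'\<bar> * M" "\<bar>G y * partial j \<eta> (x - y)\<bar> <= \<bar>A\<bar> * M"
    unfolding abs_mult using A[OF True] A'[OF True] M by (auto intro!: mult_mono)
   then show ?thesis unfolding pf by linarith
  next
   case False
   have "0 <= M" using M(1)[of 0] by linarith
   then show ?thesis using False K(3) pK by (simp add: pf)
  qed
  then have "(\<integral>y. partial j ?f y \<partial>lebesgue) = 0"
   by (intro integral_partial_zero(2)[of ?f K]) (use K(1,3) d dr' in \<open>auto intro!: differentiable_mult\<close>)
  moreover have i1: "integrable lborel (%y. partial j G y * \<eta> (x - y))"
   by (rule conv_eq_lborel(2)[OF c \<eta>c(1) K(1) b pK])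
  moreover have i2: "integrable lborel (%y. G y * partial j \<eta> (x - y))"
   by (rule conv_eq_lborel(2)[OF G \<eta>c(2) K(1) b K(3)])
  ultimately have "(\<integral>y. partial j G y * \<eta> (x - y) \<partial>lborel) = (\<integral>y. G y * partial j \<eta> (x - y) \<partial>lborel)"
   unfolding pf by (simp add: integral_completion[OF borel_measurable_diff[OF borel_measurable_integrable borel_measurable_integrable]])
  then show ?thesis using conv_derivative(2)[OF G \<eta>(1)] conv_eq_lborel(1)[OF G \<eta>c(2) K(1) b K(3)] by simp
 qed
 have "?\<phi> \<in> TF"
  unfolding test_functions_def
 proof (intro CollectI conjI exI[of _ "\<Union>x\<in>K. \<Union>y\<in>cball 0 \<delta>. {x + y}"] allI impI)
  show "smooth ?\<phi>" by (rule conv_smooth[OF G \<eta>(1)])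
  show "compact (\<Union>x\<in>K. \<Union>y\<in>cball 0 \<delta>. {x + y})" by (rule compact_sums'[OF K(1) compact_cball])
  have "x + y \<in> \<Omega>" if "x \<in> K" "norm y <= \<delta>" for x y
  proof -
   have "x + y \<in> cball x d2" using that \<delta>(3) by (simp add: dist_norm)
   then show ?thesis using d2(2) that by blast
  qed
  then show "(\<Union>x\<in>K. \<Union>y\<in>cball 0 \<delta>. {x + y}) \<subseteq> \<Omega>" by auto
  fix x assume x: "x \<notin> (\<Union>x\<in>K. \<Union>y\<in>cball 0 \<delta>. {x + y})"
  have "G y * \<eta> (x - y) = 0" for y
  proof (cases "y \<in> K")
   case True
   have "\<not> norm (x - y) <= \<delta>"
   proof
    assume "norm (x - y) <= \<delta>"
    then have "x - y \<in> cball 0 \<delta>" "x = y + (x - y)" by auto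
    then show False using x True by blast
   qed
   then show ?thesis using \<eta>(3) by simp
  qed (use K(3) in simp)
  then have "(%y. G y * \<eta> (x - y)) = (%y. 0)" by (rule ext)
  then show "?\<phi> x = 0" unfolding e1 by (simp only:) simp
 qed
 moreover have "\<bar>G x - ?\<phi> x\<bar> <= e" for x
  using mollify_close[OF G K(1,3) \<eta>c(1) \<eta>(2,3,4,5), where e=e and x=x] d0(2) \<delta>(2) by (simp add: e1 abs_minus_commute)
 moreover have "\<bar>partial j G x - partial j ?\<phi> x\<bar> <= e" for j x
 proof -
  have "\<bar>partial j G x - partial j G y\<bar> <= e" if "norm (x - y) <= \<delta>" for x y
   using d1(2)[of x y j] that \<delta>(4)[of j] by linarith
  then show ?thesis using mollify_close[OF c[of j] K(1) pK \<eta>c(1) \<eta>(2,3,4,5), where e=e and x=x] by (simp add: e2 abs_minus_commute)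
 qed
 ultimately show ?thesis by blast
qed

lemma H1_norm_le: "f \<in> LL ==> Hsn 1 f <= vD powr (- 1 / real CARD('n)) * nrm2 f + (\<Sum>j\<in>UNIV. nrm2 (D j f))"
proof (rule power2_le_imp_le)
 assume f: "f \<in> LL"
 let ?a = "vD powr (- 1 / real CARD('n)) * nrm2 f" and ?b = "\<Sum>j\<in>UNIV. nrm2 (D j f)"
 have "(\<Sum>j\<in>UNIV. (nrm2 (D j f))\<^sup>2) <= ?b\<^sup>2"
  using L2_set_le_sum[of UNIV "%j. nrm2 (D j f)"] power_mono[of "L2_set (%j. nrm2 (D j f)) UNIV" ?b 2]
  by (simp add: L2_set_def sum_nonneg)
 moreover have "?a\<^sup>2 = vD powr (- 2 / real CARD('n)) * (nrm2 f)\<^sup>2"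
  by (simp add: power_mult_distrib power2_eq_square powr_add[symmetric])
 moreover have "0 <= ?a * ?b" by (intro mult_nonneg_nonneg sum_nonneg) auto
 ultimately show "(Hsn 1 f)\<^sup>2 <= (?a + ?b)\<^sup>2"
  unfolding H1_norm_sq[OF f] power2_sum by linarith
qed (auto intro!: add_nonneg_nonneg sum_nonneg)

text \<open>Closedness of \<open>H10\<close>: one half of e goes to the distance from f to
  \<open>g n\<close>, the other to a test function approximating \<open>g n\<close>.\<close>

lemma H10_limit:
 assumes f: "f \<in> HS 1" and g: "!!n. g n \<in> H0"
  and l: "(%n. nrm2 (%x. f x - g n x)) ----> 0" "!!j. (%n. nrm2 (%x. D j f x - D j (g n) x)) ----> 0"
 shows "f \<in> H0"
 unfolding H10_def
proof (intro CollectI conjI allI impI)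
 fix e :: real assume e: "e > 0"
 let ?d = "%n x. f x - g n x"
 have gH: "g n \<in> HS 1" for n by (rule H10_H1[OF g])
 have dH: "?d n \<in> HS 1" for n by (rule Hs_diff[OF f gH])
 have "(%n. vD powr (- 1 / real CARD('n)) * nrm2 (?d n) + (\<Sum>j\<in>UNIV. nrm2 (%x. D j f x - D j (g n) x)))
  ----> vD powr (- 1 / real CARD('n)) * 0 + (\<Sum>j\<in>(UNIV::'n set). 0)"
  by (intro tendsto_intros l)
 then have "\<forall>\<^sub>F n in sequentially. vD powr (- 1 / real CARD('n)) * nrm2 (?d n) + (\<Sum>j\<in>UNIV. nrm2 (%x. D j f x - D j (g n) x)) < e / 2"
  using e by (intro order_tendstoD(2)) auto
 then obtain n where n: "vD powr (- 1 / real CARD('n)) * nrm2 (?d n) + (\<Sum>j\<in>UNIV. nrm2 (%x. D j f x - D j (g n) x)) < e / 2"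
  by (auto simp: eventually_sequentially)
 have "nrm2 (D j (?d n)) = nrm2 (%x. D j f x - D j (g n) x)" for j
  by (rule L2_norm_AE_cong[OF D_diff[OF f gH] D_L2[OF dH] sets_dom])
 then have 1: "Hsn 1 (?d n) < e / 2"
  using n H1_norm_le[OF Hs_L2[OF dH], of n] by simp
 obtain \<phi> where \<phi>: "\<phi> \<in> TF" "Hsn 1 (%x. g n x - \<phi> x) < e / 2"
  using g[of n] half_gt_zero[OF e] unfolding H10_def by blast
 have "Hsn 1 (%x. ?d n x + (g n x - \<phi> x)) <= Hsn 1 (?d n) + Hsn 1 (%x. g n x - \<phi> x)"
  by (rule Hs_norm_triangle[OF dH Hs_diff[OF gH test_H1[OF \<phi>(1)]]])
 then have "Hsn 1 (%x. f x - \<phi> x) < e" using 1 \<phi>(2) by simp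
 then show "\<exists>\<phi>\<in>TF. Hsn 1 (%x. f x - \<phi> x) < e" using \<phi>(1) by blast
qed (rule f)

lemma L2_norm_bound:
 assumes "f \<in> bm" "AE x in leb. norm (f x) <= e" "0 <= e"
 shows "nrm2 f <= e * sqrt vD"
proof -
 have "nrm2 f <= e * nrm2 (%x. 1::real)"
  by (rule L2_norm_mono[OF assms(1) const_L2 assms(3)]) (use assms(2) in auto)
 also have "nrm2 (%x. 1::real) = sqrt vD"
  by (simp add: L2_norm_def ip_def measure_restrict_space sets_dom)
 finally show ?thesis .
qed

lemma C1_H10:
 assumes d: "!!x. G differentiable (at x)" and c: "!!j. continuous_on UNIV (partial j G)"
  and K: "compact K" "K \<subseteq> \<Omega>" "!!x. x \<notin> K ==> G x = 0"
 shows "G \<in> H0" "wder (single j 1) G (partial j G)"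
proof -
 have G: "continuous_on UNIV G"
  using d by (rule diff_continuous)
 have pK: "partial j G x = 0" if "x \<notin> K" for j x
  by (rule partial_zero_outside[OF compact_imp_closed[OF K(1)] K(3) that])
 have bd: "\<exists>A. \<forall>x. \<bar>f x\<bar> <= A" if f: "continuous_on UNIV f" "!!x. x \<notin> K ==> f x = 0" for f :: "real^'n => real"
 proof -
  obtain A where A: "!!x. x \<in> K ==> \<bar>f x\<bar> <= A"
   using compact_imp_bounded[OF compact_continuous_image[OF continuous_on_subset[OF f(1)] K(1)]] by (auto simp: bounded_iff)
  show ?thesis
  proof (intro exI[of _ "\<bar>A\<bar>"] allI)
   show "\<bar>f x\<bar> <= \<bar>A\<bar>" for x using A[of x] f(2)[of x] by (cases "x \<in> K") auto
  qed
 qed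
 have m: "f \<in> bm" if "continuous_on UNIV f" for f :: "real^'n => real"
  by (rule measurable_restrict_space1, rule measurable_completion) (simp add: borel_measurable_continuous_onI[OF that])
 have l: "f \<in> LL" if "continuous_on UNIV f" "!!x. x \<notin> K ==> f x = 0" for f :: "real^'n => real"
  using bd[OF that] L2_bounded[OF m[OF that(1)] _ lmeas] by auto
 have w: "wder (single j 1) G (partial j G)" for j
  using bd[OF c pK] weak_deriv_classical(1)[OF d] by metis
 show "wder (single j 1) G (partial j G)" by (rule w)
 have H1: "G \<in> HS 1" unfolding H1_iff using l[OF G K(3)] l[OF c pK] w by blast
 have "\<forall>n. \<exists>\<phi>\<in>TF. (\<forall>x. \<bar>G x - \<phi> x\<bar> <= inverse (real (Suc n))) & (\<forall>j x. \<bar>partial j G x - partial j \<phi> x\<bar> <= inverse (real (Suc n)))"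
  by (intro allI C1_approx[OF d c K]) auto
 then obtain \<phi> where \<phi>: "!!n. \<phi> n \<in> TF" "!!n x. \<bar>G x - \<phi> n x\<bar> <= inverse (real (Suc n))"
   "!!n j x. \<bar>partial j G x - partial j (\<phi> n) x\<bar> <= inverse (real (Suc n))"
  by metis
 have lim: "(%n. inverse (real (Suc n)) * sqrt vD) ----> 0"
  by (rule tendsto_mult_left_zero[OF LIMSEQ_inverse_real_of_nat])
 have DG: "AE x in leb. D j G x = partial j G x" for j by (rule wd_eq[OF w])
 have t: "\<phi> n \<in> H0" for n
 proof -
  have "Hsn 1 (%x. \<phi> n x - \<phi> n x) = 0"
   using semi_inner.B_zero[OF semi_inner_Hs semi_inner.V_zero[OF semi_inner_Hs]] by (simp add: Hs_norm_eq)
  then show ?thesis unfolding H10_def using test_H1[OF \<phi>(1)] \<phi>(1) by (auto intro!: bexI[of _ "\<phi> n"])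
 qed
 show "G \<in> H0"
 proof (rule H10_limit[OF H1 t])
  have "nrm2 (%x. G x - \<phi> n x) <= inverse (real (Suc n)) * sqrt vD" for n
   by (rule L2_norm_bound) (use \<phi> m[OF G] test_measurable_on[OF \<phi>(1)] in auto)
  then show "(%n. nrm2 (%x. G x - \<phi> n x)) ----> 0"
   by (intro tendsto_sandwich[OF _ _ tendsto_const lim]) (auto intro!: always_eventually)
  fix j
  have "nrm2 (%x. D j G x - D j (\<phi> n) x) <= inverse (real (Suc n)) * sqrt vD" for n
  proof (rule L2_norm_bound)
   show "(%x. D j G x - D j (\<phi> n) x) \<in> bm"
    using D_L2[OF H1] D_L2[OF test_H1[OF \<phi>(1)]] L2_measurable by (intro borel_measurable_diff) blast+
   show "AE x in leb. norm (D j G x - D j (\<phi> n) x) <= inverse (real (Suc n))"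
    using DG[of j] test_D[OF \<phi>(1)[of n], of j] by eventually_elim (use \<phi>(3) in simp)
  qed auto
  then show "(%n. nrm2 (%x. D j G x - D j (\<phi> n) x)) ----> 0"
   by (intro tendsto_sandwich[OF _ _ tendsto_const lim]) (auto intro!: always_eventually)
 qed
qed


section \<open>Truncation near the zero set, and bubbles in H^1_0\<close>

definition cutoff :: "real => real => real" where
 "cutoff e s = (if s <= e then 0 else (s - e)\<^sup>2 / s)"

definition cutoff' :: "real => real => real" where
 "cutoff' e s = (if s <= e then 0 else 1 - e\<^sup>2 / s\<^sup>2)"

text \<open>For s > e the function is s - 2 e + e^2 / s. It vanishes to second order at e, which
  makes the pieces fit together with their derivatives, and it stays within 2 e of the
  identity.\<close>

lemma cutoff_derivative: assumes "e > 0" shows "(cutoff e has_real_derivative cutoff' e s) (at s)"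
proof -
 consider "s < e" | "s = e" | "s > e" by linarith
 then show ?thesis
 proof cases
  case 1
  have "((%_. 0) has_real_derivative cutoff' e s) (at s)" using 1 by (simp add: cutoff'_def)
  then show ?thesis
   by (rule has_field_derivative_transform_within_open[where S="{..<e}"]) (use 1 in \<open>auto simp: cutoff_def\<close>)
 next
  case 3
  have "((%s. (s - e)\<^sup>2 / s) has_real_derivative cutoff' e s) (at s)"
   using 3 assms by (auto intro!: derivative_eq_intros simp: cutoff'_def power2_eq_square field_simps)
  then show ?thesis
   by (rule has_field_derivative_transform_within_open[where S="{e<..}"]) (use 3 in \<open>auto simp: cutoff_def\<close>)
 next
  case 2
  have "((%h. (cutoff e (e + h) - cutoff e e) / h) \<longlongrightarrow> 0) (at 0)"
  proof (rule Lim_null_comparison)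
   have "\<bar>(cutoff e (e + h) - cutoff e e) / h\<bar> <= \<bar>h\<bar> / e" if "h ~= 0" for h
    using assms that by (auto simp: cutoff_def power2_eq_square abs_mult field_simps)
   then show "\<forall>\<^sub>F h in at 0. norm ((cutoff e (e + h) - cutoff e e) / h) <= \<bar>h\<bar> / e"
    by (auto simp: eventually_at intro!: exI[of _ 1])
   have "((%h. \<bar>h\<bar> / e) \<longlongrightarrow> \<bar>0\<bar> / e) (at 0)" by (intro tendsto_intros) (use assms in auto)
   then show "((%h. \<bar>h\<bar> / e) \<longlongrightarrow> 0) (at 0)" by simp
  qed
  then show ?thesis using 2 by (simp add: DERIV_def cutoff'_def)
 qed
qed

lemma cutoff'_bounds: "e > 0 ==> 0 <= cutoff' e s" "e > 0 ==> cutoff' e s <= 1"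
 by (auto simp: cutoff'_def field_simps power_mono less_imp_le)

lemma cutoff_close: "0 < e ==> 0 <= s ==> \<bar>s - cutoff e s\<bar> <= 2 * e"
 by (auto simp: cutoff_def field_simps power2_eq_square abs_if)

lemma cutoff'_continuous: assumes "e > 0" shows "continuous_on UNIV (cutoff' e)"
proof -
 have "cutoff' e = (%s. 1 - e\<^sup>2 / (max e s)\<^sup>2)" using assms by (auto simp: cutoff'_def fun_eq_iff max_def)
 then show ?thesis using assms by (auto intro!: continuous_intros)
qed

text \<open>A nonnegative function that vanishes outside an open \<open>U\<close>, is \<open>C\<^sup>1\<close> with bounded gradient inside
  and has compact superlevel sets: composing with \<open>cutoff e\<close> makes it \<open>C\<^sup>1\<close> with compact support.\<close>

lemma bubble_H10:
 assumes U: "open U" "U \<subseteq> \<Omega>" and d: "!!x. x \<in> U ==> g differentiable (at x)"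
  and c: "!!j. continuous_on U (partial j g)" and M: "!!j x. x \<in> U ==> \<bar>partial j g x\<bar> <= M"
  and pos: "!!x. x \<in> U ==> 0 < g x" and out: "!!x. x \<notin> U ==> g x = 0"
  and K: "!!e. 0 < e ==> compact {x. e <= g x}"
 shows "g \<in> H0"
proof -
 have g0: "0 <= g x" for x using pos[of x] out[of x] by (cases "x \<in> U") auto
 have cg: "continuous_on U g"
  using d by (rule diff_continuous)
 define G where "G n = (%x. cutoff (inverse (real (Suc n))) (g x))" for n
 define dG where "dG n j = (%x. if x \<in> U then cutoff' (inverse (real (Suc n))) (g x) * partial j g x else 0)" for n j
 let ?K = "%n. {x. inverse (real (Suc n)) <= g x}"
 have KU: "?K n \<subseteq> U" for n using out by (force simp: not_le)
 have Kc: "compact (?K n)" for n by (rule K) simp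
 have G_out: "G n x = 0" "dG n j x = 0" if "x \<notin> ?K n" for n j x using that by (auto simp: G_def dG_def cutoff_def cutoff'_def)
 have Gd_U: "(G n has_derivative (%h. cutoff' (inverse (real (Suc n))) (g x) * frechet_derivative g (at x) h)) (at x)" if "x \<in> U" for n x
  unfolding G_def
  by (rule has_derivative_compose[OF d[OF that, unfolded frechet_derivative_works] cutoff_derivative[unfolded has_field_derivative_def]]) simp
 have Gd_out: "(G n has_derivative (%h. 0)) (at x)" if "x \<notin> ?K n" for n x
 proof (rule has_derivative_transform_within_open[where s="- ?K n" and f="%_. 0"])
  show "open (- ?K n)" using compact_imp_closed[OF Kc] by (rule open_Compl)
  show "0 = G n y" if "y \<in> - ?K n" for y using G_out[of y n] that by simp
 qed (use that in auto)
 have Gd: "G n differentiable (at x)" for n x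
  using Gd_U[of x n] Gd_out[of x n] KU by (cases "x \<in> ?K n") (auto simp: differentiable_def)
 have pG: "partial j (G n) = dG n j" for n j
 proof
  fix x show "partial j (G n) x = dG n j x"
  proof (cases "x \<in> U")
   case True
   then show ?thesis using partial_eq[OF Gd_U[OF True]] by (simp add: dG_def partial_def)
  next
   case False
   then have "x \<notin> ?K n" using KU by auto
   then show ?thesis using partial_eq[OF Gd_out[of x n]] False by (simp add: dG_def)
  qed
 qed
 have Gc: "continuous_on UNIV (partial j (G n))" for n j
 proof -
  have "continuous_on U (%x. cutoff' (inverse (real (Suc n))) (g x) * partial j g x)"
   by (intro continuous_intros c continuous_on_compose2[OF cutoff'_continuous cg]) auto
  then have "continuous_on U (dG n j)" by (rule continuous_on_eq) (simp add: dG_def)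
  moreover have "continuous_on (- ?K n) (dG n j)"
   by (rule continuous_on_eq[OF continuous_on_const]) (use G_out in auto)
  \<comment> \<open>Two open sets cover the space: on U the formula holds, off the superlevel set
    the value is 0.\<close>
  ultimately have "continuous_on (U \<union> - ?K n) (dG n j)"
   using U(1) compact_imp_closed[OF Kc[of n]] by (intro continuous_on_open_Un) auto
  moreover have "U \<union> - ?K n = UNIV" using KU by auto
  ultimately show ?thesis by (simp add: pG)
 qed
 have GH: "G n \<in> H0" "wder (single j 1) (G n) (dG n j)" for n j
 proof -
  have KO: "?K n \<subseteq> \<Omega>" using KU U(2) by blast
  show "G n \<in> H0" by (rule C1_H10(1)[OF Gd Gc Kc KO]) (rule G_out(1))
  show "wder (single j 1) (G n) (dG n j)"
  proof -
   have "wder (single j 1) (G n) (partial j (G n))" by (rule C1_H10(2)[OF Gd Gc Kc KO]) (rule G_out(1))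
   then show ?thesis by (simp only: pG)
  qed
 qed
 have mc: "f \<in> bm" if "continuous_on UNIV f" for f :: "real^'n => real"
  by (rule measurable_restrict_space1, rule measurable_completion) (simp add: borel_measurable_continuous_onI[OF that])
 have Gm: "G n \<in> bm" "dG n j \<in> bm" for n j
  using mc Gc[of j n] Gd by (auto simp: pG intro!: mc) (meson continuous_at_imp_continuous_on differentiable_imp_continuous_within)
 have lim0: "(%n. 2 * inverse (real (Suc n))) ----> 0"
  by (rule tendsto_mult_right_zero[OF LIMSEQ_inverse_real_of_nat])
 have close: "\<bar>g x - G n x\<bar> <= 2 * inverse (real (Suc n))" for n x
  unfolding G_def by (rule cutoff_close[OF _ g0]) simp
 have Glim: "(%n. G n x) ----> g x" for x
 proof -
  have "(%n. g x - G n x) ----> 0"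
   by (rule Lim_null_comparison[OF _ lim0]) (use close in auto)
  then show ?thesis using tendsto_diff[OF tendsto_const[of "g x"]] by force
 qed
 define dg where "dg j = (%x. if x \<in> U then partial j g x else 0)" for j
 have dlim: "(%n. dG n j x) ----> dg j x" for j x
 proof (cases "x \<in> U")
  case True
  have "\<forall>\<^sub>F n in sequentially. inverse (real (Suc n)) < g x"
   using order_tendstoD(2)[OF LIMSEQ_inverse_real_of_nat pos[OF True]] .
  then have "\<forall>\<^sub>F n in sequentially. (1 - (inverse (real (Suc n)))\<^sup>2 / (g x)\<^sup>2) * partial j g x = dG n j x"
   by eventually_elim (use True in \<open>simp add: dG_def cutoff'_def\<close>)
  moreover have "(%n. (1 - (inverse (real (Suc n)))\<^sup>2 / (g x)\<^sup>2) * partial j g x) ----> (1 - 0\<^sup>2 / (g x)\<^sup>2) * partial j g x"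
   by (intro tendsto_intros LIMSEQ_inverse_real_of_nat) (use pos[OF True] in auto)
  ultimately show ?thesis using True by (auto simp: dg_def intro: Lim_transform_eventually)
 qed (simp add: dg_def dG_def)
 have gm: "g \<in> bm" "dg j \<in> bm" for j
  by (rule borel_measurable_LIMSEQ_real[OF Glim Gm(1)] borel_measurable_LIMSEQ_real[OF dlim Gm(2)])+
 have dgb: "\<bar>dg j x\<bar> <= \<bar>M\<bar>" "\<bar>dG n j x - dg j x\<bar> <= \<bar>M\<bar>" for n j x
 proof -
  show 1: "\<bar>dg j x\<bar> <= \<bar>M\<bar>" using M[of x j] by (auto simp: dg_def)
  let ?c = "cutoff' (inverse (real (Suc n))) (g x)"
  have c01: "0 <= ?c" "?c <= 1" by (rule cutoff'_bounds, simp)+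
  have "dG n j x - dg j x = - ((1 - ?c) * dg j x)" by (simp add: dG_def dg_def algebra_simps)
  then have "\<bar>dG n j x - dg j x\<bar> = (1 - ?c) * \<bar>dg j x\<bar>" using c01 by (simp add: abs_mult)
  also have "... <= 1 * \<bar>M\<bar>" by (rule mult_mono) (use c01 1 in auto)
  finally show "\<bar>dG n j x - dg j x\<bar> <= \<bar>M\<bar>" by simp
 qed
 have dgL: "dg j \<in> LL" for j by (rule L2_bounded[OF gm(2) _ lmeas]) (use dgb in auto)
 have dGL: "dG n j \<in> LL" for n j by (rule L2_AE_cong[OF D_L2[OF H10_H1[OF GH(1)]] sets_dom wd_eq[OF GH(2)]])
 have gL: "g \<in> LL"
 proof -
  have "(%x. (g x - G 0 x) + G 0 x) \<in> LL"
   by (intro L2_add L2_bounded[OF _ _ lmeas, of "%x. g x - G 0 x" "2 * inverse (real (Suc 0))"] Hs_L2[OF H10_H1[OF GH(1)]] borel_measurable_diff gm Gm)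
    (use close[of _ 0] in auto)
  then show ?thesis by simp
 qed
 have l1: "(%n. nrm2 (%x. g x - G n x)) ----> 0"
 proof (rule tendsto_sandwich[OF _ _ tendsto_const tendsto_mult_left_zero[OF lim0, of "sqrt vD"]])
  show "\<forall>\<^sub>F n in sequentially. nrm2 (%x. g x - G n x) <= 2 * inverse (real (Suc n)) * sqrt vD"
   by (intro always_eventually allI L2_norm_bound borel_measurable_diff gm Gm) (use close in auto)
 qed auto
 \<comment> \<open>The derivatives converge pointwise, but not uniformly near the zero set of g; a
   common bound and finite measure of the domain give convergence in L2.\<close>
 have l2: "(%n. nrm2 (%x. dg j x - dG n j x)) ----> 0" for j
 proof -
  have "(%n. \<integral>x. (dg j x - dG n j x) * (dg j x - dG n j x) \<partial>leb) ----> (\<integral>x. 0 \<partial>leb)"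
  proof (rule integral_dominated_convergence[where w="%x. \<bar>M\<bar> * \<bar>M\<bar>"])
   show "integrable leb (%x. \<bar>M\<bar> * \<bar>M\<bar>)"
    using lmeas by (simp add: finite_measure.integrable_const finite_measure_lebesgue_on)
   show "(%x. (dg j x - dG n j x) * (dg j x - dG n j x)) \<in> bm" for n
    by (intro borel_measurable_times borel_measurable_diff gm Gm)
   show "AE x in leb. (%n. (dg j x - dG n j x) * (dg j x - dG n j x)) ----> 0"
   proof (rule AE_I2)
    fix x
    have "(%n. (dg j x - dG n j x) * (dg j x - dG n j x)) ----> (dg j x - dg j x) * (dg j x - dg j x)"
     by (intro tendsto_intros dlim)
    then show "(%n. (dg j x - dG n j x) * (dg j x - dG n j x)) ----> 0" by simp
   qed
   show "AE x in leb. norm ((dg j x - dG n j x) * (dg j x - dG n j x)) <= \<bar>M\<bar> * \<bar>M\<bar>" for n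
   proof (rule AE_I2)
    fix x
    have "\<bar>dg j x - dG n j x\<bar> <= \<bar>M\<bar>" using dgb(2)[of n j x] by (simp add: abs_minus_commute)
    then have "\<bar>dg j x - dG n j x\<bar> * \<bar>dg j x - dG n j x\<bar> <= \<bar>M\<bar> * \<bar>M\<bar>" by (intro mult_mono) auto
    then show "norm ((dg j x - dG n j x) * (dg j x - dG n j x)) <= \<bar>M\<bar> * \<bar>M\<bar>"
     by (simp only: real_norm_def abs_mult)
   qed
  qed simp
  then have "(%n. sqrt (inn (%x. dg j x - dG n j x) (%x. dg j x - dG n j x))) ----> sqrt 0"
   by (intro tendsto_real_sqrt) (simp add: ip_def)
  then show ?thesis by (simp add: L2_norm_def)
 qed
 have w: "wder (single j 1) g (dg j)" for j
  unfolding weak_deriv_1_iff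
 proof (intro conjI ballI L2_locally_integrable gL dgL)
  fix \<phi> assume \<phi>: "\<phi> \<in> TF"
  have tl: "\<phi> \<in> LL" "partial j \<phi> \<in> LL" using \<phi> test_L2 sets_dom test_partial by blast+
  have "(%n. inn (G n) (partial j \<phi>) + inn (dG n j) \<phi>) ----> inn g (partial j \<phi>) + inn (dg j) \<phi>"
   by (intro tendsto_add ip_tendsto l1 l2 Hs_L2[OF H10_H1[OF GH(1)]] gL tl dGL dgL)
  then have "inn g (partial j \<phi>) + inn (dg j) \<phi> = 0"
   by (rule LIMSEQ_zero_unique) (use GH(2) \<phi> in \<open>simp add: weak_deriv_1_iff\<close>)
  then show "inn g (partial j \<phi>) = - inn (dg j) \<phi>" by simp
 qed
 have gH: "g \<in> HS 1" unfolding H1_iff using gL w dgL by blast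
 show ?thesis
 proof (rule H10_limit[OF gH GH(1) l1])
  fix j
  have "nrm2 (%x. D j g x - D j (G n) x) = nrm2 (%x. dg j x - dG n j x)" for n
  proof (rule L2_norm_AE_cong[OF _ L2_diff[OF D_L2[OF gH] D_L2[OF H10_H1[OF GH(1)]]] sets_dom])
   show "AE x in leb. D j g x - D j (G n) x = dg j x - dG n j x"
    using wd_eq[OF w[of j]] wd_eq[OF GH(2)[of j n]] by eventually_elim simp
  qed
  then show "(%n. nrm2 (%x. D j g x - D j (G n) x)) ----> 0" using l2 by simp
 qed
qed

end

section \<open>Shape functions\<close>

abbreviation "iref \<equiv> interior ref_simplex"

context semi_inner
begin

lemma nrm_zero: "nrm (%x. 0) = 0"
 using B_zero[OF V_zero] by (simp add: nrm_def)

lemma nrm_sum: "(!!i. i \<in> I ==> e i \<in> V) ==> nrm (%x. \<Sum>i\<in>I. a i *\<^sub>R e i x) <= (\<Sum>i\<in>I. \<bar>a i\<bar> * nrm (e i))"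
proof (induction I rule: infinite_finite_induct)
 case (insert i I)
 then show ?case
  using nrm_triangle[OF V_scaleR[of "e i" "a i"] V_sum[of I e a]] nrm_scaleR[of "e i" "a i"] by simp
qed (auto simp: nrm_zero)

text \<open>Taking residuals is linear, so null residuals are inherited by linear
  combinations.\<close>

lemma resid_null_span:
 assumes o: "orthonormal e k" and I: "finite I" "!!i. i \<in> I ==> m i \<in> V" "!!i. i \<in> I ==> nrm (resid e k (m i)) = 0"
 shows "nrm (resid e k (%x. \<Sum>i\<in>I. c i *\<^sub>R m i x)) = 0"
proof -
 have e: "!!j. j < k ==> e j \<in> V" using o by (auto simp: orthonormal_def)
 have "resid e k (%x. \<Sum>i\<in>I. c i *\<^sub>R m i x) = (%x. \<Sum>i\<in>I. c i *\<^sub>R resid e k (m i) x)"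
 proof
  fix x
  have "(\<Sum>j<k. B (%x. \<Sum>i\<in>I. c i *\<^sub>R m i x) (e j) *\<^sub>R e j x) = (\<Sum>j<k. (\<Sum>i\<in>I. c i * B (m i) (e j)) *\<^sub>R e j x)"
   by (intro sum.cong refl) (simp add: B_sum[OF I(2)] e)
  also have "... = (\<Sum>i\<in>I. c i *\<^sub>R (\<Sum>j<k. B (m i) (e j) *\<^sub>R e j x))"
   unfolding scaleR_sum_left scaleR_sum_right by (subst sum.swap) simp
  finally show "resid e k (%x. \<Sum>i\<in>I. c i *\<^sub>R m i x) x = (\<Sum>i\<in>I. c i *\<^sub>R resid e k (m i) x)"
   by (simp add: resid_def scaleR_right_diff_distrib sum_subtractf)
 qed
 moreover have "nrm (%x. \<Sum>i\<in>I. c i *\<^sub>R resid e k (m i) x) <= (\<Sum>i\<in>I. \<bar>c i\<bar> * nrm (resid e k (m i)))"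
  by (rule nrm_sum) (rule resid_in[OF o I(2)])
 moreover have "(\<Sum>i\<in>I. \<bar>c i\<bar> * nrm (resid e k (m i))) = 0" using I(3) by simp
 moreover have "(%x. \<Sum>i\<in>I. c i *\<^sub>R resid e k (m i) x) \<in> V" by (rule V_sum) (rule resid_in[OF o I(2)])
 ultimately show ?thesis using nrm_nonneg by (metis order_antisym)
qed

text \<open>A vector with null residual cannot be normalised and is skipped, which is harmless as
  only null residuals are asked for.\<close>

lemma gram_schmidt:
 assumes "finite I" "!!i. i \<in> I ==> m i \<in> V"
 shows "\<exists>e k. orthonormal e k & (\<forall>i\<in>I. nrm (resid e k (m i)) = 0)"
 using assms
proof (induction I)
 case empty
 then show ?case by (auto simp: orthonormal_def intro!: exI[of _ 0])
next
 case (insert a I)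
 then obtain e k where e: "orthonormal e k" "\<forall>i\<in>I. nrm (resid e k (m i)) = 0" by auto
 let ?r = "resid e k (m a)"
 have ma: "m a \<in> V" using insert by simp
 have r: "?r \<in> V" by (rule resid_in[OF e(1) ma])
 show ?case
 proof (cases "B ?r ?r = 0")
  case True
  then show ?thesis using e by (auto simp: nrm_def intro!: exI[of _ e] exI[of _ k])
 next
  case False
  let ?f = "%x. (1 / nrm ?r) *\<^sub>R ?r x"
  let ?e = "e(k := ?f)"
  have o: "orthonormal ?e (Suc k)" by (rule orthonormal_extend[OF e(1) ma False])
  have f: "?f \<in> V" by (intro V_scaleR r)
  have n: "nrm ?r ~= 0" using False nrm_sq[OF r] by auto
  have eV: "!!i. i \<in> {..<k} ==> e i \<in> V" using e(1) by (auto simp: orthonormal_def)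
  \<comment> \<open>The new vector is orthogonal to the old ones, so only the residual of v
    contributes to its coefficient.\<close>
  have Bf: "B v ?f = B (resid e k v) ?f" if v: "v \<in> V" for v
  proof -
   have "B (e i) ?f = 0" if "i < k" for i
    using o[unfolded orthonormal_def, THEN conjunct2, rule_format, of i k] that by simp
   then show ?thesis
    using B_diff[OF v V_sum[of "{..<k}" e "%i. B v (e i)"] f] B_sum[of "{..<k}" e ?f] eV f
    by (simp add: resid_def[of e k v])
  qed
  have res: "resid ?e (Suc k) v = (%x. resid e k v x - B v ?f *\<^sub>R ?f x)" for v
  proof
   fix x
   have "(\<Sum>i<k. B v (?e i) *\<^sub>R ?e i x) = (\<Sum>i<k. B v (e i) *\<^sub>R e i x)"
    by (intro sum.cong) auto
   then show "resid ?e (Suc k) v x = resid e k v x - B v ?f *\<^sub>R ?f x"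
    by (simp add: resid_def)
  qed
  have "nrm (resid ?e (Suc k) (m i)) = 0" if i: "i \<in> insert a I" for i
  proof (cases "i = a")
   case True
   have "nrm ?r * B (m a) ?f = nrm ?r * nrm ?r"
    using Bf[OF ma] B_sym[OF r f] B_scaleR[OF r r, of "1 / nrm ?r"] n nrm_sq[OF r]
    by (simp add: power2_eq_square field_simps)
   then have "B (m a) ?f = nrm ?r" using n by simp
   then have "resid ?e (Suc k) (m a) = (%x. 0)" unfolding res using n by simp
   then show ?thesis using True nrm_zero by simp
  next
   case False
   then have iI: "i \<in> I" "m i \<in> V" using i insert by auto
   have "B (m i) ?f = 0"
    using Bf[OF iI(2)] B_null[OF resid_in[OF e(1) iI(2)] f] e(2) iI(1) by simp
   then have "resid ?e (Suc k) (m i) = resid e k (m i)" unfolding res by simp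
   then show ?thesis using e(2) iI(1) by simp
  qed
  then show ?thesis using o by blast
 qed
qed

lemma complete_orthonormal_span:
 assumes I: "finite I" "!!i. i \<in> I ==> m i \<in> V" and span: "!!v. v \<in> V ==> \<exists>c. v = (%x. \<Sum>i\<in>I. c i *\<^sub>R m i x)"
 shows "\<exists>e k. complete_orthonormal e k"
proof -
 obtain e k where e: "orthonormal e k" "!!i. i \<in> I ==> nrm (resid e k (m i)) = 0"
  using gram_schmidt[of I m, OF I] by blast
 have "nrm (resid e k v) = 0" if "v \<in> V" for v
  using span[OF that] resid_null_span[of e k I m, OF e(1) I e(2)] by auto
 then show ?thesis using e(1) by (auto simp: complete_orthonormal_def)
qed

text \<open>Finite dimensional norm comparison for a seminorm N vanishing on null vectors. The
  constant is kept as a sum over the basis: N will depend on a point, and the sum then depends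
  continuously on it.\<close>

lemma complete_orthonormal_bound:
 assumes e: "complete_orthonormal e k"
  and N: "!!f g a b. f \<in> V ==> g \<in> V ==> N (%x. a *\<^sub>R f x + b *\<^sub>R g x) <= \<bar>a\<bar> * N f + \<bar>b\<bar> * N g"
  and N0: "!!f. f \<in> V ==> nrm f = 0 ==> N f <= 0" and Np: "!!f. f \<in> V ==> 0 <= N f" and v: "v \<in> V"
 shows "N v <= (\<Sum>i<k. N (e i)) * nrm v"
proof -
 have o: "orthonormal e k" using e by (simp add: complete_orthonormal_def)
 have eV: "!!i. i \<in> {..<k} ==> e i \<in> V" and e1: "!!i. i < k ==> nrm (e i) = 1"
  using o by (auto simp: orthonormal_def nrm_def)
 have Ns: "N (%x. \<Sum>i\<in>I. a i *\<^sub>R e i x) <= (\<Sum>i\<in>I. \<bar>a i\<bar> * N (e i))" if "I \<subseteq> {..<k}" for a and I :: "nat set"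
  using that
 proof (induction I rule: infinite_finite_induct)
  case (insert i I)
  have "N (%x. \<Sum>i\<in>insert i I. a i *\<^sub>R e i x) <= \<bar>a i\<bar> * N (e i) + \<bar>1\<bar> * N (%x. \<Sum>i\<in>I. a i *\<^sub>R e i x)"
   using N[of "e i" "%x. \<Sum>i\<in>I. a i *\<^sub>R e i x" "a i" 1] insert V_sum[of I e a] eV by (auto simp: subset_eq)
  then show ?case using insert by auto
 qed (use N0[OF V_zero nrm_zero] in auto)
 let ?s = "%x. \<Sum>i<k. B v (e i) *\<^sub>R e i x"
 have r: "resid e k v \<in> V" by (rule resid_in[OF o v])
 have s: "?s \<in> V" by (rule V_sum[OF eV])
 have "N v = N (%x. 1 *\<^sub>R resid e k v x + 1 *\<^sub>R ?s x)" by (simp add: resid_def)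
 also have "... <= N (resid e k v) + N ?s" using N[OF r s, of 1 1] by simp
 also have "... <= N ?s" using N0[OF r] e v by (simp add: complete_orthonormal_def)
 also have "... <= (\<Sum>i<k. \<bar>B v (e i)\<bar> * N (e i))" by (rule Ns) simp
 also have "... <= (\<Sum>i<k. nrm v * N (e i))"
  by (intro sum_mono mult_right_mono Np) (use Cauchy_Schwarz[OF v eV] e1 eV in force)+
 also have "... = (\<Sum>i<k. N (e i)) * nrm v" by (simp add: sum_distrib_left mult.commute)
 finally show ?thesis .
qed

end

section \<open>The reference simplex\<close>

lemma sum_Basis_cart: "(\<Sum>i\<in>(Basis :: (real^'n::finite) set). F i) = (\<Sum>i\<in>UNIV. F (axis i (1::real)))"
proof -
 have B: "(Basis :: (real^'n) set) = range (%i. axis i 1)" by (auto simp: Basis_vec_def)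
 have inj: "inj (%i. axis i 1 :: real^'n)" by (auto simp: inj_def axis_eq_axis)
 show ?thesis unfolding B by (subst sum.reindex[OF inj]) (simp add: o_def)
qed

lemma ref_simplex_eq: "(ref_simplex :: (real^'n::finite) set) = {x. (\<forall>i. 0 <= x $ i) & (\<Sum>i\<in>UNIV. x $ i) <= 1}"
 unfolding ref_simplex_def ref_vertices_def std_simplex sum_Basis_cart
 by (auto simp: inner_axis Basis_vec_def)

lemma interior_ref_simplex: "interior (ref_simplex :: (real^'n::finite) set) = {x. (\<forall>i. 0 < x $ i) & (\<Sum>i\<in>UNIV. x $ i) < 1}"
 unfolding ref_simplex_def ref_vertices_def interior_std_simplex sum_Basis_cart
 by (auto simp: inner_axis Basis_vec_def)

lemma interior_ref_nonempty: "interior (ref_simplex :: (real^'n::finite) set) ~= {}"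
 using interior_std_simplex_nonempty[where 'a="real^'n"] by (auto simp: ref_simplex_def ref_vertices_def)

lemma compact_ref_simplex: "compact (ref_simplex :: (real^'n::finite) set)"
 unfolding ref_simplex_def ref_vertices_def by (intro finite_imp_compact_convex_hull) simp

lemma convex_ref_simplex: "convex ref_simplex"
 by (simp add: ref_simplex_def)

lemma lmeasurable_ref: "ref_simplex \<in> lmeasurable"
 by (rule lmeasurable_compact[OF compact_ref_simplex])

section \<open>Polynomials and bubbles on the reference simplex\<close>

definition C1 :: "(real^'n::finite => real) => bool" where
 "C1 f \<longleftrightarrow> (\<forall>x. f differentiable (at x)) & (\<forall>j. continuous_on UNIV (partial j f))"

lemma C1_continuous: "C1 f ==> continuous_on S f"
 unfolding C1_def by (meson continuous_at_imp_continuous_on differentiable_imp_continuous_within)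

lemma C1_partial_continuous: "C1 f ==> continuous_on S (partial j f)"
 unfolding C1_def using continuous_on_subset by blast

lemma C1_differentiable: "C1 f ==> f differentiable (at x)"
 by (simp add: C1_def)

lemma C1_const: "C1 (%x::real^'n::finite. c)"
proof -
 have "partial j (%x. c) = (%x. 0)" for j :: 'n by (simp add: partial_def fun_eq_iff)
 then show ?thesis by (simp add: C1_def)
qed

lemma C1_coord: "C1 (%x::real^'n::finite. x $ i)"
proof -
 have d: "((%x::real^'n. x $ i) has_derivative (%h. h $ i)) (at x)" for x
  by (rule bounded_linear.has_derivative[OF bounded_linear_vec_nth]) (rule has_derivative_ident)
 have "partial j (%x::real^'n. x $ i) = (%x. axis j 1 $ i)" for j
  using partial_eq[OF d] by (simp add: fun_eq_iff)
 then show ?thesis using d by (auto simp: C1_def differentiable_def)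
qed

lemma C1_add: "C1 f ==> C1 g ==> C1 (%x. f x + g x)"
proof -
 assume f: "C1 f" and g: "C1 g"
 have "partial j (%x. f x + g x) = (%x. partial j f x + partial j g x)" for j
  using partial_add[OF C1_differentiable[OF f] C1_differentiable[OF g]] by (simp add: fun_eq_iff)
 then show ?thesis using f g by (auto simp: C1_def intro!: continuous_intros)
qed

lemma C1_mult: "C1 f ==> C1 g ==> C1 (%x. f x * g x)"
proof -
 assume f: "C1 f" and g: "C1 g"
 have "partial j (%x. f x * g x) = (%x. f x * partial j g x + partial j f x * g x)" for j
  using partial_mult[OF C1_differentiable[OF f] C1_differentiable[OF g]] by (simp add: fun_eq_iff)
 then show ?thesis using f g C1_continuous[OF f, of UNIV] C1_continuous[OF g, of UNIV]
  by (auto simp: C1_def intro!: continuous_intros)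
qed

lemma C1_sum: "(!!i. i \<in> I ==> C1 (f i)) ==> C1 (%x. \<Sum>i\<in>I. f i x)"
 by (induction I rule: infinite_finite_induct) (auto intro: C1_const C1_add)

lemma C1_prod: "(!!i. i \<in> I ==> C1 (f i)) ==> C1 (%x. \<Prod>i\<in>I. f i x)"
 by (induction I rule: infinite_finite_induct) (auto intro: C1_const C1_mult)

lemma C1_power: "C1 f ==> C1 (%x. f x ^ k)"
 by (induction k) (auto intro: C1_const C1_mult)

definition ref_bubble :: "real^'n::finite => real" where
 "ref_bubble y = (1 - (\<Sum>i\<in>UNIV. y $ i)) * (\<Prod>i\<in>UNIV. y $ i)"

fun shape_fun :: "('n::finite => nat) option => real^'n => real" where
 "shape_fun None y = ref_bubble y"
| "shape_fun (Some \<alpha>) y = (\<Prod>i\<in>UNIV. (y $ i) ^ \<alpha> i)"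

text \<open>The index \<open>None\<close> stands for the bubble of the mini-element.\<close>

definition shape_index :: "nat => ('n::finite => nat) option set" where
 "shape_index k = insert None (Some ` (\<Union>m\<le>k. multi_indices m))"

text \<open>One space for both kinds of elements: polynomials of degree at most k together with the
  bubble, so that a single inverse inequality serves the mini-element, Hood-Taylor velocities and
  the pressure.\<close>

definition shapes :: "nat => (real^'n::finite => real) set" where
 "shapes k = {%y. \<Sum>i\<in>shape_index k. c i * shape_fun i y | c. True}"

lemma finite_shape_index: "finite (shape_index k)"
 by (simp add: shape_index_def finite_multi_indices)

lemma C1_ref_bubble: "C1 ref_bubble"
proof -
 have "C1 (%y::real^'n. (1 + (\<Sum>i\<in>UNIV. (-1) * y $ i)) * (\<Prod>i\<in>UNIV. y $ i))"
  by (intro C1_mult C1_add C1_const C1_sum C1_prod C1_coord)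
 then show ?thesis by (simp add: ref_bubble_def[abs_def] sum_negf)
qed

lemma C1_shape_fun: "C1 (shape_fun i)"
proof (cases i)
 case None
 then have "shape_fun i = ref_bubble" by (auto simp: fun_eq_iff)
 then show ?thesis by (simp add: C1_ref_bubble)
next
 case (Some \<alpha>)
 then have "shape_fun i = (%y. \<Prod>i\<in>UNIV. (y $ i) ^ \<alpha> i)" by (auto simp: fun_eq_iff)
 then show ?thesis by (simp only:) (intro C1_prod C1_power C1_coord)
qed

lemma C1_shapes: "p \<in> shapes k ==> C1 p"
 unfolding shapes_def by (auto intro!: C1_sum C1_mult C1_const C1_shape_fun)

lemma shapes_lin: assumes "p \<in> shapes k" "q \<in> shapes k" shows "(%y. a * p y + b * q y) \<in> shapes k"
proof -
 obtain c d where "p = (%y. \<Sum>i\<in>shape_index k. c i * shape_fun i y)" "q = (%y. \<Sum>i\<in>shape_index k. d i * shape_fun i y)"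
  using assms by (auto simp: shapes_def)
 then have "(%y. a * p y + b * q y) = (%y. \<Sum>i\<in>shape_index k. (a * c i + b * d i) * shape_fun i y)"
  by (simp add: fun_eq_iff sum_distrib_left sum.distrib algebra_simps)
 then show ?thesis unfolding shapes_def by (intro CollectI exI[of _ "%i. a * c i + b * d i"]) simp
qed

lemma shape_fun_in: "i \<in> shape_index k ==> shape_fun i \<in> shapes k"
 unfolding shapes_def
 by (auto intro!: exI[of _ "%j. if j = i then 1 else 0"] simp: fun_eq_iff finite_shape_index if_distrib[of "%t. t * _"] sum.delta cong: if_cong)

lemma ref_bubble_in: "(ref_bubble :: real^'n::finite => real) \<in> shapes k"
proof -
 have "(shape_fun None :: real^'n => real) \<in> shapes k" by (rule shape_fun_in) (simp add: shape_index_def)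
 moreover have "(shape_fun None :: real^'n => real) = ref_bubble" by (auto simp: fun_eq_iff)
 ultimately show ?thesis by simp
qed

lemma poly_deg_in: assumes "poly_deg m q" "m <= k" shows "q \<in> shapes k"
proof -
 let ?A = "%m. \<Union>j\<le>m. (multi_indices j :: ('a => nat) set)"
 obtain c where c: "!!x. q x = (\<Sum>\<alpha>\<in>?A m. c \<alpha> * (\<Prod>i\<in>UNIV. (x $ i) ^ \<alpha> i))"
  using assms(1) unfolding poly_deg_def by blast
 define d where "d i = (case i of None => 0 | Some \<alpha> => if \<alpha> \<in> ?A m then c \<alpha> else 0)" for i
 have fin: "finite (?A j)" for j by (simp add: finite_multi_indices)
 have sub: "?A m \<subseteq> ?A k" using assms(2) by (auto intro: order_trans)
 have "(\<Sum>i\<in>shape_index k. d i * shape_fun i x) = q x" for x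
 proof -
  have "(\<Sum>i\<in>shape_index k. d i * shape_fun i x) = (\<Sum>i\<in>Some ` ?A k. d i * shape_fun i x)"
   unfolding shape_index_def by (subst sum.insert) (auto simp: fin d_def)
  also have "... = (\<Sum>\<alpha>\<in>?A k. (if \<alpha> \<in> ?A m then c \<alpha> else 0) * (\<Prod>i\<in>UNIV. (x $ i) ^ \<alpha> i))"
   by (subst sum.reindex) (auto simp: d_def)
  also have "... = (\<Sum>\<alpha>\<in>?A m. (if \<alpha> \<in> ?A m then c \<alpha> else 0) * (\<Prod>i\<in>UNIV. (x $ i) ^ \<alpha> i))"
   by (rule sum.mono_neutral_right[OF fin sub]) auto
  also have "... = q x" unfolding c by (intro sum.cong) auto
  finally show ?thesis .
 qed
 then have "q = (%x. \<Sum>i\<in>shape_index k. d i * shape_fun i x)" by (simp add: fun_eq_iff)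
 then show ?thesis unfolding shapes_def by blast
qed

lemma continuous_L2_ref: assumes "continuous_on UNIV (f :: real^'n::finite => real)" shows "f \<in> L2 ref_simplex"
proof -
 obtain M where "!!x. x \<in> ref_simplex ==> \<bar>f x\<bar> <= M"
  using compact_imp_bounded[OF compact_continuous_image[OF continuous_on_subset[OF assms] compact_ref_simplex]] by (auto simp: bounded_iff)
 moreover have "f \<in> borel_measurable (lebesgue_on ref_simplex)"
  by (rule measurable_restrict_space1, rule measurable_completion) (simp add: borel_measurable_continuous_onI[OF assms])
 ultimately show ?thesis by (intro L2_bounded[where K=M] lmeasurable_ref) auto
qed

lemma AE_lebesgue_on:
 "S \<in> sets lebesgue ==> (AE x in lebesgue_on S. P x) \<longleftrightarrow> (AE x in lebesgue. x \<in> S --> P x)"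
 by (simp add: AE_restrict_space_iff)

lemma open_null_empty: "open (S :: 'a::euclidean_space set) ==> S \<in> null_sets lebesgue ==> S = {}"
 using open_not_negligible by (auto simp: negligible_iff_null_sets)

text \<open>The part of the interior where a continuous function differs from zero is open, and an
  open null set is empty.\<close>

lemma continuous_zero_ref:
 assumes f: "continuous_on UNIV (f :: real^'n::finite => real)" and z: "L2_norm ref_simplex f = 0" and y: "y \<in> iref"
 shows "f y = 0"
proof -
 have "AE x in lebesgue_on ref_simplex. f x = 0" by (rule L2_norm_zero_AE[OF continuous_L2_ref[OF f] z])
 then have "AE x in lebesgue. x \<in> ref_simplex --> f x = 0"
  by (simp only: AE_lebesgue_on[OF fmeasurableD[OF lmeasurable_ref]])
 then have "AE x in lebesgue. x \<notin> iref \<inter> f -` (- {0})"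
  by eventually_elim (use interior_subset[of ref_simplex] in auto)
 moreover have o: "open (iref \<inter> f -` (- {0}))"
  by (intro open_Int open_interior open_vimage[OF _ f]) auto
 ultimately have "iref \<inter> f -` (- {0}) \<in> null_sets lebesgue"
  by (subst AE_iff_null_sets) auto
 then have "iref \<inter> f -` (- {0}) = {}" by (rule open_null_empty[OF o])
 then show ?thesis using y by auto
qed

lemma semi_inner_shapes: "semi_inner (shapes k) (ip ref_simplex)"
proof -
 have l: "p \<in> L2 ref_simplex" if "p \<in> shapes k" for p :: "real^'n => real"
  using C1_continuous[OF C1_shapes[OF that]] continuous_L2_ref by blast
 have "(%y. 0) \<in> shapes k" using shapes_lin[OF ref_bubble_in ref_bubble_in, of 0 0 k] by simp
 then show ?thesis
 proof unfold_locales
  fix f g h :: "real^'n => real" and a b :: real assume fg: "f \<in> shapes k" "g \<in> shapes k"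
  show "(%x. a *\<^sub>R f x + b *\<^sub>R g x) \<in> shapes k" using shapes_lin[OF fg, of a b] by simp
  show "ip ref_simplex (%x. a *\<^sub>R f x + b *\<^sub>R g x) h = a * ip ref_simplex f h + b * ip ref_simplex g h" if "h \<in> shapes k"
   by (rule ip_lin[OF l l l, OF fg that])
 qed (simp_all add: ip_nonneg ip_sym[of ref_simplex])
qed

text \<open>Norm comparison at each interior point y, with a constant that is continuous in y and
  hence bounded on the compact simplex. A null vector vanishes in the interior, and so do its
  partial derivatives there.\<close>

lemma shapes_bound:
 "\<exists>C>0. \<forall>p\<in>shapes k. \<forall>y\<in>iref.
   \<bar>p y\<bar> <= C * L2_norm ref_simplex p & (\<forall>j. \<bar>partial j p y\<bar> <= C * L2_norm ref_simplex (p :: real^'n::finite => real))"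
proof -
 interpret S: semi_inner "shapes k :: (real^'n => real) set" "ip ref_simplex" by (rule semi_inner_shapes)
 have "\<exists>c. v = (%x. \<Sum>i\<in>shape_index k. c i *\<^sub>R shape_fun i x)" if "v \<in> shapes k" for v :: "real^'n => real"
  using that by (auto simp: shapes_def)
 then obtain e m where e: "S.complete_orthonormal e m"
  using S.complete_orthonormal_span[of "shape_index k" shape_fun, OF finite_shape_index shape_fun_in] by blast
 then have eV: "!!i. i < m ==> e i \<in> shapes k" by (auto simp: S.complete_orthonormal_def S.orthonormal_def)
 define N where "N y f = \<bar>f y\<bar> + (\<Sum>j\<in>UNIV. \<bar>partial j f y\<bar>)" for y :: "real^'n" and f
 have Nb: "N y p <= (\<Sum>i<m. N y (e i)) * S.nrm p" if p: "p \<in> shapes k" and y: "y \<in> iref"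
  for p and y :: "real^'n"
 proof (rule S.complete_orthonormal_bound[OF e _ _ _ p])
  fix f g :: "real^'n => real" and a b :: real assume fg: "f \<in> shapes k" "g \<in> shapes k"
  note df = C1_differentiable[OF C1_shapes[OF fg(1)]] C1_differentiable[OF C1_shapes[OF fg(2)]]
  have "partial j (%x. a *\<^sub>R f x + b *\<^sub>R g x) y = a * partial j f y + b * partial j g y" for j
   using partial_add[of "%x. a * f x" y "%x. b * g x" j] partial_scale[OF df(1)] partial_scale[OF df(2)] df
   by (simp add: differentiable_mult)
  then have "N y (%x. a *\<^sub>R f x + b *\<^sub>R g x) <= (\<bar>a\<bar> * \<bar>f y\<bar> + \<bar>b\<bar> * \<bar>g y\<bar>) + (\<Sum>j\<in>UNIV. \<bar>a\<bar> * \<bar>partial j f y\<bar> + \<bar>b\<bar> * \<bar>partial j g y\<bar>)"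
   unfolding N_def by (intro add_mono sum_mono) (auto simp: abs_mult[symmetric] intro: order_trans[OF abs_triangle_ineq])
  then show "N y (%x. a *\<^sub>R f x + b *\<^sub>R g x) <= \<bar>a\<bar> * N y f + \<bar>b\<bar> * N y g"
   by (simp add: N_def sum.distrib sum_distrib_left algebra_simps)
 next
  fix f :: "real^'n => real" assume f: "f \<in> shapes k" "S.nrm f = 0"
  have z: "f x = 0" if "x \<in> iref" for x
   using continuous_zero_ref[OF C1_continuous[OF C1_shapes[OF f(1)]] _ that] f(2) by (simp add: L2_norm_def S.nrm_def)
  have "partial j f y = 0" for j
  proof -
   have "partial j f y = partial j (%x. 0) y" by (rule partial_local[OF open_interior y]) (rule z)
   then show ?thesis by (simp add: partial_def)
  qed
  then show "N y f <= 0" using z[OF y] by (simp add: N_def)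
 qed (auto simp: N_def intro!: sum_nonneg add_nonneg_nonneg)
 have "continuous_on ref_simplex (%y :: real^'n. \<Sum>i<m. N y (e i))"
  unfolding N_def using C1_continuous[OF C1_shapes[OF eV]] C1_partial_continuous[OF C1_shapes[OF eV]]
  by (auto intro!: continuous_intros)
 then obtain A where A: "!!y. y \<in> ref_simplex ==> \<bar>\<Sum>i<m. N y (e i)\<bar> <= A"
  using compact_imp_bounded[OF compact_continuous_image[OF _ compact_ref_simplex]] by (fastforce simp: bounded_iff)
 show ?thesis
 proof (intro exI[of _ "\<bar>A\<bar> + 1"] conjI ballI allI)
  fix p :: "real^'n => real" and y :: "real^'n" assume p: "p \<in> shapes k" and y: "y \<in> iref"
  have L: "S.nrm p = L2_norm ref_simplex p" by (simp add: L2_norm_def S.nrm_def)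
  have "N y p <= (\<Sum>i<m. N y (e i)) * L2_norm ref_simplex p" using Nb[OF p y] L by simp
  also have "... <= (\<bar>A\<bar> + 1) * L2_norm ref_simplex p"
   using A[of y] y interior_subset[of ref_simplex] by (intro mult_right_mono) auto
  finally have n: "N y p <= (\<bar>A\<bar> + 1) * L2_norm ref_simplex p" .
  have "\<bar>p y\<bar> <= N y p" by (auto simp: N_def intro!: sum_nonneg)
  then show "\<bar>p y\<bar> <= (\<bar>A\<bar> + 1) * L2_norm ref_simplex p" using n by linarith
  fix j
  have "\<bar>partial j p y\<bar> <= (\<Sum>j\<in>UNIV. \<bar>partial j p y\<bar>)" by (rule member_le_sum) auto
  then have "\<bar>partial j p y\<bar> <= N y p" by (simp add: N_def)
  then show "\<bar>partial j p y\<bar> <= (\<bar>A\<bar> + 1) * L2_norm ref_simplex p" using n by linarith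
 qed auto
qed

text \<open>Some interior value of p is comparable to the norm of p, and the gradient bound of
  \<open>shapes_bound\<close> keeps half of it nearby. The ball must have a radius independent of p
  although that point may be close to the boundary; hence it is shifted towards a fixed interior
  point z.\<close>

lemma shapes_lower:
 "\<exists>\<rho>>0. \<exists>c>0. \<forall>p\<in>shapes k. \<exists>y. ball y \<rho> \<subseteq> iref &
  (\<forall>x\<in>ball y \<rho>. c * L2_norm ref_simplex (p :: real^'n::finite => real) <= \<bar>p x\<bar>)"
proof -
 let ?S = "ref_simplex :: (real^'n) set"
 obtain C where C: "C > 0" "!!p y. p \<in> shapes k ==> y \<in> interior ?S ==> \<bar>p y\<bar> <= C * L2_norm ?S p"
  "!!p y j. p \<in> shapes k ==> y \<in> interior ?S ==> \<bar>partial j p y\<bar> <= C * L2_norm ?S p"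
  using shapes_bound[where 'n='n] by metis
 obtain z where z: "z \<in> interior ?S" using interior_ref_nonempty by blast
 then obtain r where r: "r > 0" "ball z r \<subseteq> interior ?S" using open_interior openE by blast
 have cS: "convex (interior ?S)" by (rule convex_interior[OF convex_ref_simplex])
 define V where "V = measure lebesgue ?S"
 have Vp: "V >= 0" by (simp add: V_def)
 \<comment> \<open>If |p| stayed below a times its norm, the norm would be at most a sqrt V <= 1/2
   times itself.\<close>
 define a where "a = 1 / (2 * (sqrt V + 1))"
 have a: "a > 0" using Vp by (simp add: a_def add_nonneg_pos)
 define n where "n = real CARD('n)"
 have n: "n > 0" by (simp add: n_def)
 \<comment> \<open>The gradient is at most n C times the norm, so over the distance \<delta> the
   value changes by at most half of a times the norm.\<close>
 define \<delta> where "\<delta> = a / (2 * C * n)"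
 have \<delta>: "\<delta> > 0" using a C n by (simp add: \<delta>_def)
 obtain R where R: "!!x. x \<in> ?S ==> norm x <= R"
  using compact_imp_bounded[OF compact_ref_simplex[where 'n='n]] by (auto simp: bounded_iff)
 \<comment> \<open>The centre is moved from y0 by the fraction \<theta> towards z. By convexity the
   ball of radius \<theta> r around it stays inside, and all its points are within \<theta> (2 R +
   r) <= \<delta> of y0.\<close>
 define \<theta> where "\<theta> = min 1 (\<delta> / (2 * R + r + 1))"
 have R0: "R >= 0" using R z interior_subset norm_ge_zero order_trans by blast
 have \<theta>: "0 < \<theta>" "\<theta> <= 1" "\<theta> * (2 * R + r) <= \<delta>"
 proof -
  show "0 < \<theta>" "\<theta> <= 1" using \<delta> R0 r by (auto simp: \<theta>_def)
  have "\<theta> * (2 * R + r) <= (\<delta> / (2 * R + r + 1)) * (2 * R + r)"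
   using R0 r by (intro mult_right_mono) (auto simp: \<theta>_def)
  also have "... <= \<delta>" using \<delta> R0 r by (simp add: field_simps)
  finally show "\<theta> * (2 * R + r) <= \<delta>" .
 qed
 have pos: "0 < \<theta> * r" "0 < a / 2" using \<theta> r a by auto
 have "\<forall>p\<in>shapes k. \<exists>y. ball y (\<theta> * r) \<subseteq> interior ?S & (\<forall>x\<in>ball y (\<theta> * r). a / 2 * L2_norm ?S p <= \<bar>p x\<bar>)"
 proof
  fix p :: "real^'n => real" assume p: "p \<in> shapes k"
  let ?N = "L2_norm ?S p"
  have pc: "continuous_on UNIV p" by (rule C1_continuous[OF C1_shapes[OF p]])
  have "\<exists>y0\<in>interior ?S. a * ?N <= \<bar>p y0\<bar>"
  proof (rule ccontr)
   assume "\<not> ?thesis"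
   then have lt: "\<bar>p y\<bar> < a * ?N" if "y \<in> interior ?S" for y using that by force
   then have N: "?N > 0" using order_le_less_trans[OF abs_ge_zero lt[OF z]] a zero_less_mult_pos by blast
   have cl: "\<bar>p y\<bar> <= a * ?N" if "y \<in> ?S" for y
   proof -
    have "closure (interior ?S) = closure ?S"
     by (rule convex_closure_interior[OF convex_ref_simplex interior_ref_nonempty])
    also have "... = ?S" by (rule closure_closed[OF compact_imp_closed[OF compact_ref_simplex]])
    finally have y: "y \<in> closure (interior ?S)" using that by (simp only:)
    have "closed {y. \<bar>p y\<bar> <= a * ?N}" using pc by (intro closed_Collect_le continuous_intros) auto
    then show ?thesis using closure_minimal[of "interior ?S" "{y. \<bar>p y\<bar> <= a * ?N}"] lt y less_imp_le by blast
   qed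
   have "?N <= (a * ?N) * L2_norm ?S (%x. 1::real)"
   proof (rule L2_norm_mono)
    show "p \<in> borel_measurable (lebesgue_on ?S)" by (rule L2_measurable[OF continuous_L2_ref[OF pc]])
    show "(%x. 1::real) \<in> L2 ?S" by (rule continuous_L2_ref) simp
    show "AE x in lebesgue_on ?S. norm (p x) <= a * ?N * norm (1::real)" using cl by (intro AE_I2) simp
   qed (use a in auto)
   also have "L2_norm ?S (%x. 1::real) = sqrt V"
    using fmeasurableD[OF lmeasurable_ref[where 'a='n]] by (simp add: L2_norm_def ip_def measure_restrict_space V_def)
   finally have "1 <= a * sqrt V" using N by (simp add: field_simps)
   moreover have "a * sqrt V <= 1 / 2" 
   proof -
    have "0 < 2 + sqrt V * 2" using Vp by (simp add: add_pos_nonneg)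
    then show ?thesis by (simp add: a_def field_simps)
   qed
   ultimately show False by simp
  qed
  then obtain y0 where y0: "y0 \<in> interior ?S" "a * ?N <= \<bar>p y0\<bar>" by blast
  let ?y = "(1 - \<theta>) *\<^sub>R y0 + \<theta> *\<^sub>R z"
  have sub: "x \<in> interior ?S & norm (x - y0) <= \<delta>" if x: "x \<in> ball ?y (\<theta> * r)" for x
  proof
   let ?w = "z + (1 / \<theta>) *\<^sub>R (x - ?y)"
   have nx: "norm (x - ?y) < \<theta> * r" using x by (simp add: dist_norm norm_minus_commute)
   then have "norm (x - ?y) / \<theta> < r" by (simp only: pos_divide_less_eq[OF \<theta>(1)] mult.commute)
   moreover have "norm ((1 / \<theta>) *\<^sub>R (x - ?y)) = norm (x - ?y) / \<theta>" unfolding norm_scaleR using \<theta>(1) by simp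
   ultimately have "norm ((1 / \<theta>) *\<^sub>R (x - ?y)) < r" by linarith
   then have "?w \<in> ball z r" by (simp only: mem_ball dist_norm) (simp add: norm_minus_commute)
   then have w: "?w \<in> interior ?S" using r by blast
   have "x = (1 - \<theta>) *\<^sub>R y0 + \<theta> *\<^sub>R ?w" using \<theta>(1) by (simp add: scaleR_right_distrib)
   moreover have "(1 - \<theta>) *\<^sub>R y0 + \<theta> *\<^sub>R ?w \<in> interior ?S"
    using cS y0(1) w \<theta> by (intro convexD_alt) auto
   ultimately show "x \<in> interior ?S" by simp
   have "norm (x - y0) <= norm (x - ?y) + norm (\<theta> *\<^sub>R (z - y0))"
    by (rule order_trans[OF _ norm_triangle_ineq]) (simp add: algebra_simps)
   also have "... <= \<theta> * r + \<theta> * (R + R)"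
   proof (rule add_mono)
    have "norm (z - y0) <= R + R"
     using norm_triangle_ineq4[of z y0] R[of z] R[of y0] z y0(1) interior_subset[of ?S] by fastforce
    then show "norm (\<theta> *\<^sub>R (z - y0)) <= \<theta> * (R + R)" using \<theta> by simp
   qed (use nx in simp)
   also have "... <= \<delta>" using \<theta>(3) by (simp add: algebra_simps)
   finally show "norm (x - y0) <= \<delta>" .
  qed
  show "\<exists>y. ball y (\<theta> * r) \<subseteq> interior ?S & (\<forall>x\<in>ball y (\<theta> * r). a / 2 * ?N <= \<bar>p x\<bar>)"
  proof (intro exI[of _ ?y] conjI ballI)
   show "ball ?y (\<theta> * r) \<subseteq> interior ?S" using sub by blast
   fix x assume x: "x \<in> ball ?y (\<theta> * r)"
   have "norm (p x - p y0) <= (n * (C * ?N)) * norm (x - y0)"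
   proof (rule differentiable_bound[OF cS])
    show "(p has_derivative (%h. \<Sum>j\<in>UNIV. partial j p y * (h $ j))) (at y within interior ?S)" for y
     using has_derivative_partials[OF C1_differentiable[OF C1_shapes[OF p]]] has_derivative_at_withinI by blast
    fix y assume y: "y \<in> interior ?S"
    show "onorm (%h. \<Sum>j\<in>UNIV. partial j p y * (h $ j)) <= n * (C * ?N)"
    proof (rule onorm_bound)
     fix h :: "real^'n"
     have "norm (\<Sum>j\<in>UNIV. partial j p y * (h $ j)) <= (\<Sum>j\<in>(UNIV::'n set). (C * ?N) * norm h)"
      by (rule sum_norm_le) (auto simp: abs_mult intro!: mult_mono C(3)[OF p y] component_le_norm_cart mult_nonneg_nonneg less_imp_le[OF C(1)])
     then show "norm (\<Sum>j\<in>UNIV. partial j p y * (h $ j)) <= n * (C * ?N) * norm h" by (simp add: n_def)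
    qed (use n C in auto)
   qed (use sub[OF x] y0 in auto)
   also have "... <= (n * (C * ?N)) * \<delta>" using sub[OF x] n C by (intro mult_left_mono) auto
   also have "... = a / 2 * ?N" using n C by (simp add: \<delta>_def)
   finally have "\<bar>p x - p y0\<bar> <= (a * ?N) / 2" by simp
   moreover have "\<bar>p y0\<bar> <= \<bar>p x\<bar> + \<bar>p x - p y0\<bar>" by arith
   ultimately have "(a * ?N) / 2 <= \<bar>p x\<bar>" using y0(2) by linarith
   then show "a / 2 * ?N <= \<bar>p x\<bar>" by simp
  qed
 qed
 then show ?thesis using pos by blast
qed

section \<open>Meshes\<close>

lemma ref_simplex_points: "(0::real^'n::finite) \<in> ref_simplex" "axis i (1::real) \<in> (ref_simplex :: (real^'n) set)"
 by (auto simp: ref_simplex_eq axis_def sum.delta)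

lemma regular_element_continuous: "regular_element \<sigma> F ==> continuous_on ref_simplex F"
 unfolding regular_element_def by (metis continuous_on_eq_continuous_within has_derivative_continuous)

lemma compact_element: "regular_element \<sigma> F ==> compact (F ` ref_simplex)"
 by (rule compact_continuous_image[OF regular_element_continuous compact_ref_simplex])

lemma diameter_element_pos:
 fixes F :: "real^'n::finite => real^'n"
 assumes "regular_element \<sigma> F" shows "0 < diameter (F ` ref_simplex)"
proof -
 let ?e = "axis undefined 1 :: real^'n"
 have "inj_on F ref_simplex" using assms by (simp add: regular_element_def)
 moreover have "?e ~= 0" by (simp add: axis_eq_0_iff)
 ultimately have "F ?e ~= F 0" using ref_simplex_points by (metis inj_on_def)
 then have "0 < dist (F ?e) (F 0)" by simp
 also have "... <= diameter (F ` ref_simplex)"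
  using ref_simplex_points by (intro diameter_bounded_bound compact_imp_bounded[OF compact_element[OF assms]]) auto
 finally show ?thesis .
qed

text \<open>Openness of the image and continuity of the inverse come from invariance of domain. The
  lower bound in \<open>regular_element\<close> makes the derivative injective and bounds the
  derivative of the inverse.\<close>

lemma element_inverse:
 fixes F :: "real^'n::finite => real^'n"
 assumes F: "regular_element \<sigma> F" and \<sigma>: "0 < \<sigma>"
 obtains g g' where "open (F ` iref)" "continuous_on (F ` iref) g"
  "!!y. y \<in> iref ==> g (F y) = y"
  "!!x. x \<in> F ` iref ==> (g has_derivative g' x) (at x)"
  "!!x v. x \<in> F ` iref ==> norm (g' x v) <= \<sigma> / diameter (F ` ref_simplex) * norm v"
  "!!v. continuous_on (F ` iref) (%x. g' x v)"
proof -
 let ?R = "iref :: (real^'n) set"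
 let ?d = "diameter (F ` ref_simplex)"
 have d: "?d > 0" by (rule diameter_element_pos[OF F])
 obtain F' where F': "continuous_on ref_simplex (%x. matrix (F' x))"
  "!!x. x \<in> ref_simplex ==> (F has_derivative F' x) (at x within ref_simplex)"
  "!!x v. x \<in> ref_simplex ==> ?d * norm v <= \<sigma> * norm (F' x v)"
  using F unfolding regular_element_def by blast
 have inj: "inj_on F ?R" using F inj_on_subset[OF _ interior_subset] unfolding regular_element_def by auto
 have cont: "continuous_on ?R F" using regular_element_continuous[OF F] interior_subset continuous_on_subset by blast
 obtain g where g: "homeomorphism ?R (F ` ?R) F g"
  by (rule invariance_of_domain_homeomorphism[OF open_interior cont _ inj]) auto
 have oU: "open (F ` ?R)" by (rule invariance_of_domain[OF cont open_interior inj])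
 have gF: "g (F y) = y" if "y \<in> ?R" for y using g that by (simp add: homeomorphism_def)
 have gc: "continuous_on (F ` ?R) g" using g by (simp add: homeomorphism_def)
 have lin: "linear (F' y)" if "y \<in> ?R" for y
  using F'(2) that interior_subset has_derivative_linear by blast
 have inv: "\<exists>B. linear B & (\<forall>v. B (F' y v) = v) & (\<forall>v. F' y (B v) = v)" if y: "y \<in> ?R" for y
 proof (rule linear_injective_isomorphism[OF lin[OF y]])
  show "inj (F' y)"
  proof (rule linear_injective_0[OF lin[OF y], THEN iffD2], intro allI impI)
   fix v assume "F' y v = 0"
   then have "?d * norm v <= 0" using F'(3)[of y v] y interior_subset by auto
   then show "v = 0" using d by (simp add: mult_le_0_iff)
  qed
 qed (rule refl)
 then obtain B where B: "!!y. y \<in> ?R ==> linear (B y)" "!!y v. y \<in> ?R ==> B y (F' y v) = v" "!!y v. y \<in> ?R ==> F' y (B y v) = v"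
  by metis
 have gR: "g x \<in> ?R" "F (g x) = x" if "x \<in> F ` ?R" for x using that gF by auto
 have bd: "norm v <= \<sigma> / ?d * norm (F' y v)" if "y \<in> ?R" for y v
 proof -
  have "?d * norm v <= \<sigma> * norm (F' y v)" using F'(3) that interior_subset by blast
  then show ?thesis using d by (simp add: field_simps)
 qed
 show ?thesis
 proof (rule that[of g "%x. B (g x)"])
  fix x assume x: "x \<in> F ` ?R"
  have gx: "g x \<in> ?R" by (rule gR[OF x])
  have "(F has_derivative F' (g x)) (at (g x) within ?R)"
   using F'(2)[of "g x"] gx interior_subset has_derivative_subset by blast
  then have dF: "(F has_derivative F' (g x)) (at (g x))"
   using gx by (simp add: at_within_open[OF _ open_interior])
  show "(g has_derivative B (g x)) (at x)"
  proof (rule has_derivative_inverse_basic[where f=F and f'="F' (g x)" and T="F ` ?R" and g=g and y=x and g'="B (g x)", OF dF _ _ _ oU x])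
   show "bounded_linear (B (g x))" using B(1)[OF gx] by (rule linear_conv_bounded_linear[THEN iffD1])
   show "B (g x) \<circ> F' (g x) = id" using B(2)[OF gx] by (auto simp: fun_eq_iff)
   show "continuous (at x) g" by (rule bspec[OF iffD1[OF continuous_on_eq_continuous_at[OF oU] gc] x])
  qed (rule gR(2))
  show "norm (B (g x) v) <= \<sigma> / ?d * norm v" for v
   using bd[OF gx, of "B (g x) v"] B(3)[OF gx] by simp
 next
  fix v
  show "continuous_on (F ` ?R) (%x. B (g x) v)"
   unfolding continuous_on_def
  proof
   fix z assume z: "z \<in> F ` ?R"
   let ?b = "B (g z) v"
   have cm: "continuous_on (F ` ?R) (%x. F' (g x) ?b)"
   proof -
    have "continuous_on ?R (%y. matrix (F' y))" using F'(1) interior_subset continuous_on_subset by blast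
    then have "continuous_on (F ` ?R) (%x. matrix (F' (g x)))"
     by (rule continuous_on_compose2[OF _ gc]) (use gR in auto)
    then have "continuous_on (F ` ?R) (%x. matrix (F' (g x)) *v ?b)"
     unfolding matrix_vector_mult_def by (intro continuous_intros)
    then show ?thesis
    proof (rule continuous_on_eq)
     fix x assume "x \<in> F ` ?R"
     then have "linear (F' (g x))" by (intro lin gR(1))
     then show "matrix (F' (g x)) *v ?b = F' (g x) ?b"
      by (intro matrix_works) (simp add: linear_def scalar_mult_eq_scaleR[abs_def])
    qed
   qed
   \<comment> \<open>The difference is the inverse derivative at x applied to v - F'(g x) b with b
     fixed; the uniform bound on inverses and the continuity of F' suffice.\<close>
   have "((%x. B (g x) v - ?b) \<longlongrightarrow> 0) (at z within F ` ?R)"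
   proof (rule Lim_null_comparison)
    have "norm (B (g x) v - ?b) <= \<sigma> / ?d * norm (v - F' (g x) ?b)" if x: "x \<in> F ` ?R" for x
     using bd[OF gR(1)[OF x], of "B (g x) v - ?b"] B(3)[OF gR(1)[OF x]] linear_diff[OF lin[OF gR(1)[OF x]]] by simp
    then show "\<forall>\<^sub>F x in at z within F ` ?R. norm (B (g x) v - ?b) <= \<sigma> / ?d * norm (v - F' (g x) ?b)"
     by (auto simp: eventually_at_filter)
    have "((%x. F' (g x) ?b) \<longlongrightarrow> F' (g z) ?b) (at z within F ` ?R)" by (rule bspec[OF cm[unfolded continuous_on_def] z])
    then have "((%x. \<sigma> / ?d * norm (v - F' (g x) ?b)) \<longlongrightarrow> \<sigma> / ?d * norm (v - F' (g z) ?b)) (at z within F ` ?R)"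
     by (intro tendsto_intros)
    then show "((%x. \<sigma> / ?d * norm (v - F' (g x) ?b)) \<longlongrightarrow> 0) (at z within F ` ?R)"
     using B(3)[OF gR(1)[OF z]] by simp
   qed
   then show "((%x. B (g x) v) \<longlongrightarrow> ?b) (at z within F ` ?R)" by (simp add: Lim_null[symmetric])
  qed
 qed (use oU gc gF in auto)
qed

text \<open>Lift a segment starting at \<open>F y\<close> through F: the lift has speed at most
  \<open>\<sigma> / diameter (F ` ref_simplex)\<close>, so it cannot leave the ball around y too early.\<close>

lemma element_ball:
 fixes F :: "real^'n::finite => real^'n"
 assumes F: "regular_element \<sigma> F" and \<sigma>: "0 < \<sigma>" and b: "ball y \<rho> \<subseteq> iref"
 shows "ball (F y) (\<rho> * diameter (F ` ref_simplex) / \<sigma>) \<subseteq> F ` ball y \<rho>"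
proof
 let ?R = "iref :: (real^'n) set"
 let ?d = "diameter (F ` ref_simplex)"
 have d: "?d > 0" by (rule diameter_element_pos[OF F])
 obtain g g' where g: "open (F ` ?R)" "continuous_on (F ` ?R) g" "!!y. y \<in> ?R ==> g (F y) = y"
  "!!x. x \<in> F ` ?R ==> (g has_derivative g' x) (at x)" "!!x v. x \<in> F ` ?R ==> norm (g' x v) <= \<sigma> / ?d * norm v"
  "!!v. continuous_on (F ` ?R) (%x. g' x v)"
  by (rule element_inverse[OF F \<sigma>]) (rule that)
 have cont: "continuous_on ?R F" using regular_element_continuous[OF F] interior_subset continuous_on_subset by blast
 have inj: "inj_on F ?R" using F inj_on_subset[OF _ interior_subset] unfolding regular_element_def by auto
 let ?W = "F ` ball y \<rho>"
 have oW: "open ?W"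
  by (rule invariance_of_domain[OF continuous_on_subset[OF cont b] open_ball inj_on_subset[OF inj b]])
 fix z assume z: "z \<in> ball (F y) (\<rho> * ?d / \<sigma>)"
 then have zn: "norm (z - F y) < \<rho> * ?d / \<sigma>" by (simp add: dist_norm norm_minus_commute)
 \<comment> \<open>The distance which the lift can cover along the whole segment; it is smaller than
   \<rho>.\<close>
 define \<rho>' where "\<rho>' = \<sigma> / ?d * norm (z - F y)"
 have \<rho>': "\<rho>' < \<rho>" using zn d \<sigma> by (simp add: \<rho>'_def field_simps)
 have "0 <= \<rho>'" using d \<sigma> by (simp add: \<rho>'_def)
 then have yW: "y \<in> ball y \<rho>" using \<rho>' by simp
 let ?s = "%t. F y + t *\<^sub>R (z - F y)"
 show "z \<in> ?W"
 proof (rule ccontr)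
  assume nz: "z \<notin> ?W"
  let ?E = "{t \<in> {0..1}. ?s t \<in> - ?W}"
  have "closed ?E"
  proof -
   have "closed (?s -` (- ?W))" using oW by (intro closed_vimage closed_Compl continuous_intros)
   then have "closed ({0..1} \<inter> ?s -` (- ?W))" by (intro closed_Int closed_atLeastAtMost)
   moreover have "?E = {0..1} \<inter> ?s -` (- ?W)" by auto
   ultimately show ?thesis by (simp only:)
  qed
  have E1: "1 \<in> ?E" using nz by simp
  \<comment> \<open>The first time at which the segment is outside the image of the ball.\<close>
  define t where "t = Inf ?E"
  have tE: "t \<in> ?E" unfolding t_def by (rule closed_contains_Inf[OF _ _ \<open>closed ?E\<close>]) (use E1 in \<open>auto intro!: bdd_belowI[of _ 0]\<close>)
  have below: "?s s \<in> ?W" if "0 <= s" "s < t" for s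
  proof (rule ccontr)
   assume "?s s \<notin> ?W"
   then have "s \<in> ?E" using that tE by auto
   then have "t <= s" unfolding t_def by (intro cInf_lower) (auto intro!: bdd_belowI[of _ 0])
   then show False using that by simp
  qed
  have t0: "t > 0"
  proof -
   have "0 \<notin> ?E" using yW by auto
   then show ?thesis using tE by (cases "t = 0") auto
  qed
  have in_c: "?s s \<in> F ` cball y \<rho>'" if s: "0 <= s" "s < t" for s
  proof -
   have sub: "?s u \<in> F ` ?R" if "u \<in> {0..s}" for u using below[of u] that s b by auto
   have "norm (g (?s s) - g (?s 0)) <= (\<sigma> / ?d * norm (z - F y)) * norm (s - 0)"
   proof (rule differentiable_bound[where S="{0..s}"])
    fix u assume u: "u \<in> {0..s}"
    have "(?s has_derivative (%h. h *\<^sub>R (z - F y))) (at u within {0..s})"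
     by (auto intro!: derivative_eq_intros)
    from has_derivative_compose[OF this g(4)[OF sub[OF u]]]
    show "((%u. g (?s u)) has_derivative (%h. g' (?s u) (h *\<^sub>R (z - F y)))) (at u within {0..s})" .
    show "onorm (%h. g' (?s u) (h *\<^sub>R (z - F y))) <= \<sigma> / ?d * norm (z - F y)"
    proof (rule onorm_bound)
     show "norm (g' (?s u) (h *\<^sub>R (z - F y))) <= \<sigma> / ?d * norm (z - F y) * norm h" for h
      using g(5)[OF sub[OF u], of "h *\<^sub>R (z - F y)"] by (simp add: mult_ac)
    qed (use d \<sigma> in auto)
   qed (use s in auto)
   also have "... <= \<rho>' * 1" unfolding \<rho>'_def using s tE d \<sigma> by (intro mult_left_mono) auto
   finally have "norm (g (?s s) - g (?s 0)) <= \<rho>' * 1" .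
   moreover have "y \<in> ?R" using yW b by blast
   ultimately have "norm (g (?s s) - y) <= \<rho>'" using g(3)[of y] by simp
   then have c: "g (?s s) \<in> cball y \<rho>'" by (simp add: dist_norm norm_minus_commute)
   obtain w where "w \<in> ?R" "?s s = F w" using sub[of s] s by auto
   then have "F (g (?s s)) = ?s s" using g(3) by simp
   then show ?thesis using c by (metis imageI)
  qed
  have cb: "cball y \<rho>' \<subseteq> ball y \<rho>" using \<rho>' by auto
  have "compact (F ` cball y \<rho>')"
   using cb b by (intro compact_continuous_image continuous_on_subset[OF cont]) auto
  then have cl: "closed (F ` cball y \<rho>')" by (rule compact_imp_closed)
  \<comment> \<open>Before t the lift stays in the smaller closed ball, whose image is compact; so
    the point at time t still lies in the image, against the choice of t.\<close>
  have lim: "(%n. ?s (t * (1 - inverse (real (Suc n))))) ----> ?s (t * (1 - 0))"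
   by (intro tendsto_intros LIMSEQ_inverse_real_of_nat)
  have mem: "?s (t * (1 - inverse (real (Suc n)))) \<in> F ` cball y \<rho>'" for n
  proof (rule in_c)
   have "inverse (real (Suc n)) <= 1" "0 < inverse (real (Suc n))" by (auto simp: field_simps)
   then show "0 <= t * (1 - inverse (real (Suc n)))" "t * (1 - inverse (real (Suc n))) < t" using t0
    by (auto simp del: of_nat_Suc simp: mult_less_cancel_left2)
  qed
  have "?s (t * (1 - 0)) \<in> F ` cball y \<rho>'" by (rule closed_sequentially[OF cl mem lim])
  then have "?s t \<in> ?W" using cb by auto
  then show False using tE by auto
 qed
qed

text \<open>Only the interiors of elements are constrained. They cover the domain up to a null set
  and, being open, allow weak derivatives to be computed on each of them.\<close>

definition disc :: "(real^'n::finite => real^'n) set => nat => (real^'n => real) => bool" where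
 "disc T k v \<longleftrightarrow> (\<forall>F\<in>T. \<exists>p\<in>shapes k. \<forall>y\<in>iref. v (F y) = p y)"

locale mesh_domain = bounded_domain \<Omega> for \<Omega> :: "(real^'n::finite) set" +
 fixes \<sigma> h :: real and T :: "(real^'n => real^'n) set"
 assumes sig: "0 < \<sigma>" and mesh: "mesh \<sigma> \<Omega> h T" and regular_dom: "interior (closure \<Omega>) = \<Omega>"
begin

abbreviation "XH \<equiv> Xh \<Omega> T"
abbreviation "VH \<equiv> Vh \<Omega> T"
abbreviation "QH \<equiv> Qh \<Omega> T"


lemma element: "F \<in> T ==> regular_element \<sigma> F"
 using mesh by (simp add: mesh_def)

lemma finite_T: "finite T" and T_ne: "T ~= {}"
 using mesh by (auto simp: mesh_def)

lemma h_le: "F \<in> T ==> h <= \<sigma> * diameter (F ` ref_simplex)"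
 using mesh unfolding mesh_def by blast

lemma h_pos: "0 < h"
proof -
 obtain F where F: "F \<in> T" using T_ne by blast
 have "diameter (F ` ref_simplex) <= h"
 proof -
  have "h = Max ((%F. diameter (F ` ref_simplex)) ` T)" using mesh unfolding mesh_def by blast
  then show ?thesis using F finite_T by (simp only:) (intro Max_ge finite_imageI imageI)
 qed
 then show ?thesis using diameter_element_pos[OF element[OF F]] by linarith
qed

lemma open_element: "F \<in> T ==> open (F ` iref)"
 using element_inverse[OF element sig] by metis

lemma element_subset: assumes "F \<in> T" shows "F ` iref \<subseteq> \<Omega>"
proof -
 have "F ` ref_simplex \<subseteq> closure \<Omega>" using mesh assms by (auto simp: mesh_def)
 then have "F ` iref \<subseteq> closure \<Omega>" using interior_subset by blast
 then have "F ` iref \<subseteq> interior (closure \<Omega>)" by (rule interior_maximal[OF _ open_element[OF assms]])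
 then show ?thesis by (simp add: regular_dom)
qed

text \<open>The boundary of the simplex is negligible, and differentiable maps send negligible sets
  to negligible sets.\<close>

lemma AE_elements: "AE x in leb. \<exists>F\<in>T. \<exists>y\<in>iref. x = F y"
proof -
 let ?B = "ref_simplex - iref :: (real^'n) set"
 have nB: "negligible ?B"
  using negligible_convex_frontier[OF convex_ref_simplex]
  by (simp add: frontier_def closure_closed compact_imp_closed[OF compact_ref_simplex])
 have "negligible (F ` ?B)" if F: "F \<in> T" for F
 proof (rule negligible_differentiable_image_negligible[OF _ nB])
  show "F differentiable_on ?B"
   using element[OF F] unfolding differentiable_on_def regular_element_def differentiable_def
   by (metis Diff_iff Diff_subset has_derivative_subset)
 qed simp
 then have "negligible (\<Union>F\<in>T. F ` ?B)" using finite_T by (intro negligible_Union) auto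
 then have "AE x in lebesgue. x \<notin> (\<Union>F\<in>T. F ` ?B)"
  unfolding negligible_iff_null_sets by (rule AE_not_in)
 then have "AE x in lebesgue. x \<in> \<Omega> --> (\<exists>F\<in>T. \<exists>y\<in>iref. x = F y)"
 proof eventually_elim
  case (elim x)
  have "x \<in> (\<Union>F\<in>T. F ` ref_simplex)" if "x \<in> \<Omega>"
   using mesh closure_subset that by (auto simp: mesh_def)
  then show ?case using elim by blast
 qed
 then show ?thesis by (simp add: AE_lebesgue_on[OF sets_dom])
qed

end

lemma L2_norm_ball:
 fixes v :: "real^'n::finite => real"
 assumes v: "v \<in> L2 S" and S: "S \<in> sets lebesgue" and b: "ball x r \<subseteq> S" "0 <= r" and c: "!!y. y \<in> ball x r ==> c <= \<bar>v y\<bar>" "0 <= c"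
 shows "c * sqrt (r ^ CARD('n) * measure lborel (ball (0::real^'n) 1)) <= L2_norm S v"
proof -
 have bl: "ball x r \<in> lmeasurable" by (rule lmeasurable_ball)
 have "c\<^sup>2 * measure lebesgue (ball x r) = (\<integral>y. indicator (ball x r) y *\<^sub>R c\<^sup>2 \<partial>lebesgue)"
  using bl by simp
 also have "... <= (\<integral>y. indicator S y *\<^sub>R (v y * v y) \<partial>lebesgue)"
 proof (rule integral_mono)
  show "integrable lebesgue (%y. indicator (ball x r) y *\<^sub>R c\<^sup>2)"
   using bl by (auto simp: lmeasurable_iff_integrable)
  show "integrable lebesgue (%y. indicator S y *\<^sub>R (v y * v y))"
   using L2_inner_integrable[OF v v] integrable_lebesgue_on[OF S, of "%y. v y * v y"] by simp
  fix y
  show "indicator (ball x r) y *\<^sub>R c\<^sup>2 <= indicator S y *\<^sub>R (v y * v y)"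
  proof (cases "y \<in> ball x r")
   case True
   have "c\<^sup>2 <= \<bar>v y\<bar>\<^sup>2" using c(1)[OF True] c(2) by (rule power_mono)
   then show ?thesis using True b by (auto simp: power2_eq_square)
  next
   case False
   then have "indicator (ball x r) y *\<^sub>R c\<^sup>2 = 0" by simp
   then show ?thesis by (simp add: indicator_def)
  qed
 qed
 also have "... = ip S v v" by (simp add: ip_def integral_lebesgue_on[OF S])
 finally have "sqrt (c\<^sup>2 * measure lebesgue (ball x r)) <= L2_norm S v"
  unfolding L2_norm_def by (rule real_sqrt_le_mono)
 then show ?thesis
  using c(2) content_ball_conv_unit_ball[OF b(2), of x] by (simp add: real_sqrt_mult)
qed

lemma powr_half_dim: "0 < h ==> h powr (real n / 2) = sqrt (h ^ n)"
 by (simp add: powr_half_sqrt[symmetric] powr_realpow[symmetric] powr_powr)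

text \<open>This yields the inverse inequality. The change of variables is avoided: a shape function is bounded
  below by a multiple of its norm on a ball of fixed radius, whose image contains a ball of radius
  comparable to h.\<close>

lemma disc_inverse:
 assumes \<sigma>: "0 < \<sigma>"
 shows "\<exists>C>0. \<forall>(S :: (real^'n::finite) set) h T. mesh_domain S \<sigma> h T --> (\<forall>v. disc T k v --> v \<in> L2 S -->
  (\<forall>F\<in>T. \<exists>p\<in>shapes k. (\<forall>y\<in>iref. v (F y) = p y) & L2_norm ref_simplex p <= C * h powr (- (real CARD('n) / 2)) * L2_norm S v))"
proof -
 obtain \<rho> c where \<rho>: "\<rho> > 0" "c > 0" "!!p. p \<in> shapes k ==> \<exists>y. ball y \<rho> \<subseteq> iref &
  (\<forall>x\<in>ball y \<rho>. c * L2_norm ref_simplex (p :: real^'n => real) <= \<bar>p x\<bar>)"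
  using shapes_lower[where 'n='n] by metis
 let ?b = "measure lborel (ball (0::real^'n) 1)"
 have b: "?b > 0" by (rule content_ball_pos) simp
 \<comment> \<open>The image of a ball of radius \<rho> contains one of radius \<rho> d / \<sigma>,
   where the diameter d is at least h / \<sigma> by quasi-uniformity.\<close>
 let ?a = "\<rho> / \<sigma>\<^sup>2"
 have a: "?a > 0" using \<rho> \<sigma> by simp
 let ?C = "1 / (c * sqrt (?a ^ CARD('n) * ?b))"
 have C: "?C > 0" using a b \<rho> by simp
 show ?thesis
 proof (intro exI[of _ ?C] conjI allI impI ballI C)
  fix S :: "(real^'n) set" and h T v F
  assume m: "mesh_domain S \<sigma> h T" and v: "disc T k v" "v \<in> L2 S" and F: "F \<in> T"
  interpret mesh_domain S \<sigma> h T by (rule m)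
  obtain p where p: "p \<in> shapes k" "!!y. y \<in> iref ==> v (F y) = p y" using v(1) F unfolding disc_def by blast
  obtain y where y: "ball y \<rho> \<subseteq> iref" "!!x. x \<in> ball y \<rho> ==> c * L2_norm ref_simplex p <= \<bar>p x\<bar>" using \<rho>(3)[OF p(1)] by blast
  let ?r = "\<rho> * diameter (F ` ref_simplex) / \<sigma>"
  have r: "?a * h <= ?r" using h_le[OF F] \<sigma> \<rho>(1) by (simp add: power2_eq_square field_simps)
  have r0: "0 <= ?a * h" by (rule mult_nonneg_nonneg[OF less_imp_le[OF a] less_imp_le[OF h_pos]])
  have eb: "ball (F y) ?r \<subseteq> F ` ball y \<rho>" by (rule element_ball[OF element[OF F] sig y(1)])
  have "(c * L2_norm ref_simplex p) * sqrt ((?a * h) ^ CARD('n) * ?b) <= L2_norm S v"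
  proof (rule L2_norm_ball[OF v(2) sets_dom _ r0, of "F y"])
   have s: "ball (F y) (?a * h) \<subseteq> F ` ball y \<rho>" using eb subset_ball[OF r] by blast
   then show "ball (F y) (?a * h) \<subseteq> S" using y(1) element_subset[OF F] by blast
   fix z assume "z \<in> ball (F y) (?a * h)"
   then obtain w where "w \<in> ball y \<rho>" "z = F w" using s by blast
   then show "c * L2_norm ref_simplex p <= \<bar>v z\<bar>" using p(2)[of w] y by auto
  qed (use \<rho> in simp)
  then have "L2_norm ref_simplex p * (c * sqrt (?a ^ CARD('n) * ?b)) * h powr (real CARD('n) / 2) <= L2_norm S v"
  proof -
   have "sqrt ((?a * h) ^ CARD('n) * ?b) = sqrt (?a ^ CARD('n) * ?b) * h powr (real CARD('n) / 2)"
    unfolding powr_half_dim[OF h_pos] power_mult_distrib real_sqrt_mult by (simp only: mult_ac)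
   then show ?thesis using \<open>_ <= L2_norm S v\<close> by (simp only: mult_ac)
  qed
  then have "L2_norm ref_simplex p <= ?C * h powr (- (real CARD('n) / 2)) * L2_norm S v"
  proof -
   define X P where "X = c * sqrt (?a ^ CARD('n) * ?b)" and "P = h powr (real CARD('n) / 2)"
   have XP: "X > 0" "P > 0" using a b \<rho> h_pos by (simp_all add: X_def P_def)
   have "L2_norm ref_simplex p * X * P <= L2_norm S v"
    using \<open>L2_norm ref_simplex p * _ * _ <= L2_norm S v\<close> by (simp only: X_def P_def)
   then have "L2_norm ref_simplex p <= 1 / X * inverse P * L2_norm S v"
    using XP by (simp add: field_simps)
   then show ?thesis by (simp only: X_def P_def powr_minus)
  qed
  then show "\<exists>p\<in>shapes k. (\<forall>y\<in>iref. v (F y) = p y) & L2_norm ref_simplex p <= ?C * h powr (- (real CARD('n) / 2)) * L2_norm S v"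
   using p by blast
 qed
qed

text \<open>A single element already contains a ball of radius proportional to h. In two dimensions
  this trades a power of h for the power of the volume in \<open>K1\<close>.\<close>

lemma mesh_volume:
 assumes \<sigma>: "0 < \<sigma>"
 shows "\<exists>c>0. \<forall>(S :: (real^'n::finite) set) h T. mesh_domain S \<sigma> h T --> c * h ^ CARD('n) <= vol S"
proof -
 obtain z and r :: real where z: "ball (z::real^'n) r \<subseteq> iref" "r > 0"
  using interior_ref_nonempty open_interior openE by (metis ex_in_conv)
 let ?b = "measure lborel (ball (0::real^'n) 1)"
 have b: "?b > 0" by (rule content_ball_pos) simp
 let ?a = "r / \<sigma>\<^sup>2"
 show ?thesis
 proof (intro exI[of _ "?a ^ CARD('n) * ?b"] conjI allI impI)
  show "0 < ?a ^ CARD('n) * ?b" using b z \<sigma> by simp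
  fix S :: "(real^'n) set" and h T assume m: "mesh_domain S \<sigma> h T"
  interpret mesh_domain S \<sigma> h T by (rule m)
  obtain F where F: "F \<in> T" using T_ne by blast
  let ?r = "r * diameter (F ` ref_simplex) / \<sigma>"
  have r: "?a * h <= ?r" using h_le[OF F] \<sigma> z(2) by (simp add: power2_eq_square field_simps)
  have r0: "0 <= ?a * h" using h_pos z \<sigma> by simp
  have "ball (F z) (?a * h) \<subseteq> F ` ball z r" using element_ball[OF element[OF F] sig z(1)] subset_ball[OF r] by blast
  then have "ball (F z) (?a * h) \<subseteq> S" using z(1) element_subset[OF F] by blast
  then have "measure lebesgue (ball (F z) (?a * h)) <= vol S"
   by (rule measure_mono_fmeasurable[OF _ _ lmeas]) simp
  moreover have "measure lebesgue (ball (F z) (?a * h)) = (?a * h) ^ CARD('n) * ?b"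
   using content_ball_conv_unit_ball[OF r0, of "F z"] by simp
  moreover have "?a ^ CARD('n) * ?b * h ^ CARD('n) = (?a * h) ^ CARD('n) * ?b"
   unfolding power_mult_distrib by (simp only: mult_ac)
  ultimately show "?a ^ CARD('n) * ?b * h ^ CARD('n) <= vol S" by linarith
 qed
qed

section \<open>Weak derivatives of discrete functions\<close>

lemma composite_partial:
 fixes p :: "real^'n::finite => real" and g :: "real^'n => real^'n"
 assumes p: "C1 p" and g: "(g has_derivative g') (at x)"
 shows "(%x. p (g x)) differentiable (at x)" "partial j (%x. p (g x)) x = (\<Sum>i\<in>UNIV. partial i p (g x) * (g' (axis j 1) $ i))"
proof -
 have "((%x. p (g x)) has_derivative (%h. \<Sum>i\<in>UNIV. partial i p (g x) * (g' h $ i))) (at x)"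
  by (rule has_derivative_compose[OF g has_derivative_partials[OF C1_differentiable[OF p]]])
 then show "(%x. p (g x)) differentiable (at x)" "partial j (%x. p (g x)) x = (\<Sum>i\<in>UNIV. partial i p (g x) * (g' (axis j 1) $ i))"
  by (auto simp: differentiable_def partial_eq)
qed

lemma composite_partial_bound:
 fixes q :: "real^'n::finite"
 assumes "!!i. \<bar>a i\<bar> <= A" "norm q <= B" "0 <= A"
 shows "\<bar>\<Sum>i\<in>UNIV. a i * (q $ i)\<bar> <= real CARD('n) * (A * B)"
proof -
 have "\<bar>\<Sum>i\<in>UNIV. a i * (q $ i)\<bar> <= (\<Sum>i\<in>(UNIV::'n set). A * B)"
  using assms component_le_norm_cart[of q] by (intro order_trans[OF sum_abs] sum_mono) (auto simp: abs_mult intro!: mult_mono intro: order_trans)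
 then show ?thesis by simp
qed

context bounded_domain
begin

lemma locally_integrable_subset: "locally_integrable \<Omega> f ==> U \<subseteq> \<Omega> ==> locally_integrable U f"
 unfolding locally_integrable_def by auto

lemma ip_test_subset:
 assumes U: "open U" "U \<subseteq> \<Omega>" and \<phi>: "\<phi> \<in> test_functions U"
 shows "ip U f \<phi> = inn f \<phi>"
proof -
 have "indicator U x *\<^sub>R (f x \<bullet> \<phi> x) = indicator \<Omega> x *\<^sub>R (f x \<bullet> \<phi> x)" for x
  using test_outside[OF \<phi>, of x] U(2) by (cases "x \<in> U") (auto simp: indicator_def)
 moreover have "U \<in> sets lebesgue" using U(1) by simp
 ultimately show ?thesis unfolding ip_def by (simp only: integral_lebesgue_on sets_dom)
qed

text \<open>Test functions on U are test functions on the domain, so G restricts to a weak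
  derivative on U, where uniqueness identifies it with the classical one.\<close>

lemma weak_classical_AE:
 assumes U: "open U" "U \<subseteq> \<Omega>" and w: "wder (single j 1) f G"
  and eq: "!!x. x \<in> U ==> f x = q x"
  and d: "!!x. x \<in> U ==> q differentiable (at x)" and M: "!!x. x \<in> U ==> \<bar>partial j q x\<bar> <= M"
 shows "AE x in lebesgue_on U. G x = partial j q x"
proof (cases "U = {}")
 case False
 interpret U: bounded_domain U
  using U False bounded_subset[OF bounded_dom] by unfold_locales auto
 have "weak_deriv U (single j 1) q (partial j q)" by (rule U.weak_deriv_classical(1)[OF d M])
 moreover have "weak_deriv U (single j 1) q G"
  unfolding U.weak_deriv_1_iff
 proof (intro conjI ballI)
  show "locally_integrable U G" using w U(2) locally_integrable_subset by (auto simp: weak_deriv_def)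
  have "weak_deriv U (single j 1) q (partial j q)" by fact
  then show "locally_integrable U q" by (simp add: weak_deriv_def)
  fix \<phi> assume \<phi>: "\<phi> \<in> test_functions U"
  then have \<phi>': "\<phi> \<in> TF" using test_mono[OF U(2)] by blast
  have "ip U q (partial j \<phi>) = ip U f (partial j \<phi>)"
   unfolding ip_def by (rule Bochner_Integration.integral_cong) (auto simp: eq)
  also have "... = inn f (partial j \<phi>)" by (rule ip_test_subset[OF U test_partial[OF \<phi>]])
  also have "... = - inn G \<phi>" using w \<phi>' by (simp add: weak_deriv_1_iff)
  finally show "ip U q (partial j \<phi>) = - ip U G \<phi>" by (simp add: ip_test_subset[OF U \<phi>])
 qed
 ultimately show ?thesis using U.weak_deriv_unique by blast
qed (simp add: AE_lebesgue_on)

end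

lemma ref_bubble_pos: "y \<in> iref ==> 0 < ref_bubble y"
 by (auto simp: interior_ref_simplex ref_bubble_def intro!: mult_pos_pos prod_pos)

lemma ref_bubble_zero: assumes "y \<in> ref_simplex" "y \<notin> iref" shows "ref_bubble y = 0"
proof -
 have "(\<exists>i. y $ i = 0) \<or> (\<Sum>i\<in>UNIV. y $ i) = 1"
 proof -
  have "\<not> ((\<forall>i. 0 < y $ i) & (\<Sum>i\<in>UNIV. y $ i) < 1)" using assms(2) unfolding interior_ref_simplex by simp
  moreover have "(\<forall>i. 0 <= y $ i) & (\<Sum>i\<in>UNIV. y $ i) <= 1" using assms(1) unfolding ref_simplex_eq by simp
  ultimately show ?thesis by (auto simp: less_le)
 qed
 then show ?thesis by (auto simp: ref_bubble_def)
qed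

context mesh_domain
begin

text \<open>A qualitative bound with mesh-dependent constant: \<open>K\<close> controls the values,
  and the chain rule through the inverse element map costs a factor \<sigma>^2 / h for the
  derivatives.\<close>

lemma disc_bounds:
 "\<exists>M>0. \<forall>v. disc T k v --> v \<in> LL --> (\<forall>F\<in>T. \<forall>y\<in>iref. \<bar>v (F y)\<bar> <= M * nrm2 v) &
  (v \<in> HS 1 --> (\<forall>j. AE x in leb. \<bar>D j v x\<bar> <= M * nrm2 v))"
proof -
 obtain C1 where C1: "C1 > 0" "!!p y. p \<in> shapes k ==> y \<in> iref ==> \<bar>p y\<bar> <= C1 * L2_norm ref_simplex (p :: real^'n => real)"
  "!!p y j. p \<in> shapes k ==> y \<in> iref ==> \<bar>partial j p y\<bar> <= C1 * L2_norm ref_simplex (p :: real^'n => real)"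
  using shapes_bound[where 'n='n] by metis
 obtain C2 where C2: "C2 > 0" "!!v F. disc T k v ==> v \<in> LL ==> F \<in> T ==>
   \<exists>p\<in>shapes k. (\<forall>y\<in>iref. v (F y) = p y) & L2_norm ref_simplex p <= C2 * h powr (- (real CARD('n) / 2)) * nrm2 v"
  using disc_inverse[OF sig, where 'n='n and k=k] mesh_domain_axioms by metis
 define K where "K = C1 * (C2 * h powr (- (real CARD('n) / 2)))"
 have K: "K > 0" using C1 C2 h_pos by (simp add: K_def)
 let ?B = "\<sigma>\<^sup>2 / h"
 have B: "?B > 0" using sig h_pos by simp
 define M where "M = K + real CARD('n) * (K * ?B)"
 have M: "M > 0" "K <= M" "real CARD('n) * (K * ?B) <= M" 
 proof -
  have "0 <= real CARD('n) * (K * ?B)" by (intro mult_nonneg_nonneg less_imp_le[OF K] less_imp_le[OF B]) simp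
  then show "M > 0" "K <= M" "real CARD('n) * (K * ?B) <= M" unfolding M_def using K by linarith+
 qed
 show ?thesis
 proof (intro exI[of _ M] conjI allI impI ballI M(1))
  fix v F and y :: "real^'n" assume v: "disc T k v" "v \<in> LL" and F: "F \<in> T" and y: "y \<in> iref"
  obtain p where p: "p \<in> shapes k" "!!y. y \<in> iref ==> v (F y) = p y"
   "L2_norm ref_simplex p <= C2 * h powr (- (real CARD('n) / 2)) * nrm2 v" using C2(2)[OF v F] by blast
  have "\<bar>v (F y)\<bar> <= C1 * L2_norm ref_simplex p" using C1(2)[OF p(1) y] p(2)[OF y] by simp
  also have "... <= K * nrm2 v" using mult_left_mono[OF p(3) less_imp_le[OF C1(1)]] by (simp add: K_def mult_ac)
  also have "... <= M * nrm2 v" using M by (intro mult_right_mono) auto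
  finally show "\<bar>v (F y)\<bar> <= M * nrm2 v" .
 next
  fix v j assume v: "disc T k v" "v \<in> LL" and H: "v \<in> HS 1"
  have "AE x in lebesgue. x \<in> F ` iref --> \<bar>D j v x\<bar> <= M * nrm2 v" if F: "F \<in> T" for F
  proof -
   obtain p where p: "p \<in> shapes k" "!!y. y \<in> iref ==> v (F y) = p y"
    "L2_norm ref_simplex p <= C2 * h powr (- (real CARD('n) / 2)) * nrm2 v" using C2(2)[OF v F] by blast
   let ?U = "F ` iref"
   obtain g g' where g: "open ?U" "continuous_on ?U g" "!!y. y \<in> iref ==> g (F y) = y"
    "!!x. x \<in> ?U ==> (g has_derivative g' x) (at x)" "!!x v. x \<in> ?U ==> norm (g' x v) <= \<sigma> / diameter (F ` ref_simplex) * norm v"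
    "!!v. continuous_on ?U (%x. g' x v)"
    by (rule element_inverse[OF element[OF F] sig]) (rule that)
   let ?q = "%x. p (g x)"
   have pb: "\<bar>partial i p y\<bar> <= K * nrm2 v" if "y \<in> iref" for i y
    using C1(3)[OF p(1) that, of i] mult_left_mono[OF p(3) less_imp_le[OF C1(1)]] by (simp add: K_def mult_ac)
   have dB: "\<sigma> / diameter (F ` ref_simplex) <= ?B"
    using h_le[OF F] h_pos sig diameter_element_pos[OF element[OF F]] by (simp add: field_simps power2_eq_square)
   have qb: "\<bar>partial j ?q x\<bar> <= M * nrm2 v" if x: "x \<in> ?U" for x
   proof -
    have "norm (g' x (axis j 1)) <= ?B" using g(5)[OF x, of "axis j 1"] dB by (simp add: norm_axis_1)
    moreover have "g x \<in> iref" using x g(3) by auto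
    ultimately have "\<bar>partial j ?q x\<bar> <= real CARD('n) * ((K * nrm2 v) * ?B)"
     unfolding composite_partial(2)[OF C1_shapes[OF p(1)] g(4)[OF x]] using K
     by (intro composite_partial_bound pb) auto
    also have "... = (real CARD('n) * (K * ?B)) * nrm2 v" by (simp add: mult_ac)
    also have "... <= M * nrm2 v" using M by (intro mult_right_mono) auto
    finally show ?thesis .
   qed
   have "AE x in lebesgue_on ?U. D j v x = partial j ?q x"
   proof (rule weak_classical_AE[OF g(1) element_subset[OF F] _ _ _ qb])
    show "wder (single j 1) v (D j v)" by (rule HsD(1)[OF H single_in]) simp
    show "v x = ?q x" if "x \<in> ?U" for x using that g(3) p(2) by auto
    show "?q differentiable (at x)" if "x \<in> ?U" for x by (rule composite_partial(1)[OF C1_shapes[OF p(1)] g(4)[OF that]])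
   qed
   then have "AE x in lebesgue. x \<in> ?U --> D j v x = partial j ?q x" using g(1) by (simp add: AE_lebesgue_on)
   then show ?thesis by eventually_elim (use qb in auto)
  qed
  then have "AE x in lebesgue. \<forall>F\<in>T. x \<in> F ` iref --> \<bar>D j v x\<bar> <= M * nrm2 v"
   by (rule AE_finite_allI[OF finite_T])
  then have "AE x in leb. \<forall>F\<in>T. x \<in> F ` iref --> \<bar>D j v x\<bar> <= M * nrm2 v"
   unfolding AE_lebesgue_on[OF sets_dom] by eventually_elim blast
  with AE_elements show "AE x in leb. \<bar>D j v x\<bar> <= M * nrm2 v"
   by eventually_elim blast
 qed
qed

section \<open>Element bubbles and discrete velocities\<close>

lemma bubble_eq: assumes "F \<in> T" "y \<in> ref_simplex" shows "bubble F (F y) = ref_bubble y"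
proof -
 have "inv_into ref_simplex F (F y) = y"
  using element[OF assms(1)] assms(2) by (auto simp: regular_element_def intro: inv_into_f_f)
 then show ?thesis using assms(2) by (simp add: bubble_def ref_bubble_def)
qed

text \<open>The inverse element map serves as a chart for \<open>bubble_H10\<close>; superlevel sets
  are images of compact subsets of the simplex.\<close>

lemma bubble_H10_dom: assumes F: "F \<in> T" shows "bubble F \<in> H0"
proof -
 let ?U = "F ` iref"
 obtain g g' where g: "open ?U" "continuous_on ?U g" "!!y. y \<in> iref ==> g (F y) = y"
  "!!x. x \<in> ?U ==> (g has_derivative g' x) (at x)" "!!x v. x \<in> ?U ==> norm (g' x v) <= \<sigma> / diameter (F ` ref_simplex) * norm v"
  "!!v. continuous_on ?U (%x. g' x v)"
  by (rule element_inverse[OF element[OF F] sig]) (rule that)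
 let ?q = "%x. ref_bubble (g x)"
 have gR: "g x \<in> iref" if "x \<in> ?U" for x using that g(3) by auto
 have bq: "bubble F x = ?q x" if x: "x \<in> ?U" for x
 proof -
  obtain y where y: "y \<in> iref" "x = F y" using x by blast
  then have "y \<in> ref_simplex" using interior_subset by blast
  then show ?thesis using bubble_eq[OF F] y g(3) by simp
 qed
 have dq: "?q differentiable (at x)" if "x \<in> ?U" for x
  by (rule composite_partial(1)[OF C1_ref_bubble g(4)[OF that]])
 have pq: "partial j ?q x = (\<Sum>i\<in>UNIV. partial i ref_bubble (g x) * (g' x (axis j 1) $ i))" if "x \<in> ?U" for j x
  by (rule composite_partial(2)[OF C1_ref_bubble g(4)[OF that]])
 have pb: "partial j (bubble F) x = partial j ?q x" if "x \<in> ?U" for j x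
  by (rule partial_local[OF g(1) that bq])
 have "\<exists>A. \<forall>y\<in>ref_simplex. \<bar>partial i (ref_bubble :: real^'n => real) y\<bar> <= A" for i
  using compact_imp_bounded[OF compact_continuous_image[OF C1_partial_continuous[OF C1_ref_bubble] compact_ref_simplex], of i]
  by (auto simp: bounded_iff)
 then obtain A where A: "!!i y. y \<in> ref_simplex ==> \<bar>partial i (ref_bubble :: real^'n => real) y\<bar> <= A i" by metis
 define A' where "A' = Max (range (%i. \<bar>A i\<bar>))"
 have A': "\<bar>A i\<bar> <= A'" for i unfolding A'_def by (intro Max_ge) auto
 show ?thesis
 proof (rule bubble_H10[OF g(1) element_subset[OF F]])
  fix x assume x: "x \<in> ?U"
  obtain E where E: "(?q has_derivative E) (at x)" using dq[OF x] by (auto simp: differentiable_def)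
  have "(bubble F has_derivative E) (at x)"
   by (rule has_derivative_transform_within_open[OF E g(1) x]) (simp add: bq)
  then show "bubble F differentiable (at x)" by (auto simp: differentiable_def)
  show "0 < bubble F x" using bq[OF x] ref_bubble_pos[OF gR[OF x]] by simp
  fix j
  have "\<bar>partial j ?q x\<bar> <= real CARD('n) * (A' * (\<sigma> / diameter (F ` ref_simplex)))"
   unfolding pq[OF x]
  proof (rule composite_partial_bound)
   show "\<bar>partial i ref_bubble (g x)\<bar> <= A'" for i
    using A[of "g x" i] A'[of i] gR[OF x] interior_subset[of ref_simplex] by (meson abs_ge_self order_trans subsetD)
   show "norm (g' x (axis j 1)) <= \<sigma> / diameter (F ` ref_simplex)" using g(5)[OF x, of "axis j 1"] by (simp add: norm_axis_1)
   show "0 <= A'" using A'[of undefined] abs_ge_zero order_trans by blast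
  qed
  then show "\<bar>partial j (bubble F) x\<bar> <= real CARD('n) * (A' * (\<sigma> / diameter (F ` ref_simplex)))" by (simp add: pb[OF x])
 next
  fix j
  have "continuous_on ?U (%x. \<Sum>i\<in>UNIV. partial i ref_bubble (g x) * (g' x (axis j 1) $ i))"
   by (intro continuous_intros continuous_on_compose2[OF C1_partial_continuous[OF C1_ref_bubble] g(2) subset_UNIV] g(6))
  then show "continuous_on ?U (partial j (bubble F))"
   by (rule continuous_on_eq) (simp add: pb pq)
 next
  fix x assume x: "x \<notin> ?U"
  show "bubble F x = 0"
  proof (cases "x \<in> F ` ref_simplex")
   case True
   then obtain y where y: "y \<in> ref_simplex" "x = F y" by blast
   then have "y \<notin> iref" using x by blast
   then show ?thesis using y bubble_eq[OF F] ref_bubble_zero by simp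
  qed (simp add: bubble_def)
 next
  fix e :: real assume e: "0 < e"
  have "{x. e <= bubble F x} = F ` {y \<in> ref_simplex. e <= ref_bubble y}"
  proof
   show "{x. e <= bubble F x} \<subseteq> F ` {y \<in> ref_simplex. e <= ref_bubble y}"
   proof
    fix x assume "x \<in> {x. e <= bubble F x}"
    then have x: "e <= bubble F x" by simp
    then have "x \<in> F ` ref_simplex" using e by (auto simp: bubble_def split: if_splits)
    then obtain y where "y \<in> ref_simplex" "x = F y" by blast
    then show "x \<in> F ` {y \<in> ref_simplex. e <= ref_bubble y}" using x bubble_eq[OF F] by auto
   qed
  qed (use bubble_eq[OF F] in auto)
  moreover have "compact {y \<in> ref_simplex. e <= ref_bubble (y::real^'n)}"
  proof -
   have "closed {y::real^'n. e <= ref_bubble y}" by (intro closed_Collect_le continuous_intros C1_continuous[OF C1_ref_bubble])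
   then have "compact (ref_simplex \<inter> {y::real^'n. e <= ref_bubble y})" by (rule compact_Int_closed[OF compact_ref_simplex])
   then show ?thesis by (simp add: Int_def)
  qed
  ultimately show "compact {x. e <= bubble F x}"
   by (simp only:) (rule compact_continuous_image[OF continuous_on_subset[OF regular_element_continuous[OF element[OF F]]]], auto)
 qed
qed

text \<open>By conformity two elements meet in the image of a proper face. Such a face omits a
  vertex, so a barycentric coordinate vanishes on it, whereas all are positive at interior
  points.\<close>

lemma bubble_other: assumes FG: "F \<in> T" "G \<in> T" "F ~= G" and y: "y \<in> iref" shows "bubble G (F y) = 0"
proof -
 have "F y \<notin> G ` ref_simplex"
 proof
  assume "F y \<in> G ` ref_simplex"
  moreover have yr: "y \<in> ref_simplex" using y interior_subset by blast
  moreover obtain A where A: "A \<subset> (ref_vertices :: (real^'n) set)" "F ` ref_simplex \<inter> G ` ref_simplex = F ` (convex hull A)"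
  proof -
   have "conforming F G" using mesh FG unfolding mesh_def by blast
   then show ?thesis using that unfolding conforming_def by blast
  qed
  ultimately have "F y \<in> F ` (convex hull A)" by blast
  moreover have "convex hull A \<subseteq> ref_simplex" unfolding ref_simplex_def using A(1) by (intro hull_mono) auto
  moreover have "inj_on F ref_simplex" using element[OF FG(1)] by (simp add: regular_element_def)
  ultimately have ya: "y \<in> convex hull A" using yr by (auto dest: inj_onD)
  obtain v :: "real^'n" where v: "v \<in> ref_vertices" "v \<notin> A" using A(1) by blast
  have pos: "0 < y $ i" "(\<Sum>i\<in>UNIV. y $ i) < 1" for i using y by (auto simp: interior_ref_simplex)
  \<comment> \<open>Omitting the vertex 0 forces the coordinates to sum to 1; omitting the i-th unit
    vector forces coordinate i to vanish.\<close>
  show False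
  proof (cases "v = 0")
   case True
   have "A \<subseteq> {x. (\<Sum>i\<in>UNIV. x $ i) = 1}"
    using A(1) v True by (auto simp: ref_vertices_def Basis_vec_def axis_def)
   moreover have "convex {x::real^'n. (\<Sum>i\<in>UNIV. x $ i) = 1}"
    by (auto simp: convex_def sum.distrib sum_distrib_left[symmetric])
   ultimately have "convex hull A \<subseteq> {x. (\<Sum>i\<in>UNIV. x $ i) = 1}" by (rule hull_minimal)
   then show False using ya pos(2) by auto
  next
   case False
   then obtain i where i: "v = axis i 1" using v(1) by (auto simp: ref_vertices_def Basis_vec_def)
   have "A \<subseteq> {x. x $ i = 0}"
   proof
    fix x assume x: "x \<in> A"
    then have "x ~= axis i 1" "x \<in> ref_vertices" using v i A(1) by auto
    then have "x = 0 \<or> (\<exists>k. x = axis k 1)" by (auto simp: ref_vertices_def Basis_vec_def)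
    then show "x \<in> {x. x $ i = 0}"
    proof
     assume "\<exists>k. x = axis k 1"
     then obtain k where k: "x = axis k 1" by blast
     then have "k ~= i" using \<open>x ~= axis i 1\<close> by blast
     then show ?thesis using k by (simp add: axis_def)
    qed simp
   qed
   moreover have "convex {x::real^'n. x $ i = 0}" by (auto simp: convex_def)
   ultimately have "convex hull A \<subseteq> {x. x $ i = 0}" by (rule hull_minimal)
   then show False using ya pos(1)[of i] by auto
  qed
 qed
 then show ?thesis by (simp add: bubble_def)
qed

lemma Sh_disc: assumes v: "v \<in> Sh \<Omega> T r" and k: "r - 1 <= k" shows "disc T k v"
 unfolding disc_def
proof
 fix F assume "F \<in> T"
 then obtain q where q: "poly_deg (r - 1) q" "\<forall>x\<in>ref_simplex. v (F x) = q x" using v by (auto simp: Sh_def)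
 then show "\<exists>p\<in>shapes k. \<forall>y\<in>iref. v (F y) = p y"
  using poly_deg_in[OF q(1) k] interior_subset by blast
qed

lemma Sh_lin: assumes v: "v \<in> Sh \<Omega> T r" "w \<in> Sh \<Omega> T r" shows "(%x. a * v x + b * w x) \<in> Sh \<Omega> T r"
 unfolding Sh_def
proof (intro CollectI conjI ballI)
 show "continuous_on (closure \<Omega>) (%x. a * v x + b * w x)" using v by (auto simp: Sh_def intro!: continuous_intros)
 fix F assume "F \<in> T"
 then obtain p q where "poly_deg (r - 1) p" "\<forall>x\<in>ref_simplex. v (F x) = p x" "poly_deg (r - 1) q" "\<forall>x\<in>ref_simplex. w (F x) = q x"
  using v unfolding Sh_def by blast
 moreover have "poly_deg (r - 1) (%x. a * p x + b * q x)"
 proof -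
  obtain c d where "\<forall>x. p x = (\<Sum>\<alpha>\<in>(\<Union>m\<le>r - 1. multi_indices m). c \<alpha> * (\<Prod>i\<in>UNIV. (x $ i) ^ \<alpha> i))"
   "\<forall>x. q x = (\<Sum>\<alpha>\<in>(\<Union>m\<le>r - 1. multi_indices m). d \<alpha> * (\<Prod>i\<in>UNIV. (x $ i) ^ \<alpha> i))"
   using calculation unfolding poly_deg_def by blast
  then show ?thesis unfolding poly_deg_def
   by (intro exI[of _ "%\<alpha>. a * c \<alpha> + b * d \<alpha>"]) (simp add: sum_distrib_left sum.distrib algebra_simps)
 qed
 ultimately show "\<exists>q. poly_deg (r - 1) q & (\<forall>x\<in>ref_simplex. a * v (F x) + b * w (F x) = q x)"
  by (intro exI[of _ "%x. a * p x + b * q x"]) auto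
qed

lemma Sh0_vec_lin: "v \<in> Sh0_vec \<Omega> T r ==> w \<in> Sh0_vec \<Omega> T r ==> (%x. a *\<^sub>R v x + b *\<^sub>R w x) \<in> Sh0_vec \<Omega> T r"
 using Sh_lin H10_lin by (auto simp: Sh0_vec_def)

lemma Xh_lin: assumes "v \<in> XH r" "w \<in> XH r" shows "(%x. a *\<^sub>R v x + b *\<^sub>R w x) \<in> XH r"
proof (cases "r = 2")
 case True
 obtain v0 c w0 d where v: "v0 \<in> Sh0_vec \<Omega> T 2" "v = (%x. v0 x + (\<Sum>F\<in>T. bubble F x *\<^sub>R c F))"
  and w: "w0 \<in> Sh0_vec \<Omega> T 2" "w = (%x. w0 x + (\<Sum>F\<in>T. bubble F x *\<^sub>R d F))"
  using assms True by (auto simp: Xh_def)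
 have "(%x. a *\<^sub>R v x + b *\<^sub>R w x) = (%x. (a *\<^sub>R v0 x + b *\<^sub>R w0 x) + (\<Sum>F\<in>T. bubble F x *\<^sub>R (a *\<^sub>R c F + b *\<^sub>R d F)))"
  by (simp add: v w fun_eq_iff scaleR_add_right scaleR_sum_right sum.distrib algebra_simps)
 then show ?thesis using Sh0_vec_lin[OF v(1) w(1), of a b] True unfolding Xh_def by auto
qed (use assms Sh0_vec_lin in \<open>auto simp: Xh_def\<close>)

lemma H10_sum: "finite I ==> I ~= {} ==> (!!i. i \<in> I ==> f i \<in> H0) ==> (%x. \<Sum>i\<in>I. a i * f i x) \<in> H0"
proof (induction I rule: finite_ne_induct)
 case (singleton i)
 then show ?case using H10_lin[of "f i" "f i" "a i" 0] by simp
next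
 case (insert i I)
 then show ?case using H10_lin[of "f i" "%x. \<Sum>i\<in>I. a i * f i x" "a i" 1] by simp
qed

lemma Xh_H10: assumes "v \<in> XH r" shows "v \<in> H0v"
proof (cases "r = 2")
 case True
 obtain v0 c where v: "v0 \<in> Sh0_vec \<Omega> T 2" "v = (%x. v0 x + (\<Sum>F\<in>T. bubble F x *\<^sub>R c F))"
  using assms True by (auto simp: Xh_def)
 have "(%x. v x $ i) \<in> H0" for i
 proof -
  have "(%x. \<Sum>F\<in>T. c F $ i * bubble F x) \<in> H0"
   by (rule H10_sum[OF finite_T T_ne bubble_H10_dom])
  then show ?thesis
   using H10_lin[of "%x. v0 x $ i" "%x. \<Sum>F\<in>T. c F $ i * bubble F x" 1 1] v
   by (simp add: Sh0_vec_def mult.commute)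
 qed
 then show ?thesis by (simp add: H10_vec_def)
qed (use assms in \<open>auto simp: Xh_def Sh0_vec_def H10_vec_def\<close>)

text \<open>Bubbles of other elements vanish in the interior of F, so only one multiple of
  \<open>ref_bubble\<close> is added there.\<close>

lemma Xh_disc: assumes "v \<in> XH r" shows "disc T r (%x. v x $ i)"
proof (cases "r = 2")
 case True
 obtain v0 c where v: "v0 \<in> Sh0_vec \<Omega> T 2" "v = (%x. v0 x + (\<Sum>F\<in>T. bubble F x *\<^sub>R c F))"
  using assms True by (auto simp: Xh_def)
 have d0: "disc T r (%x. v0 x $ i)" using v(1) True by (intro Sh_disc[of _ 2]) (auto simp: Sh0_vec_def)
 show ?thesis
  unfolding disc_def
 proof
  fix F assume F: "F \<in> T"
  obtain p where p: "p \<in> shapes r" "!!y. y \<in> iref ==> v0 (F y) $ i = p y"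
   using d0 F unfolding disc_def by blast
  have "v (F y) $ i = 1 * p y + c F $ i * ref_bubble y" if y: "y \<in> iref" for y
  proof -
   have "(\<Sum>G\<in>T. bubble G (F y) * c G $ i) = (\<Sum>G\<in>T. if G = F then bubble F (F y) * c F $ i else 0)"
    by (intro sum.cong) (use bubble_other[OF F _ _ y] in auto)
   also have "... = ref_bubble y * c F $ i" using F finite_T bubble_eq[OF F] y interior_subset by (auto simp: sum.delta)
   finally show ?thesis using v(2) p(2)[OF y] by (simp add: mult.commute)
  qed
  then show "\<exists>p\<in>shapes r. \<forall>y\<in>iref. v (F y) $ i = p y"
   by (intro bexI[OF _ shapes_lin[OF p(1) ref_bubble_in, of 1 "c F $ i"]] ballI)
 qed
next
 case False
 then show ?thesis using assms by (intro Sh_disc[of _ r]) (auto simp: Xh_def Sh0_vec_def)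
qed

end

section \<open>Vector fields\<close>

text \<open>Needed to place the interiors of the elements, whose union is only known to cover the closure,
  inside the domain.\<close>

lemma regular_open_domain:
 fixes S :: "(real^'n::finite) set"
 assumes "lipschitz_domain S"
 shows "interior (closure S) = S"
proof
 have op: "open S" using assms by (simp add: lipschitz_domain_def)
 then show "S \<subseteq> interior (closure S)" by (simp add: closure_subset interior_maximal)
 show "interior (closure S) \<subseteq> S"
 proof
  fix x assume x: "x \<in> interior (closure S)"
  show "x \<in> S"
  proof (rule ccontr)
   assume nx: "x \<notin> S"
   have "x \<in> frontier S" using x nx op interior_subset[of "closure S"] by (auto simp: frontier_def interior_open)
   then obtain g K where g: "local_graph S x g" "K-lipschitz_on UNIV g" using assms unfolding lipschitz_domain_def by blast
   then obtain \<rho> e where r: "\<rho> > 0" "norm e = 1" "S \<inter> ball x \<rho> = {y \<in> ball x \<rho>. g (y - (y \<bullet> e) *\<^sub>R e) < y \<bullet> e}"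
    unfolding local_graph_def by blast
   have gc: "continuous_on UNIV g" by (rule lipschitz_on_continuous_on[OF g(2)])
   have ee: "e \<bullet> e = 1" using r(2) by (simp add: dot_square_norm)
   obtain d where d: "d > 0" "ball x d \<subseteq> closure S" using x by (auto simp: mem_interior)
   define t where "t = min \<rho> d / 2"
   have t: "0 < t" "t < \<rho>" "t < d" using r d by (auto simp: t_def min_def)
   let ?y = "x - t *\<^sub>R e"
   have "dist x ?y = t" using t r(2) by (simp add: dist_norm)
   then have yb: "?y \<in> ball x \<rho>" "?y \<in> closure S" using t d(2) by (auto simp: subset_eq)
   let ?W = "ball x \<rho> \<inter> {y. y \<bullet> e < g (y - (y \<bullet> e) *\<^sub>R e)}"
   have "open ?W"
    by (intro open_Int open_ball open_Collect_less continuous_intros continuous_on_compose2[OF gc _ subset_UNIV])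
   moreover have "?y \<in> ?W"
   proof -
    have a: "x \<bullet> e <= g (x - (x \<bullet> e) *\<^sub>R e)" using r(1,3) nx by (force simp: not_less[symmetric])
    have b: "?y - (?y \<bullet> e) *\<^sub>R e = x - (x \<bullet> e) *\<^sub>R e" by (simp add: inner_diff_left ee scaleR_diff_left)
    have "?y \<bullet> e < x \<bullet> e" using t by (simp add: inner_diff_left ee)
    then have "?y \<bullet> e < g (?y - (?y \<bullet> e) *\<^sub>R e)" unfolding b using a by linarith
    then show ?thesis using yb by simp
   qed
   moreover have "?W \<inter> S = {}" using r(3) by force
   ultimately show False using yb(2) open_Int_closure_eq_empty[of ?W S] by blast
  qed
 qed
qed

lemma regular_open_scale:
 fixes S :: "(real^'n::finite) set"
 assumes "interior (closure S) = S" "\<rho> > 0"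
 shows "interior (closure ((%x. \<rho> *\<^sub>R x) ` S)) = (%x. \<rho> *\<^sub>R x) ` S"
proof -
 have "bij (%x::real^'n. \<rho> *\<^sub>R x)"
  by (rule o_bij[of "%x. inverse \<rho> *\<^sub>R x"]) (use assms(2) in \<open>auto simp: fun_eq_iff\<close>)
 moreover have "linear (%x::real^'n. \<rho> *\<^sub>R x)" by (rule linear_scaleR)
 ultimately have "interior ((%x. \<rho> *\<^sub>R x) ` closure S) = (%x. \<rho> *\<^sub>R x) ` interior (closure S)"
  by (intro interior_bijective_linear_image)
 then show ?thesis using assms(1) closure_scaleR[of \<rho> S] by simp
qed

section \<open>Norms of vector fields and trilinear estimates\<close>

lemma norm_matrix_vector: "norm ((A :: real^'n::finite^'m::finite) *v u) <= norm A * norm u"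
proof -
 have "(norm (A *v u))\<^sup>2 = (\<Sum>i\<in>UNIV. (A $ i \<bullet> u)\<^sup>2)"
  by (simp add: norm_vec_def L2_set_def sum_nonneg matrix_vector_mul_component)
 also have "... <= (\<Sum>i\<in>UNIV. (norm (A $ i))\<^sup>2 * (norm u)\<^sup>2)"
 proof (rule sum_mono)
  fix i
  have "\<bar>A $ i \<bullet> u\<bar>\<^sup>2 <= (norm (A $ i) * norm u)\<^sup>2" by (intro power_mono Cauchy_Schwarz_ineq2) auto
  then show "(A $ i \<bullet> u)\<^sup>2 <= (norm (A $ i))\<^sup>2 * (norm u)\<^sup>2" by (simp add: power_mult_distrib)
 qed
 also have "... = (norm A * norm u)\<^sup>2"
  by (simp add: power_mult_distrib sum_distrib_right[symmetric] norm_vec_def[of A] L2_set_def sum_nonneg)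
 finally show ?thesis by (rule power2_le_imp_le) simp
qed

lemma norm_trace: "\<bar>trace (A :: real^'n::finite^'n)\<bar> <= real CARD('n) * norm A"
proof -
 have "\<bar>trace A\<bar> <= (\<Sum>i\<in>UNIV. \<bar>A $ i $ i\<bar>)" unfolding trace_def by (rule sum_abs)
 also have "... <= (\<Sum>i\<in>(UNIV::'n set). norm A)"
  by (intro sum_mono) (metis Finite_Cartesian_Product.norm_nth_le order_trans real_norm_def)
 finally show ?thesis by simp
qed

lemma norm_le_l1: "norm (x :: ('b::real_normed_vector)^'n::finite) <= (\<Sum>i\<in>UNIV. norm (x $ i))"
 unfolding norm_vec_def by (rule L2_set_le_sum) simp

lemma ip_vec:
 fixes f g :: "real^'n::finite => ('b::euclidean_space)^'m::finite"
 assumes "f \<in> L2 S" "g \<in> L2 S"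
 shows "ip S f g = (\<Sum>i\<in>UNIV. ip S (%x. f x $ i) (%x. g x $ i))"
 unfolding ip_def inner_vec_def
 by (rule Bochner_Integration.integral_sum) (intro L2_inner_integrable L2_component assms)

lemma L2_norm_norm: "L2_norm S (%x. norm (f x)) = L2_norm S f"
 by (simp add: L2_norm_def ip_def power2_norm_eq_inner[symmetric] power2_eq_square)

lemma L2_norm_fun: "f \<in> L2 S ==> (%x. norm (f x)) \<in> L2 S"
 unfolding L2_def by (auto intro: borel_measurable_norm)

text \<open>Hoelder's inequality with exponents 2, 2 and infinity. The integrand is only required to
  be dominated by the product, which covers matrix-vector products and scalar multiples at
  once.\<close>

lemma trilinear_bound:
 fixes a :: "real^'n::finite => 'b::euclidean_space" and b :: "real^'n => 'c::euclidean_space" and c :: "real^'n => 'd::real_normed_vector"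
 assumes f: "f \<in> borel_measurable (lebesgue_on S)" and a: "a \<in> L2 S" and b: "b \<in> L2 S" and c: "AE x in lebesgue_on S. norm (c x) <= K" "0 <= K"
  and le: "!!x. \<bar>f x\<bar> <= norm (a x) * norm (b x) * norm (c x)"
 shows "integrable (lebesgue_on S) f" "\<bar>\<integral>x. f x \<partial>lebesgue_on S\<bar> <= K * (L2_norm S a * L2_norm S b)"
proof -
 let ?g = "%x. K * (norm (a x) * norm (b x))"
 have g: "integrable (lebesgue_on S) ?g"
  using L2_inner_integrable[OF L2_norm_fun[OF a] L2_norm_fun[OF b]] by simp
 have fg: "AE x in lebesgue_on S. \<bar>f x\<bar> <= ?g x"
  using c(1)
 proof eventually_elim
  case (elim x)
  show ?case using le[of x] mult_left_mono[OF elim, of "norm (a x) * norm (b x)"] by (simp add: mult.commute)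
 qed
 show fi: "integrable (lebesgue_on S) f"
  by (rule Bochner_Integration.integrable_bound[OF g f]) (use fg c(2) in \<open>auto elim!: eventually_mono\<close>)
 have "\<bar>\<integral>x. f x \<partial>lebesgue_on S\<bar> <= (\<integral>x. \<bar>f x\<bar> \<partial>lebesgue_on S)" by (rule integral_abs_bound)
 also have "... <= (\<integral>x. ?g x \<partial>lebesgue_on S)" by (rule integral_mono_AE) (use fi g fg in auto)
 also have "... = K * ip S (%x. norm (a x)) (%x. norm (b x))" by (simp add: ip_def)
 also have "... <= K * (L2_norm S a * L2_norm S b)"
  using ip_CS[OF L2_norm_fun[OF a] L2_norm_fun[OF b]] c(2) by (intro mult_left_mono) (auto simp: L2_norm_norm)
 finally show "\<bar>\<integral>x. f x \<partial>lebesgue_on S\<bar> <= K * (L2_norm S a * L2_norm S b)" .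
qed

lemma matrix_vector_inner_le: "\<bar>(A *v a) \<bullet> w\<bar> <= norm (A :: real^'n::finite^'m::finite) * norm a * norm w"
 using Cauchy_Schwarz_ineq2[of "A *v a" w] mult_right_mono[OF norm_matrix_vector[of A a], of "norm w"] by simp

lemma scaleR_inner_le: "\<bar>(g *\<^sub>R a) \<bullet> w\<bar> <= norm g * norm (a :: 'a::real_inner) * norm w"
 using Cauchy_Schwarz_ineq2[of "g *\<^sub>R a" w] by simp

lemma matrix_vector_measurable:
 fixes A :: "'x => real^'n::finite^'m::finite"
 assumes "A \<in> borel_measurable M" "u \<in> borel_measurable M"
 shows "(%x. A x *v u x) \<in> borel_measurable M"
proof -
 have "continuous_on UNIV (%z :: (real^'n^'m) \<times> (real^'n). fst z *v snd z)"
  unfolding matrix_vector_mult_def by (intro continuous_intros)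
 then show ?thesis using borel_measurable_continuous_Pair[OF assms, of "%A u. A *v u"] by simp
qed

context bounded_domain
begin

lemma Hs_vec_comp: "v \<in> Hv s ==> (%x. v x $ i) \<in> HS s"
 by (simp add: Hs_vec_def)

lemma Hs_vec_mono: "v \<in> Hv s ==> k <= s ==> v \<in> Hv k"
 using Hs_mono by (auto simp: Hs_vec_def)

lemma Hs_vec_L2: "v \<in> Hv s ==> v \<in> LL"
 by (rule L2_componentwise) (rule Hs_L2[OF Hs_vec_comp])

lemma H10_vec_comp: "v \<in> H0v ==> (%x. v x $ i) \<in> H0"
 by (simp add: H10_vec_def)

lemma H10_vec_H1: "v \<in> H0v ==> v \<in> Hv 1"
 using H10_H1 by (auto simp: H10_vec_def Hs_vec_def)

lemma H10_vec_L2: "v \<in> H0v ==> v \<in> LL"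
 by (rule Hs_vec_L2[OF H10_vec_H1])

lemma grad_L2: "v \<in> Hv 1 ==> Gr v \<in> LL"
 by (intro L2_componentwise) (simp add: grad_def D_L2[OF Hs_vec_comp])

lemma dvg_eq: "Dv v x = (\<Sum>i\<in>UNIV. Dc i i v x)"
 by (simp add: dvg_def trace_def grad_def)

lemma dvg_L2: "v \<in> Hv 1 ==> Dv v \<in> LL"
 unfolding dvg_eq[abs_def] by (intro L2_sum D_L2 Hs_vec_comp)

lemma grad_lin:
 assumes "v \<in> Hv 1" "w \<in> Hv 1"
 shows "AE x in leb. Gr (%x. a *\<^sub>R v x + b *\<^sub>R w x) x = a *\<^sub>R Gr v x + b *\<^sub>R Gr w x"
proof -
 have "AE x in leb. \<forall>i\<in>UNIV. \<forall>j\<in>UNIV. D j (%x. a * v x $ i + b * w x $ i) x = a * Dc j i v x + b * Dc j i w x"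
  by (intro AE_finite_allI D_lin Hs_vec_comp assms) auto
 then show ?thesis by eventually_elim (simp add: grad_def vec_eq_iff)
qed

lemma dvg_lin:
 assumes "v \<in> Hv 1" "w \<in> Hv 1"
 shows "AE x in leb. Dv (%x. a *\<^sub>R v x + b *\<^sub>R w x) x = a * Dv v x + b * Dv w x"
 using grad_lin[OF assms, of a b]
 by eventually_elim (simp add: dvg_def trace_def sum.distrib sum_distrib_left)

lemma grad_diff: "v \<in> Hv 1 ==> w \<in> Hv 1 ==> AE x in leb. Gr (%x. v x - w x) x = Gr v x - Gr w x"
 using grad_lin[of v w 1 "-1"] by simp

lemma dvg_diff: "v \<in> Hv 1 ==> w \<in> Hv 1 ==> AE x in leb. Dv (%x. v x - w x) x = Dv v x - Dv w x"
 using dvg_lin[of v w 1 "-1"] by simp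

lemma ip_grad: "v \<in> Hv 1 ==> w \<in> Hv 1 ==>
  inn (Gr v) (Gr w) = (\<Sum>i\<in>UNIV. \<Sum>j\<in>UNIV. inn (Dc j i v) (Dc j i w))"
proof -
 assume v: "v \<in> Hv 1" and w: "w \<in> Hv 1"
 have "inn (%x. Gr v x $ i) (%x. Gr w x $ i) = (\<Sum>j\<in>UNIV. inn (Dc j i v) (Dc j i w))" for i
  using ip_vec[OF L2_component[OF grad_L2[OF v], of i] L2_component[OF grad_L2[OF w], of i]] by (simp add: grad_def)
 then show ?thesis using ip_vec[OF grad_L2[OF v] grad_L2[OF w]] by simp
qed

lemma grad_norm_le: "v \<in> Hv 1 ==> nrm2 (Gr v) <= Hvn 1 v"
proof -
 assume v: "v \<in> Hv 1"
 have "(\<Sum>j\<in>UNIV. inn (Dc j i v) (Dc j i v)) <= (Hsn 1 (%x. v x $ i))\<^sup>2" for i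
  using H1_norm_sq[OF Hs_L2[OF Hs_vec_comp[OF v, of i]]] by (simp add: L2_norm_sq[symmetric])
 then have "inn (Gr v) (Gr v) <= (\<Sum>i\<in>UNIV. (Hsn 1 (%x. v x $ i))\<^sup>2)"
  unfolding ip_grad[OF v v] by (rule sum_mono)
 then show ?thesis unfolding L2_norm_def Hs_vec_norm_def by (rule real_sqrt_le_mono)
qed

lemma Hs_vec_norm_0: "v \<in> LL ==> Hvn 0 v = nrm2 v"
 using ip_vec[of v \<Omega> v] by (simp add: Hs_vec_norm_def L2_norm_def Hs_norm_0 L2_component ip_nonneg)

lemma dvg_norm_le: "v \<in> Hv 1 ==> nrm2 (Dv v) <= real CARD('n) * nrm2 (Gr v)"
 by (rule L2_norm_mono[OF L2_measurable[OF dvg_L2] grad_L2]) (auto simp: dvg_def intro!: norm_trace)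

lemma poincare_vec: "\<exists>C>0. \<forall>v\<in>H0v. nrm2 v <= C * nrm2 (Gr v)"
proof -
 obtain R where R: "!!x. x \<in> \<Omega> ==> norm x <= R" "R > 0"
  using bounded_dom by (auto simp: bounded_pos)
 show ?thesis
 proof (intro exI[of _ "real CARD('n) * (2 * R)"] conjI ballI)
  fix v assume v: "v \<in> H0v"
  have vl: "v \<in> LL" "Gr v \<in> LL" using v H10_vec_L2 grad_L2 H10_vec_H1 by blast+
  have "nrm2 v = nrm2 (%x. \<Sum>i\<in>UNIV. axis i (v x $ i))"
   by (rule arg_cong[where f="nrm2"]) (auto simp: fun_eq_iff vec_eq_iff axis_def if_distrib[of "%f. f $ _"] sum.delta cong: if_cong)
  also have "... <= (\<Sum>i\<in>UNIV. nrm2 (%x. axis i (v x $ i)))"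
  proof (rule L2_norm_sum)
   fix i
   have "(%x. v x $ i) \<in> bm" by (rule L2_measurable[OF L2_component[OF vl(1)]])
   moreover have "(%y. axis i y :: real^'n) \<in> borel_measurable borel"
    by (intro borel_measurable_continuous_onI linear_continuous_on) (auto simp: linear_linear intro!: linearI simp: axis_def vec_eq_iff)
   ultimately show "(%x. axis i (v x $ i)) \<in> LL"
    by (intro L2_bound[where K=1, OF _ vl(1)]) (auto simp: norm_axis_eq Finite_Cartesian_Product.norm_nth_le[of "v _" i, simplified] component_le_norm_cart intro: measurable_compose)
  qed
  also have "... <= (\<Sum>i\<in>(UNIV::'n set). 2 * R * nrm2 (Gr v))"
  proof (rule sum_mono)
   fix i
   have "nrm2 (%x. axis i (v x $ i) :: real^'n) = nrm2 (%x. v x $ i)"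
    by (subst (1 2) L2_norm_norm[symmetric]) (simp add: norm_axis_eq)
   also have "... <= 2 * R * nrm2 (Dc i i v)" by (rule poincare[OF R(1) H10_vec_comp[OF v]])
   also have "nrm2 (Dc i i v) <= 1 * nrm2 (Gr v)"
   proof (rule L2_norm_mono[OF L2_measurable[OF D_L2[OF Hs_vec_comp[OF H10_vec_H1[OF v]]]] vl(2)])
    have "norm (Gr v x $ i $ i) <= norm (Gr v x)" for x
     by (meson Finite_Cartesian_Product.norm_nth_le order_trans)
    then show "AE x in leb. norm (Dc i i v x) <= 1 * norm (Gr v x)" by (simp add: grad_def)
   qed simp
   finally show "nrm2 (%x. axis i (v x $ i) :: real^'n) <= 2 * R * nrm2 (Gr v)" using R(2) by simp
  qed
  finally show "nrm2 v <= real CARD('n) * (2 * R) * nrm2 (Gr v)" by simp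
 qed (use R in simp)
qed

lemma dvg_mean_zero: "v \<in> H0v ==> inn (%x. c) (Dv v) = 0"
proof -
 assume v: "v \<in> H0v"
 have "inn (Dv v) (%x. c) = (\<Sum>i\<in>UNIV. inn (Dc i i v) (%x. c))"
  unfolding dvg_eq[abs_def] ip_def inner_sum_left
  by (rule Bochner_Integration.integral_sum) (intro L2_inner_integrable const_L2 D_L2 Hs_vec_comp H10_vec_H1 v)
 also have "... = 0" using D_integral_zero[OF H10_vec_comp[OF v]] by simp
 finally show ?thesis by (simp add: ip_sym)
qed

lemma laplacian_ibp:
 assumes u: "u \<in> Hv 2" and \<phi>: "\<phi> \<in> H0v"
 shows "laplacian \<Omega> u \<in> LL" "inn (laplacian \<Omega> u) \<phi> = - inn (Gr u) (Gr \<phi>)"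
proof -
 let ?D2 = "%i j. wd \<Omega> (single j 2) (%y. u y $ i)"
 have u1: "u \<in> Hv 1" by (rule Hs_vec_mono[OF u]) simp
 have l2: "?D2 i j \<in> LL" for i j by (rule HsD(2)[OF Hs_vec_comp[OF u] single_in]) simp
 show l: "laplacian \<Omega> u \<in> LL" by (rule L2_componentwise) (simp add: laplacian_def L2_sum l2)
 \<comment> \<open>\<open>laplacian\<close> uses second weak derivatives of u; testing with
   \<open>partial j \<psi>\<close> shows that they are weak derivatives of the first ones.\<close>
 have w: "wder (single j 1) (Dc j i u) (?D2 i j)" for i j
  unfolding weak_deriv_1_iff
 proof (intro conjI ballI)
  show "locally_integrable \<Omega> (Dc j i u)" "locally_integrable \<Omega> (?D2 i j)"
   by (rule L2_locally_integrable[OF D_L2[OF Hs_vec_comp[OF u1]]], rule L2_locally_integrable[OF l2])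
  fix \<psi> assume \<psi>: "\<psi> \<in> TF"
  have "wder (single j 2) (%y. u y $ i) (?D2 i j)" by (rule HsD(1)[OF Hs_vec_comp[OF u] single_in]) simp
  moreover have "\<forall>k. count_list [j, j] k = single j 2 k" by (simp add: single_def)
  ultimately have "inn (%y. u y $ i) (partials [j, j] \<psi>) = (- 1) ^ (\<Sum>k\<in>UNIV. single j 2 k) * inn (?D2 i j) \<psi>"
   using \<psi> unfolding weak_deriv_def by blast
  then have "inn (%y. u y $ i) (partial j (partial j \<psi>)) = inn (?D2 i j) \<psi>" by (simp add: sum_single)
  moreover have "wder (single j 1) (%y. u y $ i) (Dc j i u)" by (rule HsD(1)[OF Hs_vec_comp[OF u1] single_in]) simp
  ultimately show "inn (Dc j i u) (partial j \<psi>) = - inn (?D2 i j) \<psi>"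
   using test_partial[OF \<psi>, of j] by (simp add: weak_deriv_1_iff)
 qed
 have \<phi>l: "(%x. \<phi> x $ i) \<in> LL" for i by (rule L2_component[OF H10_vec_L2[OF \<phi>]])
 have "inn (laplacian \<Omega> u) \<phi> = (\<Sum>i\<in>UNIV. \<Sum>j\<in>UNIV. inn (?D2 i j) (%x. \<phi> x $ i))"
  unfolding ip_vec[OF l H10_vec_L2[OF \<phi>]]
 proof (intro sum.cong refl)
  fix i
  show "inn (%x. laplacian \<Omega> u x $ i) (%x. \<phi> x $ i) = (\<Sum>j\<in>UNIV. inn (?D2 i j) (%x. \<phi> x $ i))"
   unfolding laplacian_def ip_def vec_lambda_beta inner_sum_left
   by (rule Bochner_Integration.integral_sum) (intro L2_inner_integrable l2 \<phi>l)
 qed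
 also have "... = (\<Sum>i\<in>UNIV. \<Sum>j\<in>UNIV. - inn (Dc j i u) (D j (%x. \<phi> x $ i)))"
  by (intro sum.cong refl weak_deriv_ibp[OF D_L2[OF Hs_vec_comp[OF u1]] l2 w H10_vec_comp[OF \<phi>]])
 also have "... = - inn (Gr u) (Gr \<phi>)"
  by (simp add: ip_grad[OF u1 H10_vec_H1[OF \<phi>]] sum_negf)
 finally show "inn (laplacian \<Omega> u) \<phi> = - inn (Gr u) (Gr \<phi>)" .
qed

lemma sgrad_ibp:
 assumes p: "p \<in> HS 1" and \<phi>: "\<phi> \<in> H0v"
 shows "sgrad \<Omega> p \<in> LL" "inn (sgrad \<Omega> p) \<phi> = - inn p (Dv \<phi>)"
proof -
 show l: "sgrad \<Omega> p \<in> LL" by (rule L2_componentwise) (simp add: sgrad_def D_L2[OF p])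
 have "inn (sgrad \<Omega> p) \<phi> = (\<Sum>i\<in>UNIV. - inn p (D i (%x. \<phi> x $ i)))"
  unfolding ip_vec[OF l H10_vec_L2[OF \<phi>]] by (simp add: sgrad_def D_ibp[OF p H10_vec_comp[OF \<phi>]])
 also have "... = - inn p (Dv \<phi>)"
 proof -
  have "inn p (Dv \<phi>) = (\<Sum>i\<in>UNIV. inn p (D i (%x. \<phi> x $ i)))"
   unfolding dvg_eq[abs_def] ip_def inner_sum_right
   by (rule Bochner_Integration.integral_sum) (intro L2_inner_integrable Hs_L2[OF p] D_L2 Hs_vec_comp H10_vec_H1 \<phi>)
  then show ?thesis by (simp add: sum_negf)
 qed
 finally show "inn (sgrad \<Omega> p) \<phi> = - inn p (Dv \<phi>)" .
qed

lemma convection_bound: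
 assumes a: "a \<in> LL" and v: "v \<in> Hv 1" and w: "w \<in> LL" and W: "AE x in leb. norm (w x) <= W" "0 <= W"
 shows "integrable leb (%x. (Gr v x *v a x) \<bullet> w x)" "\<bar>inn (%x. Gr v x *v a x) w\<bar> <= W * (nrm2 (Gr v) * nrm2 a)"
proof -
 have "(%x. (Gr v x *v a x) \<bullet> w x) \<in> bm"
  by (intro borel_measurable_inner matrix_vector_measurable L2_measurable grad_L2 a v w)
 from trilinear_bound[OF this grad_L2[OF v] a W matrix_vector_inner_le]
 show "integrable leb (%x. (Gr v x *v a x) \<bullet> w x)" "\<bar>inn (%x. Gr v x *v a x) w\<bar> <= W * (nrm2 (Gr v) * nrm2 a)"
  by (simp_all add: ip_def)
qed

lemma scalar_vec_bound:
 fixes g :: "real^'n => real"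
 assumes g: "g \<in> LL" and a: "a \<in> LL" and w: "w \<in> LL" and W: "AE x in leb. norm (w x) <= W" "0 <= W"
 shows "integrable leb (%x. (g x *\<^sub>R a x) \<bullet> w x)" "\<bar>inn (%x. g x *\<^sub>R a x) w\<bar> <= W * (nrm2 g * nrm2 a)"
proof -
 have "(%x. (g x *\<^sub>R a x) \<bullet> w x) \<in> bm"
  by (intro borel_measurable_inner borel_measurable_scaleR L2_measurable g a w)
 from trilinear_bound[OF this g a W scaleR_inner_le]
 show "integrable leb (%x. (g x *\<^sub>R a x) \<bullet> w x)" "\<bar>inn (%x. g x *\<^sub>R a x) w\<bar> <= W * (nrm2 g * nrm2 a)"
  by (simp_all add: ip_def)
qed

text \<open>Twice the form is the sum over i and j of the integrals of d_j (v_j e_i^2), each of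
  which is zero. The half divergence term makes this work for v with nonzero divergence; the bound
  on e makes the products integrable.\<close>

lemma bh_skew:
 assumes v: "v \<in> H0v" and e: "e \<in> H0v" and E: "AE x in leb. norm (e x) <= E" "0 <= E"
 shows "b3 v e e = 0"
proof -
 have vH: "v \<in> Hv 1" and eH: "e \<in> Hv 1" using v e H10_vec_H1 by auto
 have el: "e \<in> LL" and vl: "v \<in> LL" using e v H10_vec_L2 by auto
 have eb: "AE x in leb. \<bar>e x $ i\<bar> <= E" for i
  using E(1) by eventually_elim (meson component_le_norm_cart order_trans)
 let ?e = "%i x. e x $ i" and ?v = "%j x. v x $ j"
 have em: "?e i \<in> bm" for i by (rule L2_measurable[OF L2_component[OF el]])
 have i1: "integrable leb (%x. ?e i x * D j (?e i) x * ?v j x)" for i j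
  using L2_inner_integrable[OF mult_L2(1)[OF em eb D_L2[OF Hs_vec_comp[OF eH]]] L2_component[OF vl]] by simp
 have i2: "integrable leb (%x. ?e i x * ?e i x * D j (?v j) x)" for i j
  using L2_inner_integrable[OF mult_L2(1)[OF em eb L2_component[OF el]] D_L2[OF Hs_vec_comp[OF vH]]] by simp
 have z: "(\<integral>x. ?e i x * ?e i x * D j (?v j) x \<partial>leb) + 2 * (\<integral>x. ?e i x * D j (?e i) x * ?v j x \<partial>leb) = 0" for i j
  using trilinear[OF H10_vec_comp[OF v, of j] H10_vec_comp[OF e, of i] eb H10_vec_comp[OF e, of i] eb, of j] i1
  by (simp add: ip_def algebra_simps)
 have c1: "inn (%x. Gr e x *v v x) e = (\<Sum>i\<in>UNIV. \<Sum>j\<in>UNIV. (\<integral>x. ?e i x * D j (?e i) x * ?v j x \<partial>leb))"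
 proof -
  have "(Gr e x *v v x) \<bullet> e x = (\<Sum>i\<in>UNIV. \<Sum>j\<in>UNIV. ?e i x * D j (?e i) x * ?v j x)" for x
   by (simp add: inner_vec_def matrix_vector_mult_def grad_def sum_distrib_right sum_distrib_left mult_ac)
  then show ?thesis using i1 by (simp add: ip_def)
 qed
 have c2: "inn (%x. Dv v x *\<^sub>R e x) e = (\<Sum>i\<in>UNIV. \<Sum>j\<in>UNIV. (\<integral>x. ?e i x * ?e i x * D j (?v j) x \<partial>leb))"
 proof -
  have "(Dv v x *\<^sub>R e x) \<bullet> e x = (\<Sum>i\<in>UNIV. \<Sum>j\<in>UNIV. ?e i x * ?e i x * D j (?v j) x)" for x
   by (simp add: inner_vec_def dvg_eq sum_distrib_left sum_distrib_right mult_ac)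
  then show ?thesis using i2 by (simp add: ip_def)
 qed
 have "2 * b3 v e e = (\<Sum>i\<in>UNIV. \<Sum>j\<in>UNIV. (\<integral>x. ?e i x * ?e i x * D j (?v j) x \<partial>leb) + 2 * (\<integral>x. ?e i x * D j (?e i) x * ?v j x \<partial>leb))"
  unfolding bh_def c1 c2 by (simp add: sum.distrib sum_distrib_left)
 then show ?thesis using z by simp
qed

end

section \<open>Finite element spaces\<close>

context bounded_domain
begin

text \<open>For an orthonormal family \<open>e\<close> the pointwise bound, applied to \<open>\<Sum>\<^sub>i (e\<^sub>i(x) \<bullet> b) e\<^sub>i\<close>, bounds
  \<open>\<Sum>\<^sub>i |e\<^sub>i(x)|\<^sup>2\<close>; integration over the domain bounds the length of the family.\<close>

lemma complete_orthonormal_bounded: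
 fixes V :: "(real^'n => 'b::euclidean_space) set"
 assumes S: "semi_inner V B" and VL: "V \<subseteq> LL" and A: "AE x in leb. x \<in> A"
  and C: "!!v x. v \<in> V ==> x \<in> A ==> norm (v x) <= C * semi_inner.nrm B v"
  and M: "!!v. v \<in> V ==> semi_inner.nrm B v <= M * nrm2 v" and Mp: "0 < M"
 shows "\<exists>e k. semi_inner.complete_orthonormal V B e k"
proof -
 interpret semi_inner V B by (rule S)
 define N where "N = M\<^sup>2 * (real DIM('b) * C\<^sup>2 * vD)"
 have "k <= nat \<lceil>N\<rceil>" if o: "orthonormal e k" for e k
 proof -
  have eV: "e i \<in> V" if "i < k" for i using o that by (simp add: orthonormal_def)
  have eL: "e i \<in> LL" if "i < k" for i using eV[OF that] VL by blast
  have B1: "B (e i) (e j) = (if i = j then 1 else 0)" if "i < k" "j < k" for i j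
   using o that by (auto simp: orthonormal_def)
  have pt: "(\<Sum>i<k. (e i x \<bullet> b)\<^sup>2) <= C\<^sup>2" if x: "x \<in> A" and b: "b \<in> Basis" for x b
  proof -
   define s where "s = (\<Sum>i<k. (e i x \<bullet> b)\<^sup>2)"
   let ?v = "%y. \<Sum>i<k. (e i x \<bullet> b) *\<^sub>R e i y"
   have v: "?v \<in> V" by (rule V_sum) (use eV in auto)
   have "B ?v ?v = (\<Sum>i<k. (e i x \<bullet> b) * B (e i) ?v)"
    by (rule B_sum) (use eV v in auto)
   also have "... = (\<Sum>i<k. (e i x \<bullet> b) * (e i x \<bullet> b))"
   proof (intro sum.cong refl)
    fix i assume i: "i \<in> {..<k}"
    have "B ?v (e i) = (\<Sum>j<k. (e j x \<bullet> b) * B (e j) (e i))" by (rule B_sum) (use eV i in auto)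
    also have "... = (\<Sum>j<k. if j = i then e i x \<bullet> b else 0)" using B1 i by (intro sum.cong) auto
    also have "... = e i x \<bullet> b" using i by simp
    finally show "(e i x \<bullet> b) * B (e i) ?v = (e i x \<bullet> b) * (e i x \<bullet> b)" using B_sym[OF v eV] i by simp
   qed
   finally have n: "nrm ?v = sqrt s" by (simp add: nrm_def s_def power2_eq_square)
   have s0: "s >= 0" by (simp add: s_def sum_nonneg)
   have "s = ?v x \<bullet> b" by (simp add: s_def inner_sum_left power2_eq_square)
   also have "... <= norm (?v x)" using b by (meson Basis_le_norm abs_ge_self order_trans)
   also have "... <= C * sqrt s" using C[OF v x] n by simp
   finally have 1: "sqrt s * sqrt s <= C * sqrt s" using s0 by simp
   have "sqrt s <= \<bar>C\<bar>"
   proof (cases "sqrt s = 0")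
    case False
    then have "0 < sqrt s" using s0 by simp
    then show ?thesis using 1 using mult_le_cancel_right_pos[OF \<open>0 < sqrt s\<close>, of "sqrt s" C] by linarith
   qed simp
   then have "(sqrt s)\<^sup>2 <= \<bar>C\<bar>\<^sup>2" by (intro power_mono) (use s0 in auto)
   then show ?thesis using s0 by (simp add: s_def[symmetric])
  qed
  have pt2: "(\<Sum>i<k. e i x \<bullet> e i x) <= real DIM('b) * C\<^sup>2" if x: "x \<in> A" for x
  proof -
   have "(\<Sum>i<k. e i x \<bullet> e i x) = (\<Sum>i<k. \<Sum>b\<in>Basis. (e i x \<bullet> b)\<^sup>2)"
    by (intro sum.cong refl, subst euclidean_inner) (simp add: power2_eq_square)
   also have "... = (\<Sum>b\<in>Basis. \<Sum>i<k. (e i x \<bullet> b)\<^sup>2)" by (rule sum.swap)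
   also have "... <= (\<Sum>b\<in>(Basis::'b set). C\<^sup>2)" by (intro sum_mono pt x)
   finally show ?thesis by simp
  qed
  have "real k = (\<Sum>i<k. (nrm (e i))\<^sup>2)" by (simp add: nrm_def B1)
  also have "... <= (\<Sum>i<k. M\<^sup>2 * inn (e i) (e i))"
  proof (intro sum_mono)
   fix i assume i: "i \<in> {..<k}"
   have "(nrm (e i))\<^sup>2 <= (M * nrm2 (e i))\<^sup>2" using M[OF eV] eV i by (intro power_mono) auto
   then show "(nrm (e i))\<^sup>2 <= M\<^sup>2 * inn (e i) (e i)" by (simp add: power_mult_distrib L2_norm_sq)
  qed
  also have "... = M\<^sup>2 * (\<integral>x. (\<Sum>i<k. e i x \<bullet> e i x) \<partial>leb)"
   unfolding ip_def by (subst Bochner_Integration.integral_sum) (auto intro: L2_inner_integrable eL simp: sum_distrib_left)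
  also have "... <= M\<^sup>2 * (\<integral>x. real DIM('b) * C\<^sup>2 \<partial>leb)"
  proof (intro mult_left_mono integral_mono_AE)
   show "integrable leb (%x. \<Sum>i<k. e i x \<bullet> e i x)"
    by (intro Bochner_Integration.integrable_sum L2_inner_integrable eL) auto
   show "integrable leb (%x. real DIM('b) * C\<^sup>2)"
    using L2_inner_integrable[OF const_L2[of "real DIM('b) * C\<^sup>2"] const_L2[of "1::real"]] by simp
   show "AE x in leb. (\<Sum>i<k. e i x \<bullet> e i x) <= real DIM('b) * C\<^sup>2"
    using A by eventually_elim (rule pt2)
  qed simp
  also have "... = N" using sets_dom by (simp add: N_def measure_restrict_space)
  finally show ?thesis by linarith
 qed
 then show ?thesis by (rule complete_orthonormal_exists)
qed

end

text \<open>\<open>disc_inverse\<close> in each component, combined with the pointwise bound on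
  shape functions. The constant is chosen ahead of domain and mesh.\<close>

lemma Xh_inverse:
 assumes \<sigma>: "0 < \<sigma>"
 shows "\<exists>C>0. \<forall>(S :: (real^'n::finite) set) h T. mesh_domain S \<sigma> h T --> (\<forall>v\<in>Xh S T r.
  AE x in lebesgue_on S. norm (v x) <= C * h powr (- (real CARD('n) / 2)) * L2_norm S v)"
proof -
 obtain C1 where C1: "C1 > 0" "!!p y. p \<in> shapes r ==> y \<in> iref ==> \<bar>p y\<bar> <= C1 * L2_norm ref_simplex (p :: real^'n => real)"
  using shapes_bound[where 'n='n] by metis
 obtain C2 where C2: "C2 > 0" "!!(S :: (real^'n) set) h T v F. mesh_domain S \<sigma> h T ==> disc T r v ==> v \<in> L2 S ==> F \<in> T ==>
   \<exists>p\<in>shapes r. (\<forall>y\<in>iref. v (F y) = p y) & L2_norm ref_simplex p <= C2 * h powr (- (real CARD('n) / 2)) * L2_norm S v"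
  using disc_inverse[OF \<sigma>, where 'n='n and k=r] by metis
 show ?thesis
 proof (intro exI[of _ "real CARD('n) * C1 * C2"] conjI allI impI ballI)
  fix S :: "(real^'n) set" and h T v
  assume m: "mesh_domain S \<sigma> h T" and v: "v \<in> Xh S T r"
  interpret mesh_domain S \<sigma> h T by (rule m)
  have vL: "v \<in> L2 S" by (rule H10_vec_L2[OF Xh_H10[OF v]])
  let ?B = "C1 * C2 * h powr (- (real CARD('n) / 2)) * L2_norm S v"
  have c: "\<bar>v (F y) $ i\<bar> <= ?B" if F: "F \<in> T" and y: "y \<in> iref" for F y i
  proof -
   obtain p where p: "p \<in> shapes r" "v (F y) $ i = p y"
    "L2_norm ref_simplex p <= C2 * h powr (- (real CARD('n) / 2)) * L2_norm S (%x. v x $ i)"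
    using C2(2)[OF m Xh_disc[OF v, of i] L2_component[OF vL] F] y by auto
   have "\<bar>p y\<bar> <= C1 * L2_norm ref_simplex p" by (rule C1(2)[OF p(1) y])
   also have "... <= C1 * (C2 * h powr (- (real CARD('n) / 2)) * L2_norm S (%x. v x $ i))" using p(3) C1(1) by simp
   also have "... <= C1 * (C2 * h powr (- (real CARD('n) / 2)) * L2_norm S v)"
    using L2_norm_mono[OF L2_measurable[OF L2_component[OF vL, of i]] vL, of 1] C1(1) C2(1)
    by (intro mult_left_mono) (auto simp: component_le_norm_cart)
   finally show ?thesis using p(2) by (simp add: mult_ac)
  qed
  show "AE x in lebesgue_on S. norm (v x) <= real CARD('n) * C1 * C2 * h powr (- (real CARD('n) / 2)) * L2_norm S v"
   using AE_elements
  proof eventually_elim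
   case (elim x)
   then obtain F y where F: "F \<in> T" "y \<in> iref" "x = F y" by blast
   have "norm (v x) <= (\<Sum>i\<in>UNIV. norm (v x $ i))" by (rule norm_le_l1)
   also have "... <= (\<Sum>i\<in>(UNIV::'n set). ?B)" using c[OF F(1,2)] F(3) by (intro sum_mono) simp
   finally show ?case by simp
  qed
 qed (use C1 C2 in simp)
qed

context mesh_domain
begin

text \<open>A single set of full measure on which the pointwise bounds hold for all discrete
  functions at once; the dimension bound evaluates many of them at a common point.\<close>

definition cells :: "(real^'n) set" where "cells = (\<Union>F\<in>T. F ` iref)"

lemma AE_cells: "AE x in leb. x \<in> cells"
 using AE_elements by eventually_elim (auto simp: cells_def)

lemma Xh_bounds:
 "\<exists>M>0. \<forall>v\<in>XH r. (\<forall>x\<in>cells. norm (v x) <= M * nrm2 v) &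
  (AE x in leb. norm (Gr v x) <= M * nrm2 v) & nrm2 (Gr v) <= M * nrm2 v"
proof -
 obtain M where M: "M > 0" "!!v F y. disc T r v ==> v \<in> LL ==> F \<in> T ==> y \<in> iref ==> \<bar>v (F y)\<bar> <= M * nrm2 v"
  "!!v j. disc T r v ==> v \<in> HS 1 ==> (AE x in leb. \<bar>D j v x\<bar> <= M * nrm2 v)"
  using disc_bounds[of r] Hs_L2 by metis
 let ?n = "real CARD('n)"
 \<comment> \<open>One constant for three bounds: n^2 accounts for passing from entries to matrices,
   the root of the volume for the L2 norm of a bounded function.\<close>
 let ?M = "?n * ?n * M * (1 + sqrt vD)"
 have n1: "1 <= ?n" by (simp add: Suc_leI One_nat_def)
 have sv: "sqrt vD >= 0" by simp
 show ?thesis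
 proof (intro exI[of _ ?M] conjI ballI)
  show "0 < ?M" using M(1) sv by (simp add: add_pos_nonneg)
  fix v assume v: "v \<in> XH r"
  have vH: "v \<in> Hv 1" by (rule H10_vec_H1[OF Xh_H10[OF v]])
  have vL: "v \<in> LL" by (rule Hs_vec_L2[OF vH])
  have c: "M * nrm2 (%x. v x $ i) <= M * nrm2 v" for i
   using L2_norm_mono[OF L2_measurable[OF L2_component[OF vL, of i]] vL, of 1] M(1) by (auto simp: component_le_norm_cart)
  let ?B = "M * nrm2 v"
  have B: "?B >= 0" using M(1) by simp
  have nB: "?n * ?B <= ?M * nrm2 v" "?n * ?n * ?B <= ?M * nrm2 v" "?n * ?n * ?B * sqrt vD <= ?M * nrm2 v"
  proof -
   have "0 <= ?n * ?B" using B by simp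
   then have a: "?n * ?B <= ?n * (?n * ?B)" using mult_right_mono[OF n1, of "?n * ?B"] by (simp only: mult_1 simp_thms)
   have b: "?M * nrm2 v = ?n * (?n * ?B) + ?n * (?n * ?B) * sqrt vD" by (simp add: algebra_simps)
   have c: "0 <= ?n * (?n * ?B) * sqrt vD" "0 <= ?n * (?n * ?B)" using B by simp_all
   show "?n * ?B <= ?M * nrm2 v" using a b c by linarith
   show "?n * ?n * ?B <= ?M * nrm2 v" "?n * ?n * ?B * sqrt vD <= ?M * nrm2 v"
    using b c by (simp_all only: mult.assoc)
  qed
  show "norm (v x) <= ?M * nrm2 v" if "x \<in> cells" for x
  proof -
   obtain F y where F: "F \<in> T" "y \<in> iref" "x = F y" using \<open>x \<in> cells\<close> by (auto simp: cells_def)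
   have "norm (v x) <= (\<Sum>i\<in>UNIV. norm (v x $ i))" by (rule norm_le_l1)
   also have "... <= (\<Sum>i\<in>(UNIV::'n set). ?B)"
    using order_trans[OF M(2)[OF Xh_disc[OF v] L2_component[OF vL] F(1,2)] c] F(3) by (intro sum_mono) simp
   also have "... = ?n * ?B" by simp
   finally show ?thesis using nB(1) by linarith
  qed
  have "AE x in leb. \<forall>i\<in>UNIV. \<forall>j\<in>UNIV. \<bar>Dc j i v x\<bar> <= M * nrm2 (%x. v x $ i)"
   by (intro AE_finite_allI M(3) Xh_disc[OF v] Hs_vec_comp[OF vH]) auto
  then have g: "AE x in leb. norm (Gr v x) <= ?n * ?n * ?B"
  proof eventually_elim
   case (elim x)
   have "norm (Gr v x) <= (\<Sum>i\<in>UNIV. norm (Gr v x $ i))" by (rule norm_le_l1)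
   also have "... <= (\<Sum>i\<in>UNIV. \<Sum>j\<in>UNIV. norm (Gr v x $ i $ j))" by (intro sum_mono norm_le_l1)
   also have "... <= (\<Sum>i\<in>(UNIV::'n set). \<Sum>j\<in>(UNIV::'n set). ?B)"
    using elim order_trans[OF _ c] by (intro sum_mono) (auto simp: grad_def)
   finally show ?case by (simp add: mult_ac)
  qed
  then show "AE x in leb. norm (Gr v x) <= ?M * nrm2 v"
   by eventually_elim (use nB(2) in linarith)
  have "nrm2 (Gr v) <= ?n * ?n * ?B * nrm2 (%x. 1::real)"
   by (rule L2_norm_mono[OF L2_measurable[OF grad_L2[OF vH]] const_L2]) (use g B in auto)
  also have "nrm2 (%x. 1::real) = sqrt vD" using sets_dom by (simp add: L2_norm_def ip_def measure_restrict_space)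
  finally show "nrm2 (Gr v) <= ?M * nrm2 v" using nB(3) by linarith
 qed
qed

section \<open>The discrete pressure space\<close>

lemma Qh_L2: "q \<in> QH r ==> q \<in> LL"
proof -
 assume "q \<in> QH r"
 then have c: "continuous_on (closure \<Omega>) q" by (auto simp: Qh_def Sh_def)
 have "compact (closure \<Omega>)" using bounded_dom by (simp add: compact_eq_bounded_closed bounded_closure)
 then have "compact (q ` closure \<Omega>)" by (rule compact_continuous_image[OF c])
 then obtain B where "!!x. x \<in> closure \<Omega> ==> norm (q x) <= B" by (meson bounded_iff compact_imp_bounded imageI)
 then have B: "norm (q x) <= B" if "x \<in> \<Omega>" for x using that closure_subset by blast
 show ?thesis
 proof (rule L2_bounded[OF _ _ lmeas])
  show "q \<in> bm"
   by (rule continuous_imp_measurable_on_sets_lebesgue[OF continuous_on_subset[OF c closure_subset] sets_dom])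
  show "AE x in leb. norm (q x) <= B" using B by (intro AE_I2) (simp add: space_restrict_space)
 qed
qed

lemma Qh_lin: assumes "q \<in> QH r" "g \<in> QH r" shows "(%x. a * q x + b * g x) \<in> QH r"
proof -
 have "integrable leb q" "integrable leb g"
  using L2_inner_integrable[OF Qh_L2[OF assms(1)] const_L2[of "1::real"]] L2_inner_integrable[OF Qh_L2[OF assms(2)] const_L2[of "1::real"]] by simp_all
 then show ?thesis using assms Sh_lin by (auto simp: Qh_def)
qed

lemma Sh_zero: "(%x. 0) \<in> Sh \<Omega> T k"
 unfolding Sh_def poly_deg_def by (auto intro!: exI[of _ "%x. 0"] continuous_intros)

lemma Qh_zero: "(%x. 0) \<in> QH r"
 by (simp add: Qh_def Sh_zero)

lemma zero_H10: "(%x. 0) \<in> H0"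
 using H10_lin[OF bubble_H10_dom bubble_H10_dom, of _ _ 0 0] T_ne by auto

lemma Xh_zero: "(%x. 0) \<in> XH r"
proof -
 have "(%x. 0) \<in> Sh0_vec \<Omega> T r" for r by (simp add: Sh0_vec_def Sh_zero zero_H10)
 then show ?thesis by (auto simp: Xh_def intro!: exI[of _ "%x. 0"])
qed

section \<open>Discretely divergence-free velocities\<close>

lemma Vh_Xh: "v \<in> VH r ==> v \<in> XH r" by (simp add: Vh_def)
lemma Vh_H10: "v \<in> VH r ==> v \<in> H0v" by (rule Xh_H10[OF Vh_Xh])
lemma Vh_H1: "v \<in> VH r ==> v \<in> Hv 1" by (rule H10_vec_H1[OF Vh_H10])
lemma Vh_L2: "v \<in> VH r ==> v \<in> LL" by (rule H10_vec_L2[OF Vh_H10])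

lemma Vh_lin: assumes "v \<in> VH r" "w \<in> VH r" shows "(%x. a *\<^sub>R v x + b *\<^sub>R w x) \<in> VH r"
 unfolding Vh_def
proof (intro CollectI conjI ballI)
 show "(%x. a *\<^sub>R v x + b *\<^sub>R w x) \<in> XH r" by (rule Xh_lin[OF Vh_Xh Vh_Xh]) fact+
 fix q assume q: "q \<in> QH r"
 have d: "Dv v \<in> LL" "Dv w \<in> LL" using assms dvg_L2 Vh_H1 by blast+
 have "inn q (Dv (%x. a *\<^sub>R v x + b *\<^sub>R w x)) = inn (Dv (%x. a *\<^sub>R v x + b *\<^sub>R w x)) q" by (rule ip_sym)
 also have "... = inn (%x. a *\<^sub>R Dv v x + b *\<^sub>R Dv w x) q"
 proof (rule ip_AE_cong)
  show "AE x in leb. Dv (%x. a *\<^sub>R v x + b *\<^sub>R w x) x = a *\<^sub>R Dv v x + b *\<^sub>R Dv w x"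
   using dvg_lin[OF Vh_H1[OF assms(1)] Vh_H1[OF assms(2)], of a b] by simp
 qed (use sets_dom Qh_L2[OF q] dvg_L2[OF H10_vec_H1[OF Xh_H10[OF Xh_lin[OF Vh_Xh[OF assms(1)] Vh_Xh[OF assms(2)]]]]] in auto)
 also have "... = a * inn (Dv v) q + b * inn (Dv w) q" by (rule ip_lin[OF d Qh_L2[OF q]])
 also have "... = 0" using assms q by (simp add: Vh_def ip_sym[of \<Omega> _ q])
 finally show "inn q (Dv (%x. a *\<^sub>R v x + b *\<^sub>R w x)) = 0" .
qed

lemma dvg_zero: "AE x in leb. Dv (%x. 0) x = 0"
 using dvg_lin[OF H10_vec_H1[OF Xh_H10[OF Xh_zero]] H10_vec_H1[OF Xh_H10[OF Xh_zero]], of 0 0] by simp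

lemma Vh_zero: "(%x. 0) \<in> VH r"
proof -
 have "inn q (Dv (%x. 0)) = inn q (%x. 0)"
  if "q \<in> QH r" for q
  by (rule ip_AE_cong) (use dvg_zero sets_dom that Qh_L2 dvg_L2[OF H10_vec_H1[OF Xh_H10[OF Xh_zero]]] in auto)
 then show ?thesis using Xh_zero by (simp add: Vh_def ip_def)
qed

abbreviation gip :: "(real^'n => real^'n) => (real^'n => real^'n) => real" where
 "gip v w \<equiv> inn (Gr v) (Gr w)"

lemma Hs_vec_lin: "v \<in> Hv s ==> w \<in> Hv s ==> (%x. a *\<^sub>R v x + b *\<^sub>R w x) \<in> Hv s"
 using Hs_lin by (auto simp: Hs_vec_def)

lemma gip_lin: "v \<in> Hv 1 ==> w \<in> Hv 1 ==> z \<in> Hv 1 ==>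
  gip (%x. a *\<^sub>R v x + b *\<^sub>R w x) z = a * gip v z + b * gip w z"
 using ip_AE_cong[OF grad_lin[of v w a b] AE_I2, of "Gr z" "Gr z"] ip_lin[OF grad_L2 grad_L2 grad_L2, of v w z a b] sets_dom
 by (simp add: grad_L2 Hs_vec_lin)

lemma semi_inner_Vh: "semi_inner (VH r) gip"
 by unfold_locales (auto simp: Vh_lin Vh_zero ip_nonneg gip_lin Vh_H1 intro: ip_sym)

lemma Vh_nrm: "semi_inner.nrm gip v = nrm2 (Gr v)"
 by (simp add: semi_inner.nrm_def[OF semi_inner_Vh] L2_norm_def)

text \<open>The form of gradients is taken because it defines the Stokes projection; Poincare's
  inequality turns pointwise bounds by the L2 norm into bounds by the norm of the gradient.\<close>

lemma Vh_complete: "\<exists>e k. semi_inner.complete_orthonormal (VH r) gip e k"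
proof -
 obtain M where M: "M > 0" "!!v x. v \<in> XH r ==> x \<in> cells ==> norm (v x) <= M * nrm2 v"
  "!!v. v \<in> XH r ==> nrm2 (Gr v) <= M * nrm2 v"
  using Xh_bounds by metis
 obtain C where C: "C > 0" "!!v. v \<in> H0v ==> nrm2 v <= C * nrm2 (Gr v)"
  using poincare_vec by blast
 show ?thesis
 proof (rule complete_orthonormal_bounded[OF semi_inner_Vh _ AE_cells _ _ M(1)])
  show "VH r \<subseteq> LL" using Vh_L2 by blast
  fix v assume v: "v \<in> VH r"
  show "semi_inner.nrm gip v <= M * nrm2 v" unfolding Vh_nrm by (rule M(3)[OF Vh_Xh[OF v]])
  fix x assume x: "x \<in> cells"
  have "norm (v x) <= M * nrm2 v" by (rule M(2)[OF Vh_Xh[OF v] x])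
  also have "... <= M * (C * nrm2 (Gr v))" using C(2)[OF Vh_H10[OF v]] M(1) by simp
  finally show "norm (v x) <= (M * C) * semi_inner.nrm gip v" by (simp add: Vh_nrm)
 qed
qed

lemma Vh_Riesz:
 assumes "!!f g a b. f \<in> VH r ==> g \<in> VH r ==> l (%x. a *\<^sub>R f x + b *\<^sub>R g x) = a * l f + b * l g"
  and "!!f. f \<in> VH r ==> \<bar>l f\<bar> <= K * nrm2 (Gr f)"
 shows "\<exists>s\<in>VH r. \<forall>v\<in>VH r. gip s v = l v"
proof -
 obtain e k where e: "semi_inner.complete_orthonormal (VH r) gip e k" using Vh_complete by blast
 show ?thesis by (rule semi_inner.Riesz[OF semi_inner_Vh e, where K=K]) (use assms in \<open>auto simp: Vh_nrm\<close>)
qed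

lemma stokes_exists:
 assumes w: "w \<in> Hv 1"
 shows "\<exists>s. stokes_projection \<Omega> T r w s"
proof -
 have "\<exists>s\<in>VH r. \<forall>v\<in>VH r. gip s v = gip v w"
 proof (rule Vh_Riesz)
  show "gip (%x. a *\<^sub>R f x + b *\<^sub>R g x) w = a * gip f w + b * gip g w" if "f \<in> VH r" "g \<in> VH r" for f g a b
   by (rule gip_lin) (use that w Vh_H1 in auto)
  show "\<bar>gip f w\<bar> <= nrm2 (Gr w) * nrm2 (Gr f)" if "f \<in> VH r" for f
   using ip_CS[OF grad_L2 grad_L2, of f w] that w Vh_H1 by (simp add: mult.commute)
 qed
 then show ?thesis by (auto simp: stokes_projection_def ip_sym)
qed

text \<open>Writes an L2 pairing as a pairing of gradients. This is how the time derivative of the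
  Stokes projection is identified, since the projection is defined by gradients but its evolution is
  needed in L2.\<close>

lemma Riesz_L2:
 assumes w: "w \<in> LL"
 shows "\<exists>z\<in>VH r. \<forall>v\<in>VH r. gip z v = inn v w"
proof -
 obtain C where C: "C > 0" "!!v. v \<in> H0v ==> nrm2 v <= C * nrm2 (Gr v)"
  using poincare_vec by blast
 show ?thesis
 proof (rule Vh_Riesz)
  show "inn (%x. a *\<^sub>R f x + b *\<^sub>R g x) w = a * inn f w + b * inn g w" if "f \<in> VH r" "g \<in> VH r" for f g a b
   by (rule ip_lin) (use that w Vh_L2 in auto)
  show "\<bar>inn f w\<bar> <= (C * nrm2 w) * nrm2 (Gr f)" if f: "f \<in> VH r" for f
  proof -
   have "\<bar>inn f w\<bar> <= nrm2 f * nrm2 w" by (rule ip_CS[OF Vh_L2[OF f] w])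
   also have "... <= (C * nrm2 (Gr f)) * nrm2 w" by (rule mult_right_mono[OF C(2)[OF Vh_H10[OF f]]]) simp
   finally show ?thesis by (simp add: mult_ac)
  qed
 qed
qed

text \<open>The same scheme as for the velocities, with the L2 product itself as the form, so no
  comparison of norms is required.\<close>

lemma L2_projection_exists:
 assumes p: "p \<in> LL" and r: "2 <= r"
 shows "\<exists>q. L2_projection \<Omega> (QH r) p q"
proof -
 have S: "semi_inner (QH r) (inn)"
 proof
  fix f g h :: "real^'n => real" and a b :: real
  assume fgh: "f \<in> QH r" "g \<in> QH r" "h \<in> QH r"
  show "inn (%x. a *\<^sub>R f x + b *\<^sub>R g x) h = a * inn f h + b * inn g h" by (intro ip_lin Qh_L2 fgh | rule fgh)+
 qed (auto intro: ip_sym ip_nonneg Qh_lin Qh_zero)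
 have nrm: "semi_inner.nrm (inn) q = nrm2 q" for q :: "real^'n => real"
  by (simp add: semi_inner.nrm_def[OF S] L2_norm_def)
 have d: "disc T r q" if "q \<in> QH r" for q
  using that r by (intro Sh_disc[of q "if r = 2 then 2 else r - 1"]) (auto simp: Qh_def)
 obtain M where M: "M > 0" "!!v F y. disc T r v ==> v \<in> LL ==> F \<in> T ==> y \<in> iref ==> \<bar>v (F y)\<bar> <= M * nrm2 v"
  using disc_bounds[of r] by metis
 have "\<exists>e k. semi_inner.complete_orthonormal (QH r) (inn) e k"
  by (rule complete_orthonormal_bounded[OF S _ AE_cells, of M 1]) (use Qh_L2 M(2) d in \<open>auto simp: nrm cells_def\<close>)
 then obtain e k where e: "semi_inner.complete_orthonormal (QH r) (inn) e k" by blast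
 have "\<exists>q\<in>QH r. \<forall>g\<in>QH r. inn q g = inn g p"
 proof (rule semi_inner.Riesz[OF S e])
  show "inn (%x. a *\<^sub>R f x + b *\<^sub>R g x) p = a * inn f p + b * inn g p" if "f \<in> QH r" "g \<in> QH r" for f g a b
   by (rule ip_lin) (use that p Qh_L2 in auto)
  show "\<bar>inn f p\<bar> <= nrm2 p * semi_inner.nrm (inn) f" if "f \<in> QH r" for f
   using ip_CS[OF Qh_L2[OF that] p] by (simp add: nrm mult.commute)
 qed
 then obtain q where q: "q \<in> QH r" "!!g. g \<in> QH r ==> inn q g = inn g p" by blast
 have "L2_projection \<Omega> (QH r) p q"
  using q ip_diff[OF p Qh_L2[OF q(1)] Qh_L2] by (auto simp: L2_projection_def ip_sym[of \<Omega> p])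
 then show ?thesis by blast
qed

end

section \<open>Functions of time\<close>

text \<open>A Lipschitz functional of simple functions is simple, and the values converge almost
  everywhere. Linearity is not asked for, so inner products and lower order norms are treated
  alike.\<close>

lemma strongly_measurable_functional:
 fixes \<l> :: "('x => 'b::real_vector) => real"
 assumes sm: "strongly_measurable X N J u" and uX: "AE t in lebesgue_on J. u t \<in> X" and J: "J \<in> sets lebesgue"
  and lip: "!!v w. v \<in> X ==> w \<in> X ==> \<bar>\<l> v - \<l> w\<bar> <= K * N (%x. v x - w x)"
 shows "(%t. \<l> (u t)) \<in> borel_measurable (lebesgue_on J)"
proof -
 obtain w where w: "!!k. finite (w k ` J)" "!!k. w k ` J \<subseteq> X" "!!k y. {t\<in>J. w k t = y} \<in> sets lebesgue"
  and lim: "AE t in lebesgue_on J. (%k. N (%x. w k t x - u t x)) ----> 0"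
  using sm unfolding strongly_measurable_def by blast
 have m: "(%t. \<l> (w k t)) \<in> borel_measurable (lebesgue_on J)" for k
 proof -
  have "(%t. \<Sum>y\<in>w k ` J. \<l> y * indicator {t\<in>J. w k t = y} t) \<in> borel_measurable (lebesgue_on J)"
   using w(3) J by (intro borel_measurable_sum borel_measurable_times borel_measurable_indicator borel_measurable_const) (auto simp: sets_restrict_space_iff)
  moreover have "(\<Sum>y\<in>w k ` J. \<l> y * indicator {t\<in>J. w k t = y} t) = \<l> (w k t)" if t: "t \<in> J" for t
  proof -
   have "(\<Sum>y\<in>w k ` J. \<l> y * indicator {t\<in>J. w k t = y} t) = (\<Sum>y\<in>w k ` J. if y = w k t then \<l> y else 0)"
    using t by (intro sum.cong) (auto simp: indicator_def)
   then show ?thesis using t w(1) by (simp add: sum.delta)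
  qed
  ultimately show ?thesis by (subst measurable_cong[symmetric]) (auto simp: space_restrict_space)
 qed
 have "AE t in lebesgue_on J. lim (%k. \<l> (w k t)) = \<l> (u t)"
  using lim uX AE_space
 proof eventually_elim
  case (elim t)
  then have t: "t \<in> J" by (simp add: space_restrict_space)
  have "(%k. \<l> (w k t) - \<l> (u t)) ----> 0"
  proof (rule Lim_null_comparison)
   show "\<forall>\<^sub>F k in sequentially. norm (\<l> (w k t) - \<l> (u t)) <= K * N (%x. w k t x - u t x)"
    using lip[OF _ elim(2)] w(2) t by (intro always_eventually allI) (auto simp: image_subset_iff)
   show "(%k. K * N (%x. w k t x - u t x)) ----> 0" using tendsto_mult_left[OF elim(1), of K] by simp
  qed
  then have "(%k. \<l> (w k t)) ----> \<l> (u t)" by (simp add: LIM_zero_iff)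
  then show ?case by (rule limI)
 qed
 then show ?thesis by (rule borel_measurable_lebesgue_on_AE[OF borel_measurable_lim_metric[OF m] J])
qed

lemma AE_lebesgue_on_subset:
 assumes "AE t in lebesgue_on J. P t" "I \<subseteq> J" "J \<in> sets lebesgue" "I \<in> sets lebesgue"
 shows "AE t in lebesgue_on I. P t"
 using assms by (auto simp: AE_restrict_space_iff elim!: eventually_mono)

text \<open>\<open>ess_max\<close> passes through \<open>real_of_ereal\<close>, which sends infinite
  values to 0. Boundedness, nonnegativity and positive length of the interval keep the essential
  supremum finite.\<close>

lemma ess_max_bounds:
 fixes g :: "real => real"
 assumes g: "g \<in> borel_measurable (lebesgue_on {0..t})" and t: "0 < t"
  and M: "AE \<tau> in lebesgue_on {0..t}. g \<tau> <= M" and g0: "AE \<tau> in lebesgue_on {0..t}. 0 <= g \<tau>"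
 shows "AE \<tau> in lebesgue_on {0..t}. g \<tau> <= ess_max t g" "0 <= ess_max t g"
proof -
 let ?M = "lebesgue_on {0..t}"
 let ?s = "esssup ?M (%\<tau>. ereal (g \<tau>))"
 have nz: "emeasure ?M (space ?M) ~= 0" using t by (simp add: emeasure_restrict_space space_restrict_space)
 have ub: "?s <= ereal M" by (rule esssup_I) (use g M in auto)
 have "AE \<tau> in ?M. ereal 0 <= ereal (g \<tau>)" using g0 by simp
 then have "esssup ?M (%\<tau>. ereal 0) <= ?s" by (intro esssup_AE_mono) auto
 then have lb: "0 <= ?s" using esssup_const[OF nz, of "0::ereal"] by (simp add: zero_ereal_def)
 then show "0 <= ess_max t g" by (simp add: ess_max_def real_of_ereal_pos)
 have e: "ereal (ess_max t g) = ?s" unfolding ess_max_def using ub lb by (intro ereal_real') auto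
 show "AE \<tau> in ?M. g \<tau> <= ess_max t g"
  using esssup_AE[of "%\<tau>. ereal (g \<tau>)" ?M] by eventually_elim (simp add: e[symmetric])
qed

lemma Linf_norm_le:
 assumes "f \<in> borel_measurable (lebesgue_on S)" "AE x in lebesgue_on S. norm (f x) <= B" "0 <= B"
 shows "Linf_norm S f <= B"
proof -
 have "esssup (lebesgue_on S) (%x. ereal (norm (f x))) <= ereal B" by (rule esssup_I) (use assms in auto)
 then show ?thesis using assms(3) unfolding Linf_norm_def
  by (cases "esssup (lebesgue_on S) (%x. ereal (norm (f x)))") auto
qed

lemma (in bounded_domain) Linf_norm_bounds:
 fixes f :: "real^'n => 'b::euclidean_space"
 assumes f: "f \<in> bm" and B: "AE x in leb. norm (f x) <= B"
 shows "AE x in leb. norm (f x) <= Sn f" "0 <= Sn f"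
proof -
 let ?M = "leb"
 let ?s = "esssup ?M (%x. ereal (norm (f x)))"
 have "emeasure ?M (space ?M) = emeasure lebesgue \<Omega>"
  using sets_dom by (simp add: emeasure_restrict_space space_restrict_space)
 then have nz: "emeasure ?M (space ?M) ~= 0"
  using vol_pos by (auto simp: measure_def)
 have ub: "?s <= ereal B" by (rule esssup_I) (use f B in auto)
 have "esssup ?M (%x. ereal 0) <= ?s" by (intro esssup_AE_mono) auto
 then have lb: "0 <= ?s" using esssup_const[OF nz, of "0::ereal"] by (simp add: zero_ereal_def)
 then show "0 <= Sn f" by (simp add: Linf_norm_def real_of_ereal_pos)
 have e: "ereal (Sn f) = ?s" unfolding Linf_norm_def using ub lb by (intro ereal_real') auto
 show "AE x in ?M. norm (f x) <= Sn f"
  using esssup_AE[of "%x. ereal (norm (f x))" ?M] by eventually_elim (simp add: e[symmetric])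
qed

section \<open>Integrals over time intervals\<close>

lemma has_integral_AE_le:
 fixes f :: "real => real"
 assumes f: "(f has_integral I) {a..b}" and c: "AE \<tau> in lebesgue_on {a..b}. f \<tau> <= c" and ab: "a <= b"
 shows "I <= (b - a) * c"
proof -
 have "AE \<tau> in lebesgue. \<tau> \<in> {a..b} --> f \<tau> <= c" using c by (simp add: AE_restrict_space_iff)
 then obtain N where N: "N \<in> null_sets lebesgue" "{\<tau>. \<not> (\<tau> \<in> {a..b} --> f \<tau> <= c)} \<subseteq> N" by (auto simp: eventually_ae_filter)
 have "((%\<tau>. min (f \<tau>) c) has_integral I) {a..b}"
 proof (rule has_integral_spike[OF _ _ f])
  show "negligible N" using N(1) by (simp add: negligible_iff_null_sets)
  show "min (f \<tau>) c = f \<tau>" if "\<tau> \<in> {a..b} - N" for \<tau> using that N(2) by (auto simp: min_def)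
 qed
 moreover have "((%\<tau>. c) has_integral (b - a) * c) {a..b}" using has_integral_const_real[of c a b] ab by simp
 ultimately show ?thesis by (rule has_integral_le) simp
qed

lemma has_integral_AE_abs_le:
 fixes f :: "real => real"
 assumes "(f has_integral I) {a..b}" "AE \<tau> in lebesgue_on {a..b}. \<bar>f \<tau>\<bar> <= c" "a <= b"
 shows "\<bar>I\<bar> <= (b - a) * c"
proof -
 have "I <= (b - a) * c" by (rule has_integral_AE_le[OF assms(1) _ assms(3)]) (use assms(2) in \<open>auto elim: eventually_mono\<close>)
 moreover have "- I <= (b - a) * c"
  by (rule has_integral_AE_le[OF has_integral_neg[OF assms(1)] _ assms(3)]) (use assms(2) in \<open>auto elim: eventually_mono\<close>)
 ultimately show ?thesis by linarith
qed

lemma has_integral_AE_cong: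
 fixes f :: "real => real"
 assumes f: "(f has_integral I) {a..b}" and c: "AE \<tau> in lebesgue_on {a..b}. g \<tau> = f \<tau>"
 shows "(g has_integral I) {a..b}"
proof -
 have "AE \<tau> in lebesgue. \<tau> \<in> {a..b} --> g \<tau> = f \<tau>" using c by (simp add: AE_restrict_space_iff)
 then obtain N where N: "N \<in> null_sets lebesgue" "{\<tau>. \<not> (\<tau> \<in> {a..b} --> g \<tau> = f \<tau>)} \<subseteq> N" by (auto simp: eventually_ae_filter)
 show ?thesis
  by (rule has_integral_spike[OF _ _ f, of N]) (use N in \<open>auto simp: negligible_iff_null_sets\<close>)
qed

lemma integrable_bounded_interval:
 fixes f :: "real => real"
 assumes "f \<in> borel_measurable (lebesgue_on {a..b})" "AE \<tau> in lebesgue_on {a..b}. \<bar>f \<tau>\<bar> <= c"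
 shows "integrable (lebesgue_on {a..b}) f"
 by (rule Bochner_Integration.integrable_bound[of _ "%_. \<bar>c\<bar>"])
  (use assms finite_measure.integrable_const[OF finite_measure_lebesgue_on[OF lmeasurable_cbox[of a b]]] in \<open>auto elim!: eventually_mono simp: cbox_interval\<close>)

text \<open>With n equal steps the recursion has factor 1 - a t1 / n, whose n-th power tends to an
  exponential, while the quadratic errors add up to O(1/n). No differentiability of Y
  enters.\<close>

lemma discrete_gronwall:
 fixes Y :: "real => real"
 assumes step: "!!s t. 0 <= s ==> s <= t ==> t <= t1 ==> Y t - Y s <= (t - s) * (B - a * Y s) + K * (t - s)\<^sup>2"
  and a: "0 < a" and B: "0 <= B" and K: "0 <= K" and t1: "0 <= t1" and Y0: "0 <= Y 0"
 shows "Y t1 <= exp (- a * t1) * Y 0 + B / a"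
proof -
 let ?d = "%n. t1 / real n"
 \<comment> \<open>The fixed point of c = q c + \<delta> (B + K \<delta>) with q = 1 - a \<delta>,
   so that it reproduces itself in the induction.\<close>
 let ?c = "%n. (B + K * ?d n) / a"
 have bd: "Y t1 <= (1 + (- a * t1) / real n) ^ n * Y 0 + ?c n" if n: "0 < n" "a * t1 <= real n" for n
 proof -
  define \<delta> where "\<delta> = t1 / real n"
  define q where "q = 1 - a * \<delta>"
  have \<delta>: "0 <= \<delta>" using t1 by (simp add: \<delta>_def)
  \<comment> \<open>Holds once n >= a t1; only then can the inductive bound be multiplied by
    q.\<close>
  have q: "0 <= q" using n by (simp add: q_def \<delta>_def field_simps)
  have "Y (real k * \<delta>) <= q ^ k * Y 0 + ?c n" if "k <= n" for k
   using that
  proof (induction k)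
   case 0
   have "0 <= ?c n" using a B K t1 by simp
   then show ?case by simp
  next
   case (Suc k)
   have k: "real (Suc k) * \<delta> <= t1"
   proof -
    have "real (Suc k) * \<delta> <= real n * \<delta>" using Suc.prems \<delta> by (intro mult_right_mono) auto
    then show ?thesis using n by (simp add: \<delta>_def)
   qed
   have "Y (real (Suc k) * \<delta>) - Y (real k * \<delta>) <= \<delta> * (B - a * Y (real k * \<delta>)) + K * \<delta>\<^sup>2"
    using step[of "real k * \<delta>" "real (Suc k) * \<delta>"] k \<delta> by (simp add: algebra_simps)
   then have "Y (real (Suc k) * \<delta>) <= q * Y (real k * \<delta>) + a * \<delta> * ?c n"
   proof -
    have "a * \<delta> * ?c n = \<delta> * (B + K * \<delta>)" using a by (simp add: \<delta>_def)
    then show ?thesis using \<open>Y (real (Suc k) * \<delta>) - Y (real k * \<delta>) <= _\<close>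
     by (simp only:) (simp add: q_def algebra_simps power2_eq_square)
   qed
   also have "... <= q * (q ^ k * Y 0 + ?c n) + a * \<delta> * ?c n"
    using Suc q by (intro add_right_mono mult_left_mono) auto
   also have "... = q ^ Suc k * Y 0 + ?c n" proof -
    have "q * (x + c) + a * \<delta> * c = q * x + c" for x c by (simp add: q_def algebra_simps)
    from this[of "q ^ k * Y 0" "?c n"] show ?thesis by (simp add: mult.assoc)
   qed
   finally show ?case .
  qed
  from this[of n] show ?thesis using n by (simp add: \<delta>_def q_def)
 qed
 have "(%n. (1 + (- a * t1) / real n) ^ n * Y 0 + ?c n) ----> exp (- a * t1) * Y 0 + (B + K * 0) / a"
  by (intro tendsto_intros tendsto_exp_limit_sequentially lim_const_over_n) (use a in auto)
 moreover have "\<forall>\<^sub>F n in sequentially. Y t1 <= (1 + (- a * t1) / real n) ^ n * Y 0 + ?c n"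
 proof -
  obtain N :: nat where N: "a * t1 <= real N" using real_arch_simple by blast
  show ?thesis using eventually_ge_at_top[of "Suc N"] by eventually_elim (use N in \<open>intro bd; simp\<close>)
 qed
 ultimately show ?thesis using tendsto_le[OF trivial_limit_sequentially _ tendsto_const] by simp
qed

section \<open>The energy estimate\<close>

text \<open>Young's inequality on a budget, with y, G, \<open>dv\<close> and \<open>ie\<close> the
  norms of the error, its gradient, its divergence and its interpolant. Of \<mu> \<open>dv\<close>^2
  one quarter each pays for the pressure and for the term with S, one half for g; half of \<beta>
  \<open>ie\<close>^2 pays for v. The other half together with viscosity yields \<gamma>/2 y^2, of
  which L y^2 <= \<gamma>/4 y^2 is consumed.\<close>

lemma energy_arith:
 fixes y :: real
 assumes D: "D <= a1 * y - \<nu> * G\<^sup>2 + (A2 * y + Gs * y\<^sup>2 + S * dv * y / 2) + P * dv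
   + (- \<mu> * dv\<^sup>2 + \<mu> * (g * dv)) + (- \<beta> * ie\<^sup>2 + \<beta> * (v * ie))"
  and c: "y\<^sup>2 <= 2 * (k * G)\<^sup>2 + 2 * ie\<^sup>2"
  and GS: "Gs + S\<^sup>2 / (4 * \<mu>) <= L / 2" and L: "0 < L" "4 * L <= \<gamma>" and \<gamma>: "\<gamma> * (2 * k\<^sup>2) <= \<nu>" "\<gamma> <= \<beta> / 2"
  and pos: "0 < \<mu>" "0 < \<beta>"
 shows "D <= - (\<gamma> / 4) * y\<^sup>2 + ((a1 + A2)\<^sup>2 / L + 2 * P\<^sup>2 / \<mu> + \<mu> * g\<^sup>2 + \<beta> * v\<^sup>2) / 2"
proof -
 have 1: "P * dv <= \<mu> / 4 * dv\<^sup>2 + P\<^sup>2 / \<mu>"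
 proof -
  have "0 <= (\<mu> * dv / 2 - P)\<^sup>2 / \<mu>" using pos by simp
  also have "... = \<mu> / 4 * dv\<^sup>2 + P\<^sup>2 / \<mu> - P * dv" using pos by (simp add: field_simps power2_eq_square)
  finally show ?thesis by simp
 qed
 have 2: "S * dv * y / 2 <= \<mu> / 4 * dv\<^sup>2 + S\<^sup>2 / (4 * \<mu>) * y\<^sup>2"
 proof -
  have "0 <= (\<mu> * dv - S * y)\<^sup>2 / (4 * \<mu>)" using pos by simp
  also have "... = \<mu> / 4 * dv\<^sup>2 + S\<^sup>2 / (4 * \<mu>) * y\<^sup>2 - S * dv * y / 2" using pos by (simp add: field_simps power2_eq_square)
  finally show ?thesis by simp
 qed
 have 3: "\<mu> * (g * dv) <= \<mu> / 2 * dv\<^sup>2 + \<mu> * g\<^sup>2 / 2"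
 proof -
  have "0 <= \<mu> / 2 * (g - dv)\<^sup>2" using pos by simp
  then show ?thesis by (simp add: field_simps power2_eq_square)
 qed
 have 4: "\<beta> * (v * ie) <= \<beta> / 2 * ie\<^sup>2 + \<beta> * v\<^sup>2 / 2"
 proof -
  have "0 <= \<beta> / 2 * (v - ie)\<^sup>2" using pos by simp
  then show ?thesis by (simp add: field_simps power2_eq_square)
 qed
 have 5: "(a1 + A2) * y <= L / 2 * y\<^sup>2 + (a1 + A2)\<^sup>2 / (2 * L)"
 proof -
  have "0 <= (L * y - (a1 + A2))\<^sup>2 / (2 * L)" using L by simp
  also have "... = L / 2 * y\<^sup>2 + (a1 + A2)\<^sup>2 / (2 * L) - (a1 + A2) * y" using L by (simp add: field_simps power2_eq_square)
  finally show ?thesis by simp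
 qed
 have 6: "(Gs + S\<^sup>2 / (4 * \<mu>)) * y\<^sup>2 <= L / 2 * y\<^sup>2" using GS by (intro mult_right_mono) auto
 have 7: "\<gamma> * (2 * k\<^sup>2) * G\<^sup>2 <= \<nu> * G\<^sup>2" using \<gamma> by (intro mult_right_mono) auto
 have 8: "\<gamma> * ie\<^sup>2 <= \<beta> / 2 * ie\<^sup>2" using \<gamma> by (intro mult_right_mono) auto
 have 9: "\<gamma> / 2 * y\<^sup>2 <= \<gamma> / 2 * (2 * (k * G)\<^sup>2 + 2 * ie\<^sup>2)" using c L by (intro mult_left_mono) auto
 have 10: "\<gamma> / 2 * (2 * (k * G)\<^sup>2 + 2 * ie\<^sup>2) = \<gamma> * (2 * k\<^sup>2) * G\<^sup>2 / 2 + \<gamma> * ie\<^sup>2" by (simp add: field_simps power_mult_distrib)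
 have 11: "L * y\<^sup>2 <= \<gamma> / 4 * y\<^sup>2" using L by (intro mult_right_mono) auto
 have 12: "0 <= \<nu> * G\<^sup>2"
  using 7 L by (intro order_trans[OF _ 7]) auto
 have "a1 * y + A2 * y = (a1 + A2) * y" "(Gs + S\<^sup>2 / (4 * \<mu>)) * y\<^sup>2 = Gs * y\<^sup>2 + S\<^sup>2 / (4 * \<mu>) * y\<^sup>2" by (simp_all add: algebra_simps)
 then have "D <= - (\<gamma> / 4) * y\<^sup>2 + ((a1 + A2)\<^sup>2 / (2 * L) + P\<^sup>2 / \<mu> + \<mu> * g\<^sup>2 / 2 + \<beta> * v\<^sup>2 / 2)"
  using D 1 2 3 4 5 6 7 8 9 10 11 12 by (simp add: field_simps)
 then show ?thesis by (simp add: add_divide_distrib)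
qed

context bounded_domain
begin

text \<open>Linearity of these integrals is not automatic: the triple products are known to be
  integrable through the bound on \<phi>.\<close>

lemma convection_diff:
 assumes a: "a \<in> LL" "b \<in> LL" and v: "v \<in> Hv 1" "w \<in> Hv 1"
  and \<phi>: "\<phi> \<in> LL" "AE x in leb. norm (\<phi> x) <= W" "0 <= W"
 shows "inn (%x. Gr v x *v (a x - b x)) \<phi> = inn (%x. Gr v x *v a x) \<phi> - inn (%x. Gr v x *v b x) \<phi>"
  and "inn (%x. Gr (%x. v x - w x) x *v a x) \<phi> = inn (%x. Gr v x *v a x) \<phi> - inn (%x. Gr w x *v a x) \<phi>"
  and "inn (%x. Dv v x *\<^sub>R (a x - b x)) \<phi> = inn (%x. Dv v x *\<^sub>R a x) \<phi> - inn (%x. Dv v x *\<^sub>R b x) \<phi>"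
  and "inn (%x. Dv (%x. v x - w x) x *\<^sub>R a x) \<phi> = inn (%x. Dv v x *\<^sub>R a x) \<phi> - inn (%x. Dv w x *\<^sub>R a x) \<phi>"
proof -
 note I = convection_bound(1)[OF _ _ \<phi>] and I' = scalar_vec_bound(1)[OF dvg_L2 _ \<phi>]
 have vw: "(%x. v x - w x) \<in> Hv 1" by (rule Hs_vec_diff) fact+
 have d: "(\<integral>x. g x \<partial>leb) = (\<integral>x. g1 x \<partial>leb) - (\<integral>x. g2 x \<partial>leb)"
  if "integrable leb g" "integrable leb g1" "integrable leb g2" "AE x in leb. g x = g1 x - g2 x" for g g1 g2 :: "real^'n => real"
  using integral_cong_AE[of g leb "%x. g1 x - g2 x"] that by simp
 have ab: "(%x. a x - b x) \<in> LL" by (rule L2_diff[OF a])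
 show "inn (%x. Gr v x *v (a x - b x)) \<phi> = inn (%x. Gr v x *v a x) \<phi> - inn (%x. Gr v x *v b x) \<phi>"
  unfolding ip_def by (rule d[OF I[OF ab v(1)] I[OF a(1) v(1)] I[OF a(2) v(1)]]) (simp add: matrix_vector_mult_diff_distrib inner_diff_left)
 show "inn (%x. Dv v x *\<^sub>R (a x - b x)) \<phi> = inn (%x. Dv v x *\<^sub>R a x) \<phi> - inn (%x. Dv v x *\<^sub>R b x) \<phi>"
  unfolding ip_def by (rule d[OF I'[OF v(1) ab] I'[OF v(1) a(1)] I'[OF v(1) a(2)]]) (simp add: scaleR_diff_right inner_diff_left)
 show "inn (%x. Gr (%x. v x - w x) x *v a x) \<phi> = inn (%x. Gr v x *v a x) \<phi> - inn (%x. Gr w x *v a x) \<phi>"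
  unfolding ip_def
  by (rule d[OF I[OF a(1) vw] I[OF a(1) v(1)] I[OF a(1) v(2)]])
   (use grad_diff[OF v] in eventually_elim, simp add: matrix_vector_mult_diff_rdistrib inner_diff_left)
 show "inn (%x. Dv (%x. v x - w x) x *\<^sub>R a x) \<phi> = inn (%x. Dv v x *\<^sub>R a x) \<phi> - inn (%x. Dv w x *\<^sub>R a x) \<phi>"
  unfolding ip_def
  by (rule d[OF I'[OF vw a(1)] I'[OF v(1) a(1)] I'[OF v(2) a(1)]])
   (use dvg_diff[OF v] in eventually_elim, simp add: left_diff_distrib)
qed

text \<open>The divergence of a field in H^1_0 has mean zero, so any constant may be added to p
  before applying Cauchy-Schwarz. A vanishing divergence is split off because the infimum is taken
  after a division.\<close>

lemma quot_norm_pressure: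
 assumes p: "p \<in> LL" and \<phi>: "\<phi> \<in> H0v"
 shows "\<bar>inn p (Dv \<phi>)\<bar> <= qn 0 p * nrm2 (Dv \<phi>)"
proof (cases "nrm2 (Dv \<phi>) = 0")
 case True
 then show ?thesis using ip_CS[OF p dvg_L2[OF H10_vec_H1[OF \<phi>]]] by simp
next
 case False
 let ?d = "nrm2 (Dv \<phi>)"
 have d: "0 < ?d" using False L2_norm_nonneg[of \<Omega> "Dv \<phi>"] by linarith
 have "\<bar>inn p (Dv \<phi>)\<bar> / ?d <= qn 0 p"
  unfolding quot_norm_def
 proof (rule cINF_greatest)
  fix c :: real
  have pc: "(%x. p x + c) \<in> LL" by (rule L2_add[OF p const_L2])
  have "inn (%x. p x + c) (Dv \<phi>) = inn p (Dv \<phi>)"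
   using ip_add[OF p const_L2 dvg_L2[OF H10_vec_H1[OF \<phi>]], of c] dvg_mean_zero[OF \<phi>, of c] by simp
  then have "\<bar>inn p (Dv \<phi>)\<bar> <= Hsn 0 (%x. p x + c) * ?d"
   using ip_CS[OF pc dvg_L2[OF H10_vec_H1[OF \<phi>]]] Hs_norm_0[OF pc] by simp
  then show "\<bar>inn p (Dv \<phi>)\<bar> / ?d <= Hsn 0 (%x. p x + c)" using d by (simp add: field_simps)
 qed simp
 then show ?thesis using d by (simp add: field_simps)
qed

end

text \<open>The problem frozen at one time. The derivatives \<open>ut\<close> and \<open>uh'\<close>
  enter as mere functions, so everything proved here is stationary and can be used at almost every
  time.\<close>

locale nudged_step = mesh_domain \<Omega> \<sigma> h T for \<Omega> :: "(real^'n::finite) set" and \<sigma> h T +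
 fixes r :: nat and \<nu> \<mu> \<beta> c\<^sub>0 c\<^sub>I H :: real and IH :: "(real^'n => real^'n) => real^'n => real^'n"
  and u ut f s sd uh uh' :: "real^'n => real^'n" and p q :: "real^'n => real"
 assumes coarse: "coarse_interpolation c\<^sub>0 c\<^sub>I H \<Omega> IH"
  and pos: "0 < \<nu>" "0 < \<mu>" "0 < \<beta>" "0 < H" "0 < c\<^sub>I" "0 < c\<^sub>0" and r2: "2 <= r"
  and u2: "u \<in> Hv 2" and u_df: "u \<in> div_free \<Omega>" and p1: "p \<in> HS 1" and ut1: "ut \<in> Hv 1" and fL: "f \<in> LL"
  and momentum: "AE x in leb. ut x - \<nu> *\<^sub>R laplacian \<Omega> u x + Gr u x *v u x + sgrad \<Omega> p x = f x"
  and s_proj: "stokes_projection \<Omega> T r u s" and sd_proj: "stokes_projection \<Omega> T r ut sd" and q_proj: "L2_projection \<Omega> (QH r) p q"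
  and uhV: "uh \<in> VH r" and uh'V: "uh' \<in> VH r"
  and galerkin: "!!\<phi>. \<phi> \<in> VH r ==> inn uh' \<phi> + \<nu> * inn (Gr uh) (Gr \<phi>) + b3 uh uh \<phi>
      + \<mu> * inn (Dv uh) (Dv \<phi>) = inn f \<phi> - \<beta> * inn (%x. IH uh x - IH u x) (IH \<phi>)"
begin

abbreviation "e \<equiv> (%x. uh x - s x)"
abbreviation "w \<equiv> (%x. u x - s x)"
abbreviation "Dt \<phi> \<equiv> inn uh' \<phi> - inn sd \<phi>"

lemma sV: "s \<in> VH r" and sdV: "sd \<in> VH r"
 using s_proj sd_proj by (auto simp: stokes_projection_def)

lemma eV: "e \<in> VH r"
 using Vh_lin[OF uhV sV, of 1 "-1"] by simp

lemma u10: "u \<in> H0v" using u_df by (simp add: div_free_def)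
lemma u1: "u \<in> Hv 1" by (rule H10_vec_H1[OF u10])
lemma w1: "w \<in> Hv 1" by (rule Hs_vec_diff[OF u1 Vh_H1[OF sV]])

lemma L2s [simp]: "u \<in> LL" "s \<in> LL" "uh \<in> LL" "sd \<in> LL" "ut \<in> LL" "p \<in> LL" "q \<in> LL" "e \<in> LL" "w \<in> LL"
 using Vh_L2 sV sdV uhV eV Hs_vec_L2[OF u1] Hs_vec_L2[OF ut1] Hs_vec_L2[OF w1] Hs_L2[OF p1] Qh_L2 q_proj by (auto simp: L2_projection_def)

text \<open>The momentum equation tested with \<phi> is compared with the Galerkin equation, and the
  projection of \<open>ut\<close> is subtracted on both sides.\<close>

lemma error_identity:
 assumes \<phi>: "\<phi> \<in> VH r"
 shows "Dt \<phi> = inn (%x. ut x - sd x) \<phi> - \<nu> * gip e \<phi> + (inn (%x. Gr u x *v u x) \<phi> - b3 uh uh \<phi>)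
  - inn p (Dv \<phi>) - \<mu> * inn (Dv uh) (Dv \<phi>) - \<beta> * inn (%x. IH uh x - IH u x) (IH \<phi>)"
proof -
 let ?c = "%x. Gr u x *v u x"
 have \<phi>L: "\<phi> \<in> LL" and \<phi>1: "\<phi> \<in> Hv 1" and \<phi>10: "\<phi> \<in> H0v" using Vh_L2 Vh_H1 Vh_H10 \<phi> by auto
 note lap = laplacian_ibp[OF u2 \<phi>10] and sg = sgrad_ibp[OF p1 \<phi>10]
 have nl: "(%x. \<nu> *\<^sub>R laplacian \<Omega> u x) \<in> LL" by (rule L2_scaleR[OF lap(1)])
 have a: "(%x. ut x - \<nu> *\<^sub>R laplacian \<Omega> u x) \<in> LL" by (intro L2_diff nl) simp
 have b: "(%x. ut x - \<nu> *\<^sub>R laplacian \<Omega> u x + sgrad \<Omega> p x) \<in> LL" by (intro L2_add a sg)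
 \<comment> \<open>Square integrability of the convection term is read off from the equation, whose
   other terms are square integrable; no embedding is used.\<close>
 have c: "?c \<in> LL"
 proof (rule L2_AE_cong[OF L2_diff[OF fL b] sets_dom])
  show "AE x in leb. f x - (ut x - \<nu> *\<^sub>R laplacian \<Omega> u x + sgrad \<Omega> p x) = ?c x"
   using momentum by eventually_elim (auto simp: algebra_simps)
 qed
 have "inn f \<phi> = inn (%x. (ut x - \<nu> *\<^sub>R laplacian \<Omega> u x + sgrad \<Omega> p x) + ?c x) \<phi>"
 proof (rule ip_AE_cong)
  show "AE x in leb. f x = (ut x - \<nu> *\<^sub>R laplacian \<Omega> u x + sgrad \<Omega> p x) + ?c x"
   using momentum by eventually_elim (auto simp: algebra_simps)
 qed (use fL \<phi>L sets_dom in auto)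
 also have "... = inn ut \<phi> - \<nu> * inn (laplacian \<Omega> u) \<phi> + inn (sgrad \<Omega> p) \<phi> + inn ?c \<phi>"
  by (simp add: ip_add[OF b c \<phi>L] ip_add[OF a sg(1) \<phi>L] ip_diff[OF L2s(5) nl \<phi>L] ip_scaleR[OF lap(1) \<phi>L])
 finally have fe: "inn f \<phi> = inn ut \<phi> + \<nu> * gip u \<phi> - inn p (Dv \<phi>) + inn ?c \<phi>"
  using lap(2) sg(2) by simp
 \<comment> \<open>The Stokes projection removes the viscous consistency error, so no term with
   \<nu> and w remains.\<close>
 have "gip u \<phi> = gip s \<phi>" using s_proj \<phi> by (simp add: stokes_projection_def)
 moreover have "\<nu> * gip e \<phi> = \<nu> * gip uh \<phi> - \<nu> * gip s \<phi>"
  using gip_lin[OF Vh_H1[OF uhV] Vh_H1[OF sV] \<phi>1, of 1 "-1"] by (simp add: right_diff_distrib)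
 moreover have "inn (%x. ut x - sd x) \<phi> = inn ut \<phi> - inn sd \<phi>" by (rule ip_diff) (use \<phi>L in auto)
 ultimately show ?thesis using galerkin[OF \<phi>] fe by simp
qed

context
 fixes \<kappa> S G :: real
 assumes sup_Vh: "!!\<phi>. \<phi> \<in> VH r ==> AE x in leb. norm (\<phi> x) <= \<kappa> * nrm2 \<phi>" and \<kappa>: "0 <= \<kappa>"
  and S: "AE x in leb. norm (s x) <= S" "0 <= S"
  and G: "AE x in leb. norm (Gr s x) <= G" "0 <= G"
begin

text \<open>The coefficient of the norm of \<phi> in the convective consistency error: the gradient
  of s acting on w, the gradient of w acting on s together with half the divergence of w, and the
  part quadratic in w.\<close>

abbreviation "A2 \<equiv> G * nrm2 w + (1 + real CARD('n) / 2) * S * nrm2 (Gr w) + \<kappa> * nrm2 w * nrm2 (Gr w)"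

lemma matrix_bounded:
 assumes a: "a \<in> LL" and \<phi>: "\<phi> \<in> LL"
 shows "\<bar>inn (%x. Gr s x *v a x) \<phi>\<bar> <= G * (nrm2 a * nrm2 \<phi>)"
proof -
 have "(%x. (Gr s x *v a x) \<bullet> \<phi> x) \<in> bm"
  by (intro borel_measurable_inner matrix_vector_measurable L2_measurable grad_L2[OF Vh_H1[OF sV]] a \<phi>)
 from trilinear_bound(2)[OF this a \<phi> G] show ?thesis
  using matrix_vector_inner_le[of "Gr s _" "a _" "\<phi> _"] by (simp add: ip_def mult_ac)
qed

lemma sv_bounded:
 assumes g: "g \<in> LL" and \<phi>: "\<phi> \<in> LL"
 shows "\<bar>inn (%x. g x *\<^sub>R s x) \<phi>\<bar> <= S * (nrm2 g * nrm2 \<phi>)"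
proof -
 have "\<bar>inn (%x. g x *\<^sub>R s x) \<phi>\<bar> = \<bar>inn (%x. g x *\<^sub>R \<phi> x) s\<bar>" by (simp add: ip_def inner_commute)
 also have "... <= S * (nrm2 g * nrm2 \<phi>)" by (rule scalar_vec_bound(2)[OF g \<phi> _ S]) simp
 finally show ?thesis .
qed

lemma gs_bounded:
 assumes v: "v \<in> Hv 1" and \<phi>: "\<phi> \<in> LL"
 shows "\<bar>inn (%x. Gr v x *v s x) \<phi>\<bar> <= S * (nrm2 (Gr v) * nrm2 \<phi>)"
proof -
 have "(%x. (Gr v x *v s x) \<bullet> \<phi> x) \<in> bm"
  by (intro borel_measurable_inner matrix_vector_measurable L2_measurable grad_L2 v \<phi>) simp
 from trilinear_bound(2)[OF this grad_L2[OF v] \<phi> S] show ?thesis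
  using matrix_vector_inner_le[of "Gr v _" "s _" "\<phi> _"] by (simp add: ip_def mult_ac)
qed

text \<open>Substituting \<open>uh\<close> = s + e collapses the three discrete forms to the form at
  (s, s), so only u and s remain. Expanding u = s + w then leaves terms containing w, in which s
  appears with its supremum norms.\<close>

lemma nonlinear_split:
 assumes \<phi>: "\<phi> \<in> VH r"
 shows "\<bar>inn (%x. Gr u x *v u x) \<phi> - b3 uh uh \<phi> + b3 e s \<phi> + b3 uh e \<phi>\<bar> <= A2 * nrm2 \<phi>"
proof -
 have \<phi>L: "\<phi> \<in> LL" by (rule Vh_L2[OF \<phi>])
 let ?W = "\<kappa> * nrm2 \<phi>"
 have W: "0 <= ?W" using \<kappa> by simp
 note C = convection_diff[OF _ _ _ _ \<phi>L sup_Vh[OF \<phi>] W]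
 note h1 = u1 Vh_H1[OF sV] Vh_H1[OF uhV] w1 Vh_H1[OF eV]
 let ?C = "%v a. inn (%x. Gr v x *v a x) \<phi>" and ?d = "%v a. inn (%x. Dv v x *\<^sub>R a x) \<phi>"
 \<comment> \<open>As u is divergence free, the divergence of s is minus that of w; this turns the
   half divergence term at (s, s) into a term that is small.\<close>
 have du: "?d u s = 0"
 proof -
  have "AE x in leb. (Dv u x *\<^sub>R s x) \<bullet> \<phi> x = 0"
   using u_df by (auto simp: div_free_def elim!: eventually_mono)
  then show ?thesis unfolding ip_def by (rule integral_eq_zero_AE)
 qed
 have "?C s w = ?C s u - ?C s s" "?C w s = ?C u s - ?C s s" "?C w w = ?C w u - ?C w s" "?C w u = ?C u u - ?C s u"
  "?d w s = ?d u s - ?d s s" "?C s e = ?C s uh - ?C s s" "?d e s = ?d uh s - ?d s s" "?C e uh = ?C uh uh - ?C s uh" "?d uh e = ?d uh uh - ?d uh s"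
  by (rule C(1)[OF _ _ h1(2) h1(2)] C(2)[OF _ _ h1(1,2), of s s] C(1)[OF _ _ h1(4) h1(4)] C(2)[OF _ _ h1(1,2), of u u] C(4)[OF _ _ h1(1,2), of s s]
    C(4)[OF _ _ h1(3,2), of s s] C(2)[OF _ _ h1(3,2), of uh uh] C(3)[OF _ _ h1(3) h1(3)]; simp)+
 then have eq: "inn (%x. Gr u x *v u x) \<phi> - b3 uh uh \<phi> + b3 e s \<phi> + b3 uh e \<phi> = ?C s w + ?C w s + ?C w w + ?d w s / 2"
  unfolding bh_def using du by linarith
 have "\<bar>?C s w\<bar> <= G * (nrm2 w * nrm2 \<phi>)" by (rule matrix_bounded) (use \<phi>L in auto)
 moreover have "\<bar>?C w s\<bar> <= S * (nrm2 (Gr w) * nrm2 \<phi>)" by (rule gs_bounded[OF w1 \<phi>L])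
 moreover have "\<bar>?C w w\<bar> <= ?W * (nrm2 (Gr w) * nrm2 w)"
  by (rule convection_bound(2)[OF _ w1 \<phi>L sup_Vh[OF \<phi>] W]) simp
 moreover have "\<bar>?d w s\<bar> <= S * (real CARD('n) * nrm2 (Gr w) * nrm2 \<phi>)"
 proof -
  have "\<bar>?d w s\<bar> <= S * (nrm2 (Dv w) * nrm2 \<phi>)" by (rule sv_bounded[OF dvg_L2[OF w1] \<phi>L])
  also have "... <= S * (real CARD('n) * nrm2 (Gr w) * nrm2 \<phi>)"
   by (intro mult_left_mono mult_right_mono dvg_norm_le w1 S) simp
  finally show ?thesis .
 qed
 ultimately show ?thesis unfolding eq by (simp add: algebra_simps)
qed

text \<open>Fields in \<open>Vh\<close> are discretely divergence free, so the projection q can be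
  subtracted from p at no cost.\<close>

lemma pressure_bound:
 assumes \<phi>: "\<phi> \<in> VH r"
 shows "\<bar>inn p (Dv \<phi>)\<bar> <= qn 0 (%x. p x - q x) * nrm2 (Dv \<phi>)"
proof -
 have "inn q (Dv \<phi>) = 0" using \<phi> q_proj by (simp add: Vh_def L2_projection_def)
 then have "inn p (Dv \<phi>) = inn (%x. p x - q x) (Dv \<phi>)"
  using ip_diff[OF L2s(6,7) dvg_L2[OF Vh_H1[OF \<phi>]]] by simp
 then show ?thesis using quot_norm_pressure[OF L2_diff[OF L2s(6,7)] Vh_H10[OF \<phi>]] by simp
qed

text \<open>The error tested with itself. Viscosity is used only through the lower bound it provides
  jointly with nudging, so no power of \<nu> appears on the right.\<close>

lemma energy_estimate:
 assumes GS: "G + S\<^sup>2 / (4 * \<mu>) <= L / 2" and L: "0 < L" "4 * L <= \<gamma>"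
  and \<gamma>: "\<gamma> * (2 * (c\<^sub>I * H)\<^sup>2) <= \<nu>" "\<gamma> <= \<beta> / 2"
 shows "Dt e <= - (\<gamma> / 4) * (nrm2 e)\<^sup>2 + ((nrm2 (%x. ut x - sd x) + A2)\<^sup>2 / L
  + 2 * (qn 0 (%x. p x - q x))\<^sup>2 / \<mu> + \<mu> * (real CARD('n) * nrm2 (Gr w))\<^sup>2 + \<beta> * (c\<^sub>0 * nrm2 w)\<^sup>2) / 2"
proof (rule energy_arith[OF _ _ GS L \<gamma> pos(2,3)])
 have e1: "e \<in> Hv 1" by (rule Vh_H1[OF eV])
 have IL: "IH e \<in> LL" "IH w \<in> LL" "IH uh \<in> LL" "IH u \<in> LL" "IH s \<in> LL"
  using coarse by (simp_all add: coarse_interpolation_def)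
 have Il: "AE x in leb. IH (%x. v x - z x) x = IH v x - IH z x" if "v \<in> LL" "z \<in> LL" for v z
 proof -
  have "AE x in leb. IH (%x. 1 *\<^sub>R v x + (-1) *\<^sub>R z x) x = 1 *\<^sub>R IH v x + (-1) *\<^sub>R IH z x"
   using coarse that unfolding coarse_interpolation_def by blast
  then show ?thesis by simp
 qed
 \<comment> \<open>What the coarse interpolant misses of e is controlled by its gradient, with the
   factor \<open>c\<^sub>I * H\<close>.\<close>
 show "(nrm2 e)\<^sup>2 <= 2 * (c\<^sub>I * H * nrm2 (Gr e))\<^sup>2 + 2 * (nrm2 (IH e))\<^sup>2"
 proof -
  let ?a = "nrm2 (%x. e x - IH e x)"
  have "nrm2 (%x. (e x - IH e x) + IH e x) <= ?a + nrm2 (IH e)"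
   by (rule L2_norm_triangle) (intro L2_diff IL L2s)+
  then have "nrm2 e <= ?a + nrm2 (IH e)" by simp
  also have "?a <= c\<^sub>I * H * nrm2 (Gr e)"
  proof -
   have "\<forall>v\<in>H0v. nrm2 (%x. v x - IH v x) <= c\<^sub>I * H * nrm2 (Gr v)"
    using coarse by (simp add: coarse_interpolation_def)
   from bspec[OF this Vh_H10[OF eV]] show ?thesis .
  qed
  finally have "(nrm2 e)\<^sup>2 <= (c\<^sub>I * H * nrm2 (Gr e) + nrm2 (IH e))\<^sup>2" by (intro power_mono) auto
  also have "... <= 2 * (c\<^sub>I * H * nrm2 (Gr e))\<^sup>2 + 2 * (nrm2 (IH e))\<^sup>2"
   using sum_squares_bound[of "c\<^sub>I * H * nrm2 (Gr e)" "nrm2 (IH e)"] by (simp add: power2_sum)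
  finally show ?thesis .
 qed
 have t1: "inn (%x. ut x - sd x) e <= nrm2 (%x. ut x - sd x) * nrm2 e"
  using ip_CS[OF L2_diff[OF L2s(5,4)] L2s(8)] by linarith
 have t2: "gip e e = (nrm2 (Gr e))\<^sup>2" by (simp add: L2_norm_sq)
 have t3: "inn (%x. Gr u x *v u x) e - b3 uh uh e
   <= A2 * nrm2 e + G * (nrm2 e)\<^sup>2 + S * nrm2 (Dv e) * nrm2 e / 2"
 proof -
  have "b3 uh e e = 0"
   by (rule bh_skew[OF Vh_H10[OF uhV] Vh_H10[OF eV] sup_Vh[OF eV]]) (use \<kappa> in simp)
  moreover have "\<bar>b3 e s e\<bar> <= G * (nrm2 e)\<^sup>2 + S * nrm2 (Dv e) * nrm2 e / 2"
   using matrix_bounded[OF L2s(8,8)] sv_bounded[OF dvg_L2[OF e1] L2s(8)] unfolding bh_def by (simp add: power2_eq_square mult.assoc)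
  ultimately show ?thesis using nonlinear_split[OF eV] by linarith
 qed
 have t4: "- inn p (Dv e) <= qn 0 (%x. p x - q x) * nrm2 (Dv e)"
  using pressure_bound[OF eV] by linarith
 have t5: "- (\<mu> * inn (Dv uh) (Dv e)) <= - \<mu> * (nrm2 (Dv e))\<^sup>2 + \<mu> * (real CARD('n) * nrm2 (Gr w) * nrm2 (Dv e))"
 proof -
  have dL: "Dv e \<in> LL" "Dv w \<in> LL" "Dv uh \<in> LL" by (intro dvg_L2 e1 w1 Vh_H1[OF uhV])+
  \<comment> \<open>Since div u = 0, div s = - div w almost everywhere.\<close>
  have "AE x in leb. Dv uh x = Dv e x - Dv w x"
   using dvg_diff[OF Vh_H1[OF uhV] Vh_H1[OF sV]] dvg_diff[OF u1 Vh_H1[OF sV]] u_df[unfolded div_free_def, simplified, THEN conjunct2]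
   by eventually_elim simp
  then have "inn (Dv uh) (Dv e) = inn (%x. Dv e x - Dv w x) (Dv e)"
   by (rule ip_AE_cong) (use dL sets_dom in auto)
  also have "... = (nrm2 (Dv e))\<^sup>2 - inn (Dv w) (Dv e)"
   by (simp add: ip_diff[OF dL(1,2,1)] L2_norm_sq)
  finally have 1: "inn (Dv uh) (Dv e) = (nrm2 (Dv e))\<^sup>2 - inn (Dv w) (Dv e)" .
  have "\<bar>inn (Dv w) (Dv e)\<bar> <= nrm2 (Dv w) * nrm2 (Dv e)" by (rule ip_CS[OF dL(2,1)])
  also have "... <= (real CARD('n) * nrm2 (Gr w)) * nrm2 (Dv e)" by (intro mult_right_mono dvg_norm_le w1) simp
  finally have "\<mu> * inn (Dv w) (Dv e) <= \<mu> * (real CARD('n) * nrm2 (Gr w) * nrm2 (Dv e))"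
   using pos by (intro mult_left_mono) auto
  then show ?thesis unfolding 1 by (simp add: algebra_simps)
 qed
 have t6: "- (\<beta> * inn (%x. IH uh x - IH u x) (IH e)) <= - \<beta> * (nrm2 (IH e))\<^sup>2 + \<beta> * (c\<^sub>0 * nrm2 w * nrm2 (IH e))"
 proof -
  have "AE x in leb. IH uh x - IH u x = IH e x - IH w x"
   using Il[OF L2s(3,2)] Il[OF L2s(1,2)] by eventually_elim simp
  then have "inn (%x. IH uh x - IH u x) (IH e) = inn (%x. IH e x - IH w x) (IH e)"
   by (rule ip_AE_cong) (use IL sets_dom in \<open>auto intro: L2_diff\<close>)
  also have "... = (nrm2 (IH e))\<^sup>2 - inn (IH w) (IH e)"
   by (simp add: ip_diff[OF IL(1,2,1)] L2_norm_sq)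
  finally have 1: "inn (%x. IH uh x - IH u x) (IH e) = (nrm2 (IH e))\<^sup>2 - inn (IH w) (IH e)" .
  have "\<bar>inn (IH w) (IH e)\<bar> <= nrm2 (IH w) * nrm2 (IH e)" by (rule ip_CS[OF IL(2,1)])
  also have "... <= (c\<^sub>0 * nrm2 w) * nrm2 (IH e)"
   using coarse by (intro mult_right_mono) (simp_all add: coarse_interpolation_def)
  finally have "\<beta> * inn (IH w) (IH e) <= \<beta> * (c\<^sub>0 * nrm2 w * nrm2 (IH e))"
   using pos by (intro mult_left_mono) auto
  then show ?thesis unfolding 1 by (simp add: algebra_simps)
 qed
 show "Dt e <= nrm2 (%x. ut x - sd x) * nrm2 e - \<nu> * (nrm2 (Gr e))\<^sup>2
   + (A2 * nrm2 e + G * (nrm2 e)\<^sup>2 + S * nrm2 (Dv e) * nrm2 e / 2)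
   + qn 0 (%x. p x - q x) * nrm2 (Dv e)
   + (- \<mu> * (nrm2 (Dv e))\<^sup>2 + \<mu> * (real CARD('n) * nrm2 (Gr w) * nrm2 (Dv e)))
   + (- \<beta> * (nrm2 (IH e))\<^sup>2 + \<beta> * (c\<^sub>0 * nrm2 w * nrm2 (IH e)))"
  unfolding error_identity[OF eV] t2 using t1 t3 t4 t5 t6 by linarith
qed

text \<open>Only the linear dependence on the norm of \<phi> matters; it will make the error
  Lipschitz in time. Inverse bounds are therefore applied freely, with a constant M depending on the
  mesh.\<close>

lemma crude_bound:
 assumes \<phi>: "\<phi> \<in> VH r" and M: "!!\<phi>. \<phi> \<in> VH r ==> nrm2 (Gr \<phi>) <= M * nrm2 \<phi>" "0 <= M"
  and Q: "nrm2 (%x. ut x - sd x) <= Q" "A2 <= Q" "qn 0 (%x. p x - q x) <= Q"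
   "nrm2 s <= Q" "nrm2 uh <= Q" "nrm2 u <= Q"
 shows "\<bar>Dt \<phi>\<bar> <= (Q + \<nu> * (M * (2 * Q) * M) + (Q + \<kappa> * (M * ((2 + real CARD('n)) * Q\<^sup>2)) * 2) + Q * (real CARD('n) * M) + \<mu> * (real CARD('n) * M * Q * (real CARD('n) * M)) + \<beta> * (c\<^sub>0 * (2 * Q) * c\<^sub>0)) * nrm2 \<phi>"
proof -
 have Q0: "0 <= Q" using Q(4) L2_norm_nonneg[of \<Omega> s] by linarith
 let ?y = "nrm2 \<phi>"
 have y: "0 <= ?y" by simp
 have \<phi>L: "\<phi> \<in> LL" by (rule Vh_L2[OF \<phi>])
 have eQ: "nrm2 e <= 2 * Q" using L2_norm_diff_triangle[OF L2s(3,2)] Q by linarith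
 have g: "nrm2 (Gr v) <= M * B" if "v \<in> VH r" "nrm2 v <= B" for v B
  using M(1)[OF that(1)] mult_left_mono[OF that(2) M(2)] by linarith
 have d: "nrm2 (Dv v) <= real CARD('n) * (M * B)" if "v \<in> VH r" "nrm2 v <= B" for v B
  using dvg_norm_le[OF Vh_H1[OF that(1)]] mult_left_mono[OF g[OF that], of "real CARD('n)"] by linarith
 have IL: "IH \<phi> \<in> LL" "IH uh \<in> LL" "IH u \<in> LL"
  using coarse \<phi>L by (simp_all add: coarse_interpolation_def)
 have t1: "\<bar>inn (%x. ut x - sd x) \<phi>\<bar> <= Q * ?y"
  using ip_CS[OF L2_diff[OF L2s(5,4)] \<phi>L] mult_right_mono[OF Q(1) y] by linarith
 have t2: "\<bar>\<nu> * gip e \<phi>\<bar> <= \<nu> * (M * (2 * Q) * M) * ?y"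
 proof -
  have "\<bar>gip e \<phi>\<bar> <= nrm2 (Gr e) * nrm2 (Gr \<phi>)" by (intro ip_CS grad_L2 Vh_H1[OF eV] Vh_H1[OF \<phi>])
  also have "... <= (M * (2 * Q)) * (M * ?y)" using M Q0 by (intro mult_mono g eV \<phi> eQ) auto
  finally have "\<nu> * \<bar>gip e \<phi>\<bar> <= \<nu> * ((M * (2 * Q)) * (M * ?y))" using pos by (intro mult_left_mono) auto
  then show ?thesis using pos by (simp add: abs_mult mult_ac)
 qed
 \<comment> \<open>Prescribing the product \<open>A * B\<close> lets one bound cover both forms, in
   which Q and 2 Q change places.\<close>
 have b: "\<bar>b3 a v \<phi>\<bar> <= \<kappa> * (M * ((2 + real CARD('n)) * Q\<^sup>2)) * ?y"
  if a: "a \<in> VH r" and v: "v \<in> VH r" and AB: "nrm2 a <= A" "nrm2 v <= B" "A * B = 2 * Q\<^sup>2" "0 <= A" "0 <= B" for a v A B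
 proof -
  let ?W = "\<kappa> * ?y"
  have W: "0 <= ?W" using \<kappa> by simp
  have "\<bar>inn (%x. Gr v x *v a x) \<phi>\<bar> <= ?W * (nrm2 (Gr v) * nrm2 a)"
   by (rule convection_bound(2)[OF Vh_L2[OF a] Vh_H1[OF v] \<phi>L sup_Vh[OF \<phi>] W])
  also have "... <= ?W * ((M * B) * A)" using M AB W by (intro mult_left_mono mult_mono g v AB) auto
  finally have 1: "\<bar>inn (%x. Gr v x *v a x) \<phi>\<bar> <= ?W * (M * (A * B))" by (simp add: mult_ac)
  have "\<bar>inn (%x. Dv a x *\<^sub>R v x) \<phi>\<bar> <= ?W * (nrm2 (Dv a) * nrm2 v)"
   by (rule scalar_vec_bound(2)[OF dvg_L2[OF Vh_H1[OF a]] Vh_L2[OF v] \<phi>L sup_Vh[OF \<phi>] W])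
  also have "... <= ?W * ((real CARD('n) * (M * A)) * B)" using M AB W by (intro mult_left_mono mult_mono d a AB) auto
  finally have "\<bar>inn (%x. Dv a x *\<^sub>R v x) \<phi>\<bar> <= ?W * (real CARD('n) * M * (A * B))" by (simp add: mult_ac)
  with 1 have "\<bar>b3 a v \<phi>\<bar> <= ?W * (M * (A * B)) + ?W * (real CARD('n) * M * (A * B)) / 2" unfolding bh_def by linarith
  also have "... = \<kappa> * (M * ((2 + real CARD('n)) * Q\<^sup>2)) * ?y" unfolding AB(3) by (simp add: field_simps)
  finally show ?thesis .
 qed
 have t3: "\<bar>inn (%x. Gr u x *v u x) \<phi> - b3 uh uh \<phi>\<bar> <= (Q + \<kappa> * (M * ((2 + real CARD('n)) * Q\<^sup>2)) * 2) * ?y"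
 proof -
  have "\<bar>b3 e s \<phi>\<bar> <= \<kappa> * (M * ((2 + real CARD('n)) * Q\<^sup>2)) * ?y" by (rule b[OF eV sV eQ Q(4)]) (use Q0 in \<open>auto simp: power2_eq_square\<close>)
  moreover have "\<bar>b3 uh e \<phi>\<bar> <= \<kappa> * (M * ((2 + real CARD('n)) * Q\<^sup>2)) * ?y" by (rule b[OF uhV eV Q(5) eQ]) (use Q0 in \<open>auto simp: power2_eq_square\<close>)
  moreover note nonlinear_split[OF \<phi>] mult_right_mono[OF Q(2) y]
  ultimately have "\<bar>inn (%x. Gr u x *v u x) \<phi> - b3 uh uh \<phi>\<bar> <= Q * ?y + 2 * (\<kappa> * (M * ((2 + real CARD('n)) * Q\<^sup>2)) * ?y)" by linarith
  then show ?thesis by (simp add: algebra_simps)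
 qed
 have t4: "\<bar>inn p (Dv \<phi>)\<bar> <= Q * (real CARD('n) * M) * ?y"
 proof -
  have "\<bar>inn p (Dv \<phi>)\<bar> <= qn 0 (%x. p x - q x) * nrm2 (Dv \<phi>)" by (rule pressure_bound[OF \<phi>])
  also have "... <= Q * (real CARD('n) * (M * ?y))" using Q0 by (intro mult_mono Q d \<phi>) auto
  finally show ?thesis by (simp add: mult_ac)
 qed
 have t5: "\<bar>\<mu> * inn (Dv uh) (Dv \<phi>)\<bar> <= \<mu> * (real CARD('n) * M * Q * (real CARD('n) * M)) * ?y"
 proof -
  have "\<bar>inn (Dv uh) (Dv \<phi>)\<bar> <= nrm2 (Dv uh) * nrm2 (Dv \<phi>)" by (intro ip_CS dvg_L2 Vh_H1[OF uhV] Vh_H1[OF \<phi>])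
  also have "... <= (real CARD('n) * (M * Q)) * (real CARD('n) * (M * ?y))" using M Q0 by (intro mult_mono d uhV \<phi> Q) auto
  finally have "\<mu> * \<bar>inn (Dv uh) (Dv \<phi>)\<bar> <= \<mu> * ((real CARD('n) * (M * Q)) * (real CARD('n) * (M * ?y)))" using pos by (intro mult_left_mono) auto
  then show ?thesis using pos by (simp add: abs_mult mult_ac)
 qed
 have t6: "\<bar>\<beta> * inn (%x. IH uh x - IH u x) (IH \<phi>)\<bar> <= \<beta> * (c\<^sub>0 * (2 * Q) * c\<^sub>0) * ?y"
 proof -
  have I: "nrm2 (IH v) <= c\<^sub>0 * nrm2 v" if "v \<in> LL" for v using coarse that by (simp add: coarse_interpolation_def)
  have "nrm2 (%x. IH uh x - IH u x) <= c\<^sub>0 * (2 * Q)"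
  proof -
   have "c\<^sub>0 * nrm2 uh <= c\<^sub>0 * Q" "c\<^sub>0 * nrm2 u <= c\<^sub>0 * Q" using Q(5,6) pos(6) by simp_all
   moreover have "c\<^sub>0 * (2 * Q) = c\<^sub>0 * Q + c\<^sub>0 * Q" by simp
   ultimately show ?thesis using L2_norm_diff_triangle[OF IL(2,3)] I[OF L2s(3)] I[OF L2s(1)] by linarith
  qed
  then have "nrm2 (%x. IH uh x - IH u x) * nrm2 (IH \<phi>) <= (c\<^sub>0 * (2 * Q)) * (c\<^sub>0 * ?y)"
   using pos Q0 by (intro mult_mono I \<phi>L) auto
  with ip_CS[OF L2_diff[OF IL(2,3)] IL(1)]
  have "\<bar>inn (%x. IH uh x - IH u x) (IH \<phi>)\<bar> <= (c\<^sub>0 * (2 * Q)) * (c\<^sub>0 * ?y)" by linarith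
  then have "\<beta> * \<bar>inn (%x. IH uh x - IH u x) (IH \<phi>)\<bar> <= \<beta> * ((c\<^sub>0 * (2 * Q)) * (c\<^sub>0 * ?y))" using pos by (intro mult_left_mono) auto
  then show ?thesis using pos by (simp add: abs_mult mult_ac)
 qed
 have "\<bar>Dt \<phi>\<bar> <= Q * ?y + \<nu> * (M * (2 * Q) * M) * ?y + (Q + \<kappa> * (M * ((2 + real CARD('n)) * Q\<^sup>2)) * 2) * ?y + Q * (real CARD('n) * M) * ?y
  + \<mu> * (real CARD('n) * M * Q * (real CARD('n) * M)) * ?y + \<beta> * (c\<^sub>0 * (2 * Q) * c\<^sub>0) * ?y"
  unfolding error_identity[OF \<phi>] using t1 t2 t3 t4 t5 t6 by linarith
 then show ?thesis by (simp only: distrib_right)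
qed

end

end

section \<open>Evolution of the Stokes projection\<close>

lemma square_le_cancel: "0 <= g ==> 0 <= K ==> g * g <= K * g ==> g <= (K :: real)"
 using mult_le_cancel_right_pos[of g g K] by (cases "g = 0") auto

lemma time_interval_facts:
 assumes "time_interval J"
 shows "0 \<in> J" "J \<in> sets lebesgue" "!!t. t \<in> J ==> 0 <= t" "!!t. t \<in> J ==> {0..t} \<subseteq> J" "\<exists>T>0. T \<in> J"
 using assms by (auto simp: time_interval_def intro: exI[of _ "1::real"])

text \<open>A set of full measure meets every interval of positive length; near an end point only
  one side is available, and a < b keeps the clipped interval nondegenerate.\<close>

lemma AE_dense:
 fixes P :: "real => bool"
 assumes "AE \<tau> in lebesgue_on {a..b}. P \<tau>" "a < b" "t \<in> {a..b}" "0 < \<epsilon>"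
 shows "\<exists>\<tau>\<in>{a..b}. \<bar>\<tau> - t\<bar> < \<epsilon> & P \<tau>"
proof (rule ccontr)
 assume n: "\<not> ?thesis"
 define c d where "c = max a (t - \<epsilon> / 2)" and "d = min b (t + \<epsilon> / 2)"
 have cd: "c < d" "{c..d} \<subseteq> {a..b}" "!!\<tau>. \<tau> \<in> {c..d} ==> \<bar>\<tau> - t\<bar> < \<epsilon>" using assms(2-4) by (auto simp: c_def d_def)
 have "AE \<tau> in lebesgue. \<tau> \<in> {a..b} --> P \<tau>" using assms(1) by (simp add: AE_restrict_space_iff)
 then have "AE \<tau> in lebesgue. \<tau> \<notin> {c..d}" by eventually_elim (use n cd in blast)
 then have "{c..d} \<in> null_sets lebesgue" by (simp add: AE_iff_null_sets)
 then have "emeasure lborel {c..d} = 0" by (simp add: null_sets_def)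
 then show False using cd(1) by simp
qed

lemma has_integral_tail:
 fixes f :: "real => real"
 assumes "(f has_integral k) {a..b}" "(f has_integral i) {a..c}" "a <= c" "c <= b"
 shows "(f has_integral (k - i)) {c..b}"
proof -
 have "f integrable_on {c..b}"
  by (rule integrable_subinterval_real[OF has_integral_integrable[OF assms(1)]]) (use assms(3,4) in auto)
 then obtain j where j: "(f has_integral j) {c..b}" by blast
 have "(f has_integral (i + j)) {a..b}" by (rule has_integral_combine[OF assms(3,4,2) j])
 then have "i + j = k" using assms(1) has_integral_unique by blast
 then show ?thesis using j by auto
qed

context bounded_domain
begin

lemma quot_norm_nonneg: "0 <= qn k p"
 unfolding quot_norm_def by (rule cINF_greatest) auto

lemma quot_norm_le: "qn k p <= Hsn k (%x. p x + c)"
 unfolding quot_norm_def by (rule cINF_lower) (auto intro: bdd_belowI2[of _ 0])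

lemma quot_norm_approx: "0 < \<epsilon> ==> \<exists>c. Hsn k (%x. p x + c) < qn k p + \<epsilon>"
proof -
 assume "0 < \<epsilon>"
 moreover have "bdd_below (range (%c. Hsn k (%x. p x + c)))" by (rule bdd_belowI2[of _ 0]) simp
 ultimately show ?thesis
  using cINF_less_iff[of UNIV "%c. Hsn k (%x. p x + c)" "qn k p + \<epsilon>"] by (auto simp: quot_norm_def)
qed

lemma test_H10: "\<phi> \<in> TF ==> \<phi> \<in> H0"
 using test_H1 semi_inner.nrm_zero[OF semi_inner_Hs[of 1], folded Hs_norm_eq_nrm]
 by (auto simp: H10_def intro!: bexI[of _ \<phi>])

text \<open>Quotient norms add constants, so these must lie in the space. That their weak
  derivatives vanish amounts to derivatives of test functions having integral zero.\<close>

lemma const_Hs: "(%x. c) \<in> HS k"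
 unfolding Hs_def
proof (intro CollectI conjI allI impI ballI const_L2)
 fix j \<alpha> assume "\<alpha> \<in> (multi_indices j :: ('n => nat) set)"
 show "\<exists>g\<in>LL. wder \<alpha> (%x. c) g"
 proof (cases "\<alpha> = (%i. 0)")
  case True
  have nil: "is = []" if "\<forall>i. count_list is i = \<alpha> i" for "is"
   using that True by (cases "is") (auto dest!: spec[of _ "hd is"])
  have "partials is \<phi> = \<phi>" if "\<forall>i. count_list is i = \<alpha> i" for "is" and \<phi> :: "real^'n => real"
   using nil[OF that] by simp
  moreover have "(\<Sum>i\<in>UNIV. \<alpha> i) = 0" by (simp add: True)
  ultimately have "wder \<alpha> (%x. c) (%x. c)"
   unfolding weak_deriv_def using L2_locally_integrable[OF const_L2[of c]] by simp
  then show ?thesis using const_L2 by blast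
 next
  case False
  then obtain i0 where i0: "\<alpha> i0 ~= 0" by (auto simp: fun_eq_iff)
  have "inn (%x. c) (partials is \<phi>) = 0" if \<phi>: "\<phi> \<in> TF" and c: "\<forall>i. count_list is i = \<alpha> i" for \<phi> "is"
  proof -
   have "is ~= []" using c i0 by auto
   then obtain a as where "is": "is = a # as" by (cases "is") auto
   have t: "partials as \<phi> \<in> TF" by (rule test_partials[OF \<phi>])
   have "inn (D a (partials as \<phi>)) (%x. c) = 0"
    by (rule D_integral_zero[OF test_H10[OF t]])
   moreover have "inn (D a (partials as \<phi>)) (%x. c) = inn (partial a (partials as \<phi>)) (%x. c)"
    by (rule ip_AE_cong[OF test_D[OF t]]) (use D_L2[OF test_H1[OF t]] const_L2 sets_dom in auto)
   ultimately show ?thesis by (simp add: "is" ip_sym)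
  qed
  then have "wder \<alpha> (%x. c) (%x. 0)"
   unfolding weak_deriv_def using L2_locally_integrable[OF const_L2] by (auto simp: ip_def)
  then show ?thesis using const_L2[of 0] by blast
 qed
qed

text \<open>Nearly optimal constants for two summands add up to an admissible constant for the sum.
  The estimate is what makes quotient norms of the pressure measurable in time.\<close>

lemma quot_norm_lipschitz:
 assumes p: "p \<in> HS k" and q: "q \<in> HS k"
 shows "\<bar>qn k p - qn k q\<bar> <= qn k (%x. p x - q x)"
proof -
 have tri: "qn k p <= qn k q + qn k (%x. p x - q x)" if p: "p \<in> HS k" and q: "q \<in> HS k" for p q
 proof (rule field_le_epsilon)
  fix \<epsilon> :: real assume "0 < \<epsilon>"
  then have e2: "0 < \<epsilon> / 2" by simp
  obtain c where c: "Hsn k (%x. q x + c) < qn k q + \<epsilon> / 2"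
   using quot_norm_approx[OF e2, of k q] by blast
  obtain d where d: "Hsn k (%x. (p x - q x) + d) < qn k (%x. p x - q x) + \<epsilon> / 2"
   using quot_norm_approx[OF e2, of k "%x. p x - q x"] by blast
  have "qn k p <= Hsn k (%x. p x + (c + d))" by (rule quot_norm_le)
  also have "(%x. p x + (c + d)) = (%x. (q x + c) + ((p x - q x) + d))" by (auto simp: fun_eq_iff)
  also have "Hsn k ... <= Hsn k (%x. q x + c) + Hsn k (%x. (p x - q x) + d)"
   by (rule Hs_norm_triangle[OF Hs_add[OF q const_Hs] Hs_add[OF Hs_diff[OF p q] const_Hs]])
  finally show "qn k p <= qn k q + qn k (%x. p x - q x) + \<epsilon>" using c d by linarith
 qed
 have "qn k (%x. q x - p x) = qn k (%x. p x - q x)"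
 proof -
  have le: "qn k (%x. q x - p x) <= qn k (%x. p x - q x)" if p: "p \<in> HS k" and q: "q \<in> HS k" for p q
   unfolding quot_norm_def[of _ _ "%x. p x - q x"]
  proof (rule cINF_greatest)
   fix c
   have "qn k (%x. q x - p x) <= Hsn k (%x. (q x - p x) + (- c))" by (rule quot_norm_le)
   also have "(%x. (q x - p x) + (- c)) = (%x. (-1) *\<^sub>R ((p x - q x) + c))" by (auto simp: fun_eq_iff)
   also have "Hsn k ... = \<bar>-1\<bar> * Hsn k (%x. (p x - q x) + c)"
    unfolding Hs_norm_eq_nrm by (rule semi_inner.nrm_scaleR[OF semi_inner_Hs Hs_add[OF Hs_diff[OF p q] const_Hs]])
   finally show "qn k (%x. q x - p x) <= Hsn k (%x. (p x - q x) + c)" by simp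
  qed simp
  show ?thesis by (rule antisym[OF le[OF p q] le[OF q p]])
 qed
 then show ?thesis using tri[OF p q] tri[OF q p] by linarith
qed

lemma quot_norm_mono:
 assumes "k <= s"
 shows "qn k p <= vD powr ((real s - real k) / real CARD('n)) * qn s p"
proof -
 let ?c = "vD powr ((real s - real k) / real CARD('n))"
 have c: "0 < ?c" using vol_pos by simp
 have "qn k p / ?c <= qn s p"
  unfolding quot_norm_def[of _ s]
 proof (rule cINF_greatest)
  fix a
  have "qn k p <= ?c * Hsn s (%x. p x + a)"
   using quot_norm_le[of k p a] Hs_norm_mono[OF assms, of "%x. p x + a"] by linarith
  then show "qn k p / ?c <= Hsn s (%x. p x + a)" using c by (simp add: pos_divide_le_eq mult.commute)
 qed simp
 then show ?thesis using c by (simp add: pos_divide_le_eq mult.commute)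
qed

lemma D_component_norm: "v \<in> Hv 1 ==> nrm2 (Dc j i v) <= Hvn 1 v"
proof -
 assume v: "v \<in> Hv 1"
 have "nrm2 (Dc j i v) <= Hsn 1 (%x. v x $ i)" by (rule H1_norm_D[OF Hs_L2[OF Hs_vec_comp[OF v]]])
 also have "(Hsn 1 (%x. v x $ i))\<^sup>2 <= (\<Sum>i\<in>UNIV. (Hsn 1 (%x. v x $ i))\<^sup>2)" by (rule member_le_sum) auto
 then have "Hsn 1 (%x. v x $ i) <= Hvn 1 v"
  unfolding Hs_vec_norm_def by (rule real_le_rsqrt)
 finally show ?thesis .
qed

end

locale nudged_flow = mesh_domain \<Omega> \<sigma> h T for \<Omega> :: "(real^'n::finite) set" and \<sigma> h T +
 fixes r s :: nat and \<nu> \<mu> \<beta> c\<^sub>0 c\<^sub>I H C\<^sub>a :: real and IH :: "(real^'n => real^'n) => real^'n => real^'n" and J :: "real set"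
  and f u ut uh sm :: "real => real^'n => real^'n" and p :: "real => real^'n => real"
 assumes coarse: "coarse_interpolation c\<^sub>0 c\<^sub>I H \<Omega> IH"
  and pos: "0 < \<nu>" "0 < \<mu>" "0 < \<beta>" "0 < H" "0 < c\<^sub>I" "0 < c\<^sub>0" and r2: "2 <= r" and rs: "r <= s"
  and tJ: "time_interval J" and ns: "navier_stokes \<nu> \<Omega> J f u ut p"
  and uLinf: "u \<in> Linf_time (Hv s) (Hvn s) J"
  and pLinf: "p \<in> Linf_time (HS (s - 1)) (qn (s - 1)) J"
  and utLinf: "ut \<in> Linf_time (Hv (s - 1)) (Hvn (s - 1)) J"
  and da: "da_galerkin \<nu> \<mu> \<beta> \<Omega> T IH J f u uh r"
  and proj: "!!t. t \<in> J ==> stokes_projection \<Omega> T r (u t) (sm t)"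
  and ap: "approximation_properties C\<^sub>a \<Omega> h T r J u ut sm p"
begin

abbreviation "reg B \<tau> \<equiv> u \<tau> \<in> Hv s & ut \<tau> \<in> Hv (s - 1) & p \<tau> \<in> HS (s - 1) &
  (\<forall>k\<le>s. Hvn k (u \<tau>) <= B) & (\<forall>k\<le>s - 1. Hvn k (ut \<tau>) <= B & qn k (p \<tau>) <= B)"
abbreviation "utreg B \<tau> \<equiv> ut \<tau> \<in> Hv (s - 1) & (\<forall>k\<le>s - 1. Hvn k (ut \<tau>) <= B)"

lemmas J_facts = time_interval_facts[OF tJ]

lemma AE_sub:
 assumes "t \<in> J" "AE \<tau> in lebesgue_on J. P \<tau>" "0 <= t'"
 shows "AE \<tau> in lebesgue_on {t'..t}. P \<tau>"
 by (rule AE_lebesgue_on_subset[OF assms(2) _ J_facts(2)]) (use J_facts(4)[OF assms(1)] assms(3) in auto)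

lemma meas_sub:
 fixes g :: "real => real"
 assumes "t \<in> J" "g \<in> borel_measurable (lebesgue_on J)" "0 <= t'"
 shows "g \<in> borel_measurable (lebesgue_on {t'..t})"
 by (rule measurable_restrict_mono[OF assms(2)]) (use J_facts(4)[OF assms(1)] assms(3) in auto)

lemma u_in: "t \<in> J ==> u t \<in> H0v" "t \<in> J ==> u t \<in> Hv 1" "t \<in> J ==> u t \<in> LL" "t \<in> J ==> u t \<in> div_free \<Omega>"
proof -
 show d: "t \<in> J ==> u t \<in> div_free \<Omega>" using ns by (simp add: navier_stokes_def)
 then show "t \<in> J ==> u t \<in> H0v" by (simp add: div_free_def)
 then show "t \<in> J ==> u t \<in> Hv 1" "t \<in> J ==> u t \<in> LL" by (auto intro: H10_vec_H1 H10_vec_L2)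
qed

lemma sm_in: "t \<in> J ==> sm t \<in> VH r"
 using proj by (simp add: stokes_projection_def)

lemma bounds:
 "\<exists>B. AE \<tau> in lebesgue_on J. reg B \<tau>"
proof -
 obtain B1 where B1: "AE \<tau> in lebesgue_on J. u \<tau> \<in> Hv s & Hvn s (u \<tau>) <= B1"
  using uLinf by (auto simp: Linf_time_def)
 obtain B2 where B2: "AE \<tau> in lebesgue_on J. ut \<tau> \<in> Hv (s - 1) & Hvn (s - 1) (ut \<tau>) <= B2"
  using utLinf by (auto simp: Linf_time_def)
 obtain B3 where B3: "AE \<tau> in lebesgue_on J. p \<tau> \<in> HS (s - 1) & qn (s - 1) (p \<tau>) <= B3"
  using pLinf by (auto simp: Linf_time_def)
 note B = B1 B2 B3
 define B where "B = max B1 (max B2 B3)"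
 \<comment> \<open>The sum of all volume powers that occur when passing to lower orders, hence an
   upper bound for each of them.\<close>
 define E where "E = (\<Sum>m\<le>s. vD powr (real m / real CARD('n)))"
 have E: "vD powr ((real j - real k) / real CARD('n)) <= E" if "k <= j" "j <= s" for j k
 proof -
  have "vD powr (real (j - k) / real CARD('n)) <= E" unfolding E_def by (rule member_le_sum) (use that in auto)
  then show ?thesis using that by (simp add: of_nat_diff)
 qed
 have M: "N <= E * B" if "N <= c * X" "c <= E" "X <= B" "0 <= X" "0 <= c" for N c X :: real
  using that mult_mono[of c E X B] by linarith
 show ?thesis
 proof (intro exI[of _ "E * B"])
  show "AE \<tau> in lebesgue_on J. reg (E * B) \<tau>"
   using B
  proof eventually_elim
   case (elim \<tau>)
   have "Hvn k (u \<tau>) <= E * B" if "k <= s" for k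
    by (rule M[OF Hs_vec_norm_mono[OF that] E[OF that]]) (use elim in \<open>auto simp: B_def\<close>)
   moreover have "Hvn k (ut \<tau>) <= E * B" if "k <= s - 1" for k
    by (rule M[OF Hs_vec_norm_mono[OF that] E[OF that]]) (use elim in \<open>auto simp: B_def\<close>)
   moreover have "qn k (p \<tau>) <= E * B" if "k <= s - 1" for k
    by (rule M[OF quot_norm_mono[OF that] E[OF that]]) (use elim in \<open>auto simp: B_def quot_norm_nonneg\<close>)
   ultimately show ?case using elim by blast
  qed
 qed
qed

section \<open>Measurability in time\<close>

lemma u_norm_meas: "k <= s ==> (%\<tau>. Hvn k (u \<tau>)) \<in> borel_measurable (lebesgue_on J)"
proof (rule strongly_measurable_functional[where X="Hv s" and N="Hvn s"])
 assume k: "k <= s"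
 show "strongly_measurable (Hv s) (Hvn s) J u" "AE t in lebesgue_on J. u t \<in> Hv s"
  using uLinf by (auto simp: Linf_time_def elim: eventually_mono)
 show "\<bar>Hvn k v - Hvn k w\<bar> <= vD powr ((real s - real k) / real CARD('n)) * Hvn s (%x. v x - w x)"
  if "v \<in> Hv s" "w \<in> Hv s" for v w
  by (rule order_trans[OF Hs_vec_norm_reverse_triangle[OF Hs_vec_mono[OF that(1) k] Hs_vec_mono[OF that(2) k]] Hs_vec_norm_mono[OF k]])
qed (rule J_facts)

lemma ut_functional_meas:
 assumes "k <= s - 1" and "!!v w. v \<in> Hv k ==> w \<in> Hv k ==> \<bar>\<l> v - \<l> w\<bar> <= K * Hvn k (%x. v x - w x)" "0 <= K"
 shows "(%\<tau>. \<l> (ut \<tau>) :: real) \<in> borel_measurable (lebesgue_on J)"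
proof (rule strongly_measurable_functional[where X="Hv (s - 1)" and N="Hvn (s - 1)"])
 show "strongly_measurable (Hv (s - 1)) (Hvn (s - 1)) J ut" "AE t in lebesgue_on J. ut t \<in> Hv (s - 1)"
  using utLinf by (auto simp: Linf_time_def elim: eventually_mono)
 show "\<bar>\<l> v - \<l> w\<bar> <= (K * vD powr ((real (s - 1) - real k) / real CARD('n))) * Hvn (s - 1) (%x. v x - w x)"
  if "v \<in> Hv (s - 1)" "w \<in> Hv (s - 1)" for v w
  using assms(2)[OF Hs_vec_mono[OF that(1) assms(1)] Hs_vec_mono[OF that(2) assms(1)]]
   mult_left_mono[OF Hs_vec_norm_mono[OF assms(1), of "%x. v x - w x"] assms(3)] by (simp add: mult.assoc)
qed (rule J_facts)

lemma ut_norm_meas: "k <= s - 1 ==> (%\<tau>. Hvn k (ut \<tau>)) \<in> borel_measurable (lebesgue_on J)"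
 by (rule ut_functional_meas[where K=1]) (use Hs_vec_norm_reverse_triangle in auto)

lemma p_norm_meas: "k <= s - 1 ==> (%\<tau>. qn k (p \<tau>)) \<in> borel_measurable (lebesgue_on J)"
proof (rule strongly_measurable_functional[where X="HS (s - 1)" and N="qn (s - 1)" and u=p and \<l>="qn k"])
 assume k: "k <= s - 1"
 show "strongly_measurable (HS (s - 1)) (qn (s - 1)) J p" "AE t in lebesgue_on J. p t \<in> HS (s - 1)"
  using pLinf by (auto simp: Linf_time_def elim: eventually_mono)
 show "\<bar>qn k v - qn k w\<bar> <= vD powr ((real (s - 1) - real k) / real CARD('n)) * qn (s - 1) (%x. v x - w x)"
  if "v \<in> HS (s - 1)" "w \<in> HS (s - 1)" for v w
  by (rule order_trans[OF quot_norm_lipschitz[OF Hs_mono[OF that(1) k] Hs_mono[OF that(2) k]] quot_norm_mono[OF k]])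
qed (rule J_facts)

lemma s1: "1 <= s - 1" using r2 rs by simp

lemma ut_bounds: "\<exists>B. AE \<tau> in lebesgue_on J. utreg B \<tau>"
proof -
 obtain B where "AE \<tau> in lebesgue_on J. reg B \<tau>"
  using bounds by blast
 then have "AE \<tau> in lebesgue_on J. utreg B \<tau>"
  by eventually_elim blast
 then show ?thesis by blast
qed

lemma ut_H1: "AE \<tau> in lebesgue_on J. ut \<tau> \<in> Hv 1"
proof -
 obtain B where "AE \<tau> in lebesgue_on J. utreg B \<tau>"
  using ut_bounds by blast
 then show ?thesis by eventually_elim (use Hs_vec_mono[OF _ s1] in blast)
qed

text \<open>The generalised derivative is stated with an integral that is 0 by default for
  non-integrable functions; measurability and boundedness of the pairing show that it is a genuine
  integral.\<close>

lemma has_integral_ut: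
 assumes w: "w \<in> LL" and t: "t \<in> J" "0 <= t'" "t' <= t"
 shows "((%\<tau>. inn (ut \<tau>) w) has_integral (inn (u t) w - inn (u t') w)) {t'..t}"
proof -
 obtain B where B: "AE \<tau> in lebesgue_on J. utreg B \<tau>"
  using ut_bounds by blast
 have m: "(%\<tau>. inn (ut \<tau>) w) \<in> borel_measurable (lebesgue_on J)"
 proof (rule ut_functional_meas[of 0 _ "nrm2 w"])
  fix v z assume v: "v \<in> Hv 0" "z \<in> Hv 0"
  have L: "v \<in> LL" "z \<in> LL" using v Hs_vec_L2 by auto
  show "\<bar>inn v w - inn z w\<bar> <= nrm2 w * Hvn 0 (%x. v x - z x)"
   using ip_CS[OF L2_diff[OF L] w] ip_diff[OF L w] Hs_vec_norm_0[OF L2_diff[OF L]] by (simp add: mult.commute)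
 qed auto
 have b: "AE \<tau> in lebesgue_on J. \<bar>inn (ut \<tau>) w\<bar> <= B * nrm2 w"
  using B
 proof eventually_elim
  case (elim \<tau>)
  have L: "ut \<tau> \<in> LL" using elim Hs_vec_L2 by blast
  have "nrm2 (ut \<tau>) <= B" using elim Hs_vec_norm_0[OF L] by auto
  then show ?case using ip_CS[OF L w] mult_right_mono[of "nrm2 (ut \<tau>)" B "nrm2 w"] by simp
 qed
 have hi: "((%\<tau>. inn (ut \<tau>) w) has_integral (inn (u t) w - inn (u 0) w)) {0..t}" if "t \<in> J" for t
 proof -
  have "integrable (lebesgue_on {0..t}) (%\<tau>. inn (ut \<tau>) w)"
   by (rule integrable_bounded_interval[OF meas_sub[OF that m] AE_sub[OF that b]]) auto
  from has_integral_integral_lebesgue_on[OF this]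
  show ?thesis using ns w that by (simp add: navier_stokes_def time_derivative_def)
 qed
 have "t' \<in> J" using J_facts(4)[OF t(1)] t by auto
 then show ?thesis using has_integral_tail[OF hi[OF t(1)] hi[OF \<open>t' \<in> J\<close>]] t by simp
qed

text \<open>The time derivative is known only in L2, so space derivatives must be shown to commute
  with the time integral. For a test function in place of g, one more integration by parts reduces
  the claim to \<open>has_integral_ut\<close>; the general g is a limit.\<close>

lemma has_integral_D:
 assumes g: "g \<in> H0" and t: "t \<in> J" "0 <= t'" "t' <= t"
 shows "((%\<tau>. inn (Dc j i (ut \<tau>)) (D j g)) has_integral
   (inn (Dc j i (u t)) (D j g) - inn (Dc j i (u t')) (D j g))) {t'..t}"
proof -
 obtain B where B: "AE \<tau> in lebesgue_on J. utreg B \<tau>"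
  using ut_bounds by blast
 have t'J: "t' \<in> J" using J_facts(4)[OF t(1)] t by auto
 have gl: "D j g \<in> LL" by (rule D_L2[OF H10_H1[OF g]])
 have bd: "AE \<tau> in lebesgue_on J. \<bar>inn (Dc j i (ut \<tau>)) G\<bar> <= B * nrm2 G" if G: "G \<in> LL" for G
  using B
 proof eventually_elim
  case (elim \<tau>)
  then have v: "ut \<tau> \<in> Hv 1" using Hs_vec_mono s1 by blast
  have "nrm2 (Dc j i (ut \<tau>)) <= B" using D_component_norm[OF v, of j i] elim s1 by (meson order_trans)
  then show ?case using ip_CS[OF D_L2[OF Hs_vec_comp[OF v]] G, of j i] mult_right_mono[of "nrm2 (Dc j i (ut \<tau>))" B "nrm2 G"] by simp
 qed
 have m: "(%\<tau>. inn (Dc j i (ut \<tau>)) G) \<in> borel_measurable (lebesgue_on J)" if G: "G \<in> LL" for G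
 proof (rule ut_functional_meas[OF s1, of _ "nrm2 G"])
  fix v z assume v: "v \<in> Hv 1" "z \<in> Hv 1"
  have vz: "(%x. v x - z x) \<in> Hv 1" by (rule Hs_vec_diff[OF v])
  have L: "Dc j i v \<in> LL" "Dc j i z \<in> LL" "D j (%x. v x $ i - z x $ i) \<in> LL"
   using D_L2 Hs_vec_comp v Hs_vec_comp[OF vz, of i] by auto
  have "inn (D j (%x. v x $ i - z x $ i)) G = inn (%x. Dc j i v x - Dc j i z x) G"
   by (rule ip_AE_cong[OF D_diff[OF Hs_vec_comp[OF v(1)] Hs_vec_comp[OF v(2)]]]) (use L G sets_dom in auto)
  also have "... = inn (Dc j i v) G - inn (Dc j i z) G" by (rule ip_diff[OF L(1,2) G])
  finally have e: "inn (Dc j i v) G - inn (Dc j i z) G = inn (D j (%x. v x $ i - z x $ i)) G" ..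
  have "\<bar>inn (D j (%x. v x $ i - z x $ i)) G\<bar> <= nrm2 (D j (%x. v x $ i - z x $ i)) * nrm2 G" by (rule ip_CS[OF L(3) G])
  also have "... <= Hvn 1 (%x. v x - z x) * nrm2 G"
   using D_component_norm[OF vz, of j i] by (intro mult_right_mono) auto
  finally show "\<bar>inn (Dc j i v) G - inn (Dc j i z) G\<bar> <= nrm2 G * Hvn 1 (%x. v x - z x)"
   unfolding e by (simp add: mult.commute)
 qed simp
 have ig: "integrable (lebesgue_on {t'..t}) (%\<tau>. inn (Dc j i (ut \<tau>)) G)" if G: "G \<in> LL" for G
  by (rule integrable_bounded_interval[OF meas_sub[OF t(1) m[OF G] t(2)] AE_sub[OF t(1) bd[OF G] t(2)]])
 define I where "I = (\<integral>\<tau>. inn (Dc j i (ut \<tau>)) (D j g) \<partial>lebesgue_on {t'..t})"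
 have I: "((%\<tau>. inn (Dc j i (ut \<tau>)) (D j g)) has_integral I) {t'..t}"
  unfolding I_def by (rule has_integral_integral_lebesgue_on[OF ig[OF gl]]) simp
 obtain \<psi> where \<psi>: "!!n. \<psi> n \<in> TF"
  "!!j. (%n. nrm2 (%x. D j g x - partial j (\<psi> n) x)) ----> 0"
  by (rule H10_approx[OF g]) blast
 have \<psi>1: "partial j (\<psi> k) \<in> LL" and \<psi>2: "partial j (partial j (\<psi> k)) \<in> LL" for k
  using test_L2[OF _ sets_dom] test_partial \<psi>(1) by blast+
 have parts: "inn (Dc j i v) (partial j (\<psi> k)) = - inn v (%x. axis i (partial j (partial j (\<psi> k)) x))"
  if v: "v \<in> Hv 1" for v k
 proof -
  have "wder (single j 1) (%x. v x $ i) (Dc j i v)" by (rule HsD(1)[OF Hs_vec_comp[OF v] single_in]) simp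
  then have "inn (%x. v x $ i) (partial j (partial j (\<psi> k))) = - inn (Dc j i v) (partial j (\<psi> k))"
   using test_partial[OF \<psi>(1)] by (simp add: weak_deriv_1_iff)
  moreover have "inn v (%x. axis i (partial j (partial j (\<psi> k)) x)) = inn (%x. v x $ i) (partial j (partial j (\<psi> k)))"
   by (simp add: ip_def inner_axis)
  ultimately show ?thesis by simp
 qed
 let ?I = "%k. inn (Dc j i (u t)) (partial j (\<psi> k)) - inn (Dc j i (u t')) (partial j (\<psi> k))"
 have Ik: "((%\<tau>. inn (Dc j i (ut \<tau>)) (partial j (\<psi> k))) has_integral ?I k) {t'..t}" for k
 proof (rule has_integral_AE_cong)
  let ?w = "%x. axis i (partial j (partial j (\<psi> k)) x) :: real^'n"
  have "?w \<in> LL"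
  proof (rule L2_componentwise)
   fix l show "(%x. ?w x $ l) \<in> LL" using \<psi>2 by (cases "l = i") (auto simp: axis_def)
  qed
  from has_integral_neg[OF has_integral_ut[OF this t]]
  show "((%\<tau>. - inn (ut \<tau>) ?w) has_integral ?I k) {t'..t}"
   using parts[OF u_in(2)[OF t(1)], of k] parts[OF u_in(2)[OF t'J], of k] by simp
  show "AE \<tau> in lebesgue_on {t'..t}. inn (Dc j i (ut \<tau>)) (partial j (\<psi> k)) = - inn (ut \<tau>) ?w"
   using AE_sub[OF t(1) B t(2)] by eventually_elim (use parts Hs_vec_mono s1 in blast)
 qed
 have lim1: "?I ----> inn (Dc j i (u t)) (D j g) - inn (Dc j i (u t')) (D j g)"
 proof (rule tendsto_diff)
  show "(%k. inn (Dc j i (u t)) (partial j (\<psi> k))) ----> inn (Dc j i (u t)) (D j g)"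
   "(%k. inn (Dc j i (u t')) (partial j (\<psi> k))) ----> inn (Dc j i (u t')) (D j g)"
   by (subst (1 2) ip_sym, rule ip_tendsto[OF \<psi>1 gl D_L2[OF Hs_vec_comp[OF u_in(2)[OF t(1)]]] \<psi>(2)],
     subst (1 2) ip_sym, rule ip_tendsto[OF \<psi>1 gl D_L2[OF Hs_vec_comp[OF u_in(2)[OF t'J]]] \<psi>(2)])
 qed
 \<comment> \<open>The gradient of \<open>ut\<close> is bounded in L2 for almost all times, so the
   approximation error of g controls the difference of the integrals.\<close>
 have "(%k. I - ?I k) ----> 0"
 proof (rule Lim_null_comparison)
  show "(%k. (t - t') * (B * nrm2 (%x. D j g x - partial j (\<psi> k) x))) ----> 0"
   using tendsto_mult_left[OF tendsto_mult_left[OF \<psi>(2)[of j]], of "t - t'" B] by simp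
  show "\<forall>\<^sub>F k in sequentially. norm (I - ?I k) <= (t - t') * (B * nrm2 (%x. D j g x - partial j (\<psi> k) x))"
  proof (intro always_eventually allI)
   fix k
   have G: "(%x. D j g x - partial j (\<psi> k) x) \<in> LL" by (rule L2_diff[OF gl \<psi>1])
   have "\<bar>I - ?I k\<bar> <= (t - t') * (B * nrm2 (%x. D j g x - partial j (\<psi> k) x))"
   proof (rule has_integral_AE_abs_le[OF has_integral_diff[OF I Ik] _ t(3)])
    show "AE \<tau> in lebesgue_on {t'..t}. \<bar>inn (Dc j i (ut \<tau>)) (D j g) - inn (Dc j i (ut \<tau>)) (partial j (\<psi> k))\<bar>
      <= B * nrm2 (%x. D j g x - partial j (\<psi> k) x)"
     using AE_sub[OF t(1) B t(2)] AE_sub[OF t(1) bd[OF G] t(2)]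
    proof eventually_elim
     case (elim \<tau>)
     then have "ut \<tau> \<in> Hv 1" using Hs_vec_mono s1 by blast
     then show ?case using elim(2) ip_diff_right[OF gl \<psi>1 D_L2[OF Hs_vec_comp]] by simp
    qed
   qed
   then show "norm (I - ?I k) <= (t - t') * (B * nrm2 (%x. D j g x - partial j (\<psi> k) x))" by simp
  qed
 qed
 from tendsto_diff[OF tendsto_const this, of I] have "?I ----> I" by simp
 then have "I = inn (Dc j i (u t)) (D j g) - inn (Dc j i (u t')) (D j g)"
  using lim1 LIMSEQ_unique by blast
 then show ?thesis using I by simp
qed

lemma has_integral_gip:
 assumes \<phi>: "\<phi> \<in> H0v" and t: "t \<in> J" "0 <= t'" "t' <= t"
 shows "((%\<tau>. gip (ut \<tau>) \<phi>) has_integral (gip (u t) \<phi> - gip (u t') \<phi>)) {t'..t}"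
proof (rule has_integral_AE_cong)
 have t'J: "t' \<in> J" using J_facts(4)[OF t(1)] t by auto
 have \<phi>1: "\<phi> \<in> Hv 1" by (rule H10_vec_H1[OF \<phi>])
 let ?S = "%v. \<Sum>i\<in>UNIV. \<Sum>j\<in>UNIV. inn (Dc j i v) (D j (%x. \<phi> x $ i))"
 have "((%\<tau>. ?S (ut \<tau>)) has_integral (\<Sum>i\<in>UNIV. \<Sum>j\<in>UNIV. (inn (Dc j i (u t)) (D j (%x. \<phi> x $ i)) - inn (Dc j i (u t')) (D j (%x. \<phi> x $ i))))) {t'..t}"
  by (intro has_integral_sum finite has_integral_D H10_vec_comp \<phi> t)
 then show "((%\<tau>. ?S (ut \<tau>)) has_integral (gip (u t) \<phi> - gip (u t') \<phi>)) {t'..t}"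
  by (simp add: ip_grad[OF u_in(2) \<phi>1] t(1) t'J sum_subtractf)
 from AE_sub[OF t(1) ut_H1 t(2)]
 show "AE \<tau> in lebesgue_on {t'..t}. gip (ut \<tau>) \<phi> = ?S (ut \<tau>)"
  by eventually_elim (rule ip_grad[OF _ \<phi>1])
qed

text \<open>Tested with itself, the increment of the projection may be replaced by that of u, an
  integral of the bounded gradient of \<open>ut\<close>; one factor of the norm then
  cancels.\<close>

lemma sm_lipschitz: "\<exists>K\<ge>0. \<forall>t\<in>J. \<forall>t'\<in>J. nrm2 (Gr (%x. sm t x - sm t' x)) <= K * \<bar>t - t'\<bar>"
proof -
 obtain B where B: "AE \<tau> in lebesgue_on J. utreg B \<tau>"
  using ut_bounds by blast
 let ?K = "\<bar>B\<bar>"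
 have le: "nrm2 (Gr (%x. sm t x - sm t' x)) <= ?K * (t - t')" if t: "t \<in> J" "0 <= t'" "t' <= t" for t t'
 proof -
  have t'J: "t' \<in> J" using J_facts(4)[OF t(1)] t by auto
  let ?v = "%x. sm t x - sm t' x"
  have v: "?v \<in> VH r" using Vh_lin[OF sm_in[OF t(1)] sm_in[OF t'J], of 1 "-1"] by simp
  have g: "gip ?v ?v = gip (u t) ?v - gip (u t') ?v"
   using gip_lin[OF Vh_H1[OF sm_in[OF t(1)]] Vh_H1[OF sm_in[OF t'J]] Vh_H1[OF v], of 1 "-1"] proj[OF t(1)] proj[OF t'J] v
   by (simp add: stokes_projection_def)
  let ?g = "nrm2 (Gr ?v)"
  have "\<bar>gip (u t) ?v - gip (u t') ?v\<bar> <= (t - t') * (?K * ?g)"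
  proof (rule has_integral_AE_abs_le[OF has_integral_gip[OF Vh_H10[OF v] t] _ t(3)])
   show "AE \<tau> in lebesgue_on {t'..t}. \<bar>gip (ut \<tau>) ?v\<bar> <= ?K * ?g"
    using AE_sub[OF t(1) B t(2)]
   proof eventually_elim
    case (elim \<tau>)
    then have h: "ut \<tau> \<in> Hv 1" using Hs_vec_mono s1 by blast
    have "nrm2 (Gr (ut \<tau>)) <= ?K" using grad_norm_le[OF h] elim s1 by force
    then show ?case using ip_CS[OF grad_L2[OF h] grad_L2[OF Vh_H1[OF v]]] mult_right_mono[of "nrm2 (Gr (ut \<tau>))" ?K ?g] by simp
   qed
  qed
  then have "?g * ?g <= (?K * (t - t')) * ?g" using g by (simp add: L2_norm_sq[symmetric] power2_eq_square mult_ac)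
  from square_le_cancel[OF _ _ this] show ?thesis using t by auto
 qed
 have sym: "nrm2 (Gr (%x. sm t x - sm t' x)) = nrm2 (Gr (%x. sm t' x - sm t x))" if t: "t \<in> J" "t' \<in> J" for t t'
 proof (rule trans[OF L2_norm_AE_cong[where g="%x. (-1) *\<^sub>R Gr (%x. sm t' x - sm t x) x"]])
  have h: "sm t \<in> Hv 1" "sm t' \<in> Hv 1" using Vh_H1 sm_in t by blast+
  show "AE x in leb. Gr (%x. sm t x - sm t' x) x = (-1) *\<^sub>R Gr (%x. sm t' x - sm t x) x"
   using grad_diff[OF h] grad_diff[OF h(2,1)] by eventually_elim simp
  show "Gr (%x. sm t x - sm t' x) \<in> LL" by (intro grad_L2 Hs_vec_diff h)
  show "nrm2 (%x. (-1) *\<^sub>R Gr (%x. sm t' x - sm t x) x) = nrm2 (Gr (%x. sm t' x - sm t x))"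
   using L2_norm_scaleR[OF grad_L2[OF Hs_vec_diff[OF h(2,1)]], of "-1"] by simp
 qed (rule sets_dom)
 show ?thesis
 proof (intro exI[of _ ?K] conjI ballI)
  fix t t' assume "t \<in> J" "t' \<in> J"
  then show "nrm2 (Gr (%x. sm t x - sm t' x)) <= ?K * \<bar>t - t'\<bar>"
   using le[of t t'] le[of t' t] sym[of t t'] J_facts(3) by (cases "t' <= t") auto
 qed simp
qed

text \<open>Arbitrary at the times, forming a null set, at which \<open>ut\<close> is not weakly differentiable.\<close>

definition sd :: "real => real^'n => real^'n" where "sd \<tau> = (SOME z. stokes_projection \<Omega> T r (ut \<tau>) z)"

lemma sd_proj: "ut \<tau> \<in> Hv 1 ==> stokes_projection \<Omega> T r (ut \<tau>) (sd \<tau>)"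
 unfolding sd_def using stokes_exists by (rule someI_ex)

text \<open>With z representing w in the gradient form, the L2 pairing of w with a Stokes projection
  of a is the gradient pairing of a with z. Thus the evolution of the projection follows from that
  of u, and its derivative is the projection of \<open>ut\<close>.\<close>

lemma has_integral_sd:
 assumes w: "w \<in> VH r" and t: "t \<in> J" "0 <= t'" "t' <= t"
 shows "((%\<tau>. inn (sd \<tau>) w) has_integral (inn (sm t) w - inn (sm t') w)) {t'..t}"
proof -
 have t'J: "t' \<in> J" using J_facts(4)[OF t(1)] t by auto
 obtain z where z: "z \<in> VH r" "!!v. v \<in> VH r ==> gip z v = inn v w"
  using Riesz_L2[OF Vh_L2[OF w], of r] by blast
 have e: "inn b w = gip a z" if "stokes_projection \<Omega> T r a b" for a b
 proof -
  have b: "b \<in> VH r" "gip b z = gip a z" using that z(1) by (auto simp: stokes_projection_def)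
  then show ?thesis using z(2)[OF b(1)] by (simp add: ip_sym)
 qed
 have hi: "((%\<tau>. gip (ut \<tau>) z) has_integral (inn (sm t) w - inn (sm t') w)) {t'..t}"
  using has_integral_gip[OF Vh_H10[OF z(1)] t] e[OF proj[OF t(1)]] e[OF proj[OF t'J]] by simp
 from AE_sub[OF t(1) ut_H1 t(2)]
 have "AE \<tau> in lebesgue_on {t'..t}. inn (sd \<tau>) w = gip (ut \<tau>) z"
  by eventually_elim (rule e[OF sd_proj])
 then show ?thesis by (rule has_integral_AE_cong[OF hi])
qed

abbreviation "galerkin v t \<equiv> (\<forall>\<phi>\<in>VH r. inn v \<phi> + \<nu> * inn (Gr (uh t)) (Gr \<phi>) + b3 (uh t) (uh t) \<phi>
 + \<mu> * inn (Dv (uh t)) (Dv \<phi>) = inn (f t) \<phi> - \<beta> * inn (%x. IH (uh t) x - IH (u t) x) (IH \<phi>))"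

definition uh' :: "real => real^'n => real^'n" where
 "uh' = (SOME uh'. \<forall>t\<in>J. uh' t \<in> VH r & has_L2_time_derivative \<Omega> J uh (uh' t) t &
   galerkin (uh' t) t)"

lemma uh':
 assumes "t \<in> J"
 shows "uh' t \<in> VH r" "has_L2_time_derivative \<Omega> J uh (uh' t) t" "uh t \<in> VH r"
  "galerkin (uh' t) t"
proof -
 show "uh t \<in> VH r" using da assms by (simp add: da_galerkin_def)
 have "\<exists>uh'. \<forall>t\<in>J. uh' t \<in> VH r & has_L2_time_derivative \<Omega> J uh (uh' t) t &
   galerkin (uh' t) t"
  using da by (simp add: da_galerkin_def)
 from someI_ex[OF this, folded uh'_def]
 show "uh' t \<in> VH r" "has_L2_time_derivative \<Omega> J uh (uh' t) t"
  "galerkin (uh' t) t"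
  using assms by blast+
qed

text \<open>Pairing with a fixed w gives a function of time differentiable at every point; for the
  gauge integral the fundamental theorem then needs no integrability of the derivative
  beforehand.\<close>

lemma has_integral_uh:
 assumes w: "w \<in> VH r" and t: "t \<in> J" "0 <= t'" "t' <= t"
 shows "((%\<tau>. inn (uh' \<tau>) w) has_integral (inn (uh t) w - inn (uh t') w)) {t'..t}"
proof (rule fundamental_theorem_of_calculus[OF t(3)])
 have sub: "{t'..t} \<subseteq> J" using J_facts(4)[OF t(1)] t by auto
 fix x assume "x \<in> {t'..t}"
 then have x: "x \<in> J" using sub by blast
 have wL: "w \<in> LL" by (rule Vh_L2[OF w])
 have L: "uh y \<in> LL" "uh' x \<in> LL" if "y \<in> J" for y using Vh_L2 uh' that x by blast+
 have "((%y. (inn (uh y) w - inn (uh x) w) / (y - x) - inn (uh' x) w) \<longlongrightarrow> 0) (at x within J)"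
 proof (rule Lim_null_comparison)
  show "((%y. nrm2 (%z. (1 / (y - x)) *\<^sub>R (uh y z - uh x z) - uh' x z) * nrm2 w) \<longlongrightarrow> 0) (at x within J)"
   using tendsto_mult_right[OF uh'(2)[OF x, unfolded has_L2_time_derivative_def], of "nrm2 w"] by simp
  have "norm ((inn (uh y) w - inn (uh x) w) / (y - x) - inn (uh' x) w)
    <= nrm2 (%z. (1 / (y - x)) *\<^sub>R (uh y z - uh x z) - uh' x z) * nrm2 w" if y: "y \<in> J" for y
  proof -
   have d: "(%z. uh y z - uh x z) \<in> LL" by (rule L2_diff[OF L(1)[OF y] L(1)[OF x]])
   have q: "(%z. (1 / (y - x)) *\<^sub>R (uh y z - uh x z)) \<in> LL" by (rule L2_scaleR[OF d])
   have "inn (%z. (1 / (y - x)) *\<^sub>R (uh y z - uh x z) - uh' x z) w = (inn (uh y) w - inn (uh x) w) / (y - x) - inn (uh' x) w"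
    by (simp add: ip_diff[OF q L(2)[OF x] wL] ip_scaleR[OF d wL] ip_diff[OF L(1)[OF y] L(1)[OF x] wL])
   then show ?thesis using ip_CS[OF L2_diff[OF q L(2)[OF x]] wL] by simp
  qed
  then show "\<forall>\<^sub>F y in at x within J. norm ((inn (uh y) w - inn (uh x) w) / (y - x) - inn (uh' x) w)
    <= nrm2 (%z. (1 / (y - x)) *\<^sub>R (uh y z - uh x z) - uh' x z) * nrm2 w"
   by (simp add: eventually_at_filter)
 qed
 then have "((%y. inn (uh y) w) has_field_derivative inn (uh' x) w) (at x within J)"
  by (simp add: has_field_derivative_iff LIM_zero_iff)
 then show "((%y. inn (uh y) w) has_vector_derivative inn (uh' x) w) (at x within {t'..t})"
  using sub by (simp add: has_real_derivative_iff_has_vector_derivative has_vector_derivative_within_subset)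
qed

lemma uh_bounded: "t \<in> J ==> \<exists>B. \<forall>\<tau>\<in>{0..t}. nrm2 (uh \<tau>) <= B"
proof -
 assume t: "t \<in> J"
 have sub: "{0..t} \<subseteq> J" by (rule J_facts(4)[OF t])
 have L: "uh y \<in> LL" "uh' y \<in> LL" if "y \<in> J" for y using Vh_L2 uh' that by blast+
 have "continuous_on J (%\<tau>. nrm2 (uh \<tau>))"
  unfolding continuous_on_def
 proof
  fix x assume x: "x \<in> J"
  let ?q = "%y. nrm2 (%z. (1 / (y - x)) *\<^sub>R (uh y z - uh x z) - uh' x z)"
  have "((%y. nrm2 (uh y) - nrm2 (uh x)) \<longlongrightarrow> 0) (at x within J)"
  proof (rule Lim_null_comparison)
   have "((%y. \<bar>y - x\<bar> * (?q y + nrm2 (uh' x))) \<longlongrightarrow> \<bar>x - x\<bar> * (0 + nrm2 (uh' x))) (at x within J)"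
    by (intro tendsto_intros uh'(2)[OF x, unfolded has_L2_time_derivative_def])
   then show "((%y. \<bar>y - x\<bar> * (?q y + nrm2 (uh' x))) \<longlongrightarrow> 0) (at x within J)" by simp
   have "norm (nrm2 (uh y) - nrm2 (uh x)) <= \<bar>y - x\<bar> * (?q y + nrm2 (uh' x))" if y: "y \<in> J" "y ~= x" for y
   proof -
    have d: "(%z. uh y z - uh x z) \<in> LL" by (rule L2_diff[OF L(1)[OF y(1)] L(1)[OF x]])
    have q: "(%z. (1 / (y - x)) *\<^sub>R (uh y z - uh x z)) \<in> LL" by (rule L2_scaleR[OF d])
    have "nrm2 (%z. (1 / (y - x)) *\<^sub>R (uh y z - uh x z)) <= ?q y + nrm2 (uh' x)"
     using L2_norm_triangle[OF L2_diff[OF q L(2)[OF x]] L(2)[OF x]] by simp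
    then have "\<bar>1 / (y - x)\<bar> * nrm2 (%z. uh y z - uh x z) <= ?q y + nrm2 (uh' x)"
     using L2_norm_scaleR[OF d, of "1 / (y - x)"] by simp
    then have "nrm2 (%z. uh y z - uh x z) <= \<bar>y - x\<bar> * (?q y + nrm2 (uh' x))"
     using y(2) by (simp add: abs_divide pos_divide_le_eq mult.commute)
    then show ?thesis using L2_norm_reverse_triangle[OF L(1)[OF y(1)] L(1)[OF x]] by simp
   qed
   then show "\<forall>\<^sub>F y in at x within J. norm (nrm2 (uh y) - nrm2 (uh x)) <= \<bar>y - x\<bar> * (?q y + nrm2 (uh' x))"
    by (simp add: eventually_at_filter)
  qed
  then show "((%\<tau>. nrm2 (uh \<tau>)) \<longlongrightarrow> nrm2 (uh x)) (at x within J)" by (rule LIM_zero_cancel)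
 qed
 then have "compact ((%\<tau>. nrm2 (uh \<tau>)) ` {0..t})"
  by (intro compact_continuous_image continuous_on_subset[OF _ sub]) auto
 then obtain B where "\<forall>x\<in>(%\<tau>. nrm2 (uh \<tau>)) ` {0..t}. norm x <= B" using compact_imp_bounded bounded_iff by metis
 then show ?thesis by (intro exI[of _ B]) auto
qed

end

section \<open>The error bound\<close>

text \<open>Here \<open>hh\<close> stands for h^(r-1), d for the dimension, and U, V, Q for the
  norms of u, \<open>ut\<close> and p. The factors G / sqrt L and S / sqrt L become multiples of
  sqrt \<beta> and sqrt \<mu> by G <= L / 2, L <= \<beta> and S^2 <= 2 \<mu> L.\<close>

lemma residual_arith:
 fixes L :: real
 assumes pos: "0 < L" "0 < \<mu>" "0 < h" "0 < hh" and \<beta>: "8 * L <= \<beta>" and S: "0 <= S" "S\<^sup>2 <= 2 * \<mu> * L" and G: "0 <= G" "G <= L / 2"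
  and c: "0 <= Ca" "0 <= c0" "0 <= d" "0 <= \<kappa>" "0 <= K" and nn: "0 <= wn" "0 <= gw" "0 <= a1" "0 <= P" "0 <= U" "0 <= V" "0 <= Q"
  and wn: "wn <= Ca * h * hh * U" and gw: "gw <= Ca * hh * U" and a1: "a1 <= Ca * hh * V" and P: "P <= Ca * hh * Q" and K: "\<kappa> * wn * Ca <= K"
 defines "g \<equiv> (sqrt \<beta> * h + sqrt \<mu> + K / sqrt L) * U + 1 / sqrt L * V + 1 / sqrt \<mu> * Q"
 shows "(a1 + (G * wn + (1 + d / 2) * S * gw + \<kappa> * wn * gw))\<^sup>2 / L + 2 * P\<^sup>2 / \<mu> + \<mu> * (d * gw)\<^sup>2 + \<beta> * (c0 * wn)\<^sup>2
   <= ((1 + Ca * (5 + 2 * d + c0)) * hh * g)\<^sup>2" (is "?lhs <= _")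
  and "wn <= (1 + Ca * (5 + 2 * d + c0)) / sqrt L * hh * g" and "0 <= g"
proof -
 let ?C = "1 + Ca * (5 + 2 * d + c0)"
 have sL: "0 < sqrt L" "0 < sqrt \<mu>" and \<beta>p: "0 < \<beta>" "0 < sqrt \<beta>" using pos \<beta> by auto
 \<comment> \<open>The five summands of g, one for each term of the final bracket.\<close>
 define t1 t2 t3 t4 t5 where "t1 = sqrt \<beta> * h * U" and "t2 = sqrt \<mu> * U" and "t3 = K / sqrt L * U" and "t4 = V / sqrt L" and "t5 = Q / sqrt \<mu>"
 have t: "0 <= t1" "0 <= t2" "0 <= t3" "0 <= t4" "0 <= t5" using pos sL \<beta>p c nn by (auto simp: t1_def t2_def t3_def t4_def t5_def)
 have g: "g = t1 + t2 + t3 + t4 + t5" by (simp add: g_def t1_def t2_def t3_def t4_def t5_def algebra_simps)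
 show g0: "0 <= g" using t g by simp
 have lb: "sqrt L <= sqrt \<beta>" using \<beta> pos by simp
 \<comment> \<open>Roots of the four summands on the left: the sum of their squares is at most the
   square of their sum, which is linear in the data.\<close>
 define X Y Z W where "X = (a1 + (G * wn + (1 + d / 2) * S * gw + \<kappa> * wn * gw)) / sqrt L" and "Y = sqrt 2 * P / sqrt \<mu>"
  and "Z = sqrt \<mu> * (d * gw)" and "W = sqrt \<beta> * (c0 * wn)"
 have x1: "a1 / sqrt L <= Ca * hh * t4" using divide_right_mono[OF a1, of "sqrt L"] sL by (simp add: t4_def)
 have x2: "G * wn / sqrt L <= Ca * hh * t1"
 proof -
  have "G / sqrt L <= (L / 2) / sqrt L" using G sL by (intro divide_right_mono) auto
  also have "... = sqrt L / 2" using pos real_div_sqrt[of L] by simp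
  also have "... <= sqrt \<beta>" using lb \<beta>p by linarith
  finally have "G / sqrt L * wn <= sqrt \<beta> * (Ca * h * hh * U)" using wn nn \<beta>p by (intro mult_mono) auto
  then show ?thesis by (simp add: t1_def mult_ac)
 qed
 have x3: "(1 + d / 2) * S * gw / sqrt L <= Ca * (2 + d) * hh * t2"
 proof -
  have "S <= 2 * sqrt \<mu> * sqrt L"
  proof (rule power2_le_imp_le)
   have "S\<^sup>2 <= 4 * \<mu> * L" using S(2) mult_pos_pos[OF pos(2,1)] by linarith
   then show "S\<^sup>2 <= (2 * sqrt \<mu> * sqrt L)\<^sup>2" using pos by (simp add: power_mult_distrib)
  qed (use sL in simp)
  then have "S / sqrt L <= 2 * sqrt \<mu>" using sL by (simp add: pos_divide_le_eq)
  then have "(1 + d / 2) * (S / sqrt L) * gw <= (1 + d / 2) * (2 * sqrt \<mu>) * (Ca * hh * U)"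
   using gw nn c S sL by (intro mult_mono mult_left_mono) auto
  moreover have "(1 + d / 2) * S * gw / sqrt L = (1 + d / 2) * (S / sqrt L) * gw" by (simp only: times_divide_eq_left times_divide_eq_right)
  moreover have "(1 + d / 2) * (2 * sqrt \<mu>) * (Ca * hh * U) = Ca * (2 + d) * hh * t2"
  proof -
   have "(1 + d / 2) * (2 * sqrt \<mu>) = (2 + d) * sqrt \<mu>" by (simp add: distrib_right)
   then show ?thesis by (simp only: t2_def mult_ac)
  qed
  ultimately show ?thesis by linarith
 qed
 have x4: "\<kappa> * wn * gw / sqrt L <= hh * t3"
 proof -
  have "\<kappa> * wn * gw <= \<kappa> * wn * (Ca * hh * U)" using gw c nn by (intro mult_left_mono) auto
  also have "... = (\<kappa> * wn * Ca) * (hh * U)" by simp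
  also have "... <= K * (hh * U)" using K pos nn by (intro mult_right_mono) auto
  finally show ?thesis using divide_right_mono[of "\<kappa> * wn * gw" "K * (hh * U)" "sqrt L"] sL by (simp add: t3_def mult_ac)
 qed
 have X: "X <= Ca * hh * t4 + Ca * hh * t1 + Ca * (2 + d) * hh * t2 + hh * t3"
  unfolding X_def add_divide_distrib using x1 x2 x3 x4 by linarith
 have Y: "Y <= Ca * 2 * hh * t5"
 proof -
  have "sqrt 2 <= (2::real)" by (rule real_le_lsqrt) auto
  then have "sqrt 2 * P <= 2 * (Ca * hh * Q)" using P nn by (intro mult_mono) auto
  from divide_right_mono[OF this, of "sqrt \<mu>"] sL show ?thesis by (simp add: Y_def t5_def mult_ac)
 qed
 have Z: "Z <= Ca * d * hh * t2"
 proof -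
  have "sqrt \<mu> * (d * gw) <= sqrt \<mu> * (d * (Ca * hh * U))" using gw sL c by (intro mult_left_mono) auto
  then show ?thesis by (simp add: Z_def t2_def mult_ac)
 qed
 have W: "W <= Ca * c0 * hh * t1"
 proof -
  have "sqrt \<beta> * (c0 * wn) <= sqrt \<beta> * (c0 * (Ca * h * hh * U))" using wn \<beta>p c by (intro mult_left_mono) auto
  then show ?thesis by (simp add: W_def t1_def mult_ac)
 qed
 \<comment> \<open>The coefficients of t1 to t5 are \<open>Ca * (1 + c0)\<close>,
   \<open>Ca * (2 + 2 * d)\<close>, 1, \<open>Ca\<close> and \<open>2 * Ca\<close>; the constant is
   a common upper bound.\<close>
 have sumb: "X + Y + Z + W <= ?C * hh * g"
 proof -
  have m: "a * (hh * x) <= ?C * (hh * x)" if "a <= ?C" "0 <= x" for a x using that pos by (intro mult_right_mono) auto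
  have d0: "0 <= Ca * d" "0 <= Ca * c0" using c by auto
  have "X + Y + Z + W <= (Ca * (1 + c0)) * (hh * t1) + (Ca * (2 + 2 * d)) * (hh * t2) + 1 * (hh * t3) + Ca * (hh * t4) + (Ca * 2) * (hh * t5)"
   using X Y Z W by (simp add: algebra_simps)
  also have "... <= ?C * (hh * t1) + ?C * (hh * t2) + ?C * (hh * t3) + ?C * (hh * t4) + ?C * (hh * t5)"
   using c d0 by (intro add_mono m t) (auto simp: algebra_simps)
  also have "... = ?C * hh * g" unfolding g by (simp add: algebra_simps)
  finally show ?thesis .
 qed
 have nnXYZ: "0 <= X" "0 <= Y" "0 <= Z" "0 <= W"
  using nn c S G sL \<beta>p by (auto simp: X_def Y_def Z_def W_def)
 have "?lhs = X\<^sup>2 + Y\<^sup>2 + Z\<^sup>2 + W\<^sup>2"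
  using pos \<beta>p by (simp add: X_def Y_def Z_def W_def power_divide power_mult_distrib)
 also have "... <= (X + Y + Z + W)\<^sup>2"
  using nnXYZ by (simp add: power2_eq_square algebra_simps)
 also have "... <= (?C * hh * g)\<^sup>2" using sumb nnXYZ by (intro power_mono) auto
 finally show "?lhs <= (?C * hh * g)\<^sup>2" .
 have "wn * sqrt L <= (Ca * h * hh * U) * sqrt \<beta>" using wn lb nn sL by (intro mult_mono) auto
 also have "... = Ca * hh * t1" by (simp add: t1_def)
 also have "... <= ?C * hh * g"
 proof -
  have "Ca <= ?C" using c by (simp add: algebra_simps add_nonneg_nonneg)
  then have "Ca * (hh * t1) <= ?C * (hh * g)" using c t pos g by (intro mult_mono) auto
  then show ?thesis by (simp add: mult.assoc)
 qed
 finally show "wn <= ?C / sqrt L * hh * g" using sL by (simp add: pos_le_divide_eq)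
qed

text \<open>The product of the inverse inequality and the bound on w leaves the power (3 - d)/2 of
  h. It has to be absorbed without reference to h, and the two summands of \<open>K1\<close>
  correspond to the two dimensions.\<close>

lemma (in bounded_domain) K1_bound:
 assumes n: "CARD('n) = 2 \<or> CARD('n) = 3" and Ci: "0 <= Ci" and cv: "0 < cv" "cv * h ^ CARD('n) <= vD" and h: "0 < h" and Ca: "0 <= Ca"
  and w: "0 <= wn" "wn <= Ca * Hvn 1 u * h" "wn <= Ca * Hvn 2 u * h\<^sup>2"
 shows "Ci * h powr (- (real CARD('n) / 2)) * wn * Ca <= K1 (Ci * Ca\<^sup>2 * (1 + cv powr (- 1 / 4))) \<Omega> u"
proof -
 let ?U = "Hvn 1 u * Hvn 2 u"
 have U: "0 <= ?U" by simp
 have "wn\<^sup>2 <= (Ca * Hvn 1 u * h) * (Ca * Hvn 2 u * h\<^sup>2)"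
  unfolding power2_eq_square[of wn] using w Ca h by (intro mult_mono) auto
 also have "... = (Ca * sqrt ?U * h powr (3/2))\<^sup>2"
 proof -
  have "(h powr (3/2))\<^sup>2 = h powr 3" using h by (simp add: powr_power)
  also have "... = h ^ 3" using h by (simp add: powr_numeral)
  finally have e: "(h powr (3/2))\<^sup>2 = h ^ 3" .
  show ?thesis unfolding power_mult_distrib e real_sqrt_pow2[OF U] by (simp add: power2_eq_square power3_eq_cube)
 qed
 finally have wn: "wn <= Ca * sqrt ?U * h powr (3/2)" by (rule power2_le_imp_le) (use Ca U in auto)
 have cp: "0 <= cv powr (- 1 / 4)" by simp
 have Cn: "0 <= Ci * Ca\<^sup>2" using Ci by simp
 have base: "Ci * h powr (- (real CARD('n) / 2)) * wn * Ca <= (Ci * Ca\<^sup>2) * (h powr (3/2 - real CARD('n) / 2) * sqrt ?U)"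
 proof -
  have "Ci * h powr (- (real CARD('n) / 2)) * wn * Ca <= Ci * h powr (- (real CARD('n) / 2)) * (Ca * sqrt ?U * h powr (3/2)) * Ca"
   using wn Ci Ca by (intro mult_right_mono mult_left_mono) auto
  also have "... = (Ci * Ca\<^sup>2) * ((h powr (3/2) * h powr (- (real CARD('n) / 2))) * sqrt ?U)" by (simp add: power2_eq_square mult_ac)
  also have "h powr (3/2) * h powr (- (real CARD('n) / 2)) = h powr (3/2 - real CARD('n) / 2)" by (simp add: powr_add[symmetric])
  finally show ?thesis .
 qed
 have "h powr (3/2 - real CARD('n) / 2) * sqrt ?U <= (1 + cv powr (- 1 / 4)) *
  (sqrt (Hvn (CARD('n) - 2) u * Hvn 2 u) + vD powr ((3 - real CARD('n)) / (2 * real CARD('n))) * sqrt ?U)" (is "_ <= (1 + ?c) * (?A + ?B)")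
 proof -
  have AB: "0 <= ?A" "0 <= ?B" by simp_all
  have "h powr (3/2 - real CARD('n) / 2) * sqrt ?U <= ?A + ?c * ?B"
   using n
  proof
   \<comment> \<open>All powers of h cancel, and since \<open>CARD('n) - 2 = 1\<close> the first
     summand of \<open>K1\<close> is the required root.\<close>
   assume 3: "CARD('n) = 3"
   show ?thesis using h vol_pos by (simp add: 3 One_nat_def)
  next
   \<comment> \<open>The remaining h^(1/2) is at most a constant times the fourth root of the
     volume, the factor of the second summand of \<open>K1\<close>.\<close>
   assume 2: "CARD('n) = 2"
   have "h\<^sup>2 <= vD / cv" using cv by (simp add: 2 field_simps)
   then have "(h\<^sup>2) powr (1/4) <= (vD / cv) powr (1/4)" using h by (intro powr_mono2) auto
   moreover have "(h\<^sup>2) powr (1/4) = h powr (1/2)" using h by (simp add: powr_powr powr_numeral[symmetric] del: powr_numeral)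
   moreover have "(vD / cv) powr (1/4) = vD powr (1/4) * cv powr (- 1 / 4)"
   proof -
    have 1: "cv powr (- 1 / 4) = 1 / cv powr (1/4)" using powr_minus_divide[of cv "1/4"] by simp
    have 2: "(vD / cv) powr (1/4) = vD powr (1/4) / cv powr (1/4)" by (rule powr_divide)
    show ?thesis unfolding 1 2 by simp
   qed
   ultimately have "h powr (1/2) <= ?c * vD powr (1/4)" by (simp add: mult.commute)
   from mult_right_mono[OF this, of "sqrt ?U"] have "h powr (1/2) * sqrt ?U <= ?c * (vD powr (1/4) * sqrt ?U)" by (simp add: mult.assoc)
   from add_increasing[OF AB(1) this] show ?thesis by (simp add: 2)
  qed
  also have "... <= (1 + ?c) * (?A + ?B)"
  proof -
   have "0 <= ?c * ?A" using AB by simp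
   then show ?thesis using AB by (simp add: algebra_simps)
  qed
  finally show ?thesis .
 qed
 from mult_left_mono[OF this Cn] base show ?thesis unfolding K1_def by (simp only: mult.assoc)
qed

lemma (in bounded_domain) K1_nonneg: "0 <= c ==> 0 <= K1 c \<Omega> u"
 by (simp add: K1_def)

text \<open>Over a null interval the essential supremum is -\<infinity>, or +\<infinity> if the
  function is not measurable; \<open>real_of_ereal\<close> sends both to 0.\<close>

lemma ess_max_0: "ess_max 0 g = 0"
proof (cases "(%\<tau>. ereal (g \<tau>)) \<in> borel_measurable (lebesgue_on {0..0})")
 case True
 have "emeasure (lebesgue_on {0..0::real}) (space (lebesgue_on {0..0})) = 0"
  by (simp add: emeasure_restrict_space space_restrict_space)
 then have "esssup (lebesgue_on {0..0}) (%\<tau>. ereal (g \<tau>)) = - \<infinity>" using True esssup_zero_space by blast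
 then show ?thesis by (simp add: ess_max_def)
next
 case False
 then show ?thesis by (simp add: ess_max_def esssup_non_measurable top_ereal_def)
qed

context nudged_flow
begin

definition qp :: "real => real^'n => real" where "qp \<tau> = (SOME z. L2_projection \<Omega> (QH r) (p \<tau>) z)"

text \<open>The exceptional times are those where the equation fails or a function lacks its
  regularity. At all others both projections exist and the stationary results apply.\<close>

lemma step_AE:
 "AE \<tau> in lebesgue_on J. nudged_step \<Omega> \<sigma> h T r \<nu> \<mu> \<beta> c\<^sub>0 c\<^sub>I H IH (u \<tau>) (ut \<tau>) (f \<tau>) (sm \<tau>) (sd \<tau>) (uh \<tau>) (uh' \<tau>) (p \<tau>) (qp \<tau>)"
proof -
 have ns_ae: "AE \<tau> in lebesgue_on J. AE x in leb. ut \<tau> x - \<nu> *\<^sub>R laplacian \<Omega> (u \<tau>) x + Gr (u \<tau>) x *v u \<tau> x + sgrad \<Omega> (p \<tau>) x = f \<tau> x"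
  using ns by (simp add: navier_stokes_def)
 obtain B where B: "AE \<tau> in lebesgue_on J. reg B \<tau>"
  using bounds by blast
 show ?thesis
  using ns_ae B AE_space
 proof eventually_elim
  case (elim \<tau>)
  then have J: "\<tau> \<in> J" by (simp add: space_restrict_space)
  have s2: "2 <= s" using r2 rs by simp
  have ut1: "ut \<tau> \<in> Hv 1" and p1: "p \<tau> \<in> HS 1" and u2: "u \<tau> \<in> Hv 2"
   using elim(2) Hs_vec_mono[OF _ s1] Hs_mono[OF _ s1] Hs_vec_mono[OF _ s2] by blast+
  have q: "L2_projection \<Omega> (QH r) (p \<tau>) (qp \<tau>)"
   unfolding qp_def using L2_projection_exists[OF Hs_L2[OF p1] r2] by (rule someI_ex)
  have fL: "f \<tau> \<in> LL" using ns J by (simp add: navier_stokes_def)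
  show ?case
   by unfold_locales (fact coarse pos r2 u2 u_in(4)[OF J] p1 ut1 fL elim(1) proj[OF J] sd_proj[OF ut1] q uh'(3)[OF J] uh'(1)[OF J] | erule bspec[OF uh'(4)[OF J]])+
 qed
qed

section \<open>Lipschitz continuity and boundedness for all times\<close>

lemma u_lipschitz: "\<exists>K\<ge>0. \<forall>t\<in>J. \<forall>t'\<in>J. nrm2 (%x. u t x - u t' x) <= K * \<bar>t - t'\<bar>"
proof -
 obtain B where B: "AE \<tau> in lebesgue_on J. utreg B \<tau>"
  using ut_bounds by blast
 let ?K = "\<bar>B\<bar>"
 have le: "nrm2 (%x. u t x - u t' x) <= ?K * (t - t')" if t: "t \<in> J" "0 <= t'" "t' <= t" for t t'
 proof -
  have t'J: "t' \<in> J" using J_facts(4)[OF t(1)] t by auto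
  let ?v = "%x. u t x - u t' x"
  have v: "?v \<in> LL" by (intro L2_diff u_in t t'J)
  have g: "inn ?v ?v = inn (u t) ?v - inn (u t') ?v" by (rule ip_diff[OF u_in(3)[OF t(1)] u_in(3)[OF t'J] v])
  let ?g = "nrm2 ?v"
  have "\<bar>inn (u t) ?v - inn (u t') ?v\<bar> <= (t - t') * (?K * ?g)"
  proof (rule has_integral_AE_abs_le[OF has_integral_ut[OF v t] _ t(3)])
   show "AE \<tau> in lebesgue_on {t'..t}. \<bar>inn (ut \<tau>) ?v\<bar> <= ?K * ?g"
    using AE_sub[OF t(1) B t(2)]
   proof eventually_elim
    case (elim \<tau>)
    then have L: "ut \<tau> \<in> LL" using Hs_vec_L2 by blast
    have "Hvn 0 (ut \<tau>) <= B" using elim by simp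
    then have "nrm2 (ut \<tau>) <= ?K" using Hs_vec_norm_0[OF L] by linarith
    then show ?case using ip_CS[OF L v] mult_right_mono[of "nrm2 (ut \<tau>)" ?K ?g] by simp
   qed
  qed
  then have "?g * ?g <= (?K * (t - t')) * ?g" using g by (simp add: L2_norm_sq[symmetric] power2_eq_square mult_ac)
  from square_le_cancel[OF _ _ this] show ?thesis using t by auto
 qed
 have sym: "nrm2 (%x. u t x - u t' x) = nrm2 (%x. u t' x - u t x)" for t t'
  by (subst (1 2) L2_norm_norm[symmetric]) (simp add: norm_minus_commute)
 show ?thesis
 proof (intro exI[of _ ?K] conjI ballI)
  fix t t' assume "t \<in> J" "t' \<in> J"
  then show "nrm2 (%x. u t x - u t' x) <= ?K * \<bar>t - t'\<bar>"
   using le[of t t'] le[of t' t] sym[of t t'] J_facts(3) by (cases "t' <= t") auto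
 qed simp
qed

lemma sm_diff_L2: "\<exists>K\<ge>0. \<forall>t\<in>J. \<forall>t'\<in>J. nrm2 (%x. sm t x - sm t' x) <= K * \<bar>t - t'\<bar>"
proof -
 obtain K where K: "K >= 0" "!!t t'. t \<in> J ==> t' \<in> J ==> nrm2 (Gr (%x. sm t x - sm t' x)) <= K * \<bar>t - t'\<bar>"
  using sm_lipschitz by blast
 obtain C where C: "C > 0" "!!v. v \<in> H0v ==> nrm2 v <= C * nrm2 (Gr v)"
  using poincare_vec by blast
 have "nrm2 (%x. sm t x - sm t' x) <= (C * K) * \<bar>t - t'\<bar>" if t: "t \<in> J" "t' \<in> J" for t t'
 proof -
  have v: "(%x. sm t x - sm t' x) \<in> VH r" using Vh_lin[OF sm_in[OF t(1)] sm_in[OF t(2)], of 1 "-1"] by simp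
  show ?thesis using C(2)[OF Vh_H10[OF v]] mult_left_mono[OF K(2)[OF t] less_imp_le[OF C(1)]] by (simp only: mult.assoc)
 qed
 then show ?thesis using K(1) C(1) by (intro exI[of _ "C * K"]) auto
qed

text \<open>The norms are bounded at almost every time; each time has such a time within distance 1,
  and the Lipschitz constants bound the change between the two.\<close>

lemma sm_bounded: "\<exists>B. \<forall>t\<in>J. nrm2 (sm t) <= B & nrm2 (Gr (sm t)) <= B & nrm2 (u t) <= B"
proof -
 obtain K where K: "K >= 0" "!!t t'. t \<in> J ==> t' \<in> J ==> nrm2 (Gr (%x. sm t x - sm t' x)) <= K * \<bar>t - t'\<bar>"
  using sm_lipschitz by blast
 obtain K2 where K2: "K2 >= 0" "!!t t'. t \<in> J ==> t' \<in> J ==> nrm2 (%x. u t x - u t' x) <= K2 * \<bar>t - t'\<bar>"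
  using u_lipschitz by blast
 obtain C where C: "C > 0" "!!v. v \<in> H0v ==> nrm2 v <= C * nrm2 (Gr v)"
  using poincare_vec by blast
 obtain B where B: "AE \<tau> in lebesgue_on J. reg B \<tau>"
  using bounds by blast
 obtain T0 where T0: "T0 > 0" "T0 \<in> J" using J_facts(5) by blast
 have gb: "nrm2 (Gr (sm t)) <= B + K & nrm2 (u t) <= B + K2" if t: "t \<in> J" for t
 proof -
  \<comment> \<open>For t = 0 some positive time of J serves as right end point, so that the
    interval is not a null set.\<close>
  obtain a where a: "a \<in> J" "t \<in> {0..a}" "0 < a"
   using t T0 J_facts(3)[OF t] by (cases "t = 0") auto
  obtain \<tau> where \<tau>: "\<tau> \<in> {0..a}" "\<bar>\<tau> - t\<bar> < 1" "\<forall>k\<le>s. Hvn k (u \<tau>) <= B"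
   using AE_dense[OF AE_sub[OF a(1) B order_refl] a(3,2), of 1] by auto
  have \<tau>J: "\<tau> \<in> J" using \<tau>(1) J_facts(4)[OF a(1)] by blast
  have s1: "sm t \<in> Hv 1" "sm \<tau> \<in> Hv 1" using Vh_H1 sm_in t \<tau>J by blast+
  have u\<tau>: "u \<tau> \<in> Hv 1" by (rule u_in(2)[OF \<tau>J])
  have "s >= 1" using r2 rs by simp
  then have ub: "nrm2 (Gr (u \<tau>)) <= B" "nrm2 (u \<tau>) <= B"
   using grad_norm_le[OF u\<tau>] \<tau>(3) Hs_vec_norm_0[OF u_in(3)[OF \<tau>J]] by (meson order_trans, metis le0)
  let ?g = "nrm2 (Gr (sm \<tau>))"
  have "gip (sm \<tau>) (sm \<tau>) = gip (u \<tau>) (sm \<tau>)" using proj[OF \<tau>J] by (simp add: stokes_projection_def)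
  then have "?g * ?g <= nrm2 (Gr (u \<tau>)) * ?g"
   using ip_CS[OF grad_L2[OF u\<tau>] grad_L2[OF s1(2)]] by (simp add: L2_norm_sq[symmetric] power2_eq_square)
  from square_le_cancel[OF _ _ this] have "?g <= nrm2 (Gr (u \<tau>))" by auto
  then have g\<tau>: "?g <= B" using ub by linarith
  have one: "K * \<bar>t - \<tau>\<bar> <= K * 1" "K2 * \<bar>t - \<tau>\<bar> <= K2 * 1" using \<tau>(2) K K2 by (intro mult_left_mono; simp)+
  have "\<bar>nrm2 (Gr (sm t)) - ?g\<bar> <= nrm2 (%x. Gr (sm t) x - Gr (sm \<tau>) x)"
   by (rule L2_norm_reverse_triangle[OF grad_L2[OF s1(1)] grad_L2[OF s1(2)]])
  also have "... = nrm2 (Gr (%x. sm t x - sm \<tau> x))"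
   by (rule L2_norm_AE_cong[symmetric, OF grad_diff[OF s1] grad_L2[OF Hs_vec_diff[OF s1]] sets_dom])
  also have "... <= K * \<bar>t - \<tau>\<bar>" by (rule K(2)[OF t \<tau>J])
  finally have "nrm2 (Gr (sm t)) <= B + K" using one g\<tau> by linarith
  moreover have "nrm2 (u t) <= B + K2"
   using L2_norm_reverse_triangle[OF u_in(3)[OF t] u_in(3)[OF \<tau>J]] K2(2)[OF t \<tau>J] one ub by linarith
  ultimately show ?thesis ..
 qed
 show ?thesis
 proof (intro exI[of _ "max (C * (B + K)) (max (B + K) (B + K2))"] ballI)
  fix t assume t: "t \<in> J"
  have "nrm2 (sm t) <= C * (B + K)"
   using C(2)[OF Vh_H10[OF sm_in[OF t]]] mult_left_mono[OF conjunct1[OF gb[OF t]] less_imp_le[OF C(1)]] by linarith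
  then show "nrm2 (sm t) <= max (C * (B + K)) (max (B + K) (B + K2)) & nrm2 (Gr (sm t)) <= max (C * (B + K)) (max (B + K) (B + K2))
   & nrm2 (u t) <= max (C * (B + K)) (max (B + K) (B + K2))"
   using gb[OF t] by linarith
 qed
qed

text \<open>A \<open>SUP\<close> dominates its members only if they are bounded above. A bound
  uniform in time comes from the mesh-dependent inverse bounds and
  \<open>sm_bounded\<close>.\<close>

lemma Linf_facts:
 assumes t: "t \<in> J"
 shows "AE x in leb. norm (sm t x) <= Sn (sm t)" "0 <= Sn (sm t)"
  "AE x in leb. norm (Gr (sm t) x) <= Sn (Gr (sm t))" "0 <= Sn (Gr (sm t))"
  "Sn (Gr (sm t)) + (Sn (sm t))\<^sup>2 / (4 * \<mu>) <= L_const \<Omega> \<mu> J sm / 2"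
  and "\<exists>Q. \<forall>t\<in>J. Sn (sm t) <= Q & Sn (Gr (sm t)) <= Q"
proof -
 obtain M where M: "M > 0" "!!v x. v \<in> XH r ==> x \<in> cells ==> norm (v x) <= M * nrm2 v"
  "!!v. v \<in> XH r ==> AE x in leb. norm (Gr v x) <= M * nrm2 v"
  using Xh_bounds[of r] by blast
 obtain B where B: "!!t. t \<in> J ==> nrm2 (sm t) <= B" using sm_bounded by blast
 have B0: "0 <= B" using B[OF t] L2_norm_nonneg[of \<Omega> "sm t"] by linarith
 have s: "AE x in leb. norm (sm t x) <= M * B" "AE x in leb. norm (Gr (sm t) x) <= M * B" if t: "t \<in> J" for t
 proof -
  have mb: "M * nrm2 (sm t) <= M * B" using B[OF t] M(1) by simp
  show "AE x in leb. norm (sm t x) <= M * B"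
   using AE_cells by eventually_elim (rule order_trans[OF M(2)[OF Vh_Xh[OF sm_in[OF t]]] mb])
  show "AE x in leb. norm (Gr (sm t) x) <= M * B"
   using M(3)[OF Vh_Xh[OF sm_in[OF t]]] by eventually_elim (use mb in linarith)
 qed
 have m: "sm t \<in> bm" "Gr (sm t) \<in> bm" if "t \<in> J" for t
  using L2_measurable[OF Vh_L2[OF sm_in[OF that]]] L2_measurable[OF grad_L2[OF Vh_H1[OF sm_in[OF that]]]] .
 show "AE x in leb. norm (sm t x) <= Sn (sm t)" "0 <= Sn (sm t)"
  by (rule Linf_norm_bounds[OF m(1)[OF t] s(1)[OF t]])+
 show "AE x in leb. norm (Gr (sm t) x) <= Sn (Gr (sm t))" "0 <= Sn (Gr (sm t))"
  by (rule Linf_norm_bounds[OF m(2)[OF t] s(2)[OF t]])+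
 have le: "Sn (sm t) <= M * B" "Sn (Gr (sm t)) <= M * B" "0 <= Sn (sm t)" if t: "t \<in> J" for t
  using Linf_norm_le[OF m(1)[OF t] s(1)[OF t]] Linf_norm_le[OF m(2)[OF t] s(2)[OF t]] Linf_norm_bounds(2)[OF m(1)[OF t] s(1)[OF t]] M(1) B0 by auto
 then show "\<exists>Q. \<forall>t\<in>J. Sn (sm t) <= Q & Sn (Gr (sm t)) <= Q" by blast
 have "bdd_above ((%t. Sn (Gr (sm t)) + (Sn (sm t))\<^sup>2 / (4 * \<mu>)) ` J)"
 proof (rule bdd_aboveI2)
  fix t assume t: "t \<in> J"
  have "(Sn (sm t))\<^sup>2 / (4 * \<mu>) <= (M * B)\<^sup>2 / (4 * \<mu>)" using le[OF t] pos by (intro divide_right_mono power_mono) auto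
  then show "Sn (Gr (sm t)) + (Sn (sm t))\<^sup>2 / (4 * \<mu>) <= M * B + (M * B)\<^sup>2 / (4 * \<mu>)"
   using le(2)[OF t] by linarith
 qed
 from cSUP_upper[OF t this]
 show "Sn (Gr (sm t)) + (Sn (sm t))\<^sup>2 / (4 * \<mu>) <= L_const \<Omega> \<mu> J sm / 2"
  by (simp add: L_const_def)
qed

abbreviation "err \<tau> \<equiv> (%x. uh \<tau> x - sm \<tau> x)"
abbreviation "perr \<tau> \<equiv> (%x. u \<tau> x - sm \<tau> x)"
abbreviation "Dt \<tau> \<phi> \<equiv> inn (uh' \<tau>) \<phi> - inn (sd \<tau>) \<phi>"

lemma err_in: "t \<in> J ==> err t \<in> VH r"
 using Vh_lin[OF uh'(3) sm_in, of t t 1 "-1"] by simp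

lemma has_integral_err:
 assumes w: "w \<in> VH r" and t: "t \<in> J" "0 <= t'" "t' <= t"
 shows "((%\<tau>. Dt \<tau> w) has_integral (inn (err t) w - inn (err t') w)) {t'..t}"
proof -
 have t'J: "t' \<in> J" using J_facts(4)[OF t(1)] t by auto
 have "inn (err a) w = inn (uh a) w - inn (sm a) w" if "a \<in> J" for a
  by (rule ip_diff[OF Vh_L2[OF uh'(3)[OF that]] Vh_L2[OF sm_in[OF that]] Vh_L2[OF w]])
 from this[OF t(1)] this[OF t'J] have e: "inn (err t) w - inn (err t') w = (inn (uh t) w - inn (uh t') w) - (inn (sm t) w - inn (sm t') w)"
  by linarith
 show ?thesis unfolding e by (rule has_integral_diff[OF has_integral_uh[OF w t] has_integral_sd[OF w t]])
qed

section \<open>Passing from the energy estimate to the error\<close>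

context
 fixes Ci cv L \<gamma> \<kappa> Cst :: real
 assumes n23: "CARD('n) = 2 \<or> CARD('n) = 3" and Ci: "0 <= Ci" and cv: "0 < cv" "cv * h ^ CARD('n) <= vD" and Ca: "0 <= C\<^sub>a"
  and inverse_ineq: "!!v. v \<in> XH r ==> AE x in leb. norm (v x) <= \<kappa> * nrm2 v"
  and \<kappa>: "\<kappa> = Ci * h powr (- (real CARD('n) / 2))" and Cst: "Cst = 1 + C\<^sub>a * (5 + 2 * real CARD('n) + c\<^sub>0)"
  and L: "L = L_const \<Omega> \<mu> J sm" "0 < L" and \<gamma>: "\<gamma> = min (\<nu> / 2 * (1 / (c\<^sub>I\<^sup>2 * H\<^sup>2))) (\<beta> / 2)"
  and \<beta>: "8 * L <= \<beta>" and H: "H <= sqrt \<nu> / (sqrt (8 * L) * c\<^sub>I)"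
begin

abbreviation "CK \<equiv> Ci * C\<^sub>a\<^sup>2 * (1 + cv powr (- 1 / 4))"
abbreviation "data \<tau> \<equiv> (sqrt \<beta> * h + sqrt \<mu> + K1 CK \<Omega> (u \<tau>) / sqrt L) * Hvn r (u \<tau>)
      + 1 / sqrt L * Hvn (r - 1) (ut \<tau>) + 1 / sqrt \<mu> * qn (r - 1) (p \<tau>)"
abbreviation "Sm \<tau> \<equiv> Sn (sm \<tau>)"
abbreviation "Gm \<tau> \<equiv> Sn (Gr (sm \<tau>))"
abbreviation "A2 \<tau> \<equiv> Gm \<tau> * nrm2 (perr \<tau>) + (1 + real CARD('n) / 2) * Sm \<tau> * nrm2 (Gr (perr \<tau>)) + \<kappa> * nrm2 (perr \<tau>) * nrm2 (Gr (perr \<tau>))"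
abbreviation "resid \<tau> \<equiv> (nrm2 (%x. ut \<tau> x - sd \<tau> x) + A2 \<tau>)\<^sup>2 / L
   + 2 * (qn 0 (%x. p \<tau> x - qp \<tau> x))\<^sup>2 / \<mu> + \<mu> * (real CARD('n) * nrm2 (Gr (perr \<tau>)))\<^sup>2 + \<beta> * (c\<^sub>0 * nrm2 (perr \<tau>))\<^sup>2"

lemma sup_Vh: "\<phi> \<in> VH r ==> AE x in leb. norm (\<phi> x) <= \<kappa> * nrm2 \<phi>" and kappa: "0 <= \<kappa>"
 using inverse_ineq Vh_Xh Ci \<kappa> by auto

text \<open>Squaring the condition on H gives \<nu> / (\<open>c\<^sub>I\<close>^2 H^2) >= 8 L; with
  \<beta> >= 8 L both arguments of the minimum are at least 4 L.\<close>

lemma gamma: "0 < \<gamma>" "4 * L <= \<gamma>" "\<gamma> * (2 * (c\<^sub>I * H)\<^sup>2) <= \<nu>" "\<gamma> <= \<beta> / 2"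
proof -
 have cH: "0 < c\<^sub>I\<^sup>2 * H\<^sup>2" using pos by simp
 show "\<gamma> <= \<beta> / 2" using \<gamma> by simp
 have "\<gamma> <= \<nu> / 2 * (1 / (c\<^sub>I\<^sup>2 * H\<^sup>2))" using \<gamma> by simp
 then have "\<gamma> * (2 * (c\<^sub>I\<^sup>2 * H\<^sup>2)) <= \<nu> / 2 * (1 / (c\<^sub>I\<^sup>2 * H\<^sup>2)) * (2 * (c\<^sub>I\<^sup>2 * H\<^sup>2))" using cH by (intro mult_right_mono) auto
 then show "\<gamma> * (2 * (c\<^sub>I * H)\<^sup>2) <= \<nu>" using pos by (simp add: power_mult_distrib)
 have "sqrt (8 * L) * c\<^sub>I * H <= sqrt \<nu>" using H pos L(2) by (simp add: pos_le_divide_eq mult.commute)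
 then have "(sqrt (8 * L) * c\<^sub>I * H)\<^sup>2 <= (sqrt \<nu>)\<^sup>2" using pos L(2) by (intro power_mono) auto
 then have "8 * L * (c\<^sub>I\<^sup>2 * H\<^sup>2) <= \<nu>" using pos L(2) by (simp add: power_mult_distrib mult.assoc)
 then have "8 * L <= \<nu> / (c\<^sub>I\<^sup>2 * H\<^sup>2)" using cH by (simp add: pos_le_divide_eq)
 then show "4 * L <= \<gamma>" using \<beta> by (simp add: \<gamma>)
 then show "0 < \<gamma>" using L(2) by simp
qed

lemma S_bound: "t \<in> J ==> Gm t <= L / 2" "t \<in> J ==> (Sm t)\<^sup>2 <= 2 * \<mu> * L"
proof -
 assume t: "t \<in> J"
 note F = Linf_facts[OF t]
 have "0 <= (Sm t)\<^sup>2 / (4 * \<mu>)" using pos by simp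
 then show "Gm t <= L / 2" using F(5) L(1) by linarith
 have "(Sm t)\<^sup>2 / (4 * \<mu>) <= L / 2" using F(4,5) L(1) by linarith
 then have "(Sm t)\<^sup>2 <= L / 2 * (4 * \<mu>)" using pos by (simp add: pos_divide_le_eq)
 then show "(Sm t)\<^sup>2 <= 2 * \<mu> * L" by (simp add: mult_ac)
qed

lemma data_nonneg: "0 <= data \<tau>"
 using pos L(2) \<beta> h_pos Ci by (intro add_nonneg_nonneg mult_nonneg_nonneg) (auto simp: K1_nonneg quot_norm_nonneg)

lemma residual_AE:
 "AE \<tau> in lebesgue_on J. Dt \<tau> (err \<tau>) <= - (\<gamma> / 4) * (nrm2 (err \<tau>))\<^sup>2 + (Cst * h ^ (r - 1) * data \<tau>)\<^sup>2 / 2 &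
  nrm2 (perr \<tau>) <= Cst / sqrt L * h ^ (r - 1) * data \<tau> &
  nrm2 (%x. ut \<tau> x - sd \<tau> x) <= C\<^sub>a * h ^ (r - 1) * Hvn (r - 1) (ut \<tau>) &
  nrm2 (Gr (perr \<tau>)) <= C\<^sub>a * h ^ (r - 1) * Hvn r (u \<tau>) &
  qn 0 (%x. p \<tau> x - qp \<tau> x) <= C\<^sub>a * h ^ (r - 1) * qn (r - 1) (p \<tau>)"
proof -
 obtain B where B: "AE \<tau> in lebesgue_on J. reg B \<tau>"
  using bounds by blast
 show ?thesis
  using step_AE ap[unfolded approximation_properties_def] B AE_space
 proof eventually_elim
  case (elim \<tau>)
  then have J: "\<tau> \<in> J" by (simp add: space_restrict_space)
  interpret N: nudged_step \<Omega> \<sigma> h T r \<nu> \<mu> \<beta> c\<^sub>0 c\<^sub>I H IH "u \<tau>" "ut \<tau>" "f \<tau>" "sm \<tau>" "sd \<tau>" "uh \<tau>" "uh' \<tau>" "p \<tau>" "qp \<tau>"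
   by (rule elim(1))
  note F = Linf_facts(1-4)[OF J]
  have h0: "0 < h" by (rule h_pos)
  have hh: "0 < h ^ (r - 1)" using h0 by simp
  \<comment> \<open>One power of h is split off: it stays in the bound on w and is cancelled in the
    bound on its gradient.\<close>
  have hr: "h ^ r = h * h ^ (r - 1)" using r2 by (cases r) auto
  have A: "nrm2 (perr \<tau>) + h * Hvn 1 (perr \<tau>) <= C\<^sub>a * Hvn j (u \<tau>) * h ^ j" if "j \<in> {1..r}" for j
   using elim(2) that by blast
  have hn: "0 <= h * Hvn 1 (perr \<tau>)" using h0 by simp
  have r1: "r \<in> {1..r}" "r - 1 \<in> {1..r}" "1 \<in> {1..r}" "2 \<in> {1..r}" using r2 by auto
  have wn: "nrm2 (perr \<tau>) <= C\<^sub>a * h * h ^ (r - 1) * Hvn r (u \<tau>)"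
   using A[OF r1(1)] hn unfolding hr by (simp add: mult_ac)
  have "h * Hvn 1 (perr \<tau>) <= h * (C\<^sub>a * h ^ (r - 1) * Hvn r (u \<tau>))"
   using A[OF r1(1)] L2_norm_nonneg[of \<Omega> "perr \<tau>"] unfolding hr by (simp only: mult_ac)
  then have "Hvn 1 (perr \<tau>) <= C\<^sub>a * h ^ (r - 1) * Hvn r (u \<tau>)" using h0 by simp
  then have gw: "nrm2 (Gr (perr \<tau>)) <= C\<^sub>a * h ^ (r - 1) * Hvn r (u \<tau>)"
   using grad_norm_le[OF N.w1] by linarith
  have a1: "nrm2 (%x. ut \<tau> x - sd \<tau> x) <= C\<^sub>a * h ^ (r - 1) * Hvn (r - 1) (ut \<tau>)"
  proof -
   \<comment> \<open>The order is r - 1, as \<open>ut\<close> is one degree less regular than u; it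
     is at least 1 because r >= 2.\<close>
   have "ut \<tau> \<in> Hv (r - 1)" using elim(3) diff_le_mono[OF rs] Hs_vec_mono by blast
   then have "nrm2 (%x. ut \<tau> x - sd \<tau> x) + h * Hvn 1 (%x. ut \<tau> x - sd \<tau> x) <= C\<^sub>a * Hvn (r - 1) (ut \<tau>) * h ^ (r - 1)"
    using elim(2) r1(2) N.sd_proj by blast
   moreover have "0 <= h * Hvn 1 (%x. ut \<tau> x - sd \<tau> x)" using h0 by simp
   ultimately show ?thesis by (simp add: mult_ac)
  qed
  have P: "qn 0 (%x. p \<tau> x - qp \<tau> x) <= C\<^sub>a * h ^ (r - 1) * qn (r - 1) (p \<tau>)"
   using elim(2) r1(1) N.q_proj by blast
  have K: "\<kappa> * nrm2 (perr \<tau>) * C\<^sub>a <= K1 CK \<Omega> (u \<tau>)"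
   unfolding \<kappa>
  proof (rule K1_bound[OF n23 Ci cv h0 Ca])
   show "nrm2 (perr \<tau>) <= C\<^sub>a * Hvn 1 (u \<tau>) * h" using A[OF r1(3)] hn by simp
   show "nrm2 (perr \<tau>) <= C\<^sub>a * Hvn 2 (u \<tau>) * h\<^sup>2" using A[OF r1(4)] hn by linarith
  qed simp
  have CK0: "0 <= K1 CK \<Omega> (u \<tau>)" using Ci by (intro K1_nonneg) simp
  note RA = residual_arith[OF L(2) pos(2) h0 hh \<beta> F(2) S_bound(2)[OF J] F(4) S_bound(1)[OF J] Ca less_imp_le[OF pos(6)] _ kappa CK0 _ _ _ _ _ _ _ wn gw a1 P K, of "real CARD('n)"]
  have R: "resid \<tau> <= (Cst * h ^ (r - 1) * data \<tau>)\<^sup>2"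
   unfolding Cst by (rule RA(1)) (auto simp: quot_norm_nonneg)
  have W: "nrm2 (perr \<tau>) <= Cst / sqrt L * h ^ (r - 1) * data \<tau>"
   unfolding Cst by (rule RA(2)) (auto simp: quot_norm_nonneg)
  have "Dt \<tau> (err \<tau>) <= - (\<gamma> / 4) * (nrm2 (err \<tau>))\<^sup>2 + resid \<tau> / 2"
   by (rule N.energy_estimate[OF sup_Vh kappa F Linf_facts(5)[OF J, folded L(1)] L(2) gamma(2,3,4)])
  also have "... <= - (\<gamma> / 4) * (nrm2 (err \<tau>))\<^sup>2 + (Cst * h ^ (r - 1) * data \<tau>)\<^sup>2 / 2"
   by (rule add_left_mono[OF divide_right_mono[OF R]]) simp
  finally have "Dt \<tau> (err \<tau>) <= - (\<gamma> / 4) * (nrm2 (err \<tau>))\<^sup>2 + (Cst * h ^ (r - 1) * data \<tau>)\<^sup>2 / 2" .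
  then show ?case using W a1 gw P by blast
 qed
qed

text \<open>The constant may depend on t, the mesh and all data; the only conclusion drawn from it
  is that the error is Lipschitz on [0,t].\<close>

lemma crude_AE:
 assumes t: "t \<in> J"
 shows "\<exists>M\<ge>0. AE \<tau> in lebesgue_on {0..t}. \<forall>\<phi>\<in>VH r. \<bar>Dt \<tau> \<phi>\<bar> <= M * nrm2 \<phi>"
proof -
 obtain B where B: "AE \<tau> in lebesgue_on J. reg B \<tau>"
  using bounds by blast
 obtain Bh where Bh: "!!\<tau>. \<tau> \<in> {0..t} ==> nrm2 (uh \<tau>) <= Bh" using uh_bounded[OF t] by blast
 obtain Bs where Bs: "!!t. t \<in> J ==> nrm2 (sm t) <= Bs" "!!t. t \<in> J ==> nrm2 (u t) <= Bs" using sm_bounded by blast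
 obtain Ql where Ql: "!!t. t \<in> J ==> Sm t <= Ql" "!!t. t \<in> J ==> Gm t <= Ql" using Linf_facts(6)[OF t] by blast
 obtain M where M: "M > 0" "!!v. v \<in> XH r ==> nrm2 (Gr v) <= M * nrm2 v"
  using Xh_bounds[of r] by blast
 define E where "E = C\<^sub>a * h ^ (r - 1) * B"
 define Q where "Q = max (max E Bs) (max Bh (Ql * (2 * Bs) + (1 + real CARD('n) / 2) * Ql * E + \<kappa> * (2 * Bs) * E))"
 let ?M = "Q + \<nu> * (M * (2 * Q) * M) + (Q + \<kappa> * (M * ((2 + real CARD('n)) * Q\<^sup>2)) * 2) + Q * (real CARD('n) * M) + \<mu> * (real CARD('n) * M * Q * (real CARD('n) * M)) + \<beta> * (c\<^sub>0 * (2 * Q) * c\<^sub>0)"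
 have Q0: "0 <= Q" using Bs(1)[OF t] L2_norm_nonneg[of \<Omega> "sm t"] unfolding Q_def by linarith
 have ch: "0 <= C\<^sub>a * h ^ (r - 1)" using Ca h_pos by simp
 show ?thesis
 proof (intro exI[of _ ?M] conjI)
  show "0 <= ?M" using Q0 M(1) pos kappa by (intro add_nonneg_nonneg mult_nonneg_nonneg) auto
  show "AE \<tau> in lebesgue_on {0..t}. \<forall>\<phi>\<in>VH r. \<bar>Dt \<tau> \<phi>\<bar> <= ?M * nrm2 \<phi>"
   using AE_sub[OF t step_AE order_refl] AE_sub[OF t B order_refl] AE_sub[OF t residual_AE order_refl] AE_space
  proof eventually_elim
   case (elim \<tau>)
   then have \<tau>: "\<tau> \<in> {0..t}" by (simp add: space_restrict_space)
   then have J: "\<tau> \<in> J" using J_facts(4)[OF t] by blast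
   interpret N: nudged_step \<Omega> \<sigma> h T r \<nu> \<mu> \<beta> c\<^sub>0 c\<^sub>I H IH "u \<tau>" "ut \<tau>" "f \<tau>" "sm \<tau>" "sd \<tau>" "uh \<tau>" "uh' \<tau>" "p \<tau>" "qp \<tau>"
    by (rule elim(1))
   note F = Linf_facts(1-4)[OF J]
   have nb: "Hvn r (u \<tau>) <= B" "Hvn (r - 1) (ut \<tau>) <= B" "qn (r - 1) (p \<tau>) <= B"
    using elim(2) rs diff_le_mono[OF rs] by blast+
   have e: "nrm2 (%x. ut \<tau> x - sd \<tau> x) <= E" "nrm2 (Gr (perr \<tau>)) <= E" "qn 0 (%x. p \<tau> x - qp \<tau> x) <= E"
    using elim(3) nb[THEN mult_left_mono, OF ch] unfolding E_def by linarith+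
   have w: "nrm2 (perr \<tau>) <= 2 * Bs"
    using L2_norm_diff_triangle[OF N.L2s(1,2)] Bs[OF J] by linarith
   have E0: "0 <= E" using e(2) L2_norm_nonneg[of \<Omega> "Gr (perr \<tau>)"] by linarith
   have Bs0: "0 <= Bs" using Bs(1)[OF J] L2_norm_nonneg[of \<Omega> "sm \<tau>"] by linarith
   have Ql0: "0 <= Ql" using Ql(1)[OF J] F(2) by linarith
   have A2: "A2 \<tau> <= Q"
   proof -
    have "Gm \<tau> * nrm2 (perr \<tau>) <= Ql * (2 * Bs)" using Ql[OF J] F w Ql0 by (intro mult_mono) auto
    moreover have "(1 + real CARD('n) / 2) * Sm \<tau> * nrm2 (Gr (perr \<tau>)) <= (1 + real CARD('n) / 2) * Ql * E"
     using Ql[OF J] F e Ql0 by (intro mult_mono mult_left_mono) auto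
    moreover have "\<kappa> * nrm2 (perr \<tau>) * nrm2 (Gr (perr \<tau>)) <= \<kappa> * (2 * Bs) * E"
     using w e kappa Bs0 by (intro mult_mono mult_left_mono) auto
    ultimately show ?thesis unfolding Q_def by linarith
   qed
   show ?case
   proof
    fix \<phi> assume \<phi>: "\<phi> \<in> VH r"
    show "\<bar>Dt \<tau> \<phi>\<bar> <= ?M * nrm2 \<phi>"
    proof (rule N.crude_bound[OF sup_Vh kappa F \<phi> M(2)[OF Vh_Xh] less_imp_le[OF M(1)] _ A2])
     show "nrm2 (%x. ut \<tau> x - sd \<tau> x) <= Q" "qn 0 (%x. p \<tau> x - qp \<tau> x) <= Q"
      "nrm2 (sm \<tau>) <= Q" "nrm2 (uh \<tau>) <= Q" "nrm2 (u \<tau>) <= Q"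
      using e Bs[OF J] Bh[OF \<tau>] unfolding Q_def by linarith+
    qed
   qed
  qed
 qed
qed

text \<open>The error is only known to be Lipschitz in time, hence the discrete Gronwall argument on increments
  instead of a differential inequality.\<close>

lemma error_growth:
 assumes t: "t \<in> J" and R: "AE \<tau> in lebesgue_on {0..t}. Dt \<tau> (err \<tau>) <= - (\<gamma> / 4) * (nrm2 (err \<tau>))\<^sup>2 + R\<^sup>2 / 2"
 shows "(nrm2 (err t))\<^sup>2 <= exp (- (\<gamma> / 2) * t) * (nrm2 (err 0))\<^sup>2 + R\<^sup>2 / (\<gamma> / 2)"
proof -
 obtain M where M: "M >= 0" "AE \<tau> in lebesgue_on {0..t}. \<forall>\<phi>\<in>VH r. \<bar>Dt \<tau> \<phi>\<bar> <= M * nrm2 \<phi>"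
  using crude_AE[OF t] by blast
 have sub: "{0..t} \<subseteq> J" by (rule J_facts(4)[OF t])
 have AEs: "AE \<tau> in lebesgue_on {a..b}. P \<tau>" if "AE \<tau> in lebesgue_on {0..t}. P \<tau>" "0 <= a" "b <= t" for P a b
  by (rule AE_lebesgue_on_subset[OF that(1)]) (use that in auto)
 have eL: "err a \<in> LL" if "a \<in> J" for a by (rule Vh_L2[OF err_in[OF that]])
 have dV: "(%x. err b x - err a x) \<in> VH r" "(%x. err b x + err a x) \<in> VH r" if "a \<in> J" "b \<in> J" for a b
  by (rule semi_inner.V_diff[OF semi_inner_Vh err_in[OF that(2)] err_in[OF that(1)]],
    rule semi_inner.V_add[OF semi_inner_Vh err_in[OF that(2)] err_in[OF that(1)]])
 have lip: "nrm2 (%x. err b x - err a x) <= M * (b - a)" if ab: "0 <= a" "a <= b" "b <= t" for a b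
 proof -
  have J: "a \<in> J" "b \<in> J" using sub ab by auto
  let ?v = "%x. err b x - err a x"
  let ?g = "nrm2 ?v"
  have "\<bar>inn (err b) ?v - inn (err a) ?v\<bar> <= (b - a) * (M * ?g)"
   by (rule has_integral_AE_abs_le[OF has_integral_err[OF dV(1)[OF J] J(2) ab(1,2)] _ ab(2)])
    (use AEs[OF M(2) ab(1,3)] dV(1)[OF J] in \<open>auto elim!: eventually_mono\<close>)
  moreover have "inn ?v ?v = inn (err b) ?v - inn (err a) ?v"
   by (rule ip_diff[OF eL[OF J(2)] eL[OF J(1)] Vh_L2[OF dV(1)[OF J]]])
  ultimately have "?g * ?g <= (M * (b - a)) * ?g" by (simp add: L2_norm_sq[symmetric] power2_eq_square mult_ac)
  from square_le_cancel[OF _ _ this] show ?thesis using M(1) ab by auto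
 qed
 define E where "E = nrm2 (err 0) + M * t"
 have E: "nrm2 (err a) <= E" if "0 <= a" "a <= t" for a
 proof -
  have J: "a \<in> J" "0 \<in> J" using sub that by auto
  have "nrm2 (err a) <= nrm2 (err 0) + M * (a - 0)"
   using lip[of 0 a] L2_norm_reverse_triangle[OF eL[OF J(1)] eL[OF J(2)]] that by linarith
  also have "M * (a - 0) <= M * t" using that M(1) by (intro mult_left_mono) auto
  finally show ?thesis by (simp add: E_def)
 qed
 have E0: "0 <= E" using E[of 0] J_facts(3)[OF t] L2_norm_nonneg[of \<Omega> "err 0"] by linarith
 let ?Y = "%a. (nrm2 (err a))\<^sup>2"
 \<comment> \<open>Collects two errors of second order in the step: replacing the test field by
   twice the error at \<tau>, and replacing the squared norm at \<tau> by that at a.\<close>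
 let ?K = "2 * M * M + \<gamma> * (M * E)"
 show ?thesis
 proof (rule discrete_gronwall[where K="?K"])
  fix a b assume ab: "0 <= a" "a <= b" "b <= t"
  have J: "a \<in> J" "b \<in> J" using sub ab by auto
  let ?v = "%x. err b x + err a x"
  have v: "?v \<in> VH r" by (rule dV(2)[OF J])
  \<comment> \<open>The difference of squares is the increment of the pairing with the sum of both
    errors. This field does not depend on \<tau>, so the integral formula for fixed test functions
    applies.\<close>
  have Yd: "?Y y - ?Y x = inn (err y) (%z. err y z + err x z) - inn (err x) (%z. err y z + err x z)" if "x \<in> J" "y \<in> J" for x y
   using ip_add_right[OF eL[OF that(2)] eL[OF that(1)] eL[OF that(2)]] ip_add_right[OF eL[OF that(2)] eL[OF that(1)] eL[OF that(1)]]
   by (simp add: L2_norm_sq ip_sym[of \<Omega> "err x" "err y"])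
  have "?Y b - ?Y a <= (b - a) * ((R\<^sup>2 - \<gamma> / 2 * ?Y a) + ?K * (b - a))"
   unfolding Yd[OF J]
  proof (rule has_integral_AE_le[OF has_integral_err[OF v J(2) ab(1,2)] _ ab(2)])
   show "AE \<tau> in lebesgue_on {a..b}. Dt \<tau> ?v <= (R\<^sup>2 - \<gamma> / 2 * ?Y a) + ?K * (b - a)"
    using AEs[OF M(2) ab(1,3)] AEs[OF R ab(1,3)] AE_sub[OF J(2) step_AE ab(1)] AE_space
   proof eventually_elim
    case (elim \<tau>)
    then have \<tau>: "a <= \<tau>" "\<tau> <= b" by (auto simp: space_restrict_space)
    have \<tau>J: "\<tau> \<in> J" using sub ab \<tau> by auto
    let ?d1 = "%x. err b x - err \<tau> x" and ?d2 = "%x. err \<tau> x - err a x"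
    have L: "uh' \<tau> \<in> LL" by (rule Vh_L2[OF uh'(1)[OF \<tau>J]])
    have d: "?d1 \<in> VH r" "?d2 \<in> VH r" by (rule dV(1)[OF \<tau>J J(2)], rule dV(1)[OF J(1) \<tau>J])
    have l1: "nrm2 ?d1 <= M * (b - a)" using lip[of \<tau> b] \<tau> ab mult_left_mono[of "b - \<tau>" "b - a" M] M(1) by linarith
    have l2: "nrm2 ?d2 <= M * (b - a)" using lip[of a \<tau>] \<tau> ab mult_left_mono[of "\<tau> - a" "b - a" M] M(1) by linarith
    interpret N: nudged_step \<Omega> \<sigma> h T r \<nu> \<mu> \<beta> c\<^sub>0 c\<^sub>I H IH "u \<tau>" "ut \<tau>" "f \<tau>" "sm \<tau>" "sd \<tau>" "uh \<tau>" "uh' \<tau>" "p \<tau>" "qp \<tau>"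
     by (rule elim(3))
    \<comment> \<open>The sum of the errors at both ends is twice the error at \<tau> plus
      increments, which are of the size of the step.\<close>
    have split: "inn X ?v = 2 * inn X (err \<tau>) + inn X ?d1 - inn X ?d2" if "X \<in> LL" for X
     using that eL[OF J(1)] eL[OF J(2)] eL[OF \<tau>J] ip_add_right[of "err b" \<Omega> "err a" X] ip_diff_right[of "err b" \<Omega> "err \<tau>" X] ip_diff_right[of "err \<tau>" \<Omega> "err a" X]
     by simp
    have 1: "Dt \<tau> ?v = 2 * Dt \<tau> (err \<tau>) + Dt \<tau> ?d1 - Dt \<tau> ?d2"
     using split[OF L] split[OF N.L2s(4)] by simp
    have "\<bar>Dt \<tau> ?d1\<bar> <= M * nrm2 ?d1" "\<bar>Dt \<tau> ?d2\<bar> <= M * nrm2 ?d2" using elim(1) d by blast+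
    moreover have "M * nrm2 ?d1 <= M * (M * (b - a))" "M * nrm2 ?d2 <= M * (M * (b - a))"
     using l1 l2 M(1) by (intro mult_left_mono; simp)+
    ultimately have 2: "Dt \<tau> ?v <= 2 * Dt \<tau> (err \<tau>) + 2 * (M * (M * (b - a)))" using 1 by linarith
    have 3: "?Y a - ?Y \<tau> <= 2 * E * (M * (b - a))"
    proof -
     let ?x = "nrm2 (err a)" and ?y = "nrm2 (err \<tau>)"
     have xy: "\<bar>?y - ?x\<bar> <= M * (b - a)" using L2_norm_reverse_triangle[OF eL[OF \<tau>J] eL[OF J(1)]] l2 by linarith
     have "?Y a - ?Y \<tau> = (?x + ?y) * (?x - ?y)" by (simp add: power2_eq_square algebra_simps)
     also have "... <= (?x + ?y) * (M * (b - a))" using xy by (intro mult_left_mono) auto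
     also have "... <= (2 * E) * (M * (b - a))" using E[of a] E[of \<tau>] \<tau> ab M(1) by (intro mult_right_mono) auto
     finally show ?thesis .
    qed
    have 4: "\<gamma> / 2 * (?Y a - ?Y \<tau>) <= \<gamma> / 2 * (2 * E * (M * (b - a)))" using 3 gamma(1) by (intro mult_left_mono) auto
    have "Dt \<tau> ?v <= - (\<gamma> / 2) * ?Y \<tau> + R\<^sup>2 + 2 * (M * (M * (b - a)))"
    proof -
     have "2 * (- (\<gamma> / 4) * ?Y \<tau> + R\<^sup>2 / 2) = - (\<gamma> / 2) * ?Y \<tau> + R\<^sup>2" by (simp add: distrib_left)
     then have "2 * Dt \<tau> (err \<tau>) <= - (\<gamma> / 2) * ?Y \<tau> + R\<^sup>2" using mult_left_mono[OF elim(2), of 2] by simp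
     then show ?thesis using 2 by linarith
    qed
    also have "... <= (R\<^sup>2 - \<gamma> / 2 * ?Y a) + ?K * (b - a)" using 4 by (simp add: algebra_simps)
    finally show ?case .
   qed
  qed
  then show "?Y b - ?Y a <= (b - a) * (R\<^sup>2 - \<gamma> / 2 * ?Y a) + ?K * (b - a)\<^sup>2"
   by (simp add: algebra_simps power2_eq_square)
 qed (use gamma(1) M(1) E0 J_facts(3)[OF t] in auto)
qed

text \<open>u and its projection are Lipschitz in time, so a bound valid at almost every time holds
  at every time. It is required at t and at 0, which may belong to the exceptional set.\<close>

lemma perr_bound:
 assumes t: "t \<in> J" "0 < t" and W: "AE \<tau> in lebesgue_on {0..t}. nrm2 (perr \<tau>) <= W" and x: "x \<in> {0..t}"
 shows "nrm2 (perr x) <= W"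
proof (rule field_le_epsilon)
 fix \<epsilon> :: real assume \<epsilon>: "0 < \<epsilon>"
 obtain K where K: "K >= 0" "!!t t'. t \<in> J ==> t' \<in> J ==> nrm2 (%x. u t x - u t' x) <= K * \<bar>t - t'\<bar>"
  using u_lipschitz by blast
 obtain K2 where K2: "K2 >= 0" "!!t t'. t \<in> J ==> t' \<in> J ==> nrm2 (%x. sm t x - sm t' x) <= K2 * \<bar>t - t'\<bar>"
  using sm_diff_L2 by blast
 have KK: "0 < K + K2 + 1" using K K2 by linarith
 obtain \<tau> where \<tau>: "\<tau> \<in> {0..t}" "\<bar>\<tau> - x\<bar> < \<epsilon> / (K + K2 + 1)" "nrm2 (perr \<tau>) <= W"
  using AE_dense[OF W t(2) x, of "\<epsilon> / (K + K2 + 1)"] \<epsilon> KK by auto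
 have J: "x \<in> J" "\<tau> \<in> J" using J_facts(4)[OF t(1)] x \<tau>(1) by auto
 have pL: "perr y \<in> LL" if "y \<in> J" for y by (rule L2_diff[OF u_in(3)[OF that] Vh_L2[OF sm_in[OF that]]])
 let ?du = "%z. u x z - u \<tau> z" and ?ds = "%z. sm x z - sm \<tau> z"
 have dL: "?du \<in> LL" "?ds \<in> LL" by (intro L2_diff u_in J Vh_L2[OF sm_in[OF J(1)]] Vh_L2[OF sm_in[OF J(2)]])+
 have "\<bar>nrm2 (perr x) - nrm2 (perr \<tau>)\<bar> <= nrm2 (%z. perr x z - perr \<tau> z)"
  by (rule L2_norm_reverse_triangle[OF pL[OF J(1)] pL[OF J(2)]])
 also have "(%z. perr x z - perr \<tau> z) = (%z. ?du z - ?ds z)" by (auto simp: fun_eq_iff)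
 also have "nrm2 ... <= nrm2 ?du + nrm2 ?ds" by (rule L2_norm_diff_triangle[OF dL])
 also have "... <= K * \<bar>x - \<tau>\<bar> + K2 * \<bar>x - \<tau>\<bar>" by (intro add_mono K(2) K2(2) J)
 also have "... <= (K + K2 + 1) * \<bar>\<tau> - x\<bar>" by (simp add: algebra_simps abs_minus_commute)
 also have "... <= \<epsilon>" using \<tau>(2) KK by (simp add: pos_less_divide_eq mult.commute)
 finally show "nrm2 (perr x) <= W + \<epsilon>" using \<tau>(3) by linarith
qed

text \<open>The bracket is a measurable function of time, bounded by the uniform bounds on all norms
  that occur in it, so its essential maximum is finite and dominates it.\<close>

lemma data_ess_max:
 assumes t: "t \<in> J" "0 < t"
 shows "AE \<tau> in lebesgue_on {0..t}. data \<tau> <= ess_max t data" "0 <= ess_max t data"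
proof -
 obtain B where B: "AE \<tau> in lebesgue_on J. reg B \<tau>"
  using bounds by blast
 have ks: "CARD('n) - 2 <= s" "1 <= s" "2 <= s" "r <= s" "r - 1 <= s - 1" using n23 r2 rs by auto
 have m: "data \<in> borel_measurable (lebesgue_on J)"
  unfolding K1_def using ks
  by (intro borel_measurable_add borel_measurable_times borel_measurable_const borel_measurable_divide measurable_compose[OF _ borel_measurable_sqrt] u_norm_meas ut_norm_meas p_norm_meas)
 define v where "v = vD powr ((3 - real CARD('n)) / (2 * real CARD('n)))"
 have v: "0 <= v" by (simp add: v_def)
 have CK0: "0 <= CK" using Ci by simp
 have "AE \<tau> in lebesgue_on J. data \<tau> <= (sqrt \<beta> * h + sqrt \<mu> + CK * (sqrt (B * B) + v * sqrt (B * B)) / sqrt L) * B + 1 / sqrt L * B + 1 / sqrt \<mu> * B"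
  using B
 proof eventually_elim
  case (elim \<tau>)
  have U: "Hvn k (u \<tau>) <= B" if "k <= s" for k using elim that by blast
  have V: "Hvn (r - 1) (ut \<tau>) <= B" "qn (r - 1) (p \<tau>) <= B" using elim ks by blast+
  have B0: "0 <= B" using U[OF ks(2)] Hs_vec_norm_nonneg[of 1 "u \<tau>"] by linarith
  have s1: "sqrt (Hvn (CARD('n) - 2) (u \<tau>) * Hvn 2 (u \<tau>)) <= sqrt (B * B)"
   "sqrt (Hvn 1 (u \<tau>) * Hvn 2 (u \<tau>)) <= sqrt (B * B)"
   using U ks B0 by (intro real_sqrt_le_mono mult_mono; simp)+
  have K: "K1 CK \<Omega> (u \<tau>) <= CK * (sqrt (B * B) + v * sqrt (B * B))"
   unfolding K1_def v_def[symmetric] by (intro mult_left_mono[OF _ CK0] add_mono s1 mult_left_mono[OF _ v])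
  have "K1 CK \<Omega> (u \<tau>) / sqrt L <= CK * (sqrt (B * B) + v * sqrt (B * B)) / sqrt L" using K L(2) by (intro divide_right_mono) auto
  moreover have "0 <= CK * (sqrt (B * B) + v * sqrt (B * B)) / sqrt L" using CK0 v L(2) by simp
  ultimately show ?case
   using U[OF ks(4)] V pos L(2) \<beta> h_pos B0 by (intro add_mono mult_mono mult_left_mono add_nonneg_nonneg order_refl) auto
 qed
 from ess_max_bounds[OF meas_sub[OF t(1) m order_refl] t(2) AE_sub[OF t(1) this order_refl]]
 show "AE \<tau> in lebesgue_on {0..t}. data \<tau> <= ess_max t data" "0 <= ess_max t data"
  using data_nonneg by auto
qed

text \<open>Three equal contributions give the factor 3: the projection error at t, the one at 0
  hidden in the initial value of the discrete error, and the inhomogeneous part of the Gronwall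
  bound.\<close>

lemma error_bound:
 assumes t: "t \<in> J"
 shows "nrm2 (%x. u t x - uh t x) <= exp (- \<gamma> * t / 4) * nrm2 (%x. uh 0 x - u 0 x)
  + (3 * Cst) / sqrt L * h ^ (r - 1) * ess_max t data"
proof (cases "t = 0")
 case True
 have "nrm2 (%x. u 0 x - uh 0 x) = nrm2 (%x. uh 0 x - u 0 x)"
  by (subst (1 2) L2_norm_norm[symmetric]) (simp add: norm_minus_commute)
 then show ?thesis by (simp add: True ess_max_0)
next
 case False
 then have t0: "0 < t" using J_facts(3)[OF t] by linarith
 let ?m = "ess_max t data"
 define R where "R = Cst * h ^ (r - 1) * ?m"
 note m = data_ess_max[OF t t0]
 have sL: "0 < sqrt L" using L(2) by simp
 have C0: "0 <= Cst" unfolding Cst using Ca pos by (intro add_nonneg_nonneg mult_nonneg_nonneg) auto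
 have ch: "0 <= Cst * h ^ (r - 1)" using C0 h_pos by simp
 have R0: "0 <= R" unfolding R_def by (rule mult_nonneg_nonneg[OF ch m(2)])
 have dR: "0 <= Cst * h ^ (r - 1) * data \<tau>" for \<tau> by (rule mult_nonneg_nonneg[OF ch data_nonneg])
 have dm: "AE \<tau> in lebesgue_on {0..t}. Cst * h ^ (r - 1) * data \<tau> <= R"
  using m(1) unfolding R_def by eventually_elim (rule mult_left_mono[OF _ ch])
 have E: "AE \<tau> in lebesgue_on {0..t}. Dt \<tau> (err \<tau>) <= - (\<gamma> / 4) * (nrm2 (err \<tau>))\<^sup>2 + R\<^sup>2 / 2"
  using AE_sub[OF t residual_AE order_refl] dm
 proof eventually_elim
  case (elim \<tau>)
  have "(Cst * h ^ (r - 1) * data \<tau>)\<^sup>2 <= R\<^sup>2" by (rule power_mono[OF elim(2) dR])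
  then show ?case using elim(1) by linarith
 qed
 have W: "AE \<tau> in lebesgue_on {0..t}. nrm2 (perr \<tau>) <= R / sqrt L"
  using AE_sub[OF t residual_AE order_refl] dm
 proof eventually_elim
  case (elim \<tau>)
  have "Cst / sqrt L * h ^ (r - 1) * data \<tau> = (Cst * h ^ (r - 1) * data \<tau>) / sqrt L" by simp
  also have "... <= R / sqrt L" using elim(2) sL by (intro divide_right_mono) auto
  finally show ?case using elim(1) by linarith
 qed
 have w: "nrm2 (perr t) <= R / sqrt L" "nrm2 (perr 0) <= R / sqrt L"
  using perr_bound[OF t t0 W] t0 by auto
 \<comment> \<open>The squared norm decays at rate \<gamma> / 2, hence the norm at rate \<gamma> /
   4.\<close>
 have ex: "exp (- (\<gamma> / 2) * t) = (exp (- \<gamma> * t / 4))\<^sup>2" by (simp add: exp_double[symmetric])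
 \<comment> \<open>By 4 L <= \<gamma> the rate in the denominator can be replaced by L, which gives
   the factor 1 / sqrt L after taking roots.\<close>
 have Rg: "R\<^sup>2 / (\<gamma> / 2) <= (R / sqrt L)\<^sup>2"
 proof -
  have "R\<^sup>2 / (\<gamma> / 2) <= R\<^sup>2 / L" using gamma(2) L(2) by (intro divide_left_mono) auto
  then show ?thesis using L(2) by (simp add: power_divide)
 qed
 let ?q = "exp (- \<gamma> * t / 4)"
 have "(nrm2 (err t))\<^sup>2 <= (?q * nrm2 (err 0))\<^sup>2 + (R / sqrt L)\<^sup>2"
  using error_growth[OF t E] Rg unfolding ex power_mult_distrib by linarith
 also have "... <= (?q * nrm2 (err 0) + R / sqrt L)\<^sup>2"
 proof -
  have "0 <= (?q * nrm2 (err 0)) * (R / sqrt L)" using R0 sL by (intro mult_nonneg_nonneg) auto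
  then show ?thesis unfolding power2_sum by simp
 qed
 finally have e: "nrm2 (err t) <= ?q * nrm2 (err 0) + R / sqrt L"
  by (rule power2_le_imp_le) (use R0 sL in auto)
 have J0: "0 \<in> J" by (rule J_facts(1))
 have L2f: "u a \<in> LL" "uh a \<in> LL" "sm a \<in> LL" if "a \<in> J" for a
  by (rule u_in(3)[OF that], rule Vh_L2[OF uh'(3)[OF that]], rule Vh_L2[OF sm_in[OF that]])
 have e0: "nrm2 (err 0) <= nrm2 (%x. uh 0 x - u 0 x) + R / sqrt L"
  using L2_norm_triangle[OF L2_diff[OF L2f(2)[OF J0] L2f(1)[OF J0]] L2_diff[OF L2f(1)[OF J0] L2f(3)[OF J0]]] w(2) by simp
 have "nrm2 (%x. u t x - uh t x) <= nrm2 (perr t) + nrm2 (err t)"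
  using L2_norm_diff_triangle[OF L2_diff[OF L2f(1)[OF t] L2f(3)[OF t]] L2_diff[OF L2f(2)[OF t] L2f(3)[OF t]]] by simp
 also have "... <= R / sqrt L + (?q * (nrm2 (%x. uh 0 x - u 0 x) + R / sqrt L) + R / sqrt L)"
  using w(1) e mult_left_mono[OF e0 exp_ge_zero[of "- \<gamma> * t / 4"]] by linarith
 also have "... <= ?q * nrm2 (%x. uh 0 x - u 0 x) + 3 * (R / sqrt L)"
 proof -
  have "?q <= 1" using gamma(1) t0 by simp
  then have "?q * (R / sqrt L) <= 1 * (R / sqrt L)" using R0 sL by (intro mult_right_mono) auto
  then show ?thesis unfolding distrib_left by linarith
 qed
 also have "3 * (R / sqrt L) = (3 * Cst) / sqrt L * h ^ (r - 1) * ?m" by (simp add: R_def)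
 finally show ?thesis .
qed

end

end

lemma mesh_domain_scaled:
 fixes S\<^sub>0 :: "(real^'n::finite) set"
 assumes "lipschitz_domain S\<^sub>0" "0 < \<rho>" "0 < \<sigma>" "mesh \<sigma> ((%x. \<rho> *\<^sub>R x) ` S\<^sub>0) h T"
 shows "mesh_domain ((%x. \<rho> *\<^sub>R x) ` S\<^sub>0) \<sigma> h T"
proof
 show "open ((%x. \<rho> *\<^sub>R x) ` S\<^sub>0)" using assms by (intro open_scaling) (auto simp: lipschitz_domain_def)
 show "bounded ((%x. \<rho> *\<^sub>R x) ` S\<^sub>0)" using assms by (intro bounded_scaling) (auto simp: lipschitz_domain_def)
 show "(%x. \<rho> *\<^sub>R x) ` S\<^sub>0 ~= {}" using assms by (auto simp: lipschitz_domain_def)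
 show "interior (closure ((%x. \<rho> *\<^sub>R x) ` S\<^sub>0)) = (%x. \<rho> *\<^sub>R x) ` S\<^sub>0"
  by (rule regular_open_scale[OF regular_open_domain[OF assms(1)] assms(2)])
qed (use assms in auto)

text \<open>Scale invariance is expressed by fixing a shape \<open>\<Omega>\<^sub>0\<close> and
  letting the domain range over its dilations, with both constants chosen before the dilation.
  \<open>C\<^sub>K\<close> is the generic constant contained in \<open>K1\<close>.\<close>

theorem theorem3p3:
  fixes \<Omega>\<^sub>0 :: "(real^'n::finite) set" and r :: nat and \<sigma> \<kappa> c\<^sub>0 C\<^sub>a :: real
  assumes "CARD('n) = 2 \<or> CARD('n) = 3"
    and "lipschitz_domain \<Omega>\<^sub>0" and "polyhedral_domain \<Omega>\<^sub>0 \<or> smooth_boundary \<Omega>\<^sub>0"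
    and "2 \<le> r" and "0 < \<sigma>" and "0 < \<kappa>" and "0 < c\<^sub>0" and "0 < C\<^sub>a"
  shows "\<exists>C>0. \<exists>C\<^sub>K>0. \<forall>\<rho>>0. \<forall>(\<Omega> :: (real^'n) set) T h H \<nu> \<mu> \<beta> c\<^sub>I J s f u ut p IH uh sm L \<gamma>.
    \<Omega> = (\<lambda>x. \<rho> *\<^sub>R x) ` \<Omega>\<^sub>0 \<longrightarrow>
    mesh \<sigma> \<Omega> h T \<longrightarrow> inf_sup \<kappa> \<Omega> T r \<longrightarrow>
    0 < \<nu> \<longrightarrow> 0 < \<mu> \<longrightarrow> 0 < \<beta> \<longrightarrow> 0 < H \<longrightarrow> 0 < c\<^sub>I \<longrightarrow>
    coarse_interpolation c\<^sub>0 c\<^sub>I H \<Omega> IH \<longrightarrow>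
    time_interval J \<longrightarrow> 2 \<le> s \<longrightarrow> r \<le> s \<longrightarrow>
    navier_stokes \<nu> \<Omega> J f u ut p \<longrightarrow>
    u \<in> Linf_time (Hs_vec \<Omega> s) (Hs_vec_norm \<Omega> s) J \<longrightarrow>
    u \<in> Linf_time (W1inf_vec \<Omega>) (W1inf_vec_norm \<Omega>) J \<longrightarrow>
    p \<in> Linf_time (Hs \<Omega> (s - 1)) (quot_norm \<Omega> (s - 1)) J \<longrightarrow>
    ut \<in> Linf_time (Hs_vec \<Omega> (s - 1)) (Hs_vec_norm \<Omega> (s - 1)) J \<longrightarrow>
    da_galerkin \<nu> \<mu> \<beta> \<Omega> T IH J f u uh r \<longrightarrow>
    (\<forall>t\<in>J. stokes_projection \<Omega> T r (u t) (sm t)) \<longrightarrow>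
    approximation_properties C\<^sub>a \<Omega> h T r J u ut sm p \<longrightarrow>
    L = L_const \<Omega> \<mu> J sm \<longrightarrow> 0 < L \<longrightarrow>
    \<gamma> = min (\<nu> / 2 * (1 / (c\<^sub>I\<^sup>2 * H\<^sup>2))) (\<beta> / 2) \<longrightarrow>
    8 * L \<le> \<beta> \<longrightarrow> H \<le> sqrt \<nu> / (sqrt (8 * L) * c\<^sub>I) \<longrightarrow>
    (\<forall>t\<in>J. L2_norm \<Omega> (\<lambda>x. u t x - uh t x)
       \<le> exp (- \<gamma> * t / 4) * L2_norm \<Omega> (\<lambda>x. uh 0 x - u 0 x)
         + C / sqrt L * h ^ (r - 1) *
           ess_max t (\<lambda>\<tau>.
             (sqrt \<beta> * h + sqrt \<mu> + K1 C\<^sub>K \<Omega> (u \<tau>) / sqrt L) * Hs_vec_norm \<Omega> r (u \<tau>)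
             + 1 / sqrt L * Hs_vec_norm \<Omega> (r - 1) (ut \<tau>)
             + 1 / sqrt \<mu> * quot_norm \<Omega> (r - 1) (p \<tau>)))"
proof -
 \<comment> \<open>Both constants are fixed before domain and mesh; they depend on \<sigma> and the
   dimension, and the first also on r.\<close>
 obtain Ci where Ci: "Ci > 0" "!!(\<Omega> :: (real^'n) set) h T v. mesh_domain \<Omega> \<sigma> h T ==> v \<in> Xh \<Omega> T r ==>
   AE x in lebesgue_on \<Omega>. norm (v x) <= Ci * h powr (- (real CARD('n) / 2)) * L2_norm \<Omega> v"
  using Xh_inverse[OF assms(5), where 'n='n and r=r] by blast
 obtain cv where cv: "cv > 0" "!!(\<Omega> :: (real^'n) set) h T. mesh_domain \<Omega> \<sigma> h T ==> cv * h ^ CARD('n) <= vol \<Omega>"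
  using mesh_volume[OF assms(5), where 'n='n] by blast
 \<comment> \<open>The constants produced by \<open>error_bound\<close>: three times
   \<open>Cst\<close>, and the constant of \<open>K1_bound\<close>.\<close>
 let ?C = "3 * (1 + C\<^sub>a * (5 + 2 * real CARD('n) + c\<^sub>0))" and ?K = "Ci * C\<^sub>a\<^sup>2 * (1 + cv powr (- 1 / 4))"
 show ?thesis
 proof (((rule exI[of _ ?C], rule conjI[OF _ exI[of _ ?K]]); (intro conjI allI impI ballI)?), goal_cases)
  \<comment> \<open>The cases 1 and 2 are the positivity of the two constants; this one is the
    estimate.\<close>
  case (3 \<rho> \<Omega> T h H \<nu> \<mu> \<beta> c\<^sub>I J s f u ut p IH uh sm L \<gamma> t)
  interpret mesh_domain \<Omega> \<sigma> h T
   using mesh_domain_scaled[OF assms(2) 3(1) assms(5)] 3(2,3) by blast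
  interpret nudged_flow \<Omega> \<sigma> h T r s \<nu> \<mu> \<beta> c\<^sub>0 c\<^sub>I H C\<^sub>a IH J f u ut uh sm p
   by unfold_locales (use 3 assms in auto)
  show ?case
   by (rule error_bound[OF assms(1) less_imp_le[OF Ci(1)] cv(1) cv(2)[OF mesh_domain_axioms] less_imp_le[OF assms(8)] Ci(2)[OF mesh_domain_axioms] refl refl]) (use 3 in auto)
 qed (use assms Ci(1) cv(1) in \<open>simp_all add: add_pos_pos\<close>)
qed

end
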